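(* Let $S$ be a closed orientable surface of genus at least two, and let $\rho$ be a Ptolemaic metric on $S$ which is also a length metric. For any $a,b\in\pi_1(S)$ with crossing axes and every $n\in\mathbb N$, $$\ell_\rho(a^n)\,\ell_\rho(b^n)\le\frac{\ell_\rho(a^nb^n)^2}{4}+\frac{\ell_\rho(a^nb^{-n})^2}{4}.$$
   Context: A metric space $(M,d)$ is Ptolemaic if $d(x,z)d(y,w)\le d(x,y)d(z,w)+d(x,w)d(y,z)$ for all $x,y,z,w\in M$. A length metric $\rho$ on $S$ is called Ptolemaic if its pullback metric $d_\rho$ on the universal cover $\widetilde S$ is Ptolemaic. For $g\in\pi_1(S)$, $\ell_\rho(g)=\lim_{m\to\infty}\frac1m d_\rho(o,g^mo)$ is the stable length of $g$ acting on $(\widetilde S,d_\rho)$ ($o\in\widetilde S$ any base point); it depends only on the conjugacy class of $g$. Fix any hyperbolic metric on $S$. Elements $a,b\in\pi_1(S)$ have crossing axes if their hyperbolic axes in the universal cover cross, i.e. the attracting/repelling endpoints at infinity appear in the cyclic order $(b^-,a^-,b^+,a^+)$ (for one of the two orientations of the circle at infinity). *)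

theory Defs
  imports
    "HOL-Complex_Analysis.Complex_Analysis"
    "HOL-Algebra.Bij"
    "HOL-Library.Extended_Nat"
begin

section \<open>Closed orientable surfaces\<close>

text \<open>Surfaces are subsets of a topological type, with the subspace topology. A chart
  \<open>(U, f, f')\<close> is an open subset of the surface with a homeomorphism \<open>f\<close>, of
  inverse \<open>f'\<close>, onto an open subset of the plane.\<close>

definition surface_chart ::
  "'s::topological_space set \<Rightarrow> 's set \<times> ('s \<Rightarrow> complex) \<times> (complex \<Rightarrow> 's) \<Rightarrow> bool" where
  "surface_chart S = (\<lambda>(U, f, f').
     openin (top_of_set S) U \<and> open (f ` U) \<and> homeomorphism U (f ` U) f f')"

definition closed_surface :: "'s::topological_space set \<Rightarrow> bool" where
  "closed_surface S \<longleftrightarrow>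
     S \<noteq> {} \<and> compact S \<and> connected S \<and> Hausdorff_space (top_of_set S) \<and>
     (\<forall>x\<in>S. \<exists>U f f'. surface_chart S (U, f, f') \<and> x \<in> U)"

text \<open>To be applied to homeomorphisms between open sets of the plane: such a map preserves
  orientation iff it maps every small positively oriented circle to a loop that winds
  once, positively, around the image of the centre.\<close>

definition preserves_orientation_on :: "complex set \<Rightarrow> (complex \<Rightarrow> complex) \<Rightarrow> bool" where
  "preserves_orientation_on V F \<longleftrightarrow>
     (\<forall>z r. 0 < r \<and> cball z r \<subseteq> V \<longrightarrow> winding_number (F \<circ> circlepath z r) (F z) = 1)"

definition orientable_surface :: "'s::topological_space set \<Rightarrow> bool" where
  "orientable_surface S \<longleftrightarrow>
     (\<exists>A. (\<forall>c\<in>A. surface_chart S c) \<and> (\<Union>c\<in>A. fst c) = S \<and>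
        (\<forall>(U, f, f')\<in>A. \<forall>(W, g, g')\<in>A. preserves_orientation_on (f ` (U \<inter> W)) (g \<circ> f')))"

text \<open>The genus is the largest number of disjoint simple closed curves that can be
  removed without disconnecting the surface.\<close>

definition surface_genus :: "'s::topological_space set \<Rightarrow> enat" where
  "surface_genus S = Sup {enat k |k. \<exists>c :: nat \<Rightarrow> real \<Rightarrow> 's.
     (\<forall>i<k. simple_path (c i) \<and> pathfinish (c i) = pathstart (c i) \<and> path_image (c i) \<subseteq> S) \<and>
     (\<forall>i<k. \<forall>j<k. i \<noteq> j \<longrightarrow> path_image (c i) \<inter> path_image (c j) = {}) \<and>
     connected (S - (\<Union>i<k. path_image (c i)))}"

section \<open>Length metrics and their pullback to a covering\<close>

definition curve_length :: "('s \<Rightarrow> 's \<Rightarrow> real) \<Rightarrow> (real \<Rightarrow> 's) \<Rightarrow> ennreal" where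
  "curve_length d c =
     (SUP (n, t) \<in> {(n :: nat, t :: nat \<Rightarrow> real). mono_on {..n} t \<and> t ` {..n} \<subseteq> {0..1}}.
        \<Sum>i<n. ennreal (d (c (t i)) (c (t (Suc i)))))"

definition paths_between :: "'s::topological_space set \<Rightarrow> 's \<Rightarrow> 's \<Rightarrow> (real \<Rightarrow> 's) set" where
  "paths_between S x y =
     {c. path c \<and> path_image c \<subseteq> S \<and> pathstart c = x \<and> pathfinish c = y}"

text \<open>A length metric on \<open>S\<close> is required to induce the given topology of \<open>S\<close>.\<close>

definition length_metric_on :: "'s::topological_space set \<Rightarrow> ('s \<Rightarrow> 's \<Rightarrow> real) \<Rightarrow> bool" where
  "length_metric_on S d \<longleftrightarrow>
     Metric_space S d \<and> Metric_space.mtopology S d = top_of_set S \<and>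
     (\<forall>x\<in>S. \<forall>y\<in>S. ennreal (d x y) = (INF c \<in> paths_between S x y. curve_length d c))"

text \<open>The infimum is finite whenever \<open>d\<close> is a length metric on the base of a path connected
  covering \<open>p\<close>, so that \<open>enn2real\<close> is only a change of type.\<close>

definition pullback_metric ::
  "'e::topological_space set \<Rightarrow> ('e \<Rightarrow> 's) \<Rightarrow> ('s \<Rightarrow> 's \<Rightarrow> real) \<Rightarrow> 'e \<Rightarrow> 'e \<Rightarrow> real" where
  "pullback_metric E p d x y = enn2real (INF c \<in> paths_between E x y. curve_length d (p \<circ> c))"

definition ptolemaic :: "'a set \<Rightarrow> ('a \<Rightarrow> 'a \<Rightarrow> real) \<Rightarrow> bool" where
  "ptolemaic M d \<longleftrightarrow>
     (\<forall>x\<in>M. \<forall>y\<in>M. \<forall>z\<in>M. \<forall>w\<in>M. d x z * d y w \<le> d x y * d z w + d x w * d y z)"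

section \<open>The fundamental group and stable lengths\<close>

text \<open>The fundamental group of the base of a universal covering \<open>p\<close> on \<open>E\<close> is realised as
  the group of deck transformations, which is how it acts on \<open>E\<close>. The product is composition.\<close>

definition deck_group :: "'e::topological_space set \<Rightarrow> ('e \<Rightarrow> 's) \<Rightarrow> ('e \<Rightarrow> 'e) monoid" where
  "deck_group E p = (BijGroup E)
     \<lparr>carrier := {g \<in> Bij E. (\<exists>g'. homeomorphism E E g g') \<and> (\<forall>x\<in>E. p (g x) = p x)}\<rparr>"

lemma group_deck_group: "group (deck_group E p)"
proof -
  interpret B: group "BijGroup E" by (rule group_BijGroup)
  let ?D = "{g \<in> Bij E. (\<exists>g'. homeomorphism E E g g') \<and> (\<forall>x\<in>E. p (g x) = p x)}"
  have "subgroup ?D (BijGroup E)"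
  proof (rule B.subgroupI)
    show "?D \<subseteq> carrier (BijGroup E)" by (auto simp: BijGroup_def)
    have "homeomorphism E E (\<lambda>x\<in>E. x) (\<lambda>x\<in>E. x)"
      by (auto simp: homeomorphism_def cong: continuous_on_cong)
    then have "(\<lambda>x\<in>E. x) \<in> ?D" using id_Bij[of E] by auto
    then show "?D \<noteq> {}" by blast
  next
    fix g assume g: "g \<in> ?D"
    then have gB: "g \<in> Bij E" by simp
    then have bij: "bij_betw g E E" by (simp add: Bij_def)
    define k where "k = (\<lambda>x\<in>E. inv_into E g x)"
    have kB: "k \<in> Bij E" unfolding k_def by (rule restrict_inv_into_Bij[OF gB])
    have kg: "k (g x) = x" and gk: "g (k x) = x" and kE: "k x \<in> E" and gE: "g x \<in> E"
      if "x \<in> E" for x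
      using that bij unfolding k_def
      by (auto simp: bij_betw_inv_into_left bij_betw_inv_into_right bij_betw_apply
          bij_betw_apply[OF bij_betw_inv_into])
    have inv: "inv\<^bsub>BijGroup E\<^esub> g = k"
      by (rule B.inv_equality) (use gB kB in \<open>auto simp: BijGroup_def k_def Bij_compose_restrict_eq\<close>)
    obtain g' where g': "homeomorphism E E g g'" using g by blast
    have eq: "k x = g' x" if "x \<in> E" for x
      using g' kg[of "g' x"] that unfolding homeomorphism_def
      by (metis image_eqI)
    have "homeomorphism E E k g"
      using g' eq kg gk unfolding homeomorphism_def
      by (metis (no_types, lifting) continuous_on_cong image_cong)
    moreover have "p (k x) = p x" if "x \<in> E" for x
      using g kE[OF that] gk[OF that] by (metis (mono_tags, lifting) mem_Collect_eq)
    ultimately show "inv\<^bsub>BijGroup E\<^esub> g \<in> ?D" using kB inv by auto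
  next
    fix g h assume g: "g \<in> ?D" and h: "h \<in> ?D"
    then obtain g' h' where gh: "homeomorphism E E g g'" "homeomorphism E E h h'" by blast
    have "homeomorphism E E (compose E g h) (h' \<circ> g')"
      using homeomorphism_compose[OF gh(2,1)]
      by (rule homeomorphism_cong) (auto simp: compose_def)
    moreover have "h x \<in> E" if "x \<in> E" for x
      using gh(2) that by (auto simp: homeomorphism_def)
    ultimately show "g \<otimes>\<^bsub>BijGroup E\<^esub> h \<in> ?D"
      using g h by (auto simp: BijGroup_def compose_Bij compose_eq)
  qed
  then show ?thesis unfolding deck_group_def by (rule B.subgroup_imp_group)
qed

definition stable_length ::
  "'e::topological_space set \<Rightarrow> ('e \<Rightarrow> 's) \<Rightarrow> ('s \<Rightarrow> 's \<Rightarrow> real) \<Rightarrow> 'e \<Rightarrow> ('e \<Rightarrow> 'e) \<Rightarrow> real" where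
  "stable_length E p d x g =
     lim (\<lambda>m :: nat. pullback_metric E p d x ((g [^]\<^bsub>deck_group E p\<^esub> m) x) / real m)"

section \<open>Hyperbolic metrics and crossing axes\<close>

text \<open>The distance of the Poincare disc \<open>ball 0 1\<close>, of curvature \<open>-1\<close>.\<close>

definition disc_dist :: "complex \<Rightarrow> complex \<Rightarrow> real" where
  "disc_dist z w =
     arcosh (1 + 2 * (cmod (z - w))\<^sup>2 / ((1 - (cmod z)\<^sup>2) * (1 - (cmod w)\<^sup>2)))"

definition hyperbolic_metric_on :: "'s::topological_space set \<Rightarrow> ('s \<Rightarrow> 's \<Rightarrow> real) \<Rightarrow> bool" where
  "hyperbolic_metric_on S h \<longleftrightarrow>
     length_metric_on S h \<and>
     (\<forall>x\<in>S. \<exists>r>0. \<exists>f. bij_betw f {y \<in> S. h x y < r} {w \<in> ball 0 1. disc_dist 0 w < r} \<and>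
        (\<forall>y\<in>S. \<forall>z\<in>S. h x y < r \<and> h x z < r \<longrightarrow> disc_dist (f y) (f z) = h y z))"

definition disc_isometry ::
  "'e::topological_space set \<Rightarrow> ('e \<Rightarrow> 's) \<Rightarrow> ('s \<Rightarrow> 's \<Rightarrow> real) \<Rightarrow> ('e \<Rightarrow> complex) \<Rightarrow> bool" where
  "disc_isometry E p h \<phi> \<longleftrightarrow>
     bij_betw \<phi> E (ball 0 1) \<and>
     (\<forall>x\<in>E. \<forall>y\<in>E. disc_dist (\<phi> x) (\<phi> y) = pullback_metric E p h x y)"

text \<open>The repelling endpoint \<open>u\<close> and the attracting endpoint \<open>v\<close> of the axis of \<open>g\<close>, on the
  unit circle: the limits of every orbit under the negative and the positive powers of \<open>g\<close>.\<close>

definition axis_endpoints ::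
  "'e::topological_space set \<Rightarrow> ('e \<Rightarrow> 's) \<Rightarrow> ('e \<Rightarrow> complex) \<Rightarrow> ('e \<Rightarrow> 'e) \<Rightarrow>
     complex \<Rightarrow> complex \<Rightarrow> bool" where
  "axis_endpoints E p \<phi> g u v \<longleftrightarrow>
     u \<in> sphere 0 1 \<and> v \<in> sphere 0 1 \<and>
     (\<forall>x\<in>E. (\<lambda>m :: nat. \<phi> ((g [^]\<^bsub>deck_group E p\<^esub> (- int m)) x)) \<longlonglongrightarrow> u) \<and>
     (\<forall>x\<in>E. (\<lambda>m :: nat. \<phi> ((g [^]\<^bsub>deck_group E p\<^esub> m) x)) \<longlonglongrightarrow> v)"

definition counterclockwise4 :: "complex \<Rightarrow> complex \<Rightarrow> complex \<Rightarrow> complex \<Rightarrow> bool" where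
  "counterclockwise4 z1 z2 z3 z4 \<longleftrightarrow>
     (\<exists>t1 t2 t3 t4. z1 = cis t1 \<and> z2 = cis t2 \<and> z3 = cis t3 \<and> z4 = cis t4 \<and>
        t1 < t2 \<and> t2 < t3 \<and> t3 < t4 \<and> t4 < t1 + 2 * pi)"

definition crossing_axes ::
  "'e::topological_space set \<Rightarrow> ('e \<Rightarrow> 's) \<Rightarrow> ('s \<Rightarrow> 's \<Rightarrow> real) \<Rightarrow> ('e \<Rightarrow> 'e) \<Rightarrow> ('e \<Rightarrow> 'e) \<Rightarrow> bool"
  where
  "crossing_axes E p h a b \<longleftrightarrow>
     (\<exists>\<phi> am ap bm bp. disc_isometry E p h \<phi> \<and>
        axis_endpoints E p \<phi> a am ap \<and> axis_endpoints E p \<phi> b bm bp \<and>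
        (counterclockwise4 bm am bp ap \<or> counterclockwise4 ap bp am bm))"

end

theory Submission
  imports Defs
begin

text \<open>The half plane is a model of the hyperbolic plane that covers the surface. Since the surface is
orientable, its deck transformations do not reverse orientation, by an argument with local degrees
(\<open>no_orientation_reversing_symmetry\<close>), and thus become real Moebius transformations. The
pullback of \<open>\<rho>\<close> becomes a metric \<open>d\<close> on the half plane that is Ptolemaic, is a length metric, and
is invariant under these matrices. Since the surface is compact, a bounded \<open>d\<close>-distance bounds the
hyperbolic distance (\<open>comparable\<close>). The stable length of a hyperbolic element \<open>X\<close> is the
translation length \<open>tau X\<close>, the infimum of \<open>d z (X z)\<close> over all points (\<open>stable_length_eq_tau\<close>):
a path from \<open>z\<close> to \<open>X\<^sup>2 z\<close> contains a point and its image under \<open>X\<close>, and so \<open>tau (X\<^sup>2) = 2 tau X\<close>.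
It remains to show
\<open>tau A * tau B \<le> (tau (A * B))\<^sup>2 / 4 + (tau (A * B\<inverse>))\<^sup>2 / 4\<close> for matrices with crossing axes
(\<open>crossing_inequality\<close>).

Write \<open>g = A * B\<close> and \<open>h = A * B\<inverse>\<close>, and suppose that both have an axis in the metric \<open>d\<close>, an
invariant curve that minimises length. The idea is to find a point \<open>Q\<close> on the axis of \<open>g\<close> for which
\<open>A Q\<close> is on the axis of \<open>h\<close>, and a common point \<open>P\<close> of the two axes that lies between \<open>Q\<close> and \<open>g Q\<close>
on the first and between \<open>B Q = h\<inverse> A Q\<close> and \<open>A Q\<close> on the second. Then Ptolemy's inequality for the
quadrilateral \<open>P, Q, A\<inverse> P, B Q\<close> gives the claim. Its diagonals have lengths at least \<open>tau A\<close> and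
\<open>tau B\<close>. One pair of opposite sides has total length \<open>d P Q + d P (g Q) = tau g\<close>, the other one
\<open>d P (B Q) + d P (A Q) = tau h\<close>, and the product of two numbers is at most a quarter of the square
of their sum.

The points exist for topological reasons. An invariant curve of \<open>g\<close> separates the two sides of
the half plane, in the sense that every path-connected set that runs from one side far out to the
other meets it (\<open>line_separates\<close>); this rests on the Poincare-Miranda theorem. Axes are replaced
by invariant curves whose length in a period exceeds the translation length by at most \<open>e\<close>. Such
curves need not be embedded and may meet each other often, so two steps are added. If
\<open>tau A + tau B\<close> is at most \<open>tau g\<close> or \<open>tau h\<close>, there is nothing to prove; otherwise convexity of
\<open>tau\<close> along powers keeps the curve of \<open>g\<close> disjoint from its image under \<open>B\<close>
(\<open>rline_disjoint_translate\<close>). And the curve of \<open>h\<close> is rerouted along that of \<open>g\<close>, so that the two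
have only one segment in common (\<open>crossing_inequality_approx\<close>).

That axes cross is expressed by the traces of \<open>A\<close>, \<open>B\<close> and \<open>A * B\<close> (\<open>crossing\<close>), a condition that
passes to the pairs needed above and that follows, for all positive powers, from the cyclic order of the
endpoints (\<open>crossing_matrices\<close>).\<close>

section \<open>Real Moebius transformations of the upper half-plane\<close>

datatype mat2 = Mat (m11: real) (m12: real) (m21: real) (m22: real)

instantiation mat2 :: monoid_mult
begin

definition one_mat2 :: mat2 where "1 = Mat 1 0 0 1"

definition times_mat2 :: "mat2 \<Rightarrow> mat2 \<Rightarrow> mat2" where
  "M * N = Mat (m11 M * m11 N + m12 M * m21 N) (m11 M * m12 N + m12 M * m22 N)
               (m21 M * m11 N + m22 M * m21 N) (m21 M * m12 N + m22 M * m22 N)"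

instance
  by standard (auto simp: one_mat2_def times_mat2_def algebra_simps)

end

definition mdet :: "mat2 \<Rightarrow> real" where "mdet M = m11 M * m22 M - m12 M * m21 M"

definition mtr :: "mat2 \<Rightarrow> real" where "mtr M = m11 M + m22 M"

definition adj :: "mat2 \<Rightarrow> mat2" where "adj M = Mat (m22 M) (- m12 M) (- m21 M) (m11 M)"

definition SL :: "mat2 set" where "SL = {M. mdet M = 1}"

lemmas mat2_defs = one_mat2_def times_mat2_def mdet_def mtr_def adj_def

lemma mdet_mult: "mdet (M * N) = mdet M * mdet N"
  by (simp add: mat2_defs algebra_simps)

lemma SL_one [simp]: "1 \<in> SL"
  by (simp add: SL_def mat2_defs)

lemma SL_mult [simp]: "M \<in> SL \<Longrightarrow> N \<in> SL \<Longrightarrow> M * N \<in> SL"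
  by (simp add: SL_def mdet_mult)

lemma SL_adj [simp]: "M \<in> SL \<Longrightarrow> adj M \<in> SL"
  by (simp add: SL_def mat2_defs algebra_simps)

lemma SL_power [simp]: "M \<in> SL \<Longrightarrow> M ^ n \<in> SL"
  by (induction n) auto

lemma adj_mult: "adj (M * N) = adj N * adj M"
  by (simp add: mat2_defs algebra_simps)

lemma adj_adj [simp]: "adj (adj M) = M"
  by (simp add: adj_def)

lemma adj_right: "M \<in> SL \<Longrightarrow> M * adj M = 1"
  by (simp add: SL_def mat2_defs algebra_simps)

lemma adj_left: "M \<in> SL \<Longrightarrow> adj M * M = 1"
  by (simp add: SL_def mat2_defs algebra_simps)

lemma adj_right_cancel: "M \<in> SL \<Longrightarrow> M * (adj M * N) = N"
  by (simp add: adj_right flip: mult.assoc)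

lemma adj_left_cancel: "M \<in> SL \<Longrightarrow> adj M * (M * N) = N"
  by (simp add: adj_left flip: mult.assoc)

lemma adj_one [simp]: "adj 1 = 1"
  by (simp add: mat2_defs)

lemma adj_power: "adj (M ^ n) = adj M ^ n"
  by (induction n) (simp_all add: adj_mult power_commutes)

definition uhp :: "complex set" where "uhp = {z. 0 < Im z}"

definition mob :: "mat2 \<Rightarrow> complex \<Rightarrow> complex" where
  "mob M z = (of_real (m11 M) * z + of_real (m12 M)) / (of_real (m21 M) * z + of_real (m22 M))"

lemma mob_denominator_nonzero:
  assumes "M \<in> SL" "z \<in> uhp"
  shows "of_real (m21 M) * z + of_real (m22 M) \<noteq> (0::complex)"
proof
  assume 0: "of_real (m21 M) * z + of_real (m22 M) = (0::complex)"
  then have "m21 M * Im z = 0" "m21 M * Re z + m22 M = 0"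
    by (auto simp: complex_eq_iff)
  with assms show False
    by (auto simp: SL_def uhp_def mdet_def)
qed

lemma mob_one [simp]: "mob 1 z = z"
  by (simp add: mob_def mat2_defs)

lemma Im_mob:
  assumes "M \<in> SL" "z \<in> uhp"
  shows "Im (mob M z) = Im z / (cmod (of_real (m21 M) * z + of_real (m22 M)))\<^sup>2"
proof -
  have "Im (mob M z) = ((m11 M * m22 M - m12 M * m21 M) * Im z) / (cmod (of_real (m21 M) * z + of_real (m22 M)))\<^sup>2"
    unfolding mob_def Im_divide cmod_power2 by (simp add: algebra_simps)
  with assms show ?thesis by (simp add: SL_def mdet_def)
qed

lemma mob_uhp [simp]: "M \<in> SL \<Longrightarrow> z \<in> uhp \<Longrightarrow> mob M z \<in> uhp"
  using mob_denominator_nonzero[of M z] Im_mob[of M z] by (simp add: uhp_def)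

lemma mob_mult:
  assumes "M \<in> SL" "N \<in> SL" "z \<in> uhp"
  shows "mob (M * N) z = mob M (mob N z)"
proof -
  define D where "D = of_real (m21 N) * z + of_real (m22 N)"
  define C where "C = of_real (m11 N) * z + of_real (m12 N)"
  have D: "D \<noteq> 0" unfolding D_def by (rule mob_denominator_nonzero) fact+
  have N: "mob N z = C / D" by (simp add: mob_def C_def D_def)
  have "mob M (mob N z) = (of_real (m11 M) * C + of_real (m12 M) * D) / (of_real (m21 M) * C + of_real (m22 M) * D)"
  proof -
    have "of_real a * (C / D) + of_real b = (of_real a * C + of_real b * D) / D" for a b :: real
      using D by (simp add: field_simps)
    then have "mob M (C / D) = (of_real (m11 M) * C + of_real (m12 M) * D) / D / ((of_real (m21 M) * C + of_real (m22 M) * D) / D)"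
      by (simp only: mob_def)
    then show ?thesis using D unfolding N by simp
  qed
  also have "\<dots> = mob (M * N) z"
    unfolding mob_def C_def D_def by (simp add: times_mat2_def algebra_simps)
  finally show ?thesis by simp
qed

lemma mob_adj_left [simp]: "M \<in> SL \<Longrightarrow> z \<in> uhp \<Longrightarrow> mob (adj M) (mob M z) = z"
  by (simp add: adj_left flip: mob_mult)

lemma mob_adj_right [simp]: "M \<in> SL \<Longrightarrow> z \<in> uhp \<Longrightarrow> mob M (mob (adj M) z) = z"
  by (simp add: adj_right flip: mob_mult)

lemma continuous_on_mob: "M \<in> SL \<Longrightarrow> S \<subseteq> uhp \<Longrightarrow> continuous_on S (mob M)"
  unfolding mob_def by (intro continuous_intros) (use mob_denominator_nonzero in auto)

lemma mob_diff:
  assumes "M \<in> SL" "z \<in> uhp" "w \<in> uhp"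
  shows "mob M z - mob M w = (z - w) / ((of_real (m21 M) * z + of_real (m22 M)) * (of_real (m21 M) * w + of_real (m22 M)))"
proof -
  have "of_real (m11 M) * of_real (m22 M) - of_real (m12 M) * of_real (m21 M) = (1::complex)"
    using assms(1) by (simp add: SL_def mdet_def flip: of_real_mult of_real_diff)
  then have e: "(of_real (m11 M) * of_real (m22 M)) = 1 + of_real (m12 M) * (of_real (m21 M)::complex)"
    by (simp add: algebra_simps)
  have "(of_real (m11 M) * z + of_real (m12 M)) * (of_real (m21 M) * w + of_real (m22 M)) -
    (of_real (m11 M) * w + of_real (m12 M)) * (of_real (m21 M) * z + of_real (m22 M)) = (z - w)"
    using arg_cong[OF e, of "\<lambda>x. x * z"] arg_cong[OF e, of "\<lambda>x. x * w"] by (simp add: algebra_simps)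
  then show ?thesis
    using mob_denominator_nonzero[OF assms(1,2)] mob_denominator_nonzero[OF assms(1,3)]
    unfolding mob_def by (simp add: divide_simps)
qed

text \<open>This is \<open>2 * (cosh r - 1)\<close> for the hyperbolic distance \<open>r\<close>.\<close>

definition hyp :: "complex \<Rightarrow> complex \<Rightarrow> real" where
  "hyp z w = (cmod (z - w))\<^sup>2 / (Im z * Im w)"

lemma hyp_mob:
  assumes "M \<in> SL" "z \<in> uhp" "w \<in> uhp"
  shows "hyp (mob M z) (mob M w) = hyp z w"
  using mob_denominator_nonzero[OF assms(1,2)] mob_denominator_nonzero[OF assms(1,3)] assms
  unfolding hyp_def mob_diff[OF assms] by (simp add: Im_mob norm_divide norm_mult divide_simps)

text \<open>The cotangent of the argument. It tends to \<open>\<infinity>\<close> at the positive and to \<open>-\<infinity>\<close> at the negative real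
axis, and it is invariant under diagonal matrices, for which it measures the position across the
axis.\<close>

definition slope :: "complex \<Rightarrow> real" where "slope z = Re z / Im z"

lemma slope_mob:
  assumes "M \<in> SL" "z \<in> uhp"
  shows "slope (mob M z) = (m11 M * m21 M * (cmod z)\<^sup>2 + m12 M * m22 M) / Im z +
     (m11 M * m22 M + m12 M * m21 M) * slope z"
proof -
  let ?D = "(cmod (of_real (m21 M) * z + of_real (m22 M)))\<^sup>2"
  have D: "?D > 0" using mob_denominator_nonzero[OF assms] by simp
  have "Re (mob M z) = (m11 M * m21 M * (cmod z)\<^sup>2 + m12 M * m22 M + (m11 M * m22 M + m12 M * m21 M) * Re z) / ?D"
    unfolding mob_def Re_divide cmod_power2 by (simp add: algebra_simps power2_eq_square)
  then show ?thesis
    using D assms(2) unfolding slope_def Im_mob[OF assms] by (simp add: uhp_def field_simps)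
qed

section \<open>Crossing pairs of matrices\<close>

text \<open>If \<open>x\<close>, \<open>y\<close>, \<open>z\<close> are the traces of \<open>X\<close>, \<open>Y\<close>, \<open>X * Y\<close>, then \<open>x\<^sup>2 + y\<^sup>2 + z\<^sup>2 - x * y * z - 2\<close> is the trace of
the commutator. Two hyperbolic elements have crossing axes iff it is less than 2. In this form it
is easy to pass to products.\<close>

definition crossing :: "mat2 \<Rightarrow> mat2 \<Rightarrow> bool" where
  "crossing X Y \<longleftrightarrow> X \<in> SL \<and> Y \<in> SL \<and> 4 < (mtr X)\<^sup>2 \<and>
     (mtr X)\<^sup>2 + (mtr Y)\<^sup>2 + (mtr (X * Y))\<^sup>2 - mtr X * mtr Y * mtr (X * Y) - 4 < 0"

lemma mtr_commute: "mtr (X * Y) = mtr (Y * X)"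
  by (simp add: mat2_defs)

lemma mtr_adj [simp]: "mtr (adj X) = mtr X"
  by (simp add: mat2_defs)

lemma mtr_mult_adj: "mtr (X * adj Y) = mtr X * mtr Y - mtr (X * Y)"
  by (simp add: mat2_defs algebra_simps)

lemma mtr_one [simp]: "mtr 1 = 2"
  by (simp add: mat2_defs)

lemma mtr_mult_twice: "X \<in> SL \<Longrightarrow> mtr (X * (X * Y)) = mtr X * mtr (X * Y) - mtr Y"
  unfolding SL_def mat2_defs by (simp, algebra)

text \<open>The second inequality says \<open>(z - x * y / 2)\<^sup>2 < (x\<^sup>2 - 4) * (y\<^sup>2 - 4) / 4\<close>.\<close>

lemma crossing_trace_aux:
  fixes x y z :: real
  assumes "4 < x\<^sup>2" "x\<^sup>2 + y\<^sup>2 + z\<^sup>2 - x * y * z - 4 < 0"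
  shows "4 < y\<^sup>2"
proof -
  have "(z - x * y / 2)\<^sup>2 < (x\<^sup>2 - 4) * (y\<^sup>2 - 4) / 4"
    using assms(2) by (simp add: algebra_simps power2_eq_square)
  then have "0 < (x\<^sup>2 - 4) * (y\<^sup>2 - 4) / 4"
    by (smt (verit) zero_le_power2)
  with assms(1) show ?thesis
    by (simp add: zero_less_mult_iff)
qed

lemma crossing_sym: "crossing X Y \<Longrightarrow> crossing Y X"
  using crossing_trace_aux[of "mtr X" "mtr Y" "mtr (X * Y)"]
  by (auto simp: crossing_def mtr_commute[of Y X] algebra_simps)

lemma crossing_adj: "crossing X Y \<Longrightarrow> crossing X (adj Y)"
  by (auto simp: crossing_def mtr_mult_adj algebra_simps power2_eq_square)

lemma crossing_mult: "crossing X Y \<Longrightarrow> crossing X (X * Y)"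
  by (auto simp: crossing_def mtr_mult_twice algebra_simps power2_eq_square)

text \<open>Passing from \<open>(X, Y)\<close> to \<open>(XY, XY\<inverse>)\<close> multiplies the polynomial by \<open>(mtr Y)\<^sup>2\<close>.\<close>

lemma crossing_mult_mult_adj:
  assumes "crossing X Y" shows "crossing (X * Y) (X * adj Y)"
proof -
  define x y z where "x = mtr X" "y = mtr Y" "z = mtr (X * Y)"
  have S: "X \<in> SL" "Y \<in> SL" and x: "4 < x\<^sup>2" and Q: "x\<^sup>2 + y\<^sup>2 + z\<^sup>2 - x * y * z - 4 < 0"
    using assms by (auto simp: crossing_def x_y_z_def)
  have y: "4 < y\<^sup>2" by (rule crossing_trace_aux[OF x Q])
  have z: "4 < z\<^sup>2" by (rule crossing_trace_aux[OF x, of _ y]) (use Q in \<open>simp add: algebra_simps\<close>)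
  have "mtr ((X * Y) * (X * adj Y)) = z * (x * y - z) - (y\<^sup>2 - 2)"
  proof -
    have "(X * Y) * adj (X * adj Y) = X * (Y * Y) * adj X"
      by (simp add: adj_mult mult.assoc)
    then have "mtr ((X * Y) * adj (X * adj Y)) = mtr (Y * Y)"
      using S by (metis mtr_commute mult.assoc adj_left mult_1)
    also have "\<dots> = y\<^sup>2 - 2"
      using mtr_mult_twice[of Y 1] S by (simp add: x_y_z_def power2_eq_square mtr_one)
    finally show ?thesis
      using mtr_mult_adj[of "X * Y" "X * adj Y"] mtr_mult_adj[of X Y] by (simp add: x_y_z_def)
  qed
  moreover have "z\<^sup>2 + (x * y - z)\<^sup>2 + (z * (x * y - z) - (y\<^sup>2 - 2))\<^sup>2 - z * (x * y - z) * (z * (x * y - z) - (y\<^sup>2 - 2)) - 4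
      = y\<^sup>2 * (x\<^sup>2 + y\<^sup>2 + z\<^sup>2 - x * y * z - 4)"
    by algebra
  moreover have "y\<^sup>2 * (x\<^sup>2 + y\<^sup>2 + z\<^sup>2 - x * y * z - 4) < 0"
    using Q y by (intro mult_pos_neg) auto
  ultimately show ?thesis
    using S z by (simp add: crossing_def mtr_mult_adj flip: x_y_z_def)
qed

lemma crossing_conj:
  assumes "crossing X Y" "N \<in> SL"
  shows "crossing (N * X * adj N) (N * Y * adj N)"
proof -
  have t: "mtr (N * Z * adj N) = mtr Z" for Z
    using assms(2) by (metis mtr_commute mult.assoc adj_left mult_1)
  have "(N * X * adj N) * (N * Y * adj N) = N * (X * Y) * adj N"
    using assms(2) by (simp add: mult.assoc adj_left_cancel)
  then show ?thesis using assms by (simp add: crossing_def t)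
qed

definition diagm :: "real \<Rightarrow> mat2" where "diagm l = Mat l 0 0 (1 / l)"

lemma diagm_SL [simp]: "l \<noteq> 0 \<Longrightarrow> diagm l \<in> SL"
  by (simp add: diagm_def SL_def mdet_def)

lemma mob_diagm: "l \<noteq> 0 \<Longrightarrow> mob (diagm l) z = of_real (l\<^sup>2) * z"
  by (simp add: diagm_def mob_def power2_eq_square)

lemma diagm_power: "diagm l ^ n = diagm (l ^ n)"
  by (induction n) (auto simp: diagm_def one_mat2_def times_mat2_def power_divide)

lemma adj_diagm: "adj (diagm l) = diagm (1 / l)"
  by (simp add: diagm_def adj_def)

text \<open>The columns \<open>(l - d, c)\<close> and \<open>(m - d, c)\<close> are eigenvectors. The factor \<open>1 / D\<close> serves to
give determinant 1.\<close>

lemma eigenvector_columns: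
  fixes a b c d l m D :: real
  assumes "(l - d) * a + c * b = l * (l - d)" "(m - d) * a + c * b = m * (m - d)"
  shows "Mat a b c d * Mat (l - d) ((m - d) / D) c (c / D) = Mat (l - d) ((m - d) / D) c (c / D) * Mat l 0 0 m"
proof -
  have "a * ((m - d) / D) + b * (c / D) = ((m - d) * a + c * b) / D"
    by (cases "D = 0") (simp_all add: field_simps)
  moreover have "c * ((m - d) / D) + d * (c / D) = c / D * m"
    by (cases "D = 0") (simp_all add: field_simps)
  ultimately show ?thesis
    using assms by (simp add: times_mat2_def algebra_simps)
qed

lemma diagonalise:
  assumes "M \<in> SL" "4 < (mtr M)\<^sup>2"
  obtains N l where "N \<in> SL" "l \<noteq> 0" "l\<^sup>2 \<noteq> 1" "N * M * adj N = diagm l"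
proof -
  define a b c d where "a = m11 M" "b = m12 M" "c = m21 M" "d = m22 M"
  have M: "M = Mat a b c d" by (simp add: a_b_c_d_def)
  have det: "a * d - b * c = 1" using assms(1) by (simp add: SL_def mdet_def M)
  have "\<exists>N l. N \<in> SL \<and> l \<noteq> 0 \<and> l\<^sup>2 \<noteq> 1 \<and> N * M * adj N = diagm l"
  proof (cases "c = 0")
    case True
    then have ad: "a * d = 1" using det by simp
    then have a0: "a \<noteq> 0" by auto
    with ad have d: "d = 1 / a" by (simp add: nonzero_eq_divide_eq mult.commute)
    have a1: "a\<^sup>2 \<noteq> 1"
    proof
      assume "a\<^sup>2 = 1"
      then have "a = 1 \<or> a = -1" by (simp add: power2_eq_1_iff)
      then show False using assms(2) d by (auto simp: mtr_def M)
    qed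
    define k where "k = b / (d - a)"
    have da: "d - a \<noteq> 0" using a1 a0 by (auto simp: d field_simps power2_eq_square)
    have "Mat 1 (-k) 0 1 * M * adj (Mat 1 (-k) 0 1) = Mat a (a * k + b - k * d) 0 d"
      using True by (simp add: M mat2_defs)
    also have "a * k + b - k * d = 0"
      using da by (simp add: k_def field_simps)
    finally have "Mat 1 (-k) 0 1 * M * adj (Mat 1 (-k) 0 1) = diagm a"
      by (simp add: diagm_def d)
    then show ?thesis using a0 a1 by (intro exI[of _ "Mat 1 (-k) 0 1"] exI[of _ a]) (simp add: SL_def mdet_def)
  next
    case False
    define t where "t = a + d"
    define r where "r = sqrt (t\<^sup>2 - 4)"
    define l m where "l = (t + r) / 2" "m = (t - r) / 2"
    have r: "r > 0" "r\<^sup>2 = t\<^sup>2 - 4" using assms(2) by (auto simp: r_def t_def mtr_def M)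
    have lm: "l * m = 1" "l + m = t" "l - m = r"
      using r by (auto simp: l_m_def field_simps power2_eq_square)
    have l0: "l \<noteq> 0" using lm(1) by auto
    with lm(1) have ml: "m = 1 / l" by (simp add: nonzero_eq_divide_eq mult.commute)
    have l1: "l\<^sup>2 \<noteq> 1"
      using lm r(1) ml by (auto simp: power2_eq_1_iff)
    define D where "D = c * (l - m)"
    have D: "D \<noteq> 0" using False lm r by (simp add: D_def)
    define N where "N = Mat (c / D) (- ((m - d) / D)) (- c) (l - d)"
    have N: "N \<in> SL" using D False by (simp add: SL_def mdet_def N_def D_def field_simps)
    have e2: "(m - d) * a + c * b = m * (m - d)"
      using lm det unfolding t_def by algebra
    have e3: "(l - d) * a + c * b = l * (l - d)"
      using lm det unfolding t_def by algebra
    have MP: "M * adj N = adj N * diagm l"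
      using eigenvector_columns[OF e3 e2, of D] by (simp add: M N_def adj_def diagm_def ml)
    have "N * M * adj N = diagm l"
      by (simp add: mult.assoc MP adj_right_cancel[OF N])
    then show ?thesis using N l0 l1 by blast
  qed
  then show ?thesis using that by blast
qed

text \<open>As \<open>M\<close> and \<open>-M\<close> act in the same way, both signs are allowed. Such a transformation maps the closed
half axis from \<open>0\<close> through the positive reals to \<open>\<infinity>\<close> into the positive reals, and its inverse maps
the closed negative half axis into the negative reals.\<close>

definition posm :: "mat2 \<Rightarrow> bool" where
  "posm M \<longleftrightarrow> (0 < m11 M \<and> 0 < m12 M \<and> 0 < m21 M \<and> 0 < m22 M) \<or>
              (m11 M < 0 \<and> m12 M < 0 \<and> m21 M < 0 \<and> m22 M < 0)"

lemma posm_mult: "posm M \<Longrightarrow> posm N \<Longrightarrow> posm (M * N)"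
  unfolding posm_def times_mat2_def
  by (elim disjE conjE)
    (simp_all add: add_pos_pos add_neg_neg mult_neg_neg mult_pos_neg mult_neg_pos)

lemma posm_power: "posm M \<Longrightarrow> posm (M ^ Suc n)"
  by (induction n) (auto intro: posm_mult)

text \<open>If \<open>A * B\<close> is diagonal with entries \<open>l\<close>, \<open>1 / l\<close> and \<open>A\<close> has rows \<open>(p, q)\<close> and \<open>(r, s)\<close>, then the
polynomial in the definition of crossing is \<open>- q * r * (l - 1 / l)\<^sup>2\<close>. Thus \<open>q * r > 0\<close>, and then
\<open>p * s > 0\<close> by the determinant. Either all entries of \<open>A\<close> have the same sign, or they have after an
exchange of \<open>0\<close> and \<open>\<infinity>\<close>. The rows of \<open>adj B\<close> are those of \<open>A\<close>, multiplied by \<open>1 / l\<close> and \<open>l\<close>.\<close>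

lemma crossing_normal_form:
  assumes "crossing A B"
  obtains N l where "N \<in> SL" "l \<noteq> 0" "l\<^sup>2 \<noteq> 1" "N * (A * B) * adj N = diagm l"
    "posm (N * A * adj N)" "posm (N * adj B * adj N)"
proof -
  have S: "A \<in> SL" "B \<in> SL" "A * B \<in> SL" using assms by (auto simp: crossing_def)
  have "crossing (A * B) A"
    by (rule crossing_sym[OF crossing_mult[OF assms]])
  then have "4 < (mtr (A * B))\<^sup>2" by (simp add: crossing_def)
  then obtain N l where N: "N \<in> SL" and l: "l \<noteq> 0" "l\<^sup>2 \<noteq> 1" and d: "N * (A * B) * adj N = diagm l"
    using S diagonalise by metis
  define A' where "A' = N * A * adj N"
  define B' where "B' = N * B * adj N"
  have S': "A' \<in> SL" "B' \<in> SL" using S N by (auto simp: A'_def B'_def)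
  have cr: "crossing A' B'" unfolding A'_def B'_def by (rule crossing_conj[OF assms N])
  have AB: "A' * B' = diagm l"
    using N d by (simp add: A'_def B'_def mult.assoc adj_left_cancel)
  define p q r s where "p = m11 A'" "q = m12 A'" "r = m21 A'" "s = m22 A'"
  have A': "A' = Mat p q r s" by (simp add: p_q_r_s_def)
  have B'eq: "B' = adj A' * diagm l" using AB S' by (metis adj_left_cancel)
  have adjB: "adj B' = Mat (p / l) (q / l) (r * l) (s * l)"
    unfolding B'eq by (simp add: A' adj_def diagm_def times_mat2_def)
  have det: "p * s - q * r = 1" using S' by (simp add: SL_def A' mdet_def)
  have "mtr B' = s * l + p / l" by (simp add: B'eq A' mat2_defs diagm_def)
  moreover have "mtr (A' * B') = l + 1 / l" by (simp add: AB diagm_def mtr_def)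
  ultimately have "(p + s)\<^sup>2 + (s * l + p / l)\<^sup>2 + (l + 1 / l)\<^sup>2 - (p + s) * (s * l + p / l) * (l + 1 / l) - 4 < 0"
    using cr by (simp add: crossing_def) (simp add: A' mtr_def)
  also have "(p + s)\<^sup>2 + (s * l + p / l)\<^sup>2 + (l + 1 / l)\<^sup>2 - (p + s) * (s * l + p / l) * (l + 1 / l) - 4
      = - (q * r) * (l - 1 / l)\<^sup>2"
  proof -
    define k where "k = 1 / l"
    have lk: "l * k = 1" using l by (simp add: k_def)
    have "(p + s)\<^sup>2 + (s * l + p * k)\<^sup>2 + (l + k)\<^sup>2 - (p + s) * (s * l + p * k) * (l + k) - 4 = - (q * r) * (l - k)\<^sup>2"
      using lk det by algebra
    then show ?thesis by (simp add: k_def)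
  qed
  finally have qr: "q * r > 0"
    using l by (auto simp: mult_less_0_iff zero_less_mult_iff)
  then have ps: "p * s > 0" using det by linarith
  show ?thesis
  proof (cases "p * q > 0")
    case True
    then have 1: "posm A'"
      using qr ps unfolding posm_def A' by (auto simp: zero_less_mult_iff)
    moreover have "posm (adj B')"
    proof (cases "l > 0")
      case True
      with 1 show ?thesis unfolding posm_def adjB A'
        by (elim disjE) (simp_all add: divide_neg_pos mult_neg_pos)
    next
      case False
      with 1 l show ?thesis unfolding posm_def adjB A'
        by (elim disjE) (simp_all add: divide_pos_neg divide_neg_neg mult_pos_neg mult_neg_neg)
    qed
    moreover have "adj B' = N * adj B * adj N" by (simp add: B'_def adj_mult mult.assoc)
    ultimately show ?thesis using that[OF N l d] by (simp add: A'_def)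
  next
    case False
    then have pq: "p * q < 0" using qr ps by (auto simp: zero_less_mult_iff mult_less_0_iff not_less)
    define J where "J = Mat 0 (-1) 1 0"
    have J: "J \<in> SL" by (simp add: J_def SL_def mdet_def)
    have JA: "J * A' * adj J = Mat s (- r) (- q) p" by (simp add: J_def A' mat2_defs)
    have JB: "J * adj B' * adj J = Mat (s * l) (- r * l) (- q / l) (p / l)"
      unfolding adjB by (simp add: J_def mat2_defs)
    have JD: "J * diagm l * adj J = diagm (1 / l)" by (simp add: J_def diagm_def mat2_defs)
    have 1: "posm (J * A' * adj J)"
      using pq qr ps unfolding posm_def JA by (auto simp: zero_less_mult_iff mult_less_0_iff)
    have 2: "posm (J * adj B' * adj J)"
    proof (cases "l > 0")
      case True
      with 1 show ?thesis unfolding posm_def JA JB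
        by (elim disjE) (simp_all add: divide_neg_pos divide_pos_pos mult_neg_pos)
    next
      case False
      with 1 l show ?thesis unfolding posm_def JA JB
        by (elim disjE) (simp_all add: divide_pos_neg divide_neg_neg mult_pos_neg mult_neg_neg)
    qed
    have eq: "J * N * Z * adj (J * N) = J * (N * Z * adj N) * adj J" for Z
      by (simp add: adj_mult mult.assoc)
    show ?thesis
    proof (rule that[of "J * N" "1 / l"])
      show "J * N \<in> SL" using J N by simp
      show "1 / l \<noteq> 0" "(1 / l)\<^sup>2 \<noteq> 1" using l by (auto simp: field_simps)
      show "J * N * (A * B) * adj (J * N) = diagm (1 / l)" unfolding eq d JD ..
      show "posm (J * N * A * adj (J * N))" unfolding eq using 1 by (simp add: A'_def)
      show "posm (J * N * adj B * adj (J * N))" unfolding eq using 2 by (simp add: B'_def adj_mult mult.assoc)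
    qed
  qed
qed

text \<open>The columns of \<open>P\<close> are the attracting and the repelling fixed point. The first is a positive real
number, the second a negative one.\<close>

lemma posm_diagonalise:
  assumes "M \<in> SL" "posm M"
  obtains P l where "P \<in> SL" "1 < l\<^sup>2" "l \<noteq> 0" "M = P * diagm l * adj P" "0 < m11 P * m21 P" "m12 P * m22 P < 0"
proof -
  have pos: "\<exists>P l. P \<in> SL \<and> 1 < l \<and> M = P * diagm l * adj P \<and> 0 < m11 P * m21 P \<and> m12 P * m22 P < 0"
    if "M \<in> SL" "0 < m11 M" "0 < m12 M" "0 < m21 M" "0 < m22 M" for M
  proof -
    define a b c d where "a = m11 M" "b = m12 M" "c = m21 M" "d = m22 M"
    have M: "M = Mat a b c d" by (simp add: a_b_c_d_def)
    have p: "a > 0" "b > 0" "c > 0" "d > 0" using that by (auto simp: a_b_c_d_def)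
    have det: "a * d - b * c = 1" using that(1) by (simp add: SL_def mdet_def M)
    define t where "t = a + d"
    have "t\<^sup>2 - 4 = (a - d)\<^sup>2 + 4 * (b * c)" using det unfolding t_def by algebra
    moreover have "b * c > 0" using p by simp
    ultimately have t4: "t\<^sup>2 - 4 > 0" by (smt (verit) zero_le_power2)
    define r where "r = sqrt (t\<^sup>2 - 4)"
    define l m where "l = (t + r) / 2" "m = (t - r) / 2"
    have r: "r > 0" "r\<^sup>2 = t\<^sup>2 - 4" using t4 by (auto simp: r_def)
    have lm: "l * m = 1" "l + m = t" "l - m = r"
      using r by (auto simp: l_m_def field_simps power2_eq_square)
    have l0: "l > 0" using r p by (simp add: l_m_def t_def)
    then have m0: "m > 0" using lm(1) by (metis zero_less_mult_pos zero_less_one)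
    have l1: "l > 1"
    proof (rule ccontr)
      assume "\<not> l > 1"
      then have "l * m < 1 * 1" using lm(3) r(1) l0 m0 by (intro mult_le_less_imp_less) auto
      then show False using lm(1) by simp
    qed
    have ml: "m = 1 / l" using lm(1) l0 by (simp add: nonzero_eq_divide_eq mult.commute)
    have prod: "(l - d) * (m - d) = - (b * c)" using lm det unfolding t_def by algebra
    have "b * c > 0" using p by simp
    then have sgn: "l - d > 0" "m - d < 0"
      using prod lm(3) r(1) by (smt (verit) mult_nonneg_nonneg mult_nonpos_nonpos)+
    define D where "D = c * (l - m)"
    have D: "D > 0" using p lm r by (simp add: D_def)
    define P where "P = Mat (l - d) ((m - d) / D) c (c / D)"
    have P: "P \<in> SL"
    proof -
      have "(l - d) * (c / D) - (m - d) / D * c = c * (l - m) / D"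
        by (simp add: algebra_simps diff_divide_distrib)
      also have "\<dots> = 1" using D by (simp flip: D_def)
      finally show ?thesis by (simp add: SL_def mdet_def P_def)
    qed
    have e2: "(m - d) * a + c * b = m * (m - d)"
      using lm det unfolding t_def by algebra
    have e3: "(l - d) * a + c * b = l * (l - d)"
      using lm det unfolding t_def by algebra
    have MP: "M * P = P * diagm l"
      using eigenvector_columns[OF e3 e2, of D] by (simp add: M P_def diagm_def ml)
    have "M = P * diagm l * adj P"
      by (simp add: MP[symmetric] mult.assoc adj_right[OF P])
    moreover have "m12 P * m22 P < 0" using sgn D p by (simp add: P_def mult_less_0_iff divide_less_0_iff)
    ultimately show ?thesis using P l1 sgn p by (intro exI[of _ P] exI[of _ l]) (simp add: P_def)
  qed
  from assms(2) consider "0 < m11 M \<and> 0 < m12 M \<and> 0 < m21 M \<and> 0 < m22 M" |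
     "m11 M < 0 \<and> m12 M < 0 \<and> m21 M < 0 \<and> m22 M < 0" by (auto simp: posm_def)
  then show ?thesis
  proof cases
    case 1
    then obtain P l where "P \<in> SL" "1 < l" "M = P * diagm l * adj P" "0 < m11 P * m21 P" "m12 P * m22 P < 0"
      using pos[OF assms(1)] by blast
    then show ?thesis using that[of P l] by auto
  next
    case 2
    define M' where "M' = Mat (- m11 M) (- m12 M) (- m21 M) (- m22 M)"
    have "M' \<in> SL" using assms(1) by (simp add: M'_def SL_def mdet_def)
    then obtain P l where P: "P \<in> SL" "1 < l" "M' = P * diagm l * adj P" "0 < m11 P * m21 P" "m12 P * m22 P < 0"
      using pos[of M'] 2 by (auto simp: M'_def)
    have "M = Mat (- m11 M') (- m12 M') (- m21 M') (- m22 M')" by (simp add: M'_def)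
    also have "\<dots> = P * diagm (- l) * adj P"
      unfolding P(3) by (simp add: diagm_def mat2_defs algebra_simps)
    finally show ?thesis using that[of P "- l"] P by auto
  qed
qed

section \<open>Plane topology\<close>

text \<open>Brouwer's theorem is applied to the map that subtracts \<open>(f z, g z)\<close> from \<open>z\<close> and clips the result
to the rectangle. At a fixed point no clipping can take place, by the signs on the boundary.\<close>

lemma poincare_miranda:
  fixes f g :: "real \<times> real \<Rightarrow> real"
  assumes ab: "a \<le> b" "c \<le> d"
    and cont: "continuous_on ({a..b} \<times> {c..d}) f" "continuous_on ({a..b} \<times> {c..d}) g"
    and f: "\<And>t. t \<in> {c..d} \<Longrightarrow> f (a, t) \<le> 0" "\<And>t. t \<in> {c..d} \<Longrightarrow> 0 \<le> f (b, t)"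
    and g: "\<And>s. s \<in> {a..b} \<Longrightarrow> g (s, c) \<le> 0" "\<And>s. s \<in> {a..b} \<Longrightarrow> 0 \<le> g (s, d)"
  obtains s t where "s \<in> {a..b}" "t \<in> {c..d}" "f (s, t) = 0" "g (s, t) = 0"
proof -
  let ?K = "{a..b} \<times> {c..d}"
  define T where "T = (\<lambda>z. (max a (min b (fst z - f z)), max c (min d (snd z - g z))))"
  have "?K = cbox (a, c) (b, d)" by (simp add: cbox_Pair_eq)
  then have K: "compact ?K" "convex ?K" "?K \<noteq> {}"
    using ab by (auto simp: compact_cbox convex_box)
  have "continuous_on ?K T" unfolding T_def
    by (intro continuous_intros cont)
  moreover have "T ` ?K \<subseteq> ?K" using ab by (auto simp: T_def)
  ultimately obtain z where z: "z \<in> ?K" "T z = z"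
    using brouwer[OF K] by (metis image_subset_iff_funcset)
  obtain s t where st: "z = (s, t)" by (cases z)
  have s: "s = max a (min b (s - f (s, t)))" and t: "t = max c (min d (t - g (s, t)))"
    and m: "s \<in> {a..b}" "t \<in> {c..d}"
    using z by (auto simp: T_def st)
  have "f (s, t) = 0"
  proof (rule ccontr)
    assume "f (s, t) \<noteq> 0"
    then consider "f (s, t) > 0" | "f (s, t) < 0" by linarith
    then show False
    proof cases
      case 1 then have "s = a" using s m by (auto simp: max_def min_def split: if_splits)
      then show ?thesis using f(1) m 1 by force
    next
      case 2 then have "s = b" using s m by (auto simp: max_def min_def split: if_splits)
      then show ?thesis using f(2) m 2 by force
    qed
  qed
  moreover have "g (s, t) = 0"
  proof (rule ccontr)
    assume "g (s, t) \<noteq> 0"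
    then consider "g (s, t) > 0" | "g (s, t) < 0" by linarith
    then show False
    proof cases
      case 1 then have "t = c" using t m by (auto simp: max_def min_def split: if_splits)
      then show ?thesis using g(1) m 1 by force
    next
      case 2 then have "t = d" using t m by (auto simp: max_def min_def split: if_splits)
      then show ?thesis using g(2) m 2 by force
    qed
  qed
  ultimately show ?thesis using m that by blast
qed

text \<open>A universal chord theorem for plane curves. If there is no such chord, then
\<open>F (s, t) = u s - u t - lam\<close> has no zero on the triangle \<open>t \<le> s\<close>, and hence it has a logarithm \<open>L\<close>
there. From \<open>F (1, t) = - F (t, 0)\<close> it follows that \<open>L\<close> has the same increment along the two legs
of the triangle, and along the hypotenuse \<open>F\<close> is constant. So \<open>L\<close> takes the same value at \<open>(1, 0)\<close>
and \<open>(0, 0)\<close>, where \<open>F\<close> takes opposite values.\<close>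

lemma half_chord:
  fixes u :: "real \<Rightarrow> complex"
  assumes cont: "continuous_on {0..1} u" and u1: "u 1 = u 0 + 2 * lam"
  obtains s t where "0 \<le> t" "t \<le> s" "s \<le> 1" "u s = u t + lam"
proof (rule ccontr)
  assume "\<not> thesis"
  then have no: "\<And>s t. 0 \<le> t \<Longrightarrow> t \<le> s \<Longrightarrow> s \<le> 1 \<Longrightarrow> u s \<noteq> u t + lam"
    using that by blast
  define F where "F = (\<lambda>z. u (fst z) - u (snd z) - lam)"
  let ?T = "{z :: real \<times> real. 0 \<le> snd z \<and> snd z \<le> fst z \<and> fst z \<le> 1}"
  have "convex ?T"
  proof -
    have "?T = {z. 0 \<le> inner (0, 1) z} \<inter> {z. 0 \<le> inner (1, -1) z} \<inter> {z. inner (1, 0) z \<le> 1}"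
      by (auto simp: inner_prod_def)
    then show ?thesis
      by (simp add: convex_Int convex_halfspace_le convex_halfspace_ge)
  qed
  then have T: "contractible ?T" by (rule convex_imp_contractible)
  have "continuous_on ?T (\<lambda>z. u (fst z))"
    by (rule continuous_on_compose2[OF cont]) (auto intro!: continuous_intros)
  moreover have "continuous_on ?T (\<lambda>z. u (snd z))"
    by (rule continuous_on_compose2[OF cont]) (auto intro!: continuous_intros)
  ultimately have cF: "continuous_on ?T F" unfolding F_def by (intro continuous_intros)
  have nz: "F z \<noteq> 0" if "z \<in> ?T" for z
    using no[of "snd z" "fst z"] that by (auto simp: F_def algebra_simps)
  obtain L where L: "continuous_on ?T L" "\<And>z. z \<in> ?T \<Longrightarrow> F z = exp (L z)"
    using continuous_logarithm_on_contractible[OF cF T nz] by blast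
  have cL: "continuous_on {0..1} (\<lambda>t. L (p t))" if "continuous_on {0..1} p" "p ` {0..1} \<subseteq> ?T" for p
    by (rule continuous_on_compose2[OF L(1) that])
  \<comment> \<open>A continuous function with constant exponential is constant.\<close>
  have const: "h 0 = h 1" if h: "continuous_on {0..1} h" "\<And>t. t \<in> {0..1} \<Longrightarrow> exp (h t) = k" 
    for h :: "real \<Rightarrow> complex" and k
  proof -
    have "h constant_on {0..1}"
    proof (rule continuous_discrete_range_constant[OF _ h(1)])
      show "connected {0..1::real}" by simp
      fix x :: real assume x: "x \<in> {0..1}"
      show "\<exists>e>0. \<forall>y. y \<in> {0..1} \<and> h y \<noteq> h x \<longrightarrow> e \<le> cmod (h y - h x)"
      proof (intro exI[of _ "2 * pi"] conjI allI impI)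
        fix y assume y: "y \<in> {0..1} \<and> h y \<noteq> h x"
        then have "exp (h y) = exp (h x)" using h(2) x by simp
        then obtain n :: int where n: "h y = h x + of_int (2 * n) * of_real pi * \<i>"
          by (auto simp: exp_eq)
        with y have "n \<noteq> 0" by auto
        then have "1 \<le> \<bar>n\<bar>" by simp
        then have "1 \<le> \<bar>real_of_int n\<bar>" by linarith
        then show "2 * pi \<le> cmod (h y - h x)" using n by (simp add: norm_mult)
      qed simp
    qed
    then show ?thesis by (auto simp: constant_on_def)
  qed
  have "L (1, 0) - L (0, 0) = L (1, 1) - L (1, 0)"
  proof (rule const[of "\<lambda>t. L (1, t) - L (t, 0)" "- 1"])
    show "continuous_on {0..1} (\<lambda>t. L (1, t) - L (t, 0))"
      by (intro continuous_intros cL) (auto intro!: continuous_intros)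
    fix t :: real assume t: "t \<in> {0..1}"
    have "F (1, t) = - F (t, 0)" by (simp add: F_def u1)
    then have "exp (L (1, t)) = - exp (L (t, 0))"
      using L(2)[of "(1, t)"] L(2)[of "(t, 0)"] t by simp
    then show "exp (L (1, t) - L (t, 0)) = - 1"
      by (simp add: exp_diff)
  qed
  moreover have "L (0, 0) = L (1, 1)"
  proof (rule const[of "\<lambda>t. L (t, t)" "- lam"])
    show "continuous_on {0..1} (\<lambda>t. L (t, t))"
      by (intro continuous_intros cL) (auto intro!: continuous_intros)
    fix t :: real assume t: "t \<in> {0..1}"
    show "exp (L (t, t)) = - lam"
      using L(2)[of "(t, t)"] t by (simp add: F_def)
  qed
  ultimately have "L (1, 0) = L (0, 0)" by (simp add: algebra_simps)
  moreover have "F (1, 0) = - F (0, 0)" by (simp add: F_def u1)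
  moreover have "F (1, 0) = exp (L (1, 0))" "F (0, 0) = exp (L (0, 0))" by (auto intro!: L(2))
  ultimately have "exp (L (0, 0)) = 0" by simp
  then show False by simp
qed

section \<open>Lines\<close>

text \<open>Coordinates that identify the half plane with the plane and in which diagonal matrices are
horizontal translations.\<close>

definition zeta :: "complex \<Rightarrow> complex" where "zeta z = Complex (ln (cmod z)) (slope z)"

lemma uhp_nonzero: "z \<in> uhp \<Longrightarrow> z \<noteq> 0"
  by (auto simp: uhp_def)

lemma zeta_inj:
  assumes "z \<in> uhp" "w \<in> uhp" "cmod z = cmod w" "slope z = slope w"
  shows "z = w"
proof -
  have e: "(cmod z)\<^sup>2 = (Im z)\<^sup>2 * (1 + (slope z)\<^sup>2)" if "z \<in> uhp" for z
    using that unfolding cmod_power2 by (simp add: slope_def uhp_def field_simps)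
  have "(Im z)\<^sup>2 * (1 + (slope z)\<^sup>2) = (Im w)\<^sup>2 * (1 + (slope z)\<^sup>2)"
    using e[OF assms(1)] e[OF assms(2)] assms(3,4) by metis
  moreover have "1 + (slope z)\<^sup>2 > 0" by (smt (verit) zero_le_power2)
  ultimately have "(Im z)\<^sup>2 = (Im w)\<^sup>2"
    by (metis less_irrefl mult_cancel_right)
  then have "Im z = Im w" using assms(1,2) by (simp add: uhp_def)
  then show ?thesis using assms by (simp add: slope_def uhp_def complex_eq_iff)
qed

lemma continuous_on_slope [continuous_intros]:
  assumes "continuous_on S f" "\<And>x. x \<in> S \<Longrightarrow> f x \<in> uhp" shows "continuous_on S (\<lambda>x. slope (f x))"
  unfolding slope_def using assms by (intro continuous_intros) (auto simp: uhp_def less_le)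

lemma continuous_on_ln_cmod [continuous_intros]:
  assumes "continuous_on S f" "\<And>x. x \<in> S \<Longrightarrow> f x \<in> uhp" shows "continuous_on S (\<lambda>x. ln (cmod (f x)))"
  using assms by (intro continuous_intros) (auto dest: uhp_nonzero)

lemma slope_scale: "0 < r \<Longrightarrow> slope (of_real r * z) = slope z"
  by (simp add: slope_def)

text \<open>Substitutes for the axis of \<open>X\<close>: invariant curves, not necessarily injective, on which \<open>X\<close> acts as
the shift by the period \<open>p\<close>.\<close>

definition line :: "mat2 \<Rightarrow> real \<Rightarrow> (real \<Rightarrow> complex) \<Rightarrow> bool" where
  "line X p c \<longleftrightarrow> 0 < p \<and> continuous_on UNIV c \<and> range c \<subseteq> uhp \<and> (\<forall>t. c (t + p) = mob X (c t))"

lemma line_uhp: "line X p c \<Longrightarrow> c t \<in> uhp"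
  by (auto simp: line_def)

lemma line_shift:
  assumes "line X p c" "X \<in> SL"
  shows "c (t + real n * p) = mob (X ^ n) (c t)"
proof (induction n)
  case (Suc n)
  have "c (t + real (Suc n) * p) = c ((t + real n * p) + p)" by (simp add: algebra_simps)
  also have "\<dots> = mob X (mob (X ^ n) (c t))" using assms Suc by (simp add: line_def)
  finally show ?case using assms by (simp add: mob_mult line_uhp)
qed simp

lemma line_shift_back:
  assumes "line X p c" "X \<in> SL"
  shows "c (t - real n * p) = mob (adj (X ^ n)) (c t)"
  using line_shift[OF assms, of "t - real n * p" n] assms by (simp add: line_uhp)

lemma line_mob:
  assumes "line X p c" "X \<in> SL" "N \<in> SL"
  shows "line (N * X * adj N) p (\<lambda>t. mob N (c t))"
proof -
  have "continuous_on UNIV (\<lambda>t. mob N (c t))"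
    using assms by (intro continuous_on_compose2[OF continuous_on_mob[OF assms(3) order_refl]])
      (auto simp: line_def)
  moreover have "mob N (c (t + p)) = mob (N * X * adj N) (mob N (c t))" for t
  proof -
    have "mob (N * X * adj N) (mob N (c t)) = mob (N * X * adj N * N) (c t)"
      using assms by (subst mob_mult) (simp_all add: line_uhp)
    also have "N * X * adj N * N = N * X" using assms by (simp add: mult.assoc adj_left)
    also have "mob (N * X) (c t) = mob N (mob X (c t))" using assms by (simp add: mob_mult line_uhp)
    finally show ?thesis using assms(1) by (simp add: line_def)
  qed
  ultimately show ?thesis using assms by (auto simp: line_def image_subset_iff)
qed

lemma periodic_range:
  fixes f :: "real \<Rightarrow> 'a"
  assumes "0 < p" "\<And>t. f (t + p) = f t"
  obtains s where "s \<in> {0..p}" "f t = f s"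
proof -
  define k where "k = \<lfloor>t / p\<rfloor>"
  have nat: "f (t + real n * p) = f t" for t n
  proof (induction n)
    case (Suc n)
    have "f (t + real (Suc n) * p) = f ((t + real n * p) + p)" by (simp add: algebra_simps)
    then show ?case using assms(2) Suc by simp
  qed simp
  have "f (t - of_int k * p) = f t"
  proof (cases "k \<ge> 0")
    case True
    then show ?thesis using nat[of "t - of_int k * p" "nat k"] by simp
  next
    case False
    then show ?thesis using nat[of t "nat (- k)"] by simp
  qed
  moreover have "t - of_int k * p \<in> {0..p}"
  proof -
    have "of_int k \<le> t / p" "t / p \<le> of_int k + 1" unfolding k_def by linarith+
    then show ?thesis using assms(1) by (simp add: field_simps)
  qed
  ultimately show ?thesis using that by metis
qed

lemma line_slope_bounded:
  assumes "line (diagm l) p c" "l \<noteq> 0"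
  obtains K where "\<And>t. \<bar>slope (c t)\<bar> \<le> K"
proof -
  have p: "p > 0" using assms(1) by (simp add: line_def)
  have per: "slope (c (t + p)) = slope (c t)" for t
    using assms by (simp add: line_def mob_diagm slope_scale del: of_real_power)
  have "compact ((\<lambda>t. slope (c t)) ` {0..p})"
    using assms(1) by (intro compact_continuous_image continuous_intros)
      (auto simp: line_def intro: continuous_on_subset)
  then obtain K where K: "\<And>t. t \<in> {0..p} \<Longrightarrow> \<bar>slope (c t)\<bar> \<le> K"
    by (metis (no_types, lifting) bounded_iff compact_imp_bounded imageI real_norm_def)
  have "\<bar>slope (c t)\<bar> \<le> K" for t
    using periodic_range[of p "\<lambda>t. slope (c t)" t] p per K by metis
  then show ?thesis using that by blast
qed

lemma line_log:
  assumes "line (diagm l) p c" "l \<noteq> 0"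
  shows "ln (cmod (c (t + real n * p))) = ln (cmod (c t)) + real n * ln (l\<^sup>2)"
proof (induction n)
  case (Suc n)
  have "c (t + real (Suc n) * p) = c ((t + real n * p) + p)" by (simp add: algebra_simps)
  also have "\<dots> = of_real (l\<^sup>2) * c (t + real n * p)" using assms by (simp add: line_def mob_diagm)
  finally have "cmod (c (t + real (Suc n) * p)) = l\<^sup>2 * cmod (c (t + real n * p))"
    by (simp add: norm_mult norm_power)
  then show ?case using Suc assms uhp_nonzero[OF line_uhp[OF assms(1), of "t + real n * p"]]
    by (simp add: ln_mult algebra_simps)
qed simp

text \<open>In the coordinates \<open>zeta\<close> the line stays in a horizontal strip and runs from one end of it to the
other, while a path in \<open>S\<close> runs from above the strip to below it. Over a sufficiently long piece of
the line the differences of the coordinates change sign as the Poincare-Miranda theorem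
requires.\<close>

lemma line_separates:
  assumes line: "line (diagm l) p c" and l: "l \<noteq> 0" "l\<^sup>2 \<noteq> 1"
    and S: "path_connected S" "S \<subseteq> uhp" "S \<inter> range c = {}"
    and up: "\<And>K. \<exists>w\<in>S. K < slope w" and dn: "\<And>K. \<exists>w\<in>S. slope w < K"
  shows False
proof -
  obtain K where K: "\<And>t. \<bar>slope (c t)\<bar> \<le> K" using line_slope_bounded[OF line l(1)] by blast
  obtain w1 w2 where w: "w1 \<in> S" "slope w1 < - K" "w2 \<in> S" "K < slope w2" using up dn by metis
  obtain \<gamma> where \<gamma>: "path \<gamma>" "path_image \<gamma> \<subseteq> S" "pathstart \<gamma> = w2" "pathfinish \<gamma> = w1"
    using S(1) w(1,3) unfolding path_connected_def by meson
  have \<gamma>S: "\<gamma> t \<in> S" if "t \<in> {0..1}" for t using \<gamma>(2) that by (auto simp: path_image_def)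
  then have \<gamma>H: "\<gamma> t \<in> uhp" if "t \<in> {0..1}" for t using S(2) that by blast
  have c\<gamma>: "continuous_on {0..1} \<gamma>" using \<gamma>(1) by (simp add: path_def)
  have "compact ((\<lambda>t. ln (cmod (\<gamma> t))) ` {0..1})"
    by (intro compact_continuous_image continuous_intros c\<gamma> \<gamma>H) auto
  then obtain B where B: "\<And>t. t \<in> {0..1} \<Longrightarrow> \<bar>ln (cmod (\<gamma> t))\<bar> \<le> B"
    by (metis (no_types, lifting) bounded_iff compact_imp_bounded imageI real_norm_def)
  have p: "p > 0" using line by (simp add: line_def)
  define \<mu> where "\<mu> = ln (l\<^sup>2)"
  have \<mu>: "\<mu> \<noteq> 0" using l by (simp add: \<mu>_def)
  obtain n :: nat where n: "real n * \<bar>\<mu>\<bar> > B + \<bar>ln (cmod (c 0))\<bar>"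
    using reals_Archimedean3[of "\<bar>\<mu>\<bar>"] \<mu> by auto
  define \<sigma> where "\<sigma> = sgn \<mu>"
  have \<sigma>: "\<sigma> * \<mu> = \<bar>\<mu>\<bar>" "\<bar>\<sigma>\<bar> = 1" using \<mu> by (auto simp: \<sigma>_def sgn_if)
  define b where "b = real n * p"
  have b: "b \<ge> 0" using p by (simp add: b_def)
  have eb: "ln (cmod (c b)) = ln (cmod (c 0)) + real n * \<mu>"
    using line_log[OF line l(1), of 0 n] by (simp add: b_def \<mu>_def)
  have ea: "ln (cmod (c (- b))) = ln (cmod (c 0)) - real n * \<mu>"
    using line_log[OF line l(1), of "- b" n] by (simp add: b_def \<mu>_def)
  have contc: "continuous_on A (\<lambda>z. c (fst z))" for A :: "(real \<times> real) set"
    by (rule continuous_on_compose2[of UNIV]) (use line in \<open>auto simp: line_def intro!: continuous_intros\<close>)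
  have contg: "continuous_on ({- b..b} \<times> {0..1}) (\<lambda>z. \<gamma> (snd z))"
    by (rule continuous_on_compose2[OF c\<gamma>]) (auto intro!: continuous_intros)
  define f where "f = (\<lambda>z. \<sigma> * (ln (cmod (c (fst z))) - ln (cmod (\<gamma> (snd z)))))"
  define g where "g = (\<lambda>z. slope (c (fst z)) - slope (\<gamma> (snd z)))"
  have bd: "\<bar>\<sigma> * x\<bar> = \<bar>x\<bar>" for x using \<sigma> by (simp add: abs_mult)
  obtain s t where st: "t \<in> {0..1}" "f (s, t) = 0" "g (s, t) = 0"
  proof (rule poincare_miranda[of "- b" b 0 1 f g])
    show "continuous_on ({- b..b} \<times> {0..1}) f" unfolding f_def
      by (intro continuous_intros contc contg) (auto intro: \<gamma>H line_uhp[OF line])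
    show "continuous_on ({- b..b} \<times> {0..1}) g" unfolding g_def
      by (intro continuous_intros contc contg) (auto intro: \<gamma>H line_uhp[OF line])
    fix t :: real assume t: "t \<in> {0..1}"
    have e: "\<sigma> * (x + real n * \<mu> - y) = real n * \<bar>\<mu>\<bar> + \<sigma> * (x - y)"
       "\<sigma> * (x - real n * \<mu> - y) = - (real n * \<bar>\<mu>\<bar>) + \<sigma> * (x - y)" for x y
      unfolding \<sigma>(1)[symmetric] by (auto simp: algebra_simps)
    have "\<bar>\<sigma> * (ln (cmod (c 0)) - ln (cmod (\<gamma> t)))\<bar> \<le> B + \<bar>ln (cmod (c 0))\<bar>"
      unfolding bd using B[OF t] by linarith
    then show "f (- b, t) \<le> 0" "0 \<le> f (b, t)" using n by (simp_all add: f_def ea eb e)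
  next
    fix s
    show "g (s, 0) \<le> 0" "0 \<le> g (s, 1)"
      using w K[of s] \<gamma>(3,4) by (auto simp: g_def pathstart_def pathfinish_def)
  qed (use b in auto)
  have "\<sigma> \<noteq> 0" using \<sigma>(2) by auto
  then have "ln (cmod (c s)) = ln (cmod (\<gamma> t))" "slope (c s) = slope (\<gamma> t)"
    using st by (auto simp: f_def g_def)
  then have "c s = \<gamma> t"
    using zeta_inj[OF line_uhp[OF line] \<gamma>H[OF st(1)]] uhp_nonzero[OF line_uhp[OF line]] uhp_nonzero[OF \<gamma>H[OF st(1)]]
    by simp
  then show False using S(3) \<gamma>S[OF st(1)] by (metis disjoint_iff rangeI)
qed

text \<open>In the coordinates \<open>zeta\<close> the matrix \<open>diagm l\<close> is a translation and its square is twice that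
translation.\<close>

lemma half_chord_line:
  fixes c :: "real \<Rightarrow> complex"
  assumes l: "l \<noteq> 0" and c: "continuous_on {0..1} c" "c ` {0..1} \<subseteq> uhp"
    and c1: "c 1 = mob (diagm (l\<^sup>2)) (c 0)"
  obtains s t where "0 \<le> t" "t \<le> s" "s \<le> 1" "c s = mob (diagm l) (c t)"
proof -
  have H: "c t \<in> uhp" if "t \<in> {0..1}" for t using c(2) that by blast
  define u where "u = l\<^sup>2"
  have u: "u > 0" using l by (simp add: u_def)
  have e: "mob (diagm l) z = of_real u * z" for z using l by (simp add: mob_diagm u_def)
  have n0: "c t \<noteq> 0" if "t \<in> {0..1}" for t using uhp_nonzero[OF H[OF that]] .
  have "continuous_on {0..1} (\<lambda>t. zeta (c t))"
    unfolding zeta_def Complex_eq by (intro continuous_intros c H) auto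
  moreover have "zeta (c 1) = zeta (c 0) + 2 * of_real (ln u)"
  proof -
    have c1': "c 1 = of_real (u * u) * c 0"
      using c1 mob_diagm[of u "c 0"] u unfolding u_def[symmetric] by (simp add: power2_eq_square)
    have uu: "0 < u * u" using u by simp
    have "cmod (c 1) = u * u * cmod (c 0)" using u by (simp add: c1' norm_mult)
    then have "ln (cmod (c 1)) = ln (cmod (c 0)) + 2 * ln u"
    proof -
      have "c 0 \<noteq> 0" by (simp add: n0)
      then show ?thesis using u \<open>cmod (c 1) = u * u * cmod (c 0)\<close> by (simp add: ln_mult)
    qed
    moreover have "slope (c 1) = slope (c 0)" unfolding c1' by (rule slope_scale[OF uu])
    ultimately show ?thesis unfolding zeta_def by (intro complex_eqI) simp_all
  qed
  ultimately obtain s t where st: "0 \<le> t" "t \<le> s" "s \<le> 1" "zeta (c s) = zeta (c t) + of_real (ln u)"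
    using half_chord by blast
  then have I: "s \<in> {0..1}" "t \<in> {0..1}" by auto
  have l1: "ln (cmod (c s)) = ln (cmod (c t)) + ln u" and l2: "slope (c s) = slope (c t)"
    using arg_cong[OF st(4), of Re] arg_cong[OF st(4), of Im] unfolding zeta_def by simp_all
  have "c s = of_real u * c t"
  proof (rule zeta_inj)
    show "c s \<in> uhp" using I H by simp
    show "of_real u * c t \<in> uhp" using H[OF I(2)] u by (simp add: uhp_def)
    have "ln (cmod (c s)) = ln (cmod (of_real u * c t))"
      unfolding l1 using n0[OF I(2)] u by (simp add: norm_mult ln_mult)
    then show "cmod (c s) = cmod (of_real u * c t)"
      using n0[OF I(1)] n0[OF I(2)] u by (subst (asm) ln_inj_iff) auto
    show "slope (c s) = slope (of_real u * c t)" unfolding l2 by (rule slope_scale[OF u, symmetric])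
  qed
  then show ?thesis using st that e by metis
qed

lemma power_unbounded:
  fixes a :: real assumes "1 < a" obtains n where "K < a ^ n" 
  using real_arch_pow[OF assms] by blast

text \<open>Multiplying by a large or a small real number pushes a point of the upper half-plane towards
  \<open>\<infinity>\<close> or \<open>0\<close>, and its image under a matrix towards a boundary point
  whose sign can be read off from the entries.\<close>

lemma slope_mob_scaled:
  assumes "Y \<in> SL" "u \<in> uhp" "0 < r"
  shows "slope (mob Y (of_real r * u)) =
    m11 Y * m21 Y * r * ((cmod u)\<^sup>2 / Im u) + m12 Y * m22 Y / (r * Im u) + (m11 Y * m22 Y + m12 Y * m21 Y) * slope u"
proof -
  have h: "of_real r * u \<in> uhp" using assms by (simp add: uhp_def)
  have "Im u > 0" using assms by (simp add: uhp_def)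
  then show ?thesis using assms(3) unfolding slope_mob[OF assms(1) h] slope_scale[OF assms(3)]
    by (simp add: norm_mult power2_eq_square field_simps)
qed

lemma slope_mob_large:
  assumes Y: "Y \<in> SL" "u \<in> uhp" "0 < m11 Y * m21 Y"
  obtains r0 where "0 < r0" "\<And>r. r0 \<le> r \<Longrightarrow> K < slope (mob Y (of_real r * u))"
proof -
  define a where "a = m11 Y * m21 Y * ((cmod u)\<^sup>2 / Im u)"
  define b where "b = \<bar>m12 Y * m22 Y / Im u\<bar>"
  define s where "s = (m11 Y * m22 Y + m12 Y * m21 Y) * slope u"
  have iu: "Im u > 0" using Y by (simp add: uhp_def)
  have a: "a > 0" using Y(3) iu uhp_nonzero[OF Y(2)] by (simp add: a_def)
  show ?thesis
  proof (rule that[of "max 1 ((\<bar>K\<bar> + b + \<bar>s\<bar> + 1) / a)"])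
    fix r assume r: "max 1 ((\<bar>K\<bar> + b + \<bar>s\<bar> + 1) / a) \<le> r"
    then have r1: "1 \<le> r" and ra: "\<bar>K\<bar> + b + \<bar>s\<bar> + 1 \<le> a * r" using a by (auto simp: field_simps)
    have "\<bar>m12 Y * m22 Y / (r * Im u)\<bar> = b / r"
      using r1 by (simp add: b_def abs_mult)
    also have "\<dots> \<le> b"
      using divide_left_mono[of 1 r b] r1 by (simp add: b_def)
    finally have "- b \<le> m12 Y * m22 Y / (r * Im u)"
      by (metis abs_le_D2 minus_le_iff)
    moreover have "slope (mob Y (of_real r * u)) = a * r + m12 Y * m22 Y / (r * Im u) + s"
      using slope_mob_scaled[OF Y(1,2), of r] r1 by (simp add: a_def s_def)
    ultimately show "K < slope (mob Y (of_real r * u))" using ra by linarith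
  qed auto
qed

lemma slope_mob_small:
  assumes Y: "Y \<in> SL" "u \<in> uhp" "m12 Y * m22 Y < 0"
  obtains r0 where "0 < r0" "\<And>r. 0 < r \<Longrightarrow> r \<le> r0 \<Longrightarrow> slope (mob Y (of_real r * u)) < K"
proof -
  define a where "a = \<bar>m11 Y * m21 Y * ((cmod u)\<^sup>2 / Im u)\<bar>"
  define b where "b = - (m12 Y * m22 Y / Im u)"
  define s where "s = (m11 Y * m22 Y + m12 Y * m21 Y) * slope u"
  have iu: "Im u > 0" using Y by (simp add: uhp_def)
  have b: "b > 0" using Y(3) iu by (simp add: b_def divide_neg_pos)
  define C where "C = \<bar>K\<bar> + a + \<bar>s\<bar> + 1"
  have C: "C > 0" by (simp add: C_def a_def add_nonneg_pos)
  show ?thesis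
  proof (rule that[of "min 1 (b / C)"])
    show "0 < min 1 (b / C)" using b C by simp
    fix r assume r: "0 < r" "r \<le> min 1 (b / C)"
    then have r1: "r \<le> 1" and rb: "C \<le> b / r" using C by (auto simp: field_simps)
    have "m11 Y * m21 Y * r * ((cmod u)\<^sup>2 / Im u) \<le> \<bar>m11 Y * m21 Y * r * ((cmod u)\<^sup>2 / Im u)\<bar>"
      by (rule abs_ge_self)
    also have "\<dots> = a * r" using r by (simp add: a_def abs_mult)
    also have "\<dots> \<le> a"
      using mult_left_le[of r a] r1 by (simp add: a_def)
    finally have "m11 Y * m21 Y * r * ((cmod u)\<^sup>2 / Im u) \<le> a" .
    moreover have "m12 Y * m22 Y / (r * Im u) = - (b / r)" by (simp add: b_def)
    ultimately have "slope (mob Y (of_real r * u)) \<le> a - b / r + s"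
      using slope_mob_scaled[OF Y(1,2) r(1)] by (simp add: s_def)
    then show "slope (mob Y (of_real r * u)) < K" using rb by (simp add: C_def)
  qed
qed

lemma line_diagm_shift:
  assumes "line (diagm l) p c" "l \<noteq> 0"
  shows "c (t + real n * p) = of_real ((l\<^sup>2) ^ n) * c t"
    and "c (t - real n * p) = of_real (1 / (l\<^sup>2) ^ n) * c t"
  using line_shift[OF assms(1), of t n] line_shift_back[OF assms(1), of t n] assms(2)
  by (simp_all add: diagm_power adj_diagm mob_diagm power_divide power_mult_distrib mult.commute flip: power_mult)

text \<open>In coordinates in which \<open>V\<close> is diagonal, the powers of \<open>V\<close> multiply a point by large or
small factors. Going back with \<open>P\<close> takes the results near the attracting fixed point, which is
positive, and the repelling one, which is negative.\<close>

lemma posm_line_slope: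
  assumes line: "line V p c" and V: "V \<in> SL" "posm V"
  shows "\<exists>t\<ge>t0. K < slope (c t)" "\<exists>t\<le>t0. slope (c t) < K"
proof -
  obtain P l where P: "P \<in> SL" "1 < l\<^sup>2" "l \<noteq> 0" "V = P * diagm l * adj P" "0 < m11 P * m21 P" "m12 P * m22 P < 0"
    using posm_diagonalise[OF V] by blast
  define u where "u = mob (adj P) (c t0)"
  have u: "u \<in> uhp" using P line by (simp add: u_def line_uhp)
  have p: "p > 0" using line by (simp add: line_def)
  have eq: "adj P * V * adj (adj P) = diagm l"
    using P(1) by (simp add: P(4) mult.assoc adj_left adj_left_cancel)
  have lu: "line (diagm l) p (\<lambda>t. mob (adj P) (c t))"
    using line_mob[OF line V(1), of "adj P"] P(1) eq by simp
  have ct: "c t = mob P (mob (adj P) (c t))" for t using P line by (simp add: line_uhp)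
  have 1: "c (t0 + real n * p) = mob P (of_real ((l\<^sup>2) ^ n) * u)" for n
    using ct[of "t0 + real n * p"] line_diagm_shift(1)[OF lu P(3), of t0 n] by (simp add: u_def)
  have 2: "c (t0 - real n * p) = mob P (of_real (1 / (l\<^sup>2) ^ n) * u)" for n
    using ct[of "t0 - real n * p"] line_diagm_shift(2)[OF lu P(3), of t0 n] by (simp add: u_def)
  show "\<exists>t\<ge>t0. K < slope (c t)"
  proof -
    obtain r0 where r0: "0 < r0" "\<And>r. r0 \<le> r \<Longrightarrow> K < slope (mob P (of_real r * u))"
      using slope_mob_large[OF P(1) u P(5)] by blast
    obtain n where "r0 < (l\<^sup>2) ^ n" using power_unbounded[OF P(2)] by blast
    then have "K < slope (c (t0 + real n * p))" unfolding 1 by (intro r0) simp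
    then show ?thesis using p by (intro exI[of _ "t0 + real n * p"]) simp
  qed
  show "\<exists>t\<le>t0. slope (c t) < K"
  proof -
    obtain r0 where r0: "0 < r0" "\<And>r. 0 < r \<Longrightarrow> r \<le> r0 \<Longrightarrow> slope (mob P (of_real r * u)) < K"
      using slope_mob_small[OF P(1) u P(6)] by blast
    obtain n where n: "1 / r0 < (l\<^sup>2) ^ n" using power_unbounded[OF P(2)] by blast
    have pn: "0 < (l\<^sup>2) ^ n" using P(3) by simp
    then have "1 / (l\<^sup>2) ^ n \<le> r0" using n r0(1) by (simp add: field_simps)
    then have "slope (c (t0 - real n * p)) < K" unfolding 2 using pn by (intro r0) auto
    then show ?thesis using p by (intro exI[of _ "t0 - real n * p"]) simp
  qed
qed

text \<open>The line contains large multiples of one of its points, and \<open>Y\<close> takes these near \<open>Y \<infinity>\<close>, a positive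
real number. The reflection in the imaginary axis exchanges \<open>adj Y\<close> with a matrix with the same
signs as \<open>Y\<close>.\<close>

lemma posm_translate_slope:
  assumes line: "line (diagm l) p c" and l: "l \<noteq> 0" "l\<^sup>2 \<noteq> 1" and Y: "Y \<in> SL" "posm Y"
  shows "\<exists>t. K < slope (mob Y (c t))" "\<exists>t. slope (mob (adj Y) (c t)) < K"
proof -
  have ex: "\<exists>t. \<exists>r\<ge>r0. c t = of_real r * c 0" for r0
  proof (cases "l\<^sup>2 > 1")
    case True
    obtain n where "r0 < (l\<^sup>2) ^ n" using power_unbounded[OF True] by blast
    then show ?thesis using line_diagm_shift(1)[OF line l(1), of 0 n] by (metis less_imp_le)
  next
    case False
    define k where "k = 1 / l\<^sup>2"
    have k: "k > 1" using False l by (simp add: k_def field_simps less_le)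
    obtain n where n: "r0 < k ^ n" using power_unbounded[OF k] by blast
    moreover have "1 / (l\<^sup>2) ^ n = k ^ n" by (simp add: k_def power_divide)
    ultimately show ?thesis using line_diagm_shift(2)[OF line l(1), of 0 n] by (metis less_imp_le)
  qed
  have u: "c 0 \<in> uhp" by (rule line_uhp[OF line])
  have m: "0 < m11 Y * m21 Y" using Y(2) by (auto simp: posm_def mult_neg_neg)
  obtain r0 where r0: "0 < r0" "\<And>r. r0 \<le> r \<Longrightarrow> K < slope (mob Y (of_real r * c 0))"
    using slope_mob_large[OF Y(1) u m] by blast
  show "\<exists>t. K < slope (mob Y (c t))" using ex[of r0] r0 by metis
  define J where "J z = - cnj z" for z
  have J: "slope (J z) = - slope z" "J z \<in> uhp \<longleftrightarrow> z \<in> uhp" "J (of_real r * z) = of_real r * J z" for z r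
    by (auto simp: J_def slope_def uhp_def)
  define Y' where "Y' = Mat (m22 Y) (m12 Y) (m21 Y) (m11 Y)"
  have Y': "Y' \<in> SL" "0 < m11 Y' * m21 Y'" using Y by (auto simp: Y'_def SL_def mdet_def posm_def mult_neg_neg algebra_simps)
  have YJ: "mob (adj Y) z = J (mob Y' (J z))" for z
    by (simp add: mob_def J_def adj_def Y'_def) (metis (no_types, opaque_lifting) add.commute minus_diff_eq minus_divide_left minus_divide_right uminus_add_conv_diff minus_minus)
  obtain r1 where r1: "0 < r1" "\<And>r. r1 \<le> r \<Longrightarrow> - K < slope (mob Y' (of_real r * J (c 0)))"
    using slope_mob_large[OF Y'(1) _ Y'(2), of "J (c 0)"] u J(2) by blast
  obtain t r where "r1 \<le> r" "c t = of_real r * c 0" using ex by blast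
  then show "\<exists>t. slope (mob (adj Y) (c t)) < K"
    using r1(2)[of r] by (intro exI[of _ t]) (simp add: YJ J)
qed

lemma crossing_adj_mult: "crossing X Y \<Longrightarrow> crossing X (adj X * Y)"
proof -
  assume c: "crossing X Y"
  then have X: "X \<in> SL" "Y \<in> SL" by (auto simp: crossing_def)
  have e: "mtr (adj X * Y) = mtr X * mtr Y - mtr (X * Y)"
    using mtr_mult_adj[of Y X] by (metis mtr_commute mult.commute)
  show ?thesis using c X unfolding crossing_def
    by (simp add: e adj_right_cancel) (simp add: algebra_simps power2_eq_square)
qed

lemma path_connected_line: "line X p c \<Longrightarrow> path_connected (c ` I)" if "convex I" for I :: "real set"
  by (rule path_connected_continuous_image)
    (use that in \<open>auto intro!: convex_imp_path_connected simp: line_def intro: continuous_on_subset\<close>)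

text \<open>In coordinates in which \<open>U\<close> is diagonal, \<open>V\<close> can be taken to have entries of the same sign, by the
normal form for the pair \<open>(V, V\<inverse> U)\<close>. Then its line runs from one side of the line of \<open>U\<close> to the
other.\<close>

lemma crossing_lines_meet:
  assumes "crossing U V" "line U p c" "line V q e"
  obtains s t where "c s = e t"
proof -
  have S: "U \<in> SL" "V \<in> SL" using assms by (auto simp: crossing_def)
  have "crossing V (adj V * U)" by (rule crossing_adj_mult[OF crossing_sym[OF assms(1)]])
  then obtain N l where N: "N \<in> SL" "l \<noteq> 0" "l\<^sup>2 \<noteq> 1" "N * (V * (adj V * U)) * adj N = diagm l" "posm (N * V * adj N)"
    using crossing_normal_form by metis
  have lc: "line (diagm l) p (\<lambda>t. mob N (c t))"
    using line_mob[OF assms(2) S(1) N(1)] N(4) S by (simp add: adj_right_cancel)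
  have le: "line (N * V * adj N) q (\<lambda>t. mob N (e t))"
    by (rule line_mob[OF assms(3) S(2) N(1)])
  have V': "N * V * adj N \<in> SL" using N S by simp
  have "range (\<lambda>t. mob N (e t)) \<inter> range (\<lambda>t. mob N (c t)) \<noteq> {}"
  proof
    assume e: "range (\<lambda>t. mob N (e t)) \<inter> range (\<lambda>t. mob N (c t)) = {}"
    show False
    proof (rule line_separates[OF lc N(2,3) _ _ e])
      show "path_connected (range (\<lambda>t. mob N (e t)))" using path_connected_line[OF _ le, of UNIV] by simp
      show "range (\<lambda>t. mob N (e t)) \<subseteq> uhp" using le by (simp add: line_def)
      show "\<exists>w\<in>range (\<lambda>t. mob N (e t)). K < slope w" for K
        using posm_line_slope(1)[OF le V' N(5)] by blast
      show "\<exists>w\<in>range (\<lambda>t. mob N (e t)). slope w < K" for K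
        using posm_line_slope(2)[OF le V' N(5)] by blast
    qed
  qed
  then obtain s t where "mob N (e t) = mob N (c s)" by blast
  then have "e t = c s"
    using N(1) line_uhp[OF assms(2)] line_uhp[OF assms(3)] by (metis mob_adj_left)
  then show ?thesis using that by metis
qed

section \<open>Metrics on the half-plane and translation lengths\<close>

text \<open>What is used of the metric: \<open>d_path\<close> says that it is a length metric, where \<open>l\<close> measures the length
along the path \<open>c\<close>; \<open>d_hyp\<close> bounds the hyperbolic distance in terms of \<open>d\<close>, and so ensures that
\<open>d\<close>-bounded sets are relatively compact.\<close>

locale plane_metric =
  fixes d :: "complex \<Rightarrow> complex \<Rightarrow> real"
  assumes d_refl: "z \<in> uhp \<Longrightarrow> d z z = 0"
    and d_nonneg: "z \<in> uhp \<Longrightarrow> w \<in> uhp \<Longrightarrow> 0 \<le> d z w"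
    and d_sym: "z \<in> uhp \<Longrightarrow> w \<in> uhp \<Longrightarrow> d z w = d w z"
    and d_tri: "x \<in> uhp \<Longrightarrow> y \<in> uhp \<Longrightarrow> z \<in> uhp \<Longrightarrow> d x z \<le> d x y + d y z"
    and d_path: "z \<in> uhp \<Longrightarrow> w \<in> uhp \<Longrightarrow> 0 < e \<Longrightarrow>
      \<exists>c l :: real \<Rightarrow> real. continuous_on {0..1} c \<and> c ` {0..1} \<subseteq> uhp \<and> c 0 = z \<and> c 1 = w \<and>
        l 1 - l 0 < d z w + e \<and> (\<forall>s t. 0 \<le> s \<longrightarrow> s \<le> t \<longrightarrow> t \<le> 1 \<longrightarrow> d (c s) (c t) \<le> l t - l s)"
    and d_hyp: "\<exists>R'. \<forall>z\<in>uhp. \<forall>w\<in>uhp. d z w \<le> R \<longrightarrow> hyp z w \<le> R'"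
    and d_bdd: "compact K \<Longrightarrow> K \<subseteq> uhp \<Longrightarrow> \<exists>N. \<forall>z\<in>K. \<forall>w\<in>K. d z w \<le> N"
begin

definition isom :: "mat2 set" where
  "isom = {M \<in> SL. \<forall>z\<in>uhp. \<forall>w\<in>uhp. d (mob M z) (mob M w) = d z w}"

lemma isomI: "M \<in> SL \<Longrightarrow> (\<And>z w. z \<in> uhp \<Longrightarrow> w \<in> uhp \<Longrightarrow> d (mob M z) (mob M w) = d z w) \<Longrightarrow> M \<in> isom"
  unfolding isom_def by blast

lemma isom_SL [simp]: "M \<in> isom \<Longrightarrow> M \<in> SL"
  unfolding isom_def by blast

lemma isom_d [simp]: "M \<in> isom \<Longrightarrow> z \<in> uhp \<Longrightarrow> w \<in> uhp \<Longrightarrow> d (mob M z) (mob M w) = d z w"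
  unfolding isom_def by blast

lemma isom_one [simp]: "1 \<in> isom"
  by (rule isomI) auto

lemma isom_mult [simp]: "M \<in> isom \<Longrightarrow> N \<in> isom \<Longrightarrow> M * N \<in> isom"
  by (rule isomI) (auto simp: mob_mult)

lemma isom_power [simp]: "M \<in> isom \<Longrightarrow> M ^ n \<in> isom"
  by (induction n) auto

lemma isom_adj [simp]:
  assumes "M \<in> isom" shows "adj M \<in> isom"
proof (rule isomI)
  fix z w assume z: "z \<in> uhp" "w \<in> uhp"
  have "d (mob (adj M) z) (mob (adj M) w) = d (mob M (mob (adj M) z)) (mob M (mob (adj M) w))"
    by (rule isom_d[OF assms, symmetric]) (use z assms in auto)
  also have "\<dots> = d z w" using z isom_SL[OF assms] by (simp del: isom_d)
  finally show "d (mob (adj M) z) (mob (adj M) w) = d z w" .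
qed (use assms in simp)

definition tau :: "mat2 \<Rightarrow> real" where
  "tau M = (INF z\<in>uhp. d z (mob M z))"

lemma uhp_nonempty: "uhp \<noteq> {}"
proof -
  have "\<i> \<in> uhp" by (simp add: uhp_def)
  then show ?thesis by blast
qed

lemma tau_le: "M \<in> SL \<Longrightarrow> z \<in> uhp \<Longrightarrow> tau M \<le> d z (mob M z)"
  unfolding tau_def by (rule cINF_lower) (auto intro!: bdd_belowI[of _ 0] d_nonneg)

lemma tau_greatest: "(\<And>z. z \<in> uhp \<Longrightarrow> k \<le> d z (mob M z)) \<Longrightarrow> k \<le> tau M"
  unfolding tau_def by (rule cINF_greatest[OF uhp_nonempty])

lemma tau_nonneg: "M \<in> SL \<Longrightarrow> 0 \<le> tau M"
  by (rule tau_greatest) (simp add: d_nonneg)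

lemma tau_approx:
  assumes "M \<in> SL" "0 < e" obtains z where "z \<in> uhp" "d z (mob M z) < tau M + e"
proof -
  have "\<exists>z\<in>uhp. d z (mob M z) < tau M + e"
  proof (rule ccontr)
    assume "\<not> (\<exists>z\<in>uhp. d z (mob M z) < tau M + e)"
    then have "\<And>z. z \<in> uhp \<Longrightarrow> tau M + e \<le> d z (mob M z)" by (meson not_less)
    then have "tau M + e \<le> tau M" by (rule tau_greatest)
    then show False using assms(2) by simp
  qed
  then show ?thesis using that by blast
qed

lemma tau_adj: assumes "M \<in> isom" shows "tau (adj M) = tau M"
proof -
  have le: "tau N \<le> tau (adj N)" if "N \<in> isom" for N
  proof (rule tau_greatest)
    fix z assume z: "z \<in> uhp"
    have "tau N \<le> d (mob (adj N) z) (mob N (mob (adj N) z))" using that z by (intro tau_le) auto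
    also have "\<dots> = d z (mob (adj N) z)" using that z by (simp add: d_sym)
    finally show "tau N \<le> d z (mob (adj N) z)" .
  qed
  show ?thesis using le[OF assms] le[of "adj M"] assms by simp
qed

lemma tau_commute: assumes "M \<in> isom" "N \<in> isom" shows "tau (M * N) = tau (N * M)"
proof -
  have le: "tau (N * M) \<le> tau (M * N)" if "M \<in> isom" "N \<in> isom" for M N
  proof (rule tau_greatest)
    fix z assume z: "z \<in> uhp"
    have "tau (N * M) \<le> d (mob N z) (mob (N * M) (mob N z))" using that z by (intro tau_le) auto
    also have "mob (N * M) (mob N z) = mob N (mob (M * N) z)" using that z by (simp add: mob_mult)
    finally show "tau (N * M) \<le> d z (mob (M * N) z)" using that z by simp
  qed
  show ?thesis using le[OF assms] le[OF assms(2,1)] by simp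
qed

lemma displacement_power:
  assumes "M \<in> isom" "z \<in> uhp" shows "d z (mob (M ^ n) z) \<le> real n * d z (mob M z)"
proof (induction n)
  case (Suc n)
  have "d z (mob (M ^ Suc n) z) \<le> d z (mob M z) + d (mob M z) (mob (M ^ Suc n) z)"
    using assms by (intro d_tri) auto
  also have "d (mob M z) (mob (M ^ Suc n) z) = d z (mob (M ^ n) z)"
    using assms by (simp add: mob_mult)
  finally show ?case using Suc by (simp add: algebra_simps)
qed (use assms in \<open>simp add: d_refl\<close>)

abbreviation hyperbolic :: "mat2 \<Rightarrow> bool" where "hyperbolic X \<equiv> 4 < (mtr X)\<^sup>2"

lemma hyperbolic_square:
  assumes "X \<in> SL" "hyperbolic X" shows "hyperbolic (X\<^sup>2)"
proof -
  have "mtr (X\<^sup>2) = (mtr X)\<^sup>2 - 2"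
    using mtr_mult_twice[OF assms(1), of 1] by (simp add: power2_eq_square)
  moreover have "(2::real)\<^sup>2 < ((mtr X)\<^sup>2 - 2)\<^sup>2"
    using assms(2) by (intro power_strict_mono) auto
  ultimately show ?thesis by simp
qed

text \<open>A path from \<open>z\<close> to \<open>X\<^sup>2 z\<close> contains points \<open>w\<close> and \<open>X w\<close>, in this order, by \<open>half_chord_line\<close>. The part
between them has length at least \<open>tau X\<close>. Removing it and moving the rest back by \<open>X\<close> leaves a path
from \<open>z\<close> to \<open>X z\<close>, which also has length at least \<open>tau X\<close>.\<close>

lemma tau_square:
  assumes X: "X \<in> isom" "hyperbolic X" shows "2 * tau X \<le> tau (X\<^sup>2)"
proof (rule tau_greatest)
  fix z assume z: "z \<in> uhp"
  show "2 * tau X \<le> d z (mob (X\<^sup>2) z)"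
  proof (rule field_le_epsilon)
    fix e :: real assume e: "e > 0"
    obtain c and l :: "real \<Rightarrow> real" where c: "continuous_on {0..1} c" "c ` {0..1} \<subseteq> uhp" "c 0 = z" "c 1 = mob (X\<^sup>2) z"
      and l: "l 1 - l 0 < d z (mob (X\<^sup>2) z) + e" "\<And>s t. 0 \<le> s \<Longrightarrow> s \<le> t \<Longrightarrow> t \<le> 1 \<Longrightarrow> d (c s) (c t) \<le> l t - l s"
      using d_path[of z "mob (X\<^sup>2) z" e] z X e by auto
    have H: "c t \<in> uhp" if "t \<in> {0..1}" for t using c(2) that by blast
    obtain N m where N: "N \<in> SL" "m \<noteq> 0" "N * X * adj N = diagm m"
      using diagonalise[of X] X isom_SL by metis
    have N1: "mob N (c 1) = mob (diagm (m\<^sup>2)) (mob N (c 0))"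
    proof -
      have "diagm (m\<^sup>2) = N * X\<^sup>2 * adj N"
        unfolding diagm_power[symmetric] N(3)[symmetric] using N(1)
        by (simp add: power2_eq_square mult.assoc adj_left_cancel)
      then have "mob (diagm (m\<^sup>2)) (mob N (c 0)) = mob (N * X\<^sup>2 * adj N * N) z"
        using N(1) X(1) z c(3) by (simp add: mob_mult)
      also have "N * X\<^sup>2 * adj N * N = N * X\<^sup>2" using N(1) by (simp add: mult.assoc adj_left)
      finally show ?thesis using N(1) X(1) z c(4) by (simp add: mob_mult)
    qed
    have N2: "continuous_on {0..1} (\<lambda>t. mob N (c t))"
      by (rule continuous_on_compose2[OF continuous_on_mob[OF N(1) order_refl] c(1) c(2)])
    have N3: "(\<lambda>t. mob N (c t)) ` {0..1} \<subseteq> uhp" using H N(1) by auto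
    obtain s t where st: "0 \<le> t" "t \<le> s" "s \<le> 1" "mob N (c s) = mob (diagm m) (mob N (c t))"
      by (rule half_chord_line[OF N(2) N2 N3 N1])
    have cs: "c s \<in> uhp" "c t \<in> uhp" using H st by auto
    have "mob N (c s) = mob N (mob X (c t))"
      using st(4) cs N(1) X unfolding N(3)[symmetric] by (simp add: mob_mult)
    then have eq: "c s = mob X (c t)" using N(1) X cs by (metis mob_adj_left mob_uhp isom_SL)
    have "tau X \<le> d (c t) (c s)" unfolding eq using cs X by (intro tau_le) auto
    also have "\<dots> \<le> l s - l t" using st by (intro l) auto
    finally have 1: "tau X \<le> l s - l t" .
    have "tau X \<le> d z (mob X z)" using z X by (intro tau_le) auto
    also have "\<dots> \<le> d z (c t) + d (c t) (mob X z)" using z cs X by (intro d_tri) auto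
    also have "d (c t) (mob X z) = d (c s) (c 1)"
      using z cs X c unfolding eq by (simp add: power2_eq_square mob_mult)
    also have "d z (c t) + \<dots> \<le> (l t - l 0) + (l 1 - l s)"
      using st l(2)[of 0 t] l(2)[of s 1] c(3) by auto
    finally show "2 * tau X \<le> d z (mob (X\<^sup>2) z) + e" using 1 l(1) by linarith
  qed
qed

text \<open>Squaring repeatedly gives the estimate for the powers of 2. If it failed for \<open>n\<close>, then the division
of a large power of 2 by \<open>n\<close>, with remainder, would contradict it.\<close>

lemma displacement_power_ge:
  assumes X: "X \<in> isom" "hyperbolic X" and z: "z \<in> uhp"
  shows "real n * tau X \<le> d z (mob (X ^ n) z)"
proof -
  have pw: "X ^ 2 ^ k \<in> isom \<and> hyperbolic (X ^ 2 ^ k) \<and> 2 ^ k * tau X \<le> tau (X ^ 2 ^ k)" for k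
  proof (induction k)
    case (Suc k)
    have e: "X ^ 2 ^ Suc k = (X ^ 2 ^ k)\<^sup>2" by (simp add: power_mult[symmetric] mult.commute)
    show ?case unfolding e using Suc tau_square[of "X ^ 2 ^ k"] hyperbolic_square[of "X ^ 2 ^ k"]
      by auto
  qed (use X in auto)
  have "tau X \<le> d z (mob (X ^ n) z) / real n" if n: "n > 0"
  proof (rule ccontr)
    let ?D = "d z (mob (X ^ n) z)" let ?E = "d z (mob X z)"
    assume "\<not> tau X \<le> ?D / real n"
    then have pos: "0 < tau X - ?D / real n" by simp
    obtain k where k: "real n * ?E < 2 ^ k * (tau X - ?D / real n)"
      using real_arch_pow[of 2 "real n * ?E / (tau X - ?D / real n)"] pos by (auto simp: field_simps)
    define q r where "q = (2::nat) ^ k div n" "r = (2::nat) ^ k mod n"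
    have qr: "2 ^ k = n * q + r" by (simp add: q_r_def)
    have z': "mob (X ^ (n * q)) z \<in> uhp" using X z by simp
    have "2 ^ k * tau X \<le> d z (mob (X ^ 2 ^ k) z)"
      using pw[of k] tau_le[of "X ^ 2 ^ k" z] z X by force
    also have "\<dots> \<le> d z (mob (X ^ (n * q)) z) + d (mob (X ^ (n * q)) z) (mob (X ^ (n * q + r)) z)"
      unfolding qr using X z by (intro d_tri) auto
    also have "d (mob (X ^ (n * q)) z) (mob (X ^ (n * q + r)) z) = d z (mob (X ^ r) z)"
      using X z by (simp add: power_add mob_mult)
    also have "d z (mob (X ^ (n * q)) z) \<le> real q * ?D"
      unfolding power_mult using X z by (intro displacement_power) auto
    also have "d z (mob (X ^ r) z) \<le> real r * ?E"
      using X z by (intro displacement_power) auto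
    also have "real q * ?D \<le> 2 ^ k / real n * ?D"
    proof (rule mult_right_mono)
      have "real q * real n \<le> 2 ^ k"
        using div_times_less_eq_dividend[of "2 ^ k" n] unfolding q_r_def
        by (metis of_nat_le_iff of_nat_mult of_nat_numeral of_nat_power)
      then show "real q \<le> 2 ^ k / real n" using n by (simp add: field_simps)
    qed (use X z in \<open>auto intro: d_nonneg\<close>)
    also have "real r * ?E \<le> real n * ?E"
      using n X z by (intro mult_right_mono) (auto simp: q_r_def intro: d_nonneg less_imp_le)
    finally have "2 ^ k * (tau X - ?D / real n) \<le> real n * ?E" by (simp add: algebra_simps)
    with k show False by simp
  qed
  then show ?thesis using z X by (cases "n = 0") (auto simp: field_simps d_refl)
qed

lemma stable_length_eq_tau:
  assumes X: "X \<in> isom" "hyperbolic X" and z: "z \<in> uhp"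
  shows "(\<lambda>m. d z (mob (X ^ m) z) / real m) \<longlonglongrightarrow> tau X"
proof (rule LIMSEQ_I)
  fix e :: real assume e: "0 < e"
  obtain w where w: "w \<in> uhp" "d w (mob X w) < tau X + e / 2" using tau_approx[of X "e / 2"] X e by auto
  obtain m0 where m0: "real m0 > 4 * d z w / e" using reals_Archimedean2 by blast
  show "\<exists>no. \<forall>n\<ge>no. norm (d z (mob (X ^ n) z) / real n - tau X) < e"
  proof (intro exI[of _ "Suc m0"] allI impI)
    fix m assume m: "Suc m0 \<le> m"
    have "real m0 * e > 4 * d z w" using m0 e by (simp add: field_simps)
    moreover have "real m0 * e \<le> real m * e" using m e by (intro mult_right_mono) auto
    ultimately have m': "real m * e > 4 * d z w" "real m > 0" using m by auto
    have "d z (mob (X ^ m) z) \<le> d z w + d w (mob (X ^ m) z)" using X z w by (intro d_tri) auto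
    also have "d w (mob (X ^ m) z) \<le> d w (mob (X ^ m) w) + d (mob (X ^ m) w) (mob (X ^ m) z)"
      using X z w by (intro d_tri) auto
    also have "d (mob (X ^ m) w) (mob (X ^ m) z) = d z w" using X z w by (simp add: d_sym)
    also have "d w (mob (X ^ m) w) \<le> real m * d w (mob X w)" using X w by (intro displacement_power) auto
    also have "\<dots> \<le> real m * (tau X + e / 2)" using w by (intro mult_left_mono) auto
    finally have "d z (mob (X ^ m) z) < real m * (tau X + e)" using m' by (simp add: algebra_simps)
    then have "d z (mob (X ^ m) z) / real m < tau X + e" using m' by (simp add: field_simps)
    moreover have "tau X \<le> d z (mob (X ^ m) z) / real m"
      using displacement_power_ge[OF X z, of m] m' by (simp add: field_simps)
    ultimately show "norm (d z (mob (X ^ m) z) / real m - tau X) < e" by simp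
  qed
qed

text \<open>If \<open>tau X = 0\<close>, then for each \<open>n\<close> some point is moved by \<open>X\<^sup>n\<close> by at most 1. The hyperbolic
distances by which \<open>X\<^sup>n\<close> moves points tend to \<open>\<infinity>\<close>, uniformly in the point.\<close>

lemma tau_pos:
  assumes X: "X \<in> isom" "hyperbolic X" shows "0 < tau X"
proof (rule ccontr)
  assume "\<not> 0 < tau X"
  then have 0: "tau X = 0" using tau_nonneg[of X] X by simp
  obtain R' where R': "\<And>z w. z \<in> uhp \<Longrightarrow> w \<in> uhp \<Longrightarrow> d z w \<le> 1 \<Longrightarrow> hyp z w \<le> R'" using d_hyp[of 1] by blast
  obtain N m where N: "N \<in> SL" "m \<noteq> 0" "m\<^sup>2 \<noteq> 1" "N * X * adj N = diagm m"
    using diagonalise[of X] X by auto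
  define u where "u = m\<^sup>2"
  have u: "u > 0" "u \<noteq> 1" using N by (auto simp: u_def)
  have bound: "(u ^ n - 1)\<^sup>2 / u ^ n \<le> R'" for n
  proof -
    obtain z where z: "z \<in> uhp" "d z (mob X z) < 1 / (real n + 1)"
      using tau_approx[of X "1 / (real n + 1)"] X 0 by (auto simp: field_simps)
    have "d z (mob (X ^ n) z) \<le> real n * d z (mob X z)" using X z by (intro displacement_power) auto
    also have "\<dots> \<le> real n * (1 / (real n + 1))" using z by (intro mult_left_mono) auto
    also have "\<dots> \<le> 1" by simp
    finally have hb: "hyp z (mob (X ^ n) z) \<le> R'" using R' z X by simp
    define w where "w = mob N z"
    have w: "w \<in> uhp" using z N by (simp add: w_def)
    have Nn: "N * X ^ n * adj N = diagm (m ^ n)"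
    proof (induction n)
      case (Suc n)
      have "N * X ^ Suc n * adj N = (N * X * adj N) * (N * X ^ n * adj N)"
        using N(1) by (simp add: mult.assoc adj_left_cancel)
      then show ?case unfolding Suc N(4) by (metis diagm_power power_Suc)
    next
      case 0
      have "diagm 1 = 1" by (simp add: diagm_def one_mat2_def)
      then show ?case using N(1) by (simp add: adj_right)
    qed
    have "mob N (mob (X ^ n) z) = mob (N * X ^ n * adj N) w"
      using N X z by (simp add: w_def mob_mult)
    also have "\<dots> = of_real (u ^ n) * w"
      unfolding Nn using N by (simp add: mob_diagm u_def flip: power_mult) (simp add: mult.commute)
    finally have hw: "hyp z (mob (X ^ n) z) = hyp w (of_real (u ^ n) * w)"
      using hyp_mob[OF N(1), of z "mob (X ^ n) z"] z X by (simp add: w_def)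
    have "(u ^ n - 1)\<^sup>2 / u ^ n \<le> hyp w (of_real (u ^ n) * w)"
    proof -
      have iw: "Im w > 0" using w by (simp add: uhp_def)
      have un: "u ^ n > 0" using u by simp
      have "w - of_real (u ^ n) * w = of_real (1 - u ^ n) * w" by (simp add: algebra_simps)
      then have "cmod (w - of_real (u ^ n) * w) = \<bar>1 - u ^ n\<bar> * cmod w"
        by (simp only: norm_mult norm_of_real)
      then have e: "(cmod (w - of_real (u ^ n) * w))\<^sup>2 = (u ^ n - 1)\<^sup>2 * (cmod w)\<^sup>2"
        by (simp only: power_mult_distrib power2_abs power2_commute[of 1])
      have "Im (of_real (u ^ n) * w) = u ^ n * Im w" by (simp del: of_real_power)
      then have h: "hyp w (of_real (u ^ n) * w) = ((u ^ n - 1)\<^sup>2 * (cmod w)\<^sup>2) / (u ^ n * (Im w)\<^sup>2)"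
        unfolding hyp_def e by (simp only: power2_eq_square[of "Im w"] mult.left_commute)
      have "(u ^ n - 1)\<^sup>2 / u ^ n = ((u ^ n - 1)\<^sup>2 * (Im w)\<^sup>2) / (u ^ n * (Im w)\<^sup>2)"
        using iw by simp
      also have "\<dots> \<le> hyp w (of_real (u ^ n) * w)"
        unfolding h using un by (intro divide_right_mono mult_left_mono) (auto simp: cmod_power2)
      finally show ?thesis .
    qed
    then show ?thesis using hb hw by linarith
  qed
  have sm: "x \<le> R' + 3" if "(x - 1)\<^sup>2 / x \<le> R'" "x > 0" for x :: real
  proof -
    have "(x - 1)\<^sup>2 / x = x - 2 + 1 / x" using that by (simp add: field_simps power2_eq_square)
    moreover have "1 / x > 0" using that by simp
    ultimately show ?thesis using that by linarith
  qed
  have b1: "u ^ n \<le> R' + 3" for n using sm[OF bound[of n]] u by simp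
  have b2: "(1 / u) ^ n \<le> R' + 3" for n
  proof (rule sm)
    have "(1 / u ^ n - 1)\<^sup>2 / (1 / u ^ n) = (u ^ n - 1)\<^sup>2 / u ^ n"
      using u by (simp add: field_simps power2_eq_square)
    then show "((1 / u) ^ n - 1)\<^sup>2 / (1 / u) ^ n \<le> R'" using bound[of n] by (simp add: power_divide)
  qed (use u in simp)
  show False
  proof (cases "u > 1")
    case True
    then show ?thesis using power_unbounded[OF True, of "R' + 3"] b1 by (metis not_less)
  next
    case False
    then have "1 / u > 1" using u by (simp add: field_simps)
    then show ?thesis using power_unbounded[of "1 / u" "R' + 3"] b2 by (metis not_less)
  qed
qed

end

section \<open>Lines of nearly minimal length\<close>

lemma crossing_hyperbolic: "crossing X Y \<Longrightarrow> 4 < (mtr X)\<^sup>2" "crossing X Y \<Longrightarrow> 4 < (mtr Y)\<^sup>2"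
  using crossing_sym[of X Y] by (auto simp: crossing_def)

lemma crossing_mult_right: "crossing X Y \<Longrightarrow> crossing X (Y * X)"
proof -
  assume c: "crossing X Y"
  have 1: "mtr (Y * X) = mtr (X * Y)" by (rule mtr_commute)
  have 2: "mtr (X * (Y * X)) = mtr (X * (X * Y))" by (metis mtr_commute mult.assoc)
  show ?thesis using crossing_mult[OF c] c by (simp add: crossing_def 1 2)
qed

context plane_metric
begin

text \<open>A line with a function \<open>l\<close> that measures length along it; \<open>T\<close> is the length of a period.\<close>

definition rline :: "mat2 \<Rightarrow> real \<Rightarrow> (real \<Rightarrow> complex) \<Rightarrow> (real \<Rightarrow> real) \<Rightarrow> real \<Rightarrow> bool" where
  "rline X p c l T \<longleftrightarrow> line X p c \<and> (\<forall>s t. s \<le> t \<longrightarrow> d (c s) (c t) \<le> l t - l s) \<and> (\<forall>t. l (t + p) = l t + T)"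

text \<open>The path is continued by its translates under the powers of \<open>X\<close>, written \<open>Z k\<close> for integers \<open>k\<close>.\<close>

lemma rline_extend:
  assumes X: "X \<in> isom" and p: "0 < p" and c: "continuous_on {0..p} c" "c ` {0..p} \<subseteq> uhp" "c p = mob X (c 0)"
    and l: "\<And>s t. 0 \<le> s \<Longrightarrow> s \<le> t \<Longrightarrow> t \<le> p \<Longrightarrow> d (c s) (c t) \<le> l t - l s"
  obtains c' l' where "rline X p c' l' (l p - l 0)" "\<And>t. t \<in> {0..p} \<Longrightarrow> c' t = c t"
proof -
  define Z where "Z = (\<lambda>k :: int. if 0 \<le> k then X ^ nat k else adj (X ^ nat (- k)))"
  have Z [simp]: "Z k \<in> isom" for k using X by (simp add: Z_def)
  have Z1: "Z (k + 1) = X * Z k" "Z (k + 1) = Z k * X" for k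
  proof -
    have "Z (k + 1) = X * Z k \<and> Z (k + 1) = Z k * X"
    proof (cases "0 \<le> k")
      case True
      then have "nat (k + 1) = Suc (nat k)" by simp
      with True show ?thesis by (simp add: Z_def power_commutes)
    next
      case False
      define m where "m = nat (- k - 1)"
      have k: "k = - int (Suc m)" using False by (simp add: m_def)
      have "nat (- k) = Suc m" "\<not> 0 \<le> k" by (auto simp: k)
      then have 1: "Z k = adj (X ^ Suc m)" by (simp only: Z_def if_False)
      have 2: "Z (k + 1) = adj (X ^ m)"
      proof (cases "m = 0")
        case True then show ?thesis by (simp add: Z_def k)
      next
        case False
        then have "\<not> 0 \<le> k + 1" "nat (- (k + 1)) = m" by (auto simp: k)
        then show ?thesis by (simp add: Z_def)
      qed
      have "X * adj (X ^ Suc m) = adj (X ^ m)"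
        using X by (simp only: power_Suc2 adj_mult adj_right_cancel isom_SL)
      moreover have "adj (X ^ Suc m) * X = adj (X ^ m)"
        using X by (simp only: power_Suc adj_mult mult.assoc adj_left isom_SL mult_1_right)
      ultimately show ?thesis by (simp only: 1 2)
    qed
    then show "Z (k + 1) = X * Z k" "Z (k + 1) = Z k * X" by auto
  qed
  define c' where "c' = (\<lambda>t. mob (Z \<lfloor>t / p\<rfloor>) (c (t - of_int \<lfloor>t / p\<rfloor> * p)))"
  define l' where "l' = (\<lambda>t. l (t - of_int \<lfloor>t / p\<rfloor> * p) + of_int \<lfloor>t / p\<rfloor> * (l p - l 0))"
  have H: "c t \<in> uhp" if "0 \<le> t" "t \<le> p" for t using c(2) that by auto
  have eq: "c' t = mob (Z k) (c (t - of_int k * p))" "l' t = l (t - of_int k * p) + of_int k * (l p - l 0)"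
    if "of_int k * p \<le> t" "t \<le> (of_int k + 1) * p" for k t
  proof -
    have "c' t = mob (Z k) (c (t - of_int k * p)) \<and> l' t = l (t - of_int k * p) + of_int k * (l p - l 0)"
    proof (cases "t = (of_int k + 1) * p")
      case True
      then have f: "\<lfloor>t / p\<rfloor> = k + 1" using p by simp
      have t: "t - of_int (k + 1) * p = 0" "t - of_int k * p = p" using True by (auto simp: algebra_simps)
      have "c' t = mob (Z (k + 1)) (c 0)" unfolding c'_def f t ..
      also have "\<dots> = mob (Z k) (c p)" unfolding Z1(2) c(3) using X H p by (simp add: mob_mult)
      finally have "c' t = mob (Z k) (c p)" .
      moreover have "l' t = l p + of_int k * (l p - l 0)" unfolding l'_def f t by (simp add: algebra_simps)
      ultimately show ?thesis unfolding t by simp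
    next
      case False
      then have "t < (of_int k + 1) * p" using that by simp
      then have f: "\<lfloor>t / p\<rfloor> = k" using that(1) p by (simp add: floor_eq_iff field_simps)
      show ?thesis unfolding c'_def l'_def f by simp
    qed
    then show "c' t = mob (Z k) (c (t - of_int k * p))" "l' t = l (t - of_int k * p) + of_int k * (l p - l 0)" by auto
  qed
  have fl: "of_int \<lfloor>t / p\<rfloor> * p \<le> t" "t < (of_int \<lfloor>t / p\<rfloor> + 1) * p" for t
  proof -
    have "of_int \<lfloor>t / p\<rfloor> \<le> t / p" "t / p < of_int \<lfloor>t / p\<rfloor> + 1" by linarith+
    then show "of_int \<lfloor>t / p\<rfloor> * p \<le> t" "t < (of_int \<lfloor>t / p\<rfloor> + 1) * p"
      using p by (simp_all only: pos_le_divide_eq pos_divide_less_eq)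
  qed
  have uhp': "c' t \<in> uhp" for t
    unfolding c'_def using fl[of t] by (intro mob_uhp H) (auto simp: algebra_simps)
  have cont1: "continuous_on {of_int k * p..(of_int k + 1) * p} c'" for k
  proof -
    have "continuous_on {of_int k * p..(of_int k + 1) * p} (\<lambda>t. c (t - of_int k * p))"
      by (rule continuous_on_compose2[OF c(1)]) (auto intro!: continuous_intros simp: algebra_simps)
    then have "continuous_on {of_int k * p..(of_int k + 1) * p} (\<lambda>t. mob (Z k) (c (t - of_int k * p)))"
      by (rule continuous_on_compose2[OF continuous_on_mob[OF isom_SL[OF Z] order_refl]])
        (auto intro!: H simp: algebra_simps)
    then show ?thesis by (rule continuous_on_eq) (rule eq(1)[symmetric], auto)
  qed
  have "isCont c' t" for t
  proof -
    define k where "k = \<lfloor>t / p\<rfloor>"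
    have k1: "of_int (k - 1) + 1 = (of_int k :: real)" by simp
    have "continuous_on ({of_int (k - 1) * p..of_int k * p} \<union> {of_int k * p..(of_int k + 1) * p}) c'"
      using cont1[of "k - 1"] cont1[of k] unfolding k1 by (intro continuous_on_closed_Un) auto
    then have "continuous_on {of_int (k - 1) * p<..<(of_int k + 1) * p} c'"
      by (rule continuous_on_subset) auto
    moreover have "t \<in> {of_int (k - 1) * p<..<(of_int k + 1) * p}"
      using fl[of t] p unfolding k_def[symmetric] by (auto simp: algebra_simps)
    ultimately show ?thesis by (meson continuous_on_eq_continuous_at open_greaterThanLessThan)
  qed
  then have cont: "continuous_on UNIV c'" by (simp add: continuous_on_eq_continuous_at)
  have per: "c' (t + p) = mob X (c' t)" "l' (t + p) = l' t + (l p - l 0)" for t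
  proof -
    define k where "k = \<lfloor>t / p\<rfloor>"
    have f: "\<lfloor>(t + p) / p\<rfloor> = k + 1" using p by (simp add: k_def add_divide_distrib)
    have t: "t + p - of_int (k + 1) * p = t - of_int k * p" by (simp add: algebra_simps)
    have "c (t - of_int k * p) \<in> uhp" using fl[of t] by (intro H) (auto simp: k_def algebra_simps)
    then show "c' (t + p) = mob X (c' t)"
      unfolding c'_def f t Z1(1) k_def[symmetric] using X by (simp add: mob_mult)
    show "l' (t + p) = l' t + (l p - l 0)" unfolding l'_def f t k_def[symmetric] by (simp add: algebra_simps)
  qed
  have dist0: "d (c' s) (c' t) \<le> l' t - l' s" if "of_int k * p \<le> s" "s \<le> t" "t \<le> (of_int k + 1) * p" for k s t
  proof -
    have "d (c' s) (c' t) = d (c (s - of_int k * p)) (c (t - of_int k * p))"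
      using that by (simp add: eq[of k] H algebra_simps)
    also have "\<dots> \<le> l (t - of_int k * p) - l (s - of_int k * p)"
      using that by (intro l) (auto simp: algebra_simps)
    finally show ?thesis using that by (simp add: eq[of k])
  qed
  have dist1: "d (c' s) (c' t) \<le> l' t - l' s"
    if "of_int k * p \<le> s" "s \<le> (of_int k + 1) * p" "s \<le> t" "t \<le> (of_int k + 1 + real n) * p" for n k s t
    using that
  proof (induction n arbitrary: k s)
    case 0 then show ?case using dist0 by auto
  next
    case (Suc n)
    let ?b = "(of_int k + 1) * p"
    show ?case
    proof (cases "t \<le> ?b")
      case True then show ?thesis using Suc dist0 by auto
    next
      case False
      have "d (c' s) (c' t) \<le> d (c' s) (c' ?b) + d (c' ?b) (c' t)" by (intro d_tri uhp')
      also have "d (c' s) (c' ?b) \<le> l' ?b - l' s" using Suc.prems by (intro dist0) auto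
      also have "d (c' ?b) (c' t) \<le> l' t - l' ?b"
        by (rule Suc.IH[of "k + 1"]) (use Suc.prems False p in \<open>auto simp: algebra_simps\<close>)
      finally show ?thesis by simp
    qed
  qed
  have dist: "d (c' s) (c' t) \<le> l' t - l' s" if "s \<le> t" for s t
  proof -
    obtain n where n: "real n > (t - s) / p" using reals_Archimedean2 by blast
    then have "t - s < real n * p" using p by (simp add: field_simps)
    then have "t \<le> (of_int \<lfloor>s / p\<rfloor> + 1 + real n) * p" using fl[of s] by (simp add: algebra_simps)
    then show ?thesis using dist1[of "\<lfloor>s / p\<rfloor>" s t n] fl[of s] that by simp
  qed
  have "rline X p c' l' (l p - l 0)"
    using p cont uhp' per dist by (auto simp: rline_def line_def)
  moreover have "c' t = c t" if "t \<in> {0..p}" for t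
    using eq(1)[of 0 t] that by (simp add: Z_def)
  ultimately show ?thesis using that by blast
qed

lemma rline_exists:
  assumes "X \<in> isom" "0 < e"
  obtains p c l T where "rline X p c l T" "T < tau X + e"
proof -
  obtain z where z: "z \<in> uhp" "d z (mob X z) < tau X + e / 2" using tau_approx[of X "e / 2"] assms by auto
  obtain c and l :: "real \<Rightarrow> real" where c: "continuous_on {0..1} c" "c ` {0..1} \<subseteq> uhp" "c 0 = z" "c 1 = mob X z"
    and l: "l 1 - l 0 < d z (mob X z) + e / 2" "\<And>s t. 0 \<le> s \<Longrightarrow> s \<le> t \<Longrightarrow> t \<le> 1 \<Longrightarrow> d (c s) (c t) \<le> l t - l s"
    using d_path[of z "mob X z" "e / 2"] z assms by (auto simp del: isom_d)
  obtain c' l' where "rline X 1 c' l' (l 1 - l 0)"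
    by (rule rline_extend[OF assms(1) zero_less_one c(1,2) _ l(2)]) (use c in auto)
  then show ?thesis using that[of 1 c' l' "l 1 - l 0"] l z by simp
qed

lemma rline_line: "rline X p c l T \<Longrightarrow> line X p c"
  by (simp add: rline_def)

lemma rline_uhp: "rline X p c l T \<Longrightarrow> c t \<in> uhp"
  using rline_line line_uhp by blast

lemma rline_d: "rline X p c l T \<Longrightarrow> s \<le> t \<Longrightarrow> d (c s) (c t) \<le> l t - l s"
  by (simp add: rline_def)

lemma rline_p: "rline X p c l T \<Longrightarrow> 0 < p"
  by (simp add: rline_def line_def)

lemma rline_mono:
  assumes "rline X p c l T" "s \<le> t" shows "l s \<le> l t"
  using rline_d[OF assms] d_nonneg[OF rline_uhp[OF assms(1)] rline_uhp[OF assms(1)], of s t] by linarith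

lemma rline_length:
  assumes "rline X p c l T" shows "l (t + real n * p) = l t + real n * T"
proof (induction n)
  case (Suc n)
  have "l (t + real (Suc n) * p) = l ((t + real n * p) + p)" by (simp add: algebra_simps)
  also have "\<dots> = l (t + real n * p) + T" using assms unfolding rline_def by blast
  finally show ?case unfolding Suc by (simp add: algebra_simps)
qed simp

lemma rline_displacement:
  assumes "rline X p c l T" "X \<in> isom"
  shows "d (c t) (mob X (c t)) \<le> T"
  using rline_d[OF assms(1), of t "t + p"] rline_p[OF assms(1)] assms(1) by (simp add: rline_def line_def)

lemma rline_tau_le: "rline X p c l T \<Longrightarrow> X \<in> isom \<Longrightarrow> tau X \<le> T"
  using rline_displacement[of X p c l T 0] tau_le[of X "c 0"] by (force simp: rline_uhp)

text \<open>If \<open>m\<close> is the number of full periods between \<open>s\<close> and \<open>t\<close>, then the next period ends at distance at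
least \<open>(m + 1) * tau X\<close> from \<open>c s\<close>. So the part from \<open>s\<close> to \<open>t\<close> can be shortened by at most
\<open>(m + 1) * (T - tau X)\<close>, and \<open>m\<close> is bounded in terms of the distance.\<close>

lemma rline_excess:
  assumes L: "rline X p c l T" and X: "X \<in> isom" "hyperbolic X" and st: "s \<le> t"
  shows "l t - l s \<le> d (c s) (c t) + ((d (c s) (c t) + T) / tau X + 1) * (T - tau X)"
proof -
  have p: "p > 0" by (rule rline_p[OF L])
  have H: "c t \<in> uhp" for t by (rule rline_uhp[OF L])
  have \<tau>: "tau X > 0" by (rule tau_pos[OF X])
  have T: "tau X \<le> T" by (rule rline_tau_le[OF L X(1)])
  define m where "m = nat \<lfloor>(t - s) / p\<rfloor>"
  have "real m = of_int \<lfloor>(t - s) / p\<rfloor>" using st p by (simp add: m_def)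
  then have "real m \<le> (t - s) / p" "(t - s) / p < real m + 1" by linarith+
  then have m: "s + real m * p \<le> t" "t \<le> s + real (Suc m) * p" using p by (auto simp: field_simps)
  have cm: "c (s + real n * p) = mob (X ^ n) (c s)" for n
    by (rule line_shift[OF rline_line[OF L]]) (use X in simp)
  have "real m * tau X \<le> d (c s) (c (s + real m * p))"
    unfolding cm by (rule displacement_power_ge[OF X H])
  also have "\<dots> \<le> d (c s) (c t) + d (c t) (c (s + real m * p))" by (intro d_tri H)
  also have "d (c t) (c (s + real m * p)) = d (c (s + real m * p)) (c t)" by (intro d_sym H)
  also have "\<dots> \<le> l t - l (s + real m * p)" by (rule rline_d[OF L m(1)])
  also have "\<dots> \<le> T" using rline_mono[OF L m(2)] unfolding rline_length[OF L] by (simp add: algebra_simps)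
  finally have "real m * tau X \<le> d (c s) (c t) + T" by simp
  then have m2: "real m \<le> (d (c s) (c t) + T) / tau X" using \<tau> by (simp add: field_simps)
  have "real (Suc m) * tau X \<le> d (c s) (c (s + real (Suc m) * p))"
    unfolding cm by (rule displacement_power_ge[OF X H])
  also have "\<dots> \<le> d (c s) (c t) + d (c t) (c (s + real (Suc m) * p))" by (intro d_tri H)
  also have "d (c t) (c (s + real (Suc m) * p)) \<le> l (s + real (Suc m) * p) - l t" by (rule rline_d[OF L m(2)])
  also have "l (s + real (Suc m) * p) = l s + real (Suc m) * T" by (rule rline_length[OF L])
  finally have "l t - l s \<le> d (c s) (c t) + real (Suc m) * (T - tau X)" by (simp add: algebra_simps)
  also have "real (Suc m) * (T - tau X) \<le> ((d (c s) (c t) + T) / tau X + 1) * (T - tau X)"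
    using m2 T by (intro mult_right_mono) auto
  finally show ?thesis by simp
qed

text \<open>If a loop contained \<open>m \<ge> 1\<close> full periods, then what it contains beyond them would have length at
least \<open>m * tau X\<close>, and what is missing to \<open>m + 1\<close> periods would have length at least
\<open>(m + 1) * tau X\<close>. Both together have length \<open>T\<close>.\<close>

lemma rline_self_intersection:
  assumes L: "rline X p c l T" and X: "X \<in> isom" "hyperbolic X" and T: "T < 3 * tau X"
    and st: "s \<le> t" "c s = c t"
  shows "t - s < p"
proof (rule ccontr)
  assume n: "\<not> t - s < p"
  have p: "p > 0" by (rule rline_p[OF L])
  have H: "c t \<in> uhp" for t by (rule rline_uhp[OF L])
  define m where "m = nat \<lfloor>(t - s) / p\<rfloor>"
  have "real m = of_int \<lfloor>(t - s) / p\<rfloor>" using st p by (simp add: m_def)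
  then have "real m \<le> (t - s) / p" "(t - s) / p < real m + 1" by linarith+
  then have m: "s + real m * p \<le> t" "t \<le> s + real (Suc m) * p" using p by (auto simp: field_simps)
  have "1 \<le> m"
  proof -
    have "1 \<le> (t - s) / p" using n p by (simp add: field_simps)
    then show ?thesis unfolding m_def by (simp add: le_nat_iff)
  qed
  have cm: "c (s + real n * p) = mob (X ^ n) (c s)" for n
    by (rule line_shift[OF rline_line[OF L]]) (use X in simp)
  have "real m * tau X \<le> d (c s) (c (s + real m * p))"
    unfolding cm by (rule displacement_power_ge[OF X H])
  also have "\<dots> = d (c (s + real m * p)) (c t)" unfolding st(2) by (intro d_sym H)
  also have "\<dots> \<le> l t - l (s + real m * p)" by (rule rline_d[OF L m(1)])
  finally have 1: "real m * tau X \<le> l t - (l s + real m * T)" unfolding rline_length[OF L] .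
  have "real (Suc m) * tau X \<le> d (c s) (c (s + real (Suc m) * p))"
    unfolding cm by (rule displacement_power_ge[OF X H])
  also have "\<dots> \<le> l (s + real (Suc m) * p) - l t" unfolding st(2) by (rule rline_d[OF L m(2)])
  finally have 2: "real (Suc m) * tau X \<le> (l s + real (Suc m) * T) - l t" unfolding rline_length[OF L] .
  have "3 * tau X \<le> (2 * real m + 1) * tau X"
    using \<open>1 \<le> m\<close> tau_nonneg[of X] X by (intro mult_right_mono) auto
  also have "\<dots> \<le> T" using 1 2 by (simp add: algebra_simps)
  finally show False using T by simp
qed

text \<open>At a common point \<open>z\<close> of nearly minimal lines of \<open>U\<close> and \<open>V\<close>, walking a period backwards along the
second and then a period along the first leads from \<open>V z\<close> to \<open>U z\<close>.\<close>

lemma tau_smoothing: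
  assumes UV: "crossing U V" "U \<in> isom" "V \<in> isom"
  shows "tau (adj V * U) \<le> tau U + tau V"
proof (rule field_le_epsilon)
  fix e :: real assume e: "e > 0"
  then have e2: "e / 2 > 0" by simp
  obtain p c l T where L: "rline U p c l T" "T < tau U + e / 2" by (rule rline_exists[OF UV(2) e2])
  obtain q c' l' T' where L': "rline V q c' l' T'" "T' < tau V + e / 2" by (rule rline_exists[OF UV(3) e2])
  obtain s t where st: "c s = c' t" using crossing_lines_meet[OF UV(1) rline_line[OF L(1)] rline_line[OF L'(1)]] by blast
  define z where "z = c s"
  have z: "z \<in> uhp" by (simp add: z_def rline_uhp[OF L(1)])
  have "tau (adj V * U) \<le> d z (mob (adj V * U) z)" using UV z by (intro tau_le) auto
  also have "\<dots> = d (mob V z) (mob U z)"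
    using isom_d[OF UV(3), of z "mob (adj V * U) z"] UV z by (simp add: mob_mult)
  also have "\<dots> \<le> d (mob V z) z + d z (mob U z)" using UV z by (intro d_tri) auto
  also have "d z (mob U z) \<le> T" unfolding z_def by (rule rline_displacement[OF L(1) UV(2)])
  also have "d (mob V z) z = d z (mob V z)" using UV z by (intro d_sym) auto
  also have "\<dots> \<le> T'" unfolding z_def st by (rule rline_displacement[OF L'(1) UV(3)])
  finally show "tau (adj V * U) \<le> tau U + tau V + e" using L L' by simp
qed

text \<open>Since \<open>Y\<^sup>2 = (X * Y\<inverse>)\<inverse> * (X * Y)\<close>, this is smoothing. Because of
\<open>tau (X * Y\<inverse>) = tau (X\<inverse> * Y)\<close> it makes \<open>tau (X\<^sup>i * Y)\<close> a convex function of \<open>i\<close>.\<close>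

lemma tau_convex:
  assumes "crossing X Y" "X \<in> isom" "Y \<in> isom"
  shows "2 * tau Y \<le> tau (X * Y) + tau (X * adj Y)"
proof -
  have "2 * tau Y \<le> tau (Y\<^sup>2)" using assms crossing_hyperbolic by (intro tau_square)
  also have "Y\<^sup>2 = adj (X * adj Y) * (X * Y)"
    using assms by (simp add: adj_mult mult.assoc adj_left_cancel power2_eq_square)
  also have "tau \<dots> \<le> tau (X * Y) + tau (X * adj Y)"
    using assms by (intro tau_smoothing crossing_mult_mult_adj) auto
  finally show ?thesis .
qed

lemma tau_mult_adj: "X \<in> isom \<Longrightarrow> Y \<in> isom \<Longrightarrow> tau (X * adj Y) = tau (adj X * Y)"
  using tau_adj[of "X * adj Y"] by (simp add: adj_mult tau_commute)

text \<open>Let \<open>g = A * B\<close>, suppose that the line of \<open>g\<close> meets its image under \<open>B\<close>, and let \<open>k\<close> be the number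
of full periods between the two parameters. Put \<open>C = g\<^sup>-\<^sup>k * B\<close>. The point of intersection
divides a period of the line into a part that joins a point to its image under \<open>C\<close> and a part that
does so for \<open>g * C\<inverse>\<close>; thus \<open>tau C + tau (g\<inverse> * C) \<le> T\<close>.
For \<open>k = 0\<close> this says \<open>tau B + tau A \<le> T\<close>, which contradicts the gap. For \<open>k > 0\<close> it bounds from
below the first increment of the convex function \<open>h i = tau (g\<^sup>i * C)\<close>, and thus all later ones, by
\<open>tau g - e\<close>. The last increment is \<open>tau B - tau A\<close>, and \<open>2 * tau B \<le> tau g + tau (A * B\<inverse>)\<close>; this
contradicts the gap again. The case \<open>k < 0\<close> is similar with \<open>A\<close> and \<open>B\<close> exchanged.\<close>

lemma rline_disjoint_translate:
  assumes cr: "crossing A B" and AB: "A \<in> isom" "B \<in> isom"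
    and L: "rline (A * B) p c l T" and T: "T \<le> tau (A * B) + e"
    and gap: "tau (A * B) + e < tau A + tau B" "tau (A * adj B) + e < tau A + tau B"
  shows "c s \<noteq> mob B (c s')"
proof
  assume meet: "c s = mob B (c s')"
  define g where "g = A * B"
  have g: "g \<in> isom" "g \<in> SL" using AB by (auto simp: g_def)
  have L: "rline g p c l T" and T: "T \<le> tau g + e" using L T by (auto simp: g_def)
  have p: "p > 0" by (rule rline_p[OF L])
  have H: "c t \<in> uhp" for t by (rule rline_uhp[OF L])
  have crg: "crossing g B" unfolding g_def by (rule crossing_sym[OF crossing_mult_right[OF crossing_sym[OF cr]]])
  have gB: "tau (adj g * B) = tau A"
  proof -
    have "tau (adj g * B) = tau (adj B * (adj A * B))" by (simp add: g_def adj_mult mult.assoc)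
    also have "\<dots> = tau ((adj A * B) * adj B)" using AB by (intro tau_commute) auto
    also have "(adj A * B) * adj B = adj A" using AB by (simp add: mult.assoc adj_right)
    finally show ?thesis using AB by (simp add: tau_adj)
  qed
  have cvB: "2 * tau B \<le> tau g + tau (A * adj B)" unfolding g_def by (rule tau_convex[OF cr AB])
  have cvA: "2 * tau A \<le> tau g + tau (A * adj B)"
  proof -
    have "tau (B * adj A) = tau (A * adj B)"
      using tau_mult_adj[OF AB(2,1)] tau_commute[of "adj B" A] AB by simp
    then show ?thesis
      using tau_convex[OF crossing_sym[OF cr] AB(2,1)] tau_commute[OF AB(2,1)] by (simp add: g_def)
  qed
  \<comment> \<open>convexity along the powers of \<open>g\<close>\<close>
  have cv: "2 * tau Y \<le> tau (g * Y) + tau (adj g * Y)" and ex: "2 * tau g \<le> tau (g * Y) + tau (adj g * Y)"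
    if Y: "crossing g Y" "Y \<in> isom" for Y
  proof -
    show "2 * tau Y \<le> tau (g * Y) + tau (adj g * Y)"
      using tau_convex[OF Y(1) g(1) Y(2)] tau_mult_adj[OF g(1) Y(2)] by simp
    have "2 * tau g \<le> tau (Y * g) + tau (Y * adj g)" by (rule tau_convex[OF crossing_sym[OF Y(1)] Y(2) g(1)])
    then show "2 * tau g \<le> tau (g * Y) + tau (adj g * Y)"
      using tau_commute[OF Y(2) g(1)] tau_commute[OF Y(2) isom_adj[OF g(1)]] by simp
  qed
  have split: "tau C + tau (adj g * C) \<le> T" if C: "C \<in> isom" "c (s' + r) = mob C (c s')" "0 \<le> r" "r \<le> p" for C r
  proof -
    have "tau C \<le> d (c s') (mob C (c s'))" using C H by (intro tau_le) auto
    also have "\<dots> \<le> l (s' + r) - l s'" unfolding C(2)[symmetric] using C by (intro rline_d[OF L]) auto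
    finally have 1: "tau C \<le> l (s' + r) - l s'" .
    have "tau (adj g * C) = tau (g * adj C)" using C g by (simp add: tau_mult_adj)
    also have "\<dots> \<le> d (c (s' + r)) (mob (g * adj C) (c (s' + r)))" using C g H by (intro tau_le) auto
    also have "mob (g * adj C) (c (s' + r)) = mob g (c s')" unfolding C(2) using C g H by (simp add: mob_mult)
    also have "\<dots> = c (s' + p)" using L by (simp add: rline_def line_def)
    also have "d (c (s' + r)) (c (s' + p)) \<le> l (s' + p) - l (s' + r)" using C by (intro rline_d[OF L]) auto
    finally show ?thesis using 1 L by (simp add: rline_def)
  qed
  define k where "k = \<lfloor>(s - s') / p\<rfloor>"
  define r where "r = (s - s') - of_int k * p"
  have r: "0 \<le> r" "r \<le> p"
  proof -
    have "of_int k \<le> (s - s') / p" "(s - s') / p < of_int k + 1" unfolding k_def by linarith+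
    then have "of_int k * p \<le> s - s'" "s - s' < (of_int k + 1) * p"
      using p by (simp_all only: pos_le_divide_eq pos_divide_less_eq)
    then show "0 \<le> r" "r \<le> p" by (auto simp: r_def algebra_simps)
  qed
  have mono: "h n - h (n - 1) \<ge> x" if "\<And>i. h (Suc (Suc i)) - h (Suc i) \<ge> h (Suc i) - h i" "h 1 - h 0 \<ge> x" "1 \<le> n"
    for h :: "nat \<Rightarrow> real" and x n
    using that(3)
  proof (induction n rule: nat_induct_at_least)
    case base show ?case using that(2) by simp
  next
    case (Suc n)
    then obtain i where "n = Suc i" by (cases n) auto
    then show ?case using Suc that(1)[of i] by simp
  qed
  consider "k = 0" | "k > 0" | "k < 0" by linarith
  then show False
  proof cases
    case 1
    then have "c (s' + r) = mob B (c s')" using meet by (simp add: r_def)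
    then show False using split[OF AB(2) _ r] gB T gap by (simp add: g_def)
  next
    case 2
    define n where "n = nat k"
    have n: "1 \<le> n" "of_int k = real n" using 2 by (auto simp: n_def)
    define C where "C = adj (g ^ n) * B"
    have C: "C \<in> isom" using g AB by (simp add: C_def)
    have "s = (s' + r) + real n * p" by (simp add: r_def n)
    then have "mob B (c s') = mob (g ^ n) (c (s' + r))"
      using line_shift[OF rline_line[OF L] g(2), of "s' + r" n] meet by simp
    then have "c (s' + r) = mob C (c s')" using H g AB by (simp add: C_def mob_mult)
    then have sp: "tau C + tau (adj g * C) \<le> T" using split[OF C _ r] by simp
    have crC: "crossing g (adj (g ^ m) * B)" for m
    proof (induction m)
      case (Suc m)
      have "adj (g ^ Suc m) * B = adj g * (adj (g ^ m) * B)" by (simp add: power_Suc2 adj_mult mult.assoc del: power_Suc)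
      then show ?case using crossing_adj_mult[OF Suc] by simp
    qed (use crg in simp)
    have cri: "crossing g (g ^ i * C)" for i
      by (induction i) (auto simp: mult.assoc intro: crossing_mult crC[of n, folded C_def])
    define h where "h i = tau (g ^ i * C)" for i
    have hc: "h (Suc (Suc i)) - h (Suc i) \<ge> h (Suc i) - h i" for i
      using cv[OF cri[of "Suc i"]] C g by (simp add: h_def mult.assoc adj_left_cancel)
    have h1: "h 1 - h 0 \<ge> tau g - e"
      using ex[OF cri[of 0]] C sp T by (simp add: h_def)
    have "h n - h (n - 1) \<ge> tau g - e" by (rule mono[OF hc h1 n(1)])
    moreover have "h n = tau B" using g by (simp add: h_def C_def adj_right_cancel)
    moreover have "h (n - 1) = tau A"
    proof -
      obtain m where m: "n = Suc m" using n(1) by (cases n) auto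
      have "g ^ m * C = adj g * B"
        using g by (simp add: C_def m adj_mult mult.assoc adj_right_cancel)
      then show ?thesis using gB by (simp add: h_def m)
    qed
    ultimately show False using cvB gap by (simp add: g_def)
  next
    case 3
    define n where "n = nat (- k)"
    have n: "1 \<le> n" "of_int k = - real n" using 3 by (auto simp: n_def)
    define C where "C = g ^ n * B"
    have C: "C \<in> isom" using g AB by (simp add: C_def)
    have "s' + r = s + real n * p" by (simp add: r_def n)
    then have "c (s' + r) = mob (g ^ n) (mob B (c s'))"
      using line_shift[OF rline_line[OF L] g(2), of s n] meet by simp
    then have "c (s' + r) = mob C (c s')" using H g AB by (simp add: C_def mob_mult)
    then have sp: "tau C + tau (adj g * C) \<le> T" using split[OF C _ r] by simp
    have "crossing g (g ^ m * B)" for m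
      by (induction m) (auto simp: mult.assoc intro: crossing_mult crg)
    then have crC: "crossing g C" by (simp add: C_def)
    have cri: "crossing g (adj g ^ i * C)" for i
      by (induction i) (auto simp: mult.assoc intro: crossing_adj_mult crC)
    define h where "h i = tau (adj g ^ Suc i * C)" for i
    have hc: "h (Suc (Suc i)) - h (Suc i) \<ge> h (Suc i) - h i" for i
      using cv[OF cri[of "Suc (Suc i)"]] C g by (simp add: h_def mult.assoc adj_right_cancel)
    have h1: "h 1 - h 0 \<ge> tau g - e"
      using ex[OF cri[of 1]] C g sp T by (simp add: h_def mult.assoc adj_right_cancel)
    have "h n - h (n - 1) \<ge> tau g - e" by (rule mono[OF hc h1 n(1)])
    moreover have nC: "adj g ^ n * C = B" using g by (simp add: C_def adj_left_cancel flip: adj_power)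
    then have "h n = tau A" "h (n - 1) = tau B" using n(1) gB by (auto simp: h_def mult.assoc)
    ultimately show False using cvA gap by (simp add: g_def)
  qed
qed

end

section \<open>The inequality in the half-plane\<close>

lemma path_connected_Un3:
  assumes "path_connected S" "path_connected T" "path_connected U" "S \<inter> T \<noteq> {}" "T \<inter> U \<noteq> {}"
  shows "path_connected (S \<union> T \<union> U)"
  using assms by (intro path_connected_Un) auto

lemma interval_between:
  fixes a b x y :: real
  assumes "a \<le> b" "x \<le> y" "{a..b} \<inter> {x..y} = {}"
  shows "b < x \<or> y < a"
  using assms by (auto simp: disjoint_iff not_le)

lemma mult_le_square_half:
  fixes x y s :: real
  assumes "0 \<le> x" "0 \<le> y" "x + y \<le> s" shows "x * y \<le> s\<^sup>2 / 4"
proof -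
  have "4 * (x * y) = (x + y)\<^sup>2 - (x - y)\<^sup>2" by algebra
  also have "\<dots> \<le> (x + y)\<^sup>2" by simp
  also have "\<dots> \<le> s\<^sup>2" using assms by (intro power_mono) auto
  finally show ?thesis by simp
qed

context plane_metric
begin

definition track :: "(real \<Rightarrow> complex) \<Rightarrow> (real \<Rightarrow> real) \<Rightarrow> real \<Rightarrow> bool" where
  "track c l m \<longleftrightarrow> 0 \<le> m \<and> continuous_on {0..m} c \<and> c ` {0..m} \<subseteq> uhp \<and>
     (\<forall>s t. 0 \<le> s \<longrightarrow> s \<le> t \<longrightarrow> t \<le> m \<longrightarrow> d (c s) (c t) \<le> l t - l s)"

lemma track_join:
  assumes 1: "track c l m" and 2: "track e k n" and eq: "e 0 = c m"
  shows "track (\<lambda>t. if t \<le> m then c t else e (t - m)) (\<lambda>t. if t \<le> m then l t else k (t - m) + (l m - k 0)) (m + n)"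
    (is "track ?c ?l _")
proof -
  have H1: "c t \<in> uhp" if "0 \<le> t" "t \<le> m" for t using 1 that by (auto simp: track_def)
  have H2: "e t \<in> uhp" if "0 \<le> t" "t \<le> n" for t using 2 that by (auto simp: track_def)
  have mn: "0 \<le> m" "0 \<le> n" using 1 2 by (auto simp: track_def)
  have "continuous_on {0..m + n} ?c"
  proof (rule continuous_on_cases_le)
    show "continuous_on {t \<in> {0..m + n}. t \<le> m} c"
      using 1 by (auto simp: track_def intro: continuous_on_subset)
    have "continuous_on {0..n} e" using 2 by (simp add: track_def)
    then show "continuous_on {t \<in> {0..m + n}. m \<le> t} (\<lambda>t. e (t - m))"
      by (rule continuous_on_compose2) (auto intro!: continuous_intros)
  qed (auto simp: eq intro!: continuous_intros)
  moreover have H: "?c t \<in> uhp" if "t \<in> {0..m + n}" for t using that H1 H2 by auto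
  moreover have "d (?c s) (?c t) \<le> ?l t - ?l s" if st: "0 \<le> s" "s \<le> t" "t \<le> m + n" for s t
  proof -
    have d1: "d (c s) (c t) \<le> l t - l s" if "0 \<le> s" "s \<le> t" "t \<le> m" for s t using 1 that by (simp add: track_def)
    have d2: "d (e s) (e t) \<le> k t - k s" if "0 \<le> s" "s \<le> t" "t \<le> n" for s t using 2 that by (simp add: track_def)
    consider "t \<le> m" | "m < s" | "s \<le> m" "m < t" by linarith
    then show ?thesis
    proof cases
      case 1 then show ?thesis using d1 st by simp
    next
      case 2 then show ?thesis using d2[of "s - m" "t - m"] st by simp
    next
      case 3
      have "d (c s) (e (t - m)) \<le> d (c s) (c m) + d (c m) (e (t - m))"
        using 3 st mn by (intro d_tri H1 H2) auto
      also have "\<dots> \<le> (l m - l s) + (k (t - m) - k 0)"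
        using 3 st d1[of s m] d2[of 0 "t - m"] eq by simp
      finally show ?thesis using 3 by simp
    qed
  qed
  ultimately show ?thesis unfolding track_def image_subset_iff using mn by simp
qed

lemma rline_track:
  assumes L: "rline X p c l T" and M: "M \<in> isom" and m: "0 \<le> m"
  shows "track (\<lambda>t. mob M (c (a + t))) (\<lambda>t. l (a + t)) m"
    and "track (\<lambda>t. mob M (c (a - t))) (\<lambda>t. - l (a - t)) m"
proof -
  have H: "c t \<in> uhp" for t by (rule rline_uhp[OF L])
  have cc: "continuous_on S c" for S
    using rline_line[OF L] continuous_on_subset by (auto simp: line_def)
  have cont: "continuous_on S (\<lambda>t. mob M (c (f t)))" if "continuous_on S f" for f :: "real \<Rightarrow> real" and S
    by (rule continuous_on_compose2[OF continuous_on_mob[OF isom_SL[OF M] order_refl]])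
      (auto intro!: H continuous_on_compose2[OF cc[of UNIV] that])
  have MH: "mob M (c t) \<in> uhp" for t using M H by simp
  have dM: "d (mob M (c s)) (mob M (c t)) = d (c s) (c t)" for s t using M H by simp
  show "track (\<lambda>t. mob M (c (a + t))) (\<lambda>t. l (a + t)) m"
    unfolding track_def dM using m by (auto intro!: cont continuous_intros MH rline_d[OF L])
  have "d (c (a - s)) (c (a - t)) \<le> - l (a - t) - - l (a - s)" if "s \<le> t" for s t
    using rline_d[OF L, of "a - t" "a - s"] that d_sym[OF H[of "a - s"] H[of "a - t"]] by simp
  then show "track (\<lambda>t. mob M (c (a - t))) (\<lambda>t. - l (a - t)) m"
    unfolding track_def dM using m by (auto intro!: cont continuous_intros MH)
qed

lemma rline_time_bound:
  assumes L: "rline X p c l T" and X: "X \<in> isom" "hyperbolic X" and st: "s \<le> t"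
  shows "t - s \<le> ((d (c s) (c t) + T) / tau X + 1) * p"
proof -
  have p: "p > 0" by (rule rline_p[OF L])
  have H: "c t \<in> uhp" for t by (rule rline_uhp[OF L])
  have \<tau>: "tau X > 0" by (rule tau_pos[OF X])
  define m where "m = nat \<lfloor>(t - s) / p\<rfloor>"
  have "real m = of_int \<lfloor>(t - s) / p\<rfloor>" using st p by (simp add: m_def)
  then have "real m \<le> (t - s) / p" "(t - s) / p < real m + 1" by linarith+
  then have m: "s + real m * p \<le> t" "t \<le> s + real (Suc m) * p" using p by (auto simp: field_simps)
  have cm: "c (s + real m * p) = mob (X ^ m) (c s)"
    by (rule line_shift[OF rline_line[OF L]]) (use X in simp)
  have "real m * tau X \<le> d (c s) (c (s + real m * p))"
    unfolding cm by (rule displacement_power_ge[OF X H])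
  also have "\<dots> \<le> d (c s) (c t) + d (c t) (c (s + real m * p))" by (intro d_tri H)
  also have "d (c t) (c (s + real m * p)) = d (c (s + real m * p)) (c t)" by (intro d_sym H)
  also have "\<dots> \<le> l t - l (s + real m * p)" by (rule rline_d[OF L m(1)])
  also have "\<dots> \<le> T" using rline_mono[OF L m(2)] unfolding rline_length[OF L] by (simp add: algebra_simps)
  finally have "real m * tau X \<le> d (c s) (c t) + T" by simp
  then have "real m \<le> (d (c s) (c t) + T) / tau X" using \<tau> by (simp add: field_simps)
  then have "(real m + 1) * p \<le> ((d (c s) (c t) + T) / tau X + 1) * p" using p by (intro mult_right_mono) auto
  then show ?thesis using m(2) by (simp add: algebra_simps)
qed

text \<open>Bounded displacement by a diagonal matrix confines a point to a sector around the imaginary axis.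
Bounded displacement by \<open>h\<close> keeps it away from \<open>0\<close> and \<open>\<infinity>\<close>, neither of which is fixed by \<open>h\<close>.\<close>

lemma bounded_displacement:
  assumes l: "l \<noteq> 0" "l\<^sup>2 \<noteq> 1" and h: "h \<in> SL" "posm h"
  obtains N where "\<And>z w. z \<in> uhp \<Longrightarrow> w \<in> uhp \<Longrightarrow> d z (mob (diagm l) z) \<le> R \<Longrightarrow> d z (mob h z) \<le> R \<Longrightarrow>
    d w (mob (diagm l) w) \<le> R \<Longrightarrow> d w (mob h w) \<le> R \<Longrightarrow> d z w \<le> N"
proof -
  obtain R0 where R0: "\<And>z w. z \<in> uhp \<Longrightarrow> w \<in> uhp \<Longrightarrow> d z w \<le> R \<Longrightarrow> hyp z w \<le> R0" using d_hyp[of R] by blast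
  define R' where "R' = max 0 R0"
  define S where "S = sqrt R'"
  have S: "S \<ge> 0" "S\<^sup>2 = R'" by (auto simp: S_def R'_def)
  define u where "u = l\<^sup>2"
  have u: "u > 0" "u \<noteq> 1" using l by (auto simp: u_def)
  define V where "V = {z \<in> uhp. d z (mob (diagm l) z) \<le> R \<and> d z (mob h z) \<le> R}"
  define K where "K = S * sqrt u / \<bar>u - 1\<bar>"
  define a b c e where "a = m11 h" "b = m12 h" "c = m21 h" "e = m22 h"
  define M where "M = S + \<bar>e - a\<bar> + \<bar>b\<bar> + \<bar>c\<bar>"
  have bc: "b \<noteq> 0" "c \<noteq> 0" using h(2) by (auto simp: posm_def a_b_c_e_def)
  have M: "M > 0" using bc S by (simp add: M_def add_nonneg_pos)
  have V1: "cmod z \<le> K * Im z" if "z \<in> V" for z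
  proof -
    have z: "z \<in> uhp" "Im z > 0" using that by (auto simp: V_def uhp_def)
    have "hyp z (mob (diagm l) z) \<le> R'"
      using R0[of z "mob (diagm l) z"] that z l by (auto simp: V_def R'_def)
    then have "(cmod (z - of_real u * z))\<^sup>2 / (Im z * (u * Im z)) \<le> R'"
      using l by (simp add: hyp_def mob_diagm u_def)
    moreover have "z - of_real u * z = of_real (1 - u) * z" by (simp add: algebra_simps)
    ultimately have "(\<bar>u - 1\<bar> * cmod z)\<^sup>2 \<le> R' * (Im z * (u * Im z))"
      using z u by (simp add: norm_mult divide_le_eq abs_minus_commute del: of_real_diff)
    also have "\<dots> = (S * sqrt u * Im z)\<^sup>2"
      using u by (simp add: power_mult_distrib S(2)) (simp add: power2_eq_square)
    finally have sq: "(\<bar>u - 1\<bar> * cmod z)\<^sup>2 \<le> (S * sqrt u * Im z)\<^sup>2" .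
    have "\<bar>u - 1\<bar> * cmod z \<le> S * sqrt u * Im z"
      by (rule power2_le_imp_le[OF sq]) (use S u z in simp)
    then show ?thesis using u by (simp add: K_def field_simps)
  qed
  have V2: "cmod (of_real c * z * z + of_real (e - a) * z - of_real b) \<le> S * cmod z" if "z \<in> V" for z
  proof -
    have z: "z \<in> uhp" "Im z > 0" using that by (auto simp: V_def uhp_def)
    define q where "q = of_real c * z + of_real e"
    have q: "q \<noteq> 0" unfolding q_def a_b_c_e_def by (rule mob_denominator_nonzero[OF h(1) z(1)])
    have "hyp z (mob h z) \<le> R'"
      using R0[of z "mob h z"] that z h by (auto simp: V_def R'_def)
    moreover have "z - mob h z = (of_real c * z * z + of_real (e - a) * z - of_real b) / q"
      using q unfolding mob_def a_b_c_e_def[symmetric] q_def[symmetric] by (simp add: field_simps) (simp add: q_def algebra_simps)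
    moreover have "Im (mob h z) = Im z / (cmod q)\<^sup>2"
      using Im_mob[OF h(1) z(1)] by (simp add: q_def a_b_c_e_def)
    ultimately have "(cmod (of_real c * z * z + of_real (e - a) * z - of_real b))\<^sup>2 / (Im z)\<^sup>2 \<le> R'"
      using q by (simp add: hyp_def norm_divide power_divide power2_eq_square[of "Im z"])
    then have sq: "(cmod (of_real c * z * z + of_real (e - a) * z - of_real b))\<^sup>2 \<le> (S * Im z)\<^sup>2"
      using z by (simp add: power_mult_distrib S(2) divide_le_eq)
    have "cmod (of_real c * z * z + of_real (e - a) * z - of_real b) \<le> S * Im z"
      by (rule power2_le_imp_le[OF sq]) (use S z in simp)
    also have "\<dots> \<le> S * cmod z" using S abs_Im_le_cmod[of z] by (intro mult_left_mono) auto
    finally show ?thesis .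
  qed
  have V3: "cmod z \<le> max 1 (M / \<bar>c\<bar>)" "min 1 (\<bar>b\<bar> / M) \<le> cmod z" if "z \<in> V" for z
  proof -
    let ?r = "cmod z"
    let ?E = "of_real c * z * z + of_real (e - a) * z - of_real b"
    have 1: "cmod (of_real c * z * z) = \<bar>c\<bar> * (?r * ?r)" "cmod (of_real (e - a) * z) = \<bar>e - a\<bar> * ?r"
      by (simp_all add: norm_mult del: of_real_diff)
    have tri: "cmod x \<le> cmod (x + y - w) + cmod y + cmod w" "cmod w \<le> cmod x + cmod y + cmod (x + y - w)" for x y w :: complex
      using norm_triangle_ineq4[of "x + y - w" "y - w"] norm_triangle_ineq4[of y w]
        norm_triangle_ineq4[of "x + y" "x + y - w"] norm_triangle_ineq[of x y] by simp_all
    have "\<bar>c\<bar> * (?r * ?r) \<le> cmod ?E + \<bar>e - a\<bar> * ?r + \<bar>b\<bar>"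
      using tri(1)[of "of_real c * z * z" "of_real (e - a) * z" "of_real b"] unfolding 1 norm_of_real .
    then have A: "\<bar>c\<bar> * (?r * ?r) \<le> S * ?r + \<bar>e - a\<bar> * ?r + \<bar>b\<bar>" using V2[OF that] by linarith
    have "\<bar>b\<bar> \<le> \<bar>c\<bar> * (?r * ?r) + \<bar>e - a\<bar> * ?r + cmod ?E"
      using tri(2)[of "of_real b" "of_real c * z * z" "of_real (e - a) * z"] unfolding 1 norm_of_real .
    then have B: "\<bar>b\<bar> \<le> \<bar>c\<bar> * (?r * ?r) + \<bar>e - a\<bar> * ?r + S * ?r" using V2[OF that] by linarith
    have Mr: "M * ?r = S * ?r + \<bar>e - a\<bar> * ?r + \<bar>b\<bar> * ?r + \<bar>c\<bar> * ?r"
      unfolding M_def by (simp only: distrib_right)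
    show "?r \<le> max 1 (M / \<bar>c\<bar>)"
    proof (cases "?r \<le> 1")
      case False
      then have "\<bar>b\<bar> * 1 \<le> \<bar>b\<bar> * ?r" by (intro mult_left_mono) auto
      moreover have "0 \<le> \<bar>c\<bar> * ?r" by simp
      ultimately have "\<bar>c\<bar> * (?r * ?r) \<le> M * ?r" using A unfolding Mr by linarith
      then have "(\<bar>c\<bar> * ?r) * ?r \<le> M * ?r" by (simp only: mult.assoc)
      then have "\<bar>c\<bar> * ?r \<le> M" by (rule mult_right_le_imp_le) (use False in linarith)
      then show ?thesis using bc by (simp add: le_max_iff_disj field_simps)
    qed simp
    show "min 1 (\<bar>b\<bar> / M) \<le> ?r"
    proof (cases "?r \<le> 1")
      case True
      then have "?r * ?r \<le> ?r" by (simp add: mult_left_le)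
      then have "\<bar>c\<bar> * (?r * ?r) \<le> \<bar>c\<bar> * ?r" by (intro mult_left_mono) auto
      moreover have "0 \<le> \<bar>b\<bar> * ?r" by simp
      ultimately have "\<bar>b\<bar> \<le> M * ?r" using B unfolding Mr by linarith
      then show ?thesis using M by (simp add: min_le_iff_disj field_simps)
    qed simp
  qed
  define r1 where "r1 = min 1 (\<bar>b\<bar> / M)"
  define r2 where "r2 = max 1 (M / \<bar>c\<bar>)"
  have r1: "r1 > 0" using M bc by (simp add: r1_def)
  define Q where "Q = cball 0 r2 \<inter> {z. r1 \<le> K * Im z}"
  have "compact Q"
    unfolding Q_def by (intro compact_Int_closed compact_cball closed_Collect_le continuous_intros)
  moreover have K0: "K \<ge> 0" using S u by (simp add: K_def)
  have "Q \<subseteq> uhp"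
  proof
    fix z assume "z \<in> Q"
    then have "0 < K * Im z" using r1 by (simp add: Q_def)
    then show "z \<in> uhp" using K0 by (simp add: uhp_def zero_less_mult_iff)
  qed
  ultimately obtain N where N: "\<forall>z\<in>Q. \<forall>w\<in>Q. d z w \<le> N" using d_bdd by blast
  have "V \<subseteq> Q"
    using V1 V3 unfolding Q_def r1_def[symmetric] r2_def[symmetric] by force
  then show ?thesis using N that unfolding V_def by blast
qed

end

lemma int_cases_period:
  obtains (zero) "k = (0 :: int)" | (pos) j where "k = int (Suc j)" | (minus_one) "k = - 1" | (neg) j where "k = - int (Suc (Suc j))"
proof -
  have "k = 0 \<or> k = int (Suc (nat (k - 1))) \<or> k = - 1 \<or> k = - int (Suc (Suc (nat (- k - 2))))" by linarith
  then show ?thesis using that by blast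
qed

context plane_metric
begin

text \<open>Let \<open>c1\<close> and \<open>c3\<close> be nearly minimal lines of \<open>g = A * B\<close> and \<open>h = A * B\<inverse>\<close>. In coordinates in which \<open>g\<close>
is diagonal and \<open>A\<close> and \<open>B\<inverse>\<close> are positive, \<open>c3\<close> crosses \<open>c1\<close> from the negative to the positive side.
It may do so many times. Let \<open>tp\<close> be the last time at which \<open>c3\<close> is on \<open>c1\<close>, and \<open>t2\<close> the first such
time after \<open>tp - p3\<close>, where \<open>p3\<close> is the period. The new line \<open>c4\<close> of \<open>h\<close> follows \<open>c3\<close> from \<open>tp\<close> to
\<open>t2 + p3\<close> and then the image under \<open>h\<close> of the segment of \<open>c1\<close> from \<open>c3 t2\<close> to \<open>c3 tp\<close>. Since \<open>c1\<close> is nearly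
a geodesic, \<open>c4\<close> is nearly minimal as well, and it meets \<open>c1\<close> only in that segment.

The point \<open>Q\<close> exists since the part of \<open>A\<inverse> c3\<close> from \<open>tp\<close> to \<open>t2 + p3\<close> connects the translates of \<open>c1\<close> by
\<open>A\<inverse>\<close> and \<open>B\<inverse>\<close>, which lie on different sides of \<open>c1\<close>, and thus meets \<open>c1\<close>. The point \<open>P\<close> of the
segment is found in the period of \<open>c1\<close> that begins at \<open>Q\<close>. Otherwise one of the two rays of \<open>c1\<close> that
begin or end with this period would avoid \<open>c4\<close>, and together with a translate of \<open>c4\<close> it would connect the two
sides of \<open>c4\<close>.

The length of a period exceeds the translation length by at most \<open>e\<close> for \<open>c1\<close>, \<open>c3\<close> and by at most
\<open>C * e\<close> for \<open>c4\<close>.\<close>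

lemma crossing_inequality_approx:
  assumes ptolemy: "\<And>x y z w. x \<in> uhp \<Longrightarrow> y \<in> uhp \<Longrightarrow> z \<in> uhp \<Longrightarrow> w \<in> uhp \<Longrightarrow>
      d x z * d y w \<le> d x y * d z w + d x w * d y z"
    and AB: "A \<in> isom" "B \<in> isom" and cr: "crossing A B"
    and dg: "A * B = diagm l" and l: "l \<noteq> 0" "l\<^sup>2 \<noteq> 1" and pos: "posm A" "posm (adj B)"
    and N: "\<And>z w. z \<in> uhp \<Longrightarrow> w \<in> uhp \<Longrightarrow>
      d z (mob (A * B) z) \<le> tau (A * B) + 1 \<Longrightarrow> d z (mob (A * adj B) z) \<le> tau (A * adj B) + 1 \<Longrightarrow>
      d w (mob (A * B) w) \<le> tau (A * B) + 1 \<Longrightarrow> d w (mob (A * adj B) w) \<le> tau (A * adj B) + 1 \<Longrightarrow> d z w \<le> N"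
    and C: "C = (N + tau (A * B) + 1) / tau (A * B) + 2"
    and e: "0 < e" "e \<le> 1" "e < 2 * tau (A * B)" "e \<le> C * e"
    and gap: "tau (A * B) + C * e < tau A + tau B" "tau (A * adj B) + C * e < tau A + tau B"
  shows "tau A * tau B \<le> (tau (A * B) + e)\<^sup>2 / 4 + (tau (A * adj B) + C * e)\<^sup>2 / 4"
proof -
  define g where "g = A * B"
  define h where "h = A * adj B"
  have iso [simp]: "A \<in> isom" "B \<in> isom" "g \<in> isom" "h \<in> isom" using AB by (auto simp: g_def h_def)
  have SLs [simp]: "A \<in> SL" "B \<in> SL" "g \<in> SL" "h \<in> SL" using iso by (auto simp del: iso)
  have gl: "g = diagm l" using dg by (simp add: g_def)
  have crgh: "crossing g h" unfolding g_def h_def by (rule crossing_mult_mult_adj[OF cr])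
  have hypg: "hyperbolic g" "hyperbolic h" using crossing_hyperbolic[OF crgh] by auto
  have posh: "posm h" unfolding h_def by (rule posm_mult[OF pos])
  note [simp] = adj_right adj_left adj_right_cancel adj_left_cancel
  obtain p1 c1 l1 T1 where L1: "rline g p1 c1 l1 T1" and T1: "T1 < tau g + e"
    by (rule rline_exists[OF iso(3) e(1)])
  obtain p3 c3 l3 T3 where L3: "rline h p3 c3 l3 T3" and T3: "T3 < tau h + e"
    by (rule rline_exists[OF iso(4) e(1)])
  have p1: "p1 > 0" and p3: "p3 > 0" using rline_p L1 L3 by auto
  have H1 [simp]: "c1 t \<in> uhp" and H3 [simp]: "c3 t \<in> uhp" for t using rline_uhp L1 L3 by auto
  have line1: "line (diagm l) p1 c1" using rline_line[OF L1] by (simp add: gl)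
  note line3 = rline_line[OF L3]
  have c1p: "c1 (t + p1) = mob g (c1 t)" and l1p: "l1 (t + p1) = l1 t + T1" for t
    using L1 by (auto simp: rline_def line_def)
  have c1m: "c1 (t - p1) = mob (adj g) (c1 t)" for t using c1p[of "t - p1"] by simp
  have c3p: "c3 (t + p3) = mob h (c3 t)" and l3p: "l3 (t + p3) = l3 t + T3" for t
    using L3 by (auto simp: rline_def line_def)
  have c3m: "c3 (t - p3) = mob (adj h) (c3 t)" and l3m: "l3 (t - p3) = l3 t - T3" for t
    using c3p[of "t - p3"] l3p[of "t - p3"] by auto
  have tg: "tau g > 0" by (rule tau_pos[OF iso(3) hypg(1)])

  \<comment> \<open>The translates by \<open>A\<inverse>\<close>, \<open>B\<inverse>\<close> and the powers of \<open>h\<close> avoid the first line. If \<open>h c1\<close> met it,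
    then \<open>A\<inverse> c1\<close> would meet \<open>B\<inverse> c1\<close>, which lies on the other side. For higher powers this is an
    induction: if \<open>h\<^sup>k\<^sup>+\<^sup>1 c1\<close> met \<open>c1\<close>, then the union of \<open>h\<inverse> c1\<close> and \<open>h\<^sup>k c1\<close> would be connected,
    avoid \<open>c1\<close> and have parts on both sides of it.\<close>
  define R where "R = range c1"
  define im where "im M = mob M ` R" for M
  have pcim: "path_connected (im M)" "im M \<subseteq> uhp" if "M \<in> SL" for M
  proof -
    show "im M \<subseteq> uhp" using that by (auto simp: im_def R_def)
    have "path_connected R" unfolding R_def using path_connected_line[OF _ line1, of UNIV] by simp
    then show "path_connected (im M)" unfolding im_def
      by (rule path_connected_continuous_image[OF continuous_on_mob[OF that], rotated]) (auto simp: R_def)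
  qed
  have up: "\<exists>w\<in>im Y. k < slope w" if "Y \<in> SL" "posm Y" for Y k
    using posm_translate_slope(1)[OF line1 l that] by (auto simp: im_def R_def)
  have dn: "\<exists>w\<in>im (adj Y). slope w < k" if "Y \<in> SL" "posm Y" for Y k
    using posm_translate_slope(2)[OF line1 l that] by (auto simp: im_def R_def)
  have sep: False if "path_connected S" "S \<subseteq> uhp" "S \<inter> R = {}" "\<And>k. \<exists>w\<in>S. k < slope w" "\<And>k. \<exists>w\<in>S. slope w < k" for S
    by (rule line_separates[OF line1 l that(1,2) _ that(4,5)]) (use that(3) in \<open>simp add: R_def\<close>)
  have disj: "im M \<inter> R = {}" if "\<And>s t. c1 s \<noteq> mob M (c1 t)" for M
    using that by (auto simp: im_def R_def) metis
  have dB: "c1 s \<noteq> mob B (c1 t)" for s t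
    by (rule rline_disjoint_translate[OF cr AB L1[unfolded g_def], of e]) (use T1 gap e(4) in \<open>simp_all add: g_def del: mult_le_cancel_right1\<close>)
  have dB': "c1 s \<noteq> mob (adj B) (c1 t)" for s t
    using dB[of t s] by (metis SLs(2) H1 mob_adj_right)
  have adjA: "adj A = B * adj g" by (simp add: g_def adj_mult)
  have dA': "c1 s \<noteq> mob (adj A) (c1 t)" for s t
    using dB[of s "t - p1"] by (simp add: c1m adjA mob_mult)
  have dh1: "c1 s \<noteq> mob h (c1 t)" for s t
  proof
    assume "c1 s = mob h (c1 t)"
    then have eq: "mob (adj A) (c1 s) = mob (adj B) (c1 t)" by (simp add: h_def mob_mult)
    show False
    proof (rule sep[of "im (adj A) \<union> im (adj B)"])
      show "path_connected (im (adj A) \<union> im (adj B))"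
      proof (rule path_connected_Un)
        have "mob (adj A) (c1 s) \<in> im (adj A)" "mob (adj B) (c1 t) \<in> im (adj B)" by (auto simp: im_def R_def)
        then show "im (adj A) \<inter> im (adj B) \<noteq> {}" using eq by auto
      qed (use pcim in auto)
      show "(im (adj A) \<union> im (adj B)) \<inter> R = {}"
        using disj[of "adj A", OF dA'] disj[of "adj B", OF dB'] by blast
      show "\<exists>w\<in>im (adj A) \<union> im (adj B). k < slope w" for k using up[of "adj B"] pos by auto
      show "\<exists>w\<in>im (adj A) \<union> im (adj B). slope w < k" for k using dn[of A] pos by auto
    qed (use pcim in auto)
  qed
  have dh1': "c1 s \<noteq> mob (adj h) (c1 t)" for s t
    using dh1[of t s] by (metis SLs(4) H1 mob_adj_right)
  have dh: "c1 s \<noteq> mob (h ^ Suc k) (c1 t)" for s t k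
  proof (induction k arbitrary: s t)
    case 0
    show ?case using dh1 by simp
  next
    case (Suc k)
    show ?case
    proof
      assume a: "c1 s = mob (h ^ Suc (Suc k)) (c1 t)"
      have "mob (h ^ Suc (Suc k)) (c1 t) = mob h (mob (h ^ Suc k) (c1 t))"
        unfolding power_Suc[of h "Suc k"] by (rule mob_mult) (simp_all del: power_Suc)
      then have eq: "mob (adj h) (c1 s) = mob (h ^ Suc k) (c1 t)"
        by (simp add: a del: power_Suc)
      show False
      proof (rule sep[of "im (adj h) \<union> im (h ^ Suc k)"])
        show "path_connected (im (adj h) \<union> im (h ^ Suc k))"
          by (rule path_connected_Un) (use pcim(1)[of "adj h"] pcim(1)[of "h ^ Suc k"] eq in \<open>auto simp: im_def R_def simp del: power_Suc\<close>)
        show "(im (adj h) \<union> im (h ^ Suc k)) \<inter> R = {}"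
          using disj[of "adj h", OF dh1'] disj[of "h ^ Suc k", OF Suc.IH] by blast
        show "\<exists>w\<in>im (adj h) \<union> im (h ^ Suc k). x < slope w" for x
          using up[of "h ^ Suc k" x] posm_power[OF posh] by (auto simp del: power_Suc)
        show "\<exists>w\<in>im (adj h) \<union> im (h ^ Suc k). slope w < x" for x using dn[of h] posh by auto
        show "im (adj h) \<union> im (h ^ Suc k) \<subseteq> uhp"
          using pcim(2)[of "adj h"] pcim(2)[of "h ^ Suc k"] by (simp del: power_Suc)
      qed
    qed
  qed
  have dh': "c1 s \<noteq> mob (adj (h ^ Suc k)) (c1 t)" for s t k
    using dh[of t k s] by (metis SLs(4) SL_power H1 mob_adj_right)

  \<comment> \<open>the intersection of the two lines is compact\<close>
  define Z where "Z = {z. c1 (fst z) = c3 (snd z)}"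
  have Zd: "d (c1 s) (c1 s') \<le> N" if "(s, t) \<in> Z" "(s', t') \<in> Z" for s t s' t'
  proof -
    have b: "d (c1 s) (mob g (c1 s)) \<le> tau g + 1 \<and> d (c1 s) (mob h (c1 s)) \<le> tau h + 1" if "(s, t) \<in> Z" for s t
    proof -
      have e: "c1 s = c3 t" using that by (simp add: Z_def)
      have "d (c1 s) (mob h (c1 s)) \<le> T3" unfolding e by (rule rline_displacement[OF L3 iso(4)])
      moreover have "d (c1 s) (mob g (c1 s)) \<le> T1" by (rule rline_displacement[OF L1 iso(3)])
      ultimately show ?thesis using T1 T3 \<open>e \<le> 1\<close> by linarith
    qed
    show ?thesis using b[OF that(1)] b[OF that(2)] by (intro N) (auto simp: g_def h_def)
  qed
  obtain s0 t0 where "c1 s0 = c3 t0" by (rule crossing_lines_meet[OF crgh rline_line[OF L1] rline_line[OF L3]])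
  then have "(s0, t0) \<in> Z" by (simp add: Z_def)
  then obtain z0 where z0: "z0 \<in> Z" by blast
  then have N0: "0 \<le> N" using Zd[of "fst z0" "snd z0" "fst z0" "snd z0"] by (simp add: d_refl)
  have contc: "continuous_on UNIV c1" "continuous_on UNIV c3" using line1 line3 by (auto simp: line_def)
  have "compact Z"
  proof -
    have "continuous_on UNIV (\<lambda>z. c1 (fst z))" "continuous_on UNIV (\<lambda>z. c3 (snd z))"
      by (rule continuous_on_compose2[OF contc(1)] continuous_on_compose2[OF contc(2)]; auto intro!: continuous_intros)+
    then have "closed Z" unfolding Z_def by (rule closed_Collect_eq)
    moreover have "bounded Z"
    proof -
      define b1 where "b1 = ((N + T1) / tau g + 1) * p1"
      define b3 where "b3 = ((N + T3) / tau h + 1) * p3"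
      have th: "tau h > 0" by (rule tau_pos[OF iso(4) hypg(2)])
      have bb: "\<bar>s - s'\<bar> \<le> b1 \<and> \<bar>t - t'\<bar> \<le> b3" if "(s, t) \<in> Z" "(s', t') \<in> Z" for s t s' t'
      proof -
        have D: "d (c1 s) (c1 s') \<le> N" "d (c1 s') (c1 s) \<le> N" "d (c3 t) (c3 t') \<le> N" "d (c3 t') (c3 t) \<le> N"
          using Zd[OF that] Zd[OF that(2,1)] that by (auto simp: Z_def)
        have m1: "((x + T1) / tau g + 1) * p1 \<le> b1" if "x \<le> N" for x
          unfolding b1_def using that tg p1 by (intro mult_right_mono add_right_mono divide_right_mono) auto
        have m3: "((x + T3) / tau h + 1) * p3 \<le> b3" if "x \<le> N" for x
          unfolding b3_def using that th p3 by (intro mult_right_mono add_right_mono divide_right_mono) auto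
        have "\<bar>s - s'\<bar> \<le> b1"
          using rline_time_bound[OF L1 iso(3) hypg(1), of s s'] rline_time_bound[OF L1 iso(3) hypg(1), of s' s]
            m1[OF D(1)] m1[OF D(2)] by linarith
        moreover have "\<bar>t - t'\<bar> \<le> b3"
          using rline_time_bound[OF L3 iso(4) hypg(2), of t t'] rline_time_bound[OF L3 iso(4) hypg(2), of t' t]
            m3[OF D(3)] m3[OF D(4)] by linarith
        ultimately show ?thesis ..
      qed
      have "Z \<subseteq> {fst z0 - b1..fst z0 + b1} \<times> {snd z0 - b3..snd z0 + b3}"
      proof
        fix z assume "z \<in> Z"
        then have "\<bar>fst z - fst z0\<bar> \<le> b1 \<and> \<bar>snd z - snd z0\<bar> \<le> b3"
          using bb[of "fst z" "snd z" "fst z0" "snd z0"] z0 by simp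
        then show "z \<in> {fst z0 - b1..fst z0 + b1} \<times> {snd z0 - b3..snd z0 + b3}"
          by (cases z) (auto simp: abs_le_iff)
      qed
      then show ?thesis by (rule bounded_subset[rotated]) (intro bounded_Times bounded_closed_interval)
    qed
    ultimately show ?thesis by (simp add: compact_eq_bounded_closed)
  qed
  then have cJ: "compact (snd ` Z)" by (intro compact_continuous_image continuous_intros)
  define J where "J = snd ` Z"
  have J: "t \<in> J \<longleftrightarrow> c3 t \<in> R" for t
    by (auto simp: J_def Z_def R_def image_iff) metis+
  \<comment> \<open>the last time at which the second line is on the first one, and the first such time in the
    preceding period\<close>
  obtain tp where tp: "tp \<in> J" "\<And>t. t \<in> J \<Longrightarrow> t \<le> tp"
    using compact_attains_sup[OF cJ] z0 unfolding J_def by blast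
  have "compact (J \<inter> {tp - p3..})" unfolding J_def by (rule compact_Int_closed[OF cJ]) simp
  moreover have "J \<inter> {tp - p3..} \<noteq> {}" using tp p3 by force
  ultimately obtain t2 where t2: "t2 \<in> J" "tp - p3 \<le> t2" "\<And>t. t \<in> J \<Longrightarrow> tp - p3 \<le> t \<Longrightarrow> t2 \<le> t"
    using compact_attains_inf[of "J \<inter> {tp - p3..}"] by auto
  obtain sp where sp: "c3 tp = c1 sp" using tp(1) by (auto simp: J R_def)
  obtain s2 where s2: "c3 t2 = c1 s2" using t2(1) by (auto simp: J R_def)
  have t2tp: "t2 \<le> tp" using t2(3)[OF tp(1)] p3 by simp
  have t2p: "tp - p3 < t2"
  proof (rule ccontr)
    assume "\<not> tp - p3 < t2"
    then have "t2 = tp - p3" using t2(2) by simp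
    then have "c1 s2 = mob (adj h) (c1 sp)" using s2 sp c3m[of tp] by simp
    then show False using dh1' by blast
  qed

  \<comment> \<open>the segment of the first line between these two points\<close>
  define lo where "lo = min s2 sp"
  define hi where "hi = max s2 sp"
  note lo_hi_def = lo_def hi_def
  have lohi: "lo \<le> hi" "s2 \<in> {lo..hi}" "sp \<in> {lo..hi}" by (auto simp: lo_hi_def)
  define len where "len = l1 hi - l1 lo"
  define D where "D = d (c3 t2) (c3 tp)"
  have Dlohi: "d (c1 lo) (c1 hi) = D"
    using d_sym[OF H1[of s2] H1[of sp]] by (simp add: D_def sp s2 lo_hi_def min_def max_def)
  have DN: "D \<le> N" using Zd[of s2 t2 sp tp] sp s2 by (simp add: Z_def D_def)
  have D3: "D \<le> l3 tp - l3 t2" unfolding D_def by (rule rline_d[OF L3 t2tp])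
  have len: "len \<le> D + (C - 1) * e"
  proof -
    have "len \<le> D + ((D + T1) / tau g + 1) * (T1 - tau g)"
      using rline_excess[OF L1 iso(3) hypg(1) lohi(1)] by (simp add: len_def Dlohi)
    also have "((D + T1) / tau g + 1) * (T1 - tau g) \<le> (C - 1) * e"
    proof (rule mult_mono)
      have "(D + T1) / tau g \<le> (N + tau g + 1) / tau g"
        using DN T1 e tg by (intro divide_right_mono) auto
      then show "(D + T1) / tau g + 1 \<le> C - 1" by (simp add: C g_def)
      have "0 \<le> (N + tau g + 1) / tau g" using N0 tg by simp
      then show "0 \<le> C - 1" by (simp add: C g_def)
    qed (use T1 rline_tau_le[OF L1 iso(3)] in auto)
    finally show ?thesis by simp
  qed

  \<comment> \<open>the new line of \<open>h\<close>: one piece of the second line, and the image of the segment\<close>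
  define q1 where "q1 = t2 + p3 - tp"
  define q where "q = q1 + (hi - lo)"
  have q1: "q1 > 0" using t2p by (simp add: q1_def)
  define cl where "cl = (\<lambda>t. if s2 \<le> sp then mob h (c1 (s2 + t)) else mob h (c1 (s2 - t)))"
  define ll where "ll = (\<lambda>t. if s2 \<le> sp then l1 (s2 + t) else - l1 (s2 - t))"
  have tr1: "track (\<lambda>t. c3 (tp + t)) (\<lambda>t. l3 (tp + t)) q1"
    using rline_track(1)[OF L3 isom_one, of q1 tp] q1 by simp
  have tr2: "track cl ll (hi - lo)"
    using rline_track[OF L1 iso(4), of "hi - lo" s2] lohi unfolding cl_def ll_def by (cases "s2 \<le> sp") auto
  have ends: "cl 0 = c3 (tp + q1)" "cl (hi - lo) = mob h (c1 sp)" "ll (hi - lo) - ll 0 = len"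
    using c3p[of t2] by (auto simp: cl_def ll_def q1_def s2 lo_hi_def len_def min_def max_def algebra_simps)
  have clr: "\<exists>\<sigma>\<in>{lo..hi}. cl t = mob h (c1 \<sigma>)" if "t \<in> {0..hi - lo}" for t
    using that by (auto simp: cl_def lo_hi_def min_def max_def intro: bexI[of _ "s2 + t"] bexI[of _ "s2 - t"])
  define cn where "cn = (\<lambda>t. if t \<le> q1 then c3 (tp + t) else cl (t - q1))"
  define ln where "ln = (\<lambda>t. if t \<le> q1 then l3 (tp + t) else ll (t - q1) + (l3 (tp + q1) - ll 0))"
  have trn: "track cn ln q"
    unfolding cn_def ln_def q_def by (rule track_join[OF tr1 tr2 ends(1)])
  have q: "q > 0" "q1 \<le> q" using q1 lohi by (auto simp: q_def)
  have cnq: "cn 0 = c3 tp" "cn q = mob h (c1 sp)"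
  proof -
    show "cn 0 = c3 tp" using q1 by (simp add: cn_def)
    show "cn q = mob h (c1 sp)"
    proof (cases "hi = lo")
      case True then show ?thesis using ends by (simp add: cn_def q_def)
    next
      case False then show ?thesis using ends lohi by (simp add: cn_def q_def)
    qed
  qed
  have lnq: "ln q - ln 0 \<le> tau h + C * e"
  proof -
    have "ln q - ln 0 = (l3 (tp + q1) - l3 tp) + len"
    proof (cases "hi = lo")
      case True then show ?thesis using ends q1 by (simp add: ln_def q_def)
    next
      case False then show ?thesis using ends lohi q1 by (simp add: ln_def q_def)
    qed
    also have "l3 (tp + q1) = l3 t2 + T3" using l3p[of t2] by (simp add: q1_def)
    finally show ?thesis using len D3 T3 by (simp add: algebra_simps)
  qed
  obtain c4 l4 where L4: "rline h q c4 l4 (ln q - ln 0)" and c4: "\<And>t. t \<in> {0..q} \<Longrightarrow> c4 t = cn t"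
  proof (rule rline_extend[OF iso(4) q(1)])
    show "continuous_on {0..q} cn" "cn ` {0..q} \<subseteq> uhp" using trn by (auto simp: track_def)
    show "cn q = mob h (cn 0)" by (simp add: cnq sp)
    show "d (cn s) (cn t) \<le> ln t - ln s" if "0 \<le> s" "s \<le> t" "t \<le> q" for s t
      using trn that by (simp add: track_def)
  qed blast
  note line4 = rline_line[OF L4]
  have H4 [simp]: "c4 t \<in> uhp" for t using rline_uhp[OF L4] .
  have c4p: "c4 (t + q) = mob h (c4 t)" for t using line4 by (simp add: line_def)
  have c4m: "c4 (t - q) = mob (adj h) (c4 t)" for t using c4p[of "t - q"] by simp
  define R4 where "R4 = range c4"

  \<comment> \<open>it meets the first line only in the segment\<close>
  have meet: "\<exists>\<sigma>\<in>{lo..hi}. c1 s = c1 \<sigma>" if st: "c1 s = c4 t" for s t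
  proof -
    define k where "k = \<lfloor>t / q\<rfloor>"
    define u where "u = t - of_int k * q"
    have u: "u \<in> {0..q}"
    proof -
      have "of_int k \<le> t / q" "t / q < of_int k + 1" unfolding k_def by linarith+
      then have "of_int k * q \<le> t" "t < (of_int k + 1) * q"
        using q by (simp_all only: pos_le_divide_eq pos_divide_less_eq)
      then show ?thesis by (simp add: u_def algebra_simps)
    qed
    have pc3: "path_connected (c3 ` I)" if "convex I" for I :: "real set"
      by (rule path_connected_line[OF that line3])
    show ?thesis
    proof (cases "u \<le> q1")
      case True
      define \<tau> where "\<tau> = tp + u"
      have \<tau>: "tp \<le> \<tau>" "\<tau> \<le> t2 + p3" using u True by (auto simp: \<tau>_def q1_def)
      have cu: "c4 u = c3 \<tau>" using c4[OF u] True by (simp add: cn_def \<tau>_def)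
      \<comment> \<open>Every other position of the piece of \<open>c3\<close>, by whole periods of the new line, would give a connected
set that avoids \<open>c1\<close> and reaches both sides.\<close>
      consider "k = 0" | j where "k = int (Suc j)" | "k = - 1" | j where "k = - int (Suc (Suc j))"
        by (rule int_cases_period)
      then show ?thesis
      proof cases
        case 1
        then have "c3 \<tau> = c1 s" using st cu by (simp add: u_def)
        then have "\<tau> \<in> J" by (simp add: J R_def)
        then have "\<tau> = tp" using tp(2) \<tau>(1) by force
        then show ?thesis using \<open>c3 \<tau> = c1 s\<close> sp lohi by metis
      next
        case 2
        have "c4 t = mob (h ^ Suc j) (c4 u)"
          using line_shift[OF line4 SLs(4), of u "Suc j"] 2 by (simp add: u_def del: power_Suc)
        then have eq: "c3 \<tau> = mob (adj (h ^ Suc j)) (c1 s)" using st cu by (simp del: power_Suc)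
        then have "\<tau> \<noteq> tp" using sp dh' by metis
        then have \<tau>': "tp < \<tau>" using \<tau> by simp
        have False
        proof (rule sep[of "im (adj (h ^ Suc j)) \<union> c3 ` {\<tau>..}"])
          show "path_connected (im (adj (h ^ Suc j)) \<union> c3 ` {\<tau>..})"
            by (rule path_connected_Un)
              (use pcim(1)[of "adj (h ^ Suc j)"] pc3[of "{\<tau>..}"] eq in \<open>auto simp: im_def R_def simp del: power_Suc\<close>)
          show "im (adj (h ^ Suc j)) \<union> c3 ` {\<tau>..} \<subseteq> uhp"
            using pcim(2)[of "adj (h ^ Suc j)"] by (auto simp del: power_Suc)
          have "c3 ` {\<tau>..} \<inter> R = {}" using tp(2) \<tau>' by (force simp: J)
          then show "(im (adj (h ^ Suc j)) \<union> c3 ` {\<tau>..}) \<inter> R = {}"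
            using disj[of "adj (h ^ Suc j)", OF dh'] by blast
          show "\<exists>w\<in>im (adj (h ^ Suc j)) \<union> c3 ` {\<tau>..}. x < slope w" for x
            using posm_line_slope(1)[OF line3 SLs(4) posh, of \<tau> x] by auto
          show "\<exists>w\<in>im (adj (h ^ Suc j)) \<union> c3 ` {\<tau>..}. slope w < x" for x
            using dn[of "h ^ Suc j" x] posm_power[OF posh] by (auto simp del: power_Suc)
        qed
        then show ?thesis ..
      next
        case 3
        then have "c4 (t + q) = c3 \<tau>" using cu by (simp add: u_def)
        then have "c3 \<tau> = mob h (c1 s)" unfolding c4p st by simp
        then have "c3 (\<tau> - p3) = c1 s" by (simp add: c3m[of \<tau>])
        then have "\<tau> - p3 \<in> J" by (simp add: J R_def)
        then have "t2 = \<tau> - p3" using t2(3)[of "\<tau> - p3"] \<tau> by simp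
        then show ?thesis using \<open>c3 (\<tau> - p3) = c1 s\<close> s2 lohi by metis
      next
        case 4
        have "c4 u = mob (h ^ Suc (Suc j)) (c4 t)"
        proof -
          have "u = t + real (Suc (Suc j)) * q" by (simp add: u_def 4 algebra_simps)
          then show ?thesis using line_shift[OF line4 SLs(4), of t "Suc (Suc j)"] by simp
        qed
        then have "c3 \<tau> = mob h (mob (h ^ Suc j) (c1 s))"
          using st cu mob_mult[of h "h ^ Suc j" "c1 s"] by simp
        then have eq: "c3 (\<tau> - p3) = mob (h ^ Suc j) (c1 s)" by (simp add: c3m del: power_Suc)
        have nJ: "x \<notin> J" if "x \<in> {tp - p3..\<tau> - p3}" for x
        proof
          assume x: "x \<in> J"
          then have "x = t2" "t2 = \<tau> - p3" using t2(3)[OF x] that \<tau> by auto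
          then have "c1 s2 = mob (h ^ Suc j) (c1 s)" using eq s2 by metis
          then show False using dh by blast
        qed
        have \<tau>': "tp - p3 \<le> \<tau> - p3" using \<tau> by simp
        have False
        proof (rule sep[of "im (adj h) \<union> c3 ` {tp - p3..\<tau> - p3} \<union> im (h ^ Suc j)"])
          show "path_connected (im (adj h) \<union> c3 ` {tp - p3..\<tau> - p3} \<union> im (h ^ Suc j))"
          proof (rule path_connected_Un3)
            have "c3 (tp - p3) \<in> im (adj h)" by (simp add: c3m sp im_def R_def)
            moreover have "c3 (tp - p3) \<in> c3 ` {tp - p3..\<tau> - p3}" using \<tau>' by simp
            ultimately show "im (adj h) \<inter> c3 ` {tp - p3..\<tau> - p3} \<noteq> {}" by blast
            have "c3 (\<tau> - p3) \<in> im (h ^ Suc j)" unfolding eq by (simp add: im_def R_def)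
            moreover have "c3 (\<tau> - p3) \<in> c3 ` {tp - p3..\<tau> - p3}" using \<tau>' by simp
            ultimately show "c3 ` {tp - p3..\<tau> - p3} \<inter> im (h ^ Suc j) \<noteq> {}" by blast
          qed (use pcim(1)[of "adj h"] pcim(1)[of "h ^ Suc j"] pc3 in \<open>auto simp del: power_Suc\<close>)
          show "im (adj h) \<union> c3 ` {tp - p3..\<tau> - p3} \<union> im (h ^ Suc j) \<subseteq> uhp"
            using pcim(2)[of "adj h"] pcim(2)[of "h ^ Suc j"] by (auto simp del: power_Suc)
          have "c3 ` {tp - p3..\<tau> - p3} \<inter> R = {}" using nJ by (force simp: J)
          then show "(im (adj h) \<union> c3 ` {tp - p3..\<tau> - p3} \<union> im (h ^ Suc j)) \<inter> R = {}"
            using disj[of "adj h", OF dh1'] disj[of "h ^ Suc j", OF dh] by blast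
          show "\<exists>w\<in>im (adj h) \<union> c3 ` {tp - p3..\<tau> - p3} \<union> im (h ^ Suc j). x < slope w" for x
            using up[of "h ^ Suc j" x] posm_power[OF posh] by (auto simp del: power_Suc)
          show "\<exists>w\<in>im (adj h) \<union> c3 ` {tp - p3..\<tau> - p3} \<union> im (h ^ Suc j). slope w < x" for x
            using dn[of h x] posh by auto
        qed
        then show ?thesis ..
      qed
    next
      case False
      then have "u - q1 \<in> {0..hi - lo}" using u by (simp add: q_def)
      then obtain \<sigma> where \<sigma>: "\<sigma> \<in> {lo..hi}" "c4 u = mob h (c1 \<sigma>)"
        using clr c4[OF u] False by (fastforce simp: cn_def)
      consider "k = -1" | j where "k = int j" | j where "k = - int (Suc (Suc j))"
        using int_cases_period[of k] by (metis int_ops(1))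
      then show ?thesis
      proof cases
        case 1
        then have "c4 (t + q) = mob h (c1 \<sigma>)" using \<sigma> by (simp add: u_def)
        then have "mob h (c1 s) = mob h (c1 \<sigma>)" using st by (simp add: c4p)
        then have "c1 s = c1 \<sigma>" by (metis SLs(4) H1 mob_adj_left)
        then show ?thesis using \<sigma> by blast
      next
        case 2
        have "c4 t = mob (h ^ j) (c4 u)" using line_shift[OF line4 SLs(4), of u j] 2 by (simp add: u_def)
        then have "c1 s = mob (h ^ Suc j) (c1 \<sigma>)"
          using st \<sigma> by (simp add: mob_mult[symmetric] power_commutes)
        then show ?thesis using dh by blast
      next
        case 3
        have "c4 u = mob (h ^ Suc (Suc j)) (c4 t)"
        proof -
          have "u = t + real (Suc (Suc j)) * q" by (simp add: u_def 3 algebra_simps)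
          then show ?thesis using line_shift[OF line4 SLs(4), of t "Suc (Suc j)"] by simp
        qed
        then have "mob h (c1 \<sigma>) = mob h (mob (h ^ Suc j) (c1 s))"
          using st \<sigma> mob_mult[of h "h ^ Suc j" "c1 s"] by simp
        then have "c1 \<sigma> = mob (h ^ Suc j) (c1 s)"
          using mob_adj_left[OF SLs(4)] H1 mob_uhp SL_power[OF SLs(4)] by metis
        then show ?thesis using dh by blast
      qed
    qed
  qed

  \<comment> \<open>the point \<open>Q\<close> with \<open>AQ\<close> on the new line\<close>
  obtain \<tau> s' where \<tau>: "tp \<le> \<tau>" "\<tau> \<le> t2 + p3" and Q: "c3 \<tau> = mob A (c1 s')"
  proof -
    define I where "I = {tp..t2 + p3}"
    define W where "W = im (adj A) \<union> (\<lambda>t. mob (adj A) (c3 t)) ` I \<union> im (adj B)"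
    have "W \<inter> R \<noteq> {}"
    proof
      assume WR: "W \<inter> R = {}"
      show False
      proof (rule sep[OF _ _ WR])
        show "path_connected W" unfolding W_def
        proof (rule path_connected_Un3)
          have I: "tp \<in> I" "t2 + p3 \<in> I" using t2p by (auto simp: I_def)
          show "im (adj A) \<inter> (\<lambda>t. mob (adj A) (c3 t)) ` I \<noteq> {}"
            using I(1) sp by (auto simp: im_def R_def)
          have "mob (adj A) (c3 (t2 + p3)) = mob (adj B) (c1 s2)"
            by (simp add: c3p s2 h_def mob_mult)
          then have "mob (adj A) (c3 (t2 + p3)) \<in> im (adj B)" by (simp add: im_def R_def)
          then show "(\<lambda>t. mob (adj A) (c3 t)) ` I \<inter> im (adj B) \<noteq> {}" using I(2) by blast
          show "path_connected ((\<lambda>t. mob (adj A) (c3 t)) ` I)"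
            using path_connected_line[OF _ line_mob[OF line3 SLs(4), of "adj A"], of I] by (simp add: I_def)
        qed (use pcim in auto)
        show "W \<subseteq> uhp" using pcim by (auto simp: W_def)
        show "\<exists>w\<in>W. x < slope w" for x using up[of "adj B" x] pos by (auto simp: W_def)
        show "\<exists>w\<in>W. slope w < x" for x using dn[of A x] pos by (auto simp: W_def)
      qed
    qed
    moreover have "im (adj A) \<inter> R = {}" "im (adj B) \<inter> R = {}"
      using disj[of "adj A", OF dA'] disj[of "adj B", OF dB'] by auto
    ultimately obtain w where "w \<in> (\<lambda>t. mob (adj A) (c3 t)) ` I" "w \<in> R" unfolding W_def by blast
    then obtain t s where ts: "t \<in> I" "mob (adj A) (c3 t) = c1 s" unfolding R_def by blast
    have "c3 t = mob A (mob (adj A) (c3 t))" by simp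
    then have "c3 t = mob A (c1 s)" unfolding ts(2) .
    then show ?thesis using that ts(1) unfolding I_def by fastforce
  qed
  define Qp where "Qp = c1 s'"
  have BQ: "mob B Qp = c3 (\<tau> - p3)"
    by (simp add: c3m Q h_def Qp_def adj_mult mob_mult)
  have BQ4: "mob B Qp = c4 (\<tau> - tp - q)"
  proof -
    have "\<tau> - tp \<in> {0..q}" "\<tau> - tp \<le> q1" using \<tau> q by (auto simp: q1_def)
    then have "c4 (\<tau> - tp) = c3 \<tau>" using c4 by (simp add: cn_def)
    then show ?thesis unfolding BQ c4m c3m by simp
  qed

  \<comment> \<open>the new line separates; coordinates in which \<open>h\<close> is diagonal\<close>
  have crh: "crossing A (adj B)" by (rule crossing_adj[OF cr])
  obtain M m where M: "M \<in> SL" and m: "m \<noteq> 0" "m\<^sup>2 \<noteq> 1" and Mh: "M * h * adj M = diagm m"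
    and posM: "posm (M * A * adj M)" "posm (M * B * adj M)"
    using crossing_normal_form[OF crh] by (metis adj_adj h_def)
  have lineM: "line (diagm m) q (\<lambda>t. mob M (c4 t))"
    using line_mob[OF line4 SLs(4) M] by (simp add: Mh)
  have SM [simp]: "M * A * adj M \<in> SL" "M * B * adj M \<in> SL" "M * g * adj M \<in> SL" using M by auto
  have gM: "posm (M * g * adj M)"
  proof -
    have "M * g * adj M = (M * A * adj M) * (M * B * adj M)" using M by (simp add: g_def mult.assoc)
    then show ?thesis using posm_mult[OF posM] by simp
  qed
  have line1M: "line (M * g * adj M) p1 (\<lambda>t. mob M (c1 t))"
    by (rule line_mob[OF rline_line[OF L1] SLs(3) M])
  have sep4: False if S: "path_connected S" "S \<subseteq> uhp" "S \<inter> R4 = {}"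
      "\<And>x. \<exists>w\<in>S. x < slope (mob M w)" "\<And>x. \<exists>w\<in>S. slope (mob M w) < x" for S
  proof (rule line_separates[OF lineM m, of "mob M ` S"])
    show "path_connected (mob M ` S)"
      by (rule path_connected_continuous_image[OF continuous_on_mob[OF M S(2)] S(1)])
    show "mob M ` S \<subseteq> uhp" using S(2) M by auto
    show "mob M ` S \<inter> range (\<lambda>t. mob M (c4 t)) = {}"
    proof -
      have "mob M w \<noteq> mob M (c4 t)" if "w \<in> S" for w t
      proof
        assume "mob M w = mob M (c4 t)"
        then have "w = c4 t" using M S(2) that H4 by (metis mob_adj_left subsetD)
        then show False using S(3) that by (auto simp: R4_def)
      qed
      then show ?thesis by blast
    qed
  qed (use S(4,5) in auto)
  have d4: "c4 s \<noteq> mob (adj B) (c4 t)" for s t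
  proof (rule rline_disjoint_translate[OF crh iso(1) isom_adj[OF iso(2)] L4[unfolded h_def]])
    show "ln q - ln 0 \<le> tau (A * adj B) + C * e" using lnq by (simp add: h_def)
  qed (use gap tau_adj[OF iso(2)] in auto)
  have d4A: "c4 s \<noteq> mob A (c4 t)" for s t
  proof
    assume "c4 s = mob A (c4 t)"
    then have "mob (adj h) (c4 s) = mob B (c4 t)" by (simp add: h_def adj_mult mob_mult)
    then have "mob (adj B) (c4 (s - q)) = c4 t" by (simp add: c4m)
    then show False using d4 by metis
  qed
  have pc1: "path_connected (c1 ` I)" if "convex I" for I :: "real set"
    by (rule path_connected_line[OF that line1])
  have pc4: "path_connected (mob Y ` R4)" if "Y \<in> SL" for Y
    using path_connected_line[OF _ line_mob[OF line4 SLs(4) that], of UNIV] by (simp add: R4_def image_image)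
  have selfint: "\<bar>s - t\<bar> < p1" if "c1 s = c1 t" for s t
  proof -
    have T: "T1 < 3 * tau g" using T1 e by (simp add: g_def)
    have si: "t - s < p1" if "s \<le> t" "c1 s = c1 t" for s t
      by (rule rline_self_intersection[OF L1 iso(3) hypg(1) T that])
    show ?thesis
    proof (cases "s \<le> t")
      case True then show ?thesis using si[OF True that] by linarith
    next
      case False
      then have "t \<le> s" by simp
      from si[OF this that[symmetric]] this show ?thesis by linarith
    qed
  qed
  obtain s \<sigma> where s: "s \<in> {s'..s' + p1}" and \<sigma>: "\<sigma> \<in> {lo..hi}" and s\<sigma>: "c1 s = c1 \<sigma>"
  proof (rule ccontr)
    assume "\<not> thesis"
    then have no: "\<And>s \<sigma>. s \<in> {s'..s' + p1} \<Longrightarrow> \<sigma> \<in> {lo..hi} \<Longrightarrow> c1 s \<noteq> c1 \<sigma>" using that by blast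
    then have "{lo..hi} \<inter> {s'..s' + p1} = {}" by blast
    then consider "hi < s'" | "s' + p1 < lo" using interval_between[OF lohi(1), of s' "s' + p1"] p1 by auto
    then show False
    proof cases
      case 1
      have av: "c1 s \<notin> R4" if "s' \<le> s" for s
      proof
        assume "c1 s \<in> R4"
        then obtain t where "c1 s = c4 t" unfolding R4_def by blast
        then obtain \<sigma> where \<sigma>: "\<sigma> \<in> {lo..hi}" "c1 s = c1 \<sigma>" using meet by blast
        then have "s \<notin> {s'..s' + p1}" using no by blast
        then show False using selfint[OF \<sigma>(2)] \<sigma>(1) that 1 by auto
      qed
      show False
      proof (rule sep4[of "c1 ` {s'..} \<union> mob (adj B) ` R4"])
        have "Qp = mob (adj B) (mob B Qp)" by (simp add: Qp_def)
        then have "c1 s' \<in> mob (adj B) ` R4" unfolding BQ4 by (simp add: Qp_def R4_def)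
        then show "path_connected (c1 ` {s'..} \<union> mob (adj B) ` R4)"
          by (intro path_connected_Un pc1 pc4) auto
        show "c1 ` {s'..} \<union> mob (adj B) ` R4 \<subseteq> uhp" by (auto simp: R4_def)
        have "mob (adj B) ` R4 \<inter> R4 = {}" using d4 by (auto simp: R4_def) metis
        then show "(c1 ` {s'..} \<union> mob (adj B) ` R4) \<inter> R4 = {}" using av by auto
        show "\<exists>w\<in>c1 ` {s'..} \<union> mob (adj B) ` R4. x < slope (mob M w)" for x
          using posm_line_slope(1)[OF line1M SM(3) gM, of s' x] by auto
        have "mob (adj (M * B * adj M)) (mob M (c4 t)) = mob M (mob (adj B) (c4 t))" for t
          using M by (simp add: adj_mult mob_mult[symmetric] mult.assoc)
        then show "\<exists>w\<in>c1 ` {s'..} \<union> mob (adj B) ` R4. slope (mob M w) < x" for x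
          using posm_translate_slope(2)[OF lineM m SM(2) posM(2), of x] by (auto simp: R4_def)
      qed
    next
      case 2
      have av: "c1 s \<notin> R4" if "s \<le> s' + p1" for s
      proof
        assume "c1 s \<in> R4"
        then obtain t where "c1 s = c4 t" unfolding R4_def by blast
        then obtain \<sigma> where \<sigma>: "\<sigma> \<in> {lo..hi}" "c1 s = c1 \<sigma>" using meet by blast
        then have "s \<notin> {s'..s' + p1}" using no by blast
        then show False using selfint[OF \<sigma>(2)] \<sigma>(1) that 2 by auto
      qed
      show False
      proof (rule sep4[of "c1 ` {..s' + p1} \<union> mob A ` R4"])
        have "c1 (s' + p1) = mob A (mob B Qp)" by (simp add: Qp_def c1p g_def mob_mult)
        then have "c1 (s' + p1) \<in> mob A ` R4" unfolding BQ4 by (simp add: R4_def)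
        then show "path_connected (c1 ` {..s' + p1} \<union> mob A ` R4)"
          by (intro path_connected_Un pc1 pc4) auto
        show "c1 ` {..s' + p1} \<union> mob A ` R4 \<subseteq> uhp" by (auto simp: R4_def)
        have "mob A ` R4 \<inter> R4 = {}" using d4A by (auto simp: R4_def) metis
        then show "(c1 ` {..s' + p1} \<union> mob A ` R4) \<inter> R4 = {}" using av by auto
        show "\<exists>w\<in>c1 ` {..s' + p1} \<union> mob A ` R4. slope (mob M w) < x" for x
          using posm_line_slope(2)[OF line1M SM(3) gM, of "s' + p1" x] by auto
        have "mob (M * A * adj M) (mob M (c4 t)) = mob M (mob A (c4 t))" for t
          using M by (simp add: mob_mult[symmetric] mult.assoc)
        then show "\<exists>w\<in>c1 ` {..s' + p1} \<union> mob A ` R4. x < slope (mob M w)" for x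
          using posm_translate_slope(1)[OF lineM m SM(1) posM(1), of x] by (auto simp: R4_def)
      qed
    qed
  qed

  \<comment> \<open>the four points\<close>
  define P where "P = c1 s"
  have PQ [simp]: "P \<in> uhp" "Qp \<in> uhp" by (auto simp: P_def Qp_def)
  have x1: "d P Qp \<le> l1 s - l1 s'"
    using rline_d[OF L1, of s' s] s d_sym[of P Qp] by (simp add: P_def Qp_def)
  have x2: "d P (mob g Qp) \<le> l1 s' + T1 - l1 s"
    using rline_d[OF L1, of s "s' + p1"] s by (simp add: P_def Qp_def c1p l1p)
  have seg: "d (c1 x) (c1 y) \<le> \<bar>l1 x - l1 y\<bar>" for x y
    using rline_d[OF L1, of x y] rline_d[OF L1, of y x] d_sym[OF H1[of x] H1[of y]] by (cases "x \<le> y") auto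
  have lens: "\<bar>l1 s2 - l1 \<sigma>\<bar> + \<bar>l1 \<sigma> - l1 sp\<bar> = len"
  proof -
    have mm: "l1 lo \<le> l1 \<sigma>" "l1 \<sigma> \<le> l1 hi" using rline_mono[OF L1] \<sigma> by auto
    show ?thesis
    proof (cases "s2 \<le> sp")
      case True
      then have "lo = s2" "hi = sp" by (auto simp: lo_hi_def)
      then show ?thesis using mm by (simp add: len_def)
    next
      case False
      then have "lo = sp" "hi = s2" by (auto simp: lo_hi_def)
      then show ?thesis using mm by (simp add: len_def)
    qed
  qed
  have y1: "d P (mob B Qp) \<le> \<bar>l1 s2 - l1 \<sigma>\<bar> + (l3 t2 - (l3 \<tau> - T3))"
  proof -
    have "d P (mob B Qp) \<le> d P (c1 s2) + d (c1 s2) (mob B Qp)" by (intro d_tri) auto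
    also have "d P (c1 s2) \<le> \<bar>l1 s2 - l1 \<sigma>\<bar>" using seg[of \<sigma> s2] by (simp add: P_def s\<sigma> abs_minus_commute)
    also have "d (c1 s2) (mob B Qp) = d (mob B Qp) (c1 s2)" by (intro d_sym) auto
    also have "\<dots> \<le> l3 t2 - l3 (\<tau> - p3)" unfolding BQ s2[symmetric] using \<tau> by (intro rline_d[OF L3]) simp
    finally show ?thesis by (simp add: l3m)
  qed
  have y2: "d P (mob A Qp) \<le> \<bar>l1 \<sigma> - l1 sp\<bar> + (l3 \<tau> - l3 tp)"
  proof -
    have "d P (mob A Qp) \<le> d P (c1 sp) + d (c1 sp) (mob A Qp)" by (intro d_tri) auto
    also have "d P (c1 sp) \<le> \<bar>l1 \<sigma> - l1 sp\<bar>" using seg[of \<sigma> sp] by (simp add: P_def s\<sigma>)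
    also have "d (c1 sp) (mob A Qp) \<le> l3 \<tau> - l3 tp"
      unfolding sp[symmetric] Qp_def Q[symmetric] using \<tau> by (intro rline_d[OF L3])
    finally show ?thesis by simp
  qed
  have "tau A \<le> d P (mob (adj A) P)" using tau_le[of "adj A" P] tau_adj[OF iso(1)] by simp
  moreover have "tau B \<le> d Qp (mob B Qp)" by (rule tau_le) auto
  ultimately have "tau A * tau B \<le> d P (mob (adj A) P) * d Qp (mob B Qp)"
    by (intro mult_mono) (auto simp: tau_nonneg d_nonneg)
  also have "\<dots> \<le> d P Qp * d (mob (adj A) P) (mob B Qp) + d P (mob B Qp) * d Qp (mob (adj A) P)"
    by (rule ptolemy) auto
  also have "d (mob (adj A) P) (mob B Qp) = d P (mob g Qp)"
    using isom_d[OF iso(1), of "mob (adj A) P" "mob B Qp"] by (simp add: g_def mob_mult)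
  also have "d Qp (mob (adj A) P) = d P (mob A Qp)"
    using isom_d[OF iso(1), of Qp "mob (adj A) P"] d_sym[of P "mob A Qp"] by simp
  also have "d P Qp * d P (mob g Qp) \<le> (tau g + e)\<^sup>2 / 4"
    by (rule mult_le_square_half) (use x1 x2 T1 in \<open>auto simp: d_nonneg\<close>)
  also have "d P (mob B Qp) * d P (mob A Qp) \<le> (tau h + C * e)\<^sup>2 / 4"
    by (rule mult_le_square_half) (use y1 y2 lens len D3 T3 in \<open>auto simp: d_nonneg algebra_simps\<close>)
  finally show ?thesis by (simp add: g_def h_def)
qed

text \<open>Letting the error tend to \<open>0\<close> in the previous estimate. If \<open>tau A + tau B\<close> is at most one of the other two
translation lengths, then the arithmetic-geometric mean inequality suffices.\<close>

lemma crossing_inequality_diagonal: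
  assumes ptolemy: "\<And>x y z w. x \<in> uhp \<Longrightarrow> y \<in> uhp \<Longrightarrow> z \<in> uhp \<Longrightarrow> w \<in> uhp \<Longrightarrow>
      d x z * d y w \<le> d x y * d z w + d x w * d y z"
    and AB: "A \<in> isom" "B \<in> isom" and cr: "crossing A B"
    and dg: "A * B = diagm l" and l: "l \<noteq> 0" "l\<^sup>2 \<noteq> 1" and pos: "posm A" "posm (adj B)"
  shows "tau A * tau B \<le> (tau (A * B))\<^sup>2 / 4 + (tau (A * adj B))\<^sup>2 / 4"
proof -
  define T1 T3 where "T1 = tau (A * B)" "T3 = tau (A * adj B)"
  have nn: "0 \<le> tau A" "0 \<le> tau B" "0 \<le> T1\<^sup>2" "0 \<le> T3\<^sup>2" using AB by (auto simp: tau_nonneg)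
  consider "tau A + tau B \<le> T1" | "tau A + tau B \<le> T3" | "T1 < tau A + tau B" "T3 < tau A + tau B" by linarith
  then have "tau A * tau B \<le> T1\<^sup>2 / 4 + T3\<^sup>2 / 4"
  proof cases
    case 1
    then show ?thesis using mult_le_square_half[OF nn(1,2) 1] nn(4) by linarith
  next
    case 2
    then show ?thesis using mult_le_square_half[OF nn(1,2) 2] nn(3) by linarith
  next
    case 3
    have posh: "posm (A * adj B)" by (rule posm_mult[OF pos])
    have SL: "A * adj B \<in> SL" using AB by simp
    have T1: "T1 > 0" unfolding T1_T3_def using AB crossing_hyperbolic(1)[OF crossing_mult_mult_adj[OF cr]]
      by (intro tau_pos) auto
    obtain N0 where N0: "\<And>z w. z \<in> uhp \<Longrightarrow> w \<in> uhp \<Longrightarrow> d z (mob (diagm l) z) \<le> max T1 T3 + 1 \<Longrightarrow>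
      d z (mob (A * adj B) z) \<le> max T1 T3 + 1 \<Longrightarrow> d w (mob (diagm l) w) \<le> max T1 T3 + 1 \<Longrightarrow>
      d w (mob (A * adj B) w) \<le> max T1 T3 + 1 \<Longrightarrow> d z w \<le> N0"
      using bounded_displacement[OF l SL posh, of "max T1 T3 + 1"] by metis
    define N where "N = max 0 N0"
    define C where "C = (N + T1 + 1) / T1 + 2"
    have "0 \<le> (N + T1 + 1) / T1" using T1 by (simp add: N_def)
    then have C: "1 \<le> C" "0 < C" unfolding C_def by linarith+
    define b where "b = min (min 1 (2 * T1)) ((tau A + tau B - max T1 T3) / C)"
    have b: "b > 0" using 3 T1 C by (simp add: b_def)
    have "tau A * tau B \<le> (T1 + e)\<^sup>2 / 4 + (T3 + C * e)\<^sup>2 / 4" if e: "e \<in> {0<..<b}" for e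
      unfolding T1_T3_def
    proof (rule crossing_inequality_approx[OF ptolemy AB cr dg l pos _ C_def[unfolded T1_T3_def]])
      have "e < (tau A + tau B - max T1 T3) / C" using e by (simp add: b_def)
      then have "C * e < tau A + tau B - max T1 T3" using C by (simp add: pos_less_divide_eq mult.commute)
      then show "tau (A * B) + C * e < tau A + tau B" "tau (A * adj B) + C * e < tau A + tau B"
        unfolding T1_T3_def by linarith+
      show "0 < e" "e \<le> 1" "e < 2 * tau (A * B)" using e by (auto simp: b_def T1_T3_def)
      show "e \<le> C * e" using C e by (simp add: mult_le_cancel_right1)
      fix z w assume a: "z \<in> uhp" "w \<in> uhp" "d z (mob (A * B) z) \<le> tau (A * B) + 1" "d z (mob (A * adj B) z) \<le> tau (A * adj B) + 1"
        "d w (mob (A * B) w) \<le> tau (A * B) + 1" "d w (mob (A * adj B) w) \<le> tau (A * adj B) + 1"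
      have "d z w \<le> N0"
        by (rule N0) (use a in \<open>simp_all add: T1_T3_def flip: dg\<close>)
      then show "d z w \<le> N" by (simp add: N_def)
    qed assumption+
    then have "eventually (\<lambda>e. tau A * tau B \<le> (T1 + e)\<^sup>2 / 4 + (T3 + C * e)\<^sup>2 / 4) (at_right 0)"
      using b by (intro eventually_at_rightI[of 0 b]) auto
    moreover have "((\<lambda>e. (T1 + e)\<^sup>2 / 4 + (T3 + C * e)\<^sup>2 / 4) \<longlongrightarrow> T1\<^sup>2 / 4 + T3\<^sup>2 / 4) (at_right 0)"
      by (auto intro!: tendsto_eq_intros)
    ultimately show ?thesis by (intro tendsto_lowerbound) auto
  qed
  then show ?thesis by (simp add: T1_T3_def)
qed

text \<open>Conjugation by \<open>N\<close> reduces the inequality to matrices in normal form.\<close>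

lemma plane_metric_mob:
  assumes N: "N \<in> SL" shows "plane_metric (\<lambda>z w. d (mob N z) (mob N w))"
proof
  fix z w :: complex and e :: real assume zw: "z \<in> uhp" "w \<in> uhp" "0 < e"
  obtain c and l :: "real \<Rightarrow> real" where c: "continuous_on {0..1} c" "c ` {0..1} \<subseteq> uhp" "c 0 = mob N z" "c 1 = mob N w"
    and l: "l 1 - l 0 < d (mob N z) (mob N w) + e" "\<forall>s t. 0 \<le> s \<longrightarrow> s \<le> t \<longrightarrow> t \<le> 1 \<longrightarrow> d (c s) (c t) \<le> l t - l s"
    using d_path[of "mob N z" "mob N w" e] zw N by auto
  have H: "c t \<in> uhp" if "0 \<le> t" "t \<le> 1" for t using c(2) that by auto
  show "\<exists>c l :: real \<Rightarrow> real. continuous_on {0..1} c \<and> c ` {0..1} \<subseteq> uhp \<and> c 0 = z \<and> c 1 = w \<and>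
        l 1 - l 0 < d (mob N z) (mob N w) + e \<and>
        (\<forall>s t. 0 \<le> s \<longrightarrow> s \<le> t \<longrightarrow> t \<le> 1 \<longrightarrow> d (mob N (c s)) (mob N (c t)) \<le> l t - l s)"
  proof (intro exI[of _ "\<lambda>t. mob (adj N) (c t)"] exI[of _ l] conjI)
    show "continuous_on {0..1} (\<lambda>t. mob (adj N) (c t))"
      by (rule continuous_on_compose2[OF continuous_on_mob[OF SL_adj[OF N] order_refl] c(1) c(2)])
    show "(\<lambda>t. mob (adj N) (c t)) ` {0..1} \<subseteq> uhp" using H N by auto
    show "\<forall>s t. 0 \<le> s \<longrightarrow> s \<le> t \<longrightarrow> t \<le> 1 \<longrightarrow> d (mob N (mob (adj N) (c s))) (mob N (mob (adj N) (c t))) \<le> l t - l s"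
      using l(2) H N by (auto simp: order_trans)
  qed (use c zw N l in auto)
next
  fix R
  obtain R' where "\<forall>z\<in>uhp. \<forall>w\<in>uhp. d z w \<le> R \<longrightarrow> hyp z w \<le> R'" using d_hyp by blast
  then show "\<exists>R'. \<forall>z\<in>uhp. \<forall>w\<in>uhp. d (mob N z) (mob N w) \<le> R \<longrightarrow> hyp z w \<le> R'"
    using N hyp_mob[OF N] mob_uhp[OF N] by metis
next
  fix K :: "complex set" assume K: "compact K" "K \<subseteq> uhp"
  then have "compact (mob N ` K)" "mob N ` K \<subseteq> uhp"
    using N by (auto intro: compact_continuous_image continuous_on_mob)
  from d_bdd[OF this] show "\<exists>b. \<forall>z\<in>K. \<forall>w\<in>K. d (mob N z) (mob N w) \<le> b" by blast
qed (use N in \<open>auto simp: d_refl d_nonneg intro: d_sym d_tri\<close>)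

lemma tau_mob:
  assumes N: "N \<in> SL" and M: "M \<in> SL"
  shows "plane_metric.tau (\<lambda>z w. d (mob N z) (mob N w)) (adj N * M * N) = tau M"
proof -
  interpret e: plane_metric "\<lambda>z w. d (mob N z) (mob N w)" by (rule plane_metric_mob[OF N])
  have eq: "mob N (mob (adj N * M * N) z) = mob M (mob N z)" if "z \<in> uhp" for z
  proof -
    have "mob N (mob (adj N * M * N) z) = mob (N * (adj N * M * N)) z" using that N M by (intro mob_mult[symmetric]) auto
    also have "N * (adj N * M * N) = M * N" using N by (simp add: mult.assoc adj_right_cancel)
    finally show ?thesis using that N M by (simp add: mob_mult)
  qed
  have "mob N ` uhp = uhp"
  proof
    show "uhp \<subseteq> mob N ` uhp"
    proof
      fix z assume "z \<in> uhp"
      then have "z = mob N (mob (adj N) z)" "mob (adj N) z \<in> uhp" using N by auto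
      then show "z \<in> mob N ` uhp" by blast
    qed
  qed (use N in auto)
  then have "(\<lambda>z. d z (mob M z)) ` uhp = (\<lambda>z. d (mob N z) (mob M (mob N z))) ` uhp"
    by (metis (no_types, lifting) image_cong image_image)
  also have "\<dots> = (\<lambda>z. d (mob N z) (mob N (mob (adj N * M * N) z))) ` uhp"
    by (rule image_cong) (simp_all add: eq)
  finally show ?thesis unfolding e.tau_def tau_def by simp
qed

lemma isom_mob:
  assumes N: "N \<in> SL" and M: "M \<in> isom"
  shows "adj N * M * N \<in> plane_metric.isom (\<lambda>z w. d (mob N z) (mob N w))"
proof -
  interpret e: plane_metric "\<lambda>z w. d (mob N z) (mob N w)" by (rule plane_metric_mob[OF N])
  have eq: "mob N (mob (adj N * M * N) z) = mob M (mob N z)" if "z \<in> uhp" for z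
  proof -
    have "mob N (mob (adj N * M * N) z) = mob (N * (adj N * M * N)) z" using that N M by (intro mob_mult[symmetric]) auto
    also have "N * (adj N * M * N) = M * N" using N by (simp add: mult.assoc adj_right_cancel)
    finally show ?thesis using that N M by (simp add: mob_mult)
  qed
  show ?thesis by (rule e.isomI) (use N M in \<open>auto simp: eq\<close>)
qed

theorem crossing_inequality:
  assumes ptolemy: "\<And>x y z w. x \<in> uhp \<Longrightarrow> y \<in> uhp \<Longrightarrow> z \<in> uhp \<Longrightarrow> w \<in> uhp \<Longrightarrow>
      d x z * d y w \<le> d x y * d z w + d x w * d y z"
    and AB: "A \<in> isom" "B \<in> isom" and cr: "crossing A B"
  shows "tau A * tau B \<le> (tau (A * B))\<^sup>2 / 4 + (tau (A * adj B))\<^sup>2 / 4"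
proof -
  obtain N l where N: "N \<in> SL" and l: "l \<noteq> 0" "l\<^sup>2 \<noteq> 1" and dg: "N * (A * B) * adj N = diagm l"
    and pos: "posm (N * A * adj N)" "posm (N * adj B * adj N)"
    using crossing_normal_form[OF cr] by metis
  define K where "K = adj N"
  have K: "K \<in> SL" using N by (simp add: K_def)
  interpret e: plane_metric "\<lambda>z w. d (mob K z) (mob K w)" by (rule plane_metric_mob[OF K])
  define A' B' where "A' = adj K * A * K" "B' = adj K * B * K"
  have e1: "A' * B' = adj K * (A * B) * K" "adj B' = adj K * adj B * K" "A' * adj B' = adj K * (A * adj B) * K"
    using K by (auto simp: A'_B'_def mult.assoc adj_mult adj_right_cancel)
  have "e.tau A' * e.tau B' \<le> (e.tau (A' * B'))\<^sup>2 / 4 + (e.tau (A' * adj B'))\<^sup>2 / 4"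
  proof (rule e.crossing_inequality_diagonal[OF _ _ _ _ _ l])
    show "A' \<in> e.isom" "B' \<in> e.isom" unfolding A'_B'_def using isom_mob[OF K] AB by auto
    show "crossing A' B'" unfolding A'_B'_def K_def using crossing_conj[OF cr N] by simp
    show "A' * B' = diagm l" unfolding e1 using dg by (simp add: K_def)
    show "posm A'" "posm (adj B')" unfolding e1 unfolding A'_B'_def using pos by (auto simp: K_def)
  qed (use ptolemy K in auto)
  moreover have "e.tau A' = tau A" "e.tau B' = tau B"
    unfolding A'_B'_def using tau_mob[OF K] AB by auto
  moreover have "e.tau (A' * B') = tau (A * B)" "e.tau (A' * adj B') = tau (A * adj B)"
    unfolding e1(1,3) using tau_mob[OF K] AB by auto
  ultimately show ?thesis by simp
qed

end

section \<open>Lengths of curves\<close>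

text \<open>The length of \<open>c\<close> on \<open>{a..b}\<close>. As a function of \<open>b\<close> it is the length function required of a path in
the half plane.\<close>

definition var :: "('s \<Rightarrow> 's \<Rightarrow> real) \<Rightarrow> (real \<Rightarrow> 's) \<Rightarrow> real \<Rightarrow> real \<Rightarrow> ennreal" where
  "var d c a b =
     (SUP (n, t) \<in> {(n :: nat, t :: nat \<Rightarrow> real). mono_on {..n} t \<and> t ` {..n} \<subseteq> {a..b}}.
        \<Sum>i<n. ennreal (d (c (t i)) (c (t (Suc i)))))"

lemma curve_length_var: "curve_length d c = var d c 0 1"
  by (simp add: curve_length_def var_def)

lemma var_upper:
  assumes "mono_on {..n} t" "t ` {..n} \<subseteq> {a..b}"
  shows "(\<Sum>i<n. ennreal (d (c (t i)) (c (t (Suc i))))) \<le> var d c a b"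
  unfolding var_def by (rule SUP_upper2[of "(n, t)"]) (use assms in auto)

lemma var_least:
  assumes "\<And>n (t :: nat \<Rightarrow> real). mono_on {..n} t \<Longrightarrow> t ` {..n} \<subseteq> {a..b} \<Longrightarrow> (\<Sum>i<n. ennreal (d (c (t i)) (c (t (Suc i))))) \<le> k"
  shows "var d c a b \<le> k"
  unfolding var_def by (rule SUP_least) (use assms in auto)

lemma dist_le_var:
  assumes "a \<le> s" "s \<le> t" "t \<le> b"
  shows "ennreal (d (c s) (c t)) \<le> var d c a b"
proof -
  let ?t = "\<lambda>i::nat. if i = 0 then s else t"
  have "mono_on {..1} ?t" using assms by (auto simp: mono_on_def)
  moreover have "?t ` {..1} \<subseteq> {a..b}" using assms by auto
  ultimately show ?thesis using var_upper[of 1 ?t a b d c] by simp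
qed

lemma var_reparametrise:
  assumes f: "mono_on {a..b} f" "f ` {a..b} \<subseteq> {a'..b'}" and c: "\<And>t. t \<in> {a..b} \<Longrightarrow> e t = c (f t)"
  shows "var d e a b \<le> var d c a' b'"
proof (rule var_least)
  fix n and t :: "nat \<Rightarrow> real" assume t: "mono_on {..n} t" "t ` {..n} \<subseteq> {a..b}"
  have t': "t i \<in> {a..b}" if "i \<le> n" for i using t(2) that by auto
  have "(\<Sum>i<n. ennreal (d (e (t i)) (e (t (Suc i))))) = (\<Sum>i<n. ennreal (d (c (f (t i))) (c (f (t (Suc i))))))"
  proof -
    have "e (t i) = c (f (t i))" if "i \<le> n" for i by (rule c[OF t'[OF that]])
    then show ?thesis by (intro sum.cong) simp_all
  qed
  also have "\<dots> \<le> var d c a' b'"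
  proof (rule var_upper[of n "\<lambda>i. f (t i)"])
    show "mono_on {..n} (\<lambda>i. f (t i))"
      using t(1) f(1) t' by (fastforce simp: mono_on_def)
    show "(\<lambda>i. f (t i)) ` {..n} \<subseteq> {a'..b'}" using f(2) t' by fastforce
  qed
  finally show "(\<Sum>i<n. ennreal (d (e (t i)) (e (t (Suc i))))) \<le> var d c a' b'" .
qed

lemma var_cong: "(\<And>t. t \<in> {a..b} \<Longrightarrow> e t = c t) \<Longrightarrow> var d e a b = var d c a b"
  by (intro antisym var_reparametrise[where f = "\<lambda>t. t"]) (auto simp: mono_on_def)

lemma var_reverse:
  assumes sym: "\<And>x y. d x y = d y x"
  shows "var d (\<lambda>t. c (1 - t)) 0 1 \<le> var d c 0 1"
proof (rule var_least)
  fix n and t :: "nat \<Rightarrow> real" assume t: "mono_on {..n} t" "t ` {..n} \<subseteq> {0..1}"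
  have "(\<Sum>i<n. ennreal (d (c (1 - t i)) (c (1 - t (Suc i)))))
      = (\<Sum>i<n. ennreal (d (c (1 - t (n - Suc i))) (c (1 - t (Suc (n - Suc i))))))"
    by (rule sum.nat_diff_reindex[symmetric])
  also have "\<dots> = (\<Sum>i<n. ennreal (d (c (1 - t (n - i))) (c (1 - t (n - Suc i)))))"
    by (rule sum.cong) (auto simp: Suc_diff_Suc sym)
  also have "\<dots> \<le> var d c 0 1"
  proof (rule var_upper[of n "\<lambda>i. 1 - t (n - i)"])
    show "mono_on {..n} (\<lambda>i. 1 - t (n - i))"
      using t(1) by (auto simp: mono_on_def)
    show "(\<lambda>i. 1 - t (n - i)) ` {..n} \<subseteq> {0..1}" using t(2) by (force simp: image_subset_iff)
  qed
  finally show "(\<Sum>i<n. ennreal (d (c (1 - t i)) (c (1 - t (Suc i))))) \<le> var d c 0 1" .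
qed

lemma var_superadditive:
  assumes m: "a \<le> m" "m \<le> b" shows "var d c a m + var d c m b \<le> var d c a b"
proof -
  let ?P = "\<lambda>a b. {(n :: nat, t :: nat \<Rightarrow> real). mono_on {..n} t \<and> t ` {..n} \<subseteq> {a..b}}"
  let ?s = "\<lambda>(n, t). \<Sum>i<n. ennreal (d (c (t i)) (c (t (Suc i))))"
  have ne: "?P a b \<noteq> {}" if "a \<le> b" for a b :: real
  proof -
    have "(0, \<lambda>i. a) \<in> ?P a b" using that by (auto simp: mono_on_def)
    then show ?thesis by blast
  qed
  have "?s x + ?s y \<le> var d c a b" if xy: "x \<in> ?P a m" "y \<in> ?P m b" for x y
  proof -
    obtain n t where x: "x = (n, t)" by (cases x)
    obtain k u where y: "y = (k, u)" by (cases y)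
    have t: "mono_on {..n} t" "t ` {..n} \<subseteq> {a..m}" and u: "mono_on {..k} u" "u ` {..k} \<subseteq> {m..b}"
      using xy by (auto simp: x y)
    define w where "w i = (if i \<le> n then t i else u (i - Suc n))" for i
    define f where "f i = ennreal (d (c (w i)) (c (w (Suc i))))" for i
    have "?s x = (\<Sum>i<n. f i)" by (simp add: x f_def w_def)
    moreover have "?s y = (\<Sum>i<k. f (Suc n + i))" by (simp add: y f_def w_def)
    moreover have "(\<Sum>i<k. f (Suc n + i)) = sum f {Suc n..<Suc n + k}"
      by (rule sum.reindex_bij_witness[of _ "\<lambda>i. i - Suc n" "\<lambda>i. Suc n + i"]) auto
    moreover have "(\<Sum>i<n. f i) + sum f {Suc n..<Suc n + k} = sum f ({..<n} \<union> {Suc n..<Suc n + k})"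
      by (rule sum.union_disjoint[symmetric]) auto
    moreover have "\<dots> \<le> sum f {..<Suc n + k}" by (rule sum_mono2) auto
    moreover have "sum f {..<Suc n + k} \<le> var d c a b"
      unfolding f_def
    proof (rule var_upper)
      have tw: "t i \<in> {a..m}" if "i \<le> n" for i using t(2) that by auto
      have uw: "u i \<in> {m..b}" if "i \<le> k" for i using u(2) that by auto
      show "w ` {..Suc n + k} \<subseteq> {a..b}"
      proof
        fix r assume "r \<in> w ` {..Suc n + k}"
        then obtain i where "i \<le> Suc n + k" "r = w i" by auto
        then show "r \<in> {a..b}"
        proof (cases "i \<le> n")
          case False
          have "i - Suc n \<le> k" using \<open>i \<le> Suc n + k\<close> by linarith
          then show ?thesis using uw[of "i - Suc n"] False \<open>r = w i\<close> m by (simp add: w_def)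
        qed (use tw[of i] m in \<open>simp add: w_def\<close>)
      qed
      show "mono_on {..Suc n + k} w"
      proof (rule mono_onI)
        fix i j assume ij: "i \<in> {..Suc n + k}" "j \<in> {..Suc n + k}" "i \<le> j"
        consider "j \<le> n" | "i \<le> n" "n < j" | "n < i" by linarith
        then show "w i \<le> w j"
        proof cases
          case 1 then show ?thesis using t(1) ij by (auto simp: w_def mono_on_def)
        next
          case 2
          then have "w i \<le> m" "m \<le> w j" using tw[of i] uw[of "j - Suc n"] ij by (auto simp: w_def)
          then show ?thesis by simp
        next
          case 3
          then have "u (i - Suc n) \<le> u (j - Suc n)" using ij by (intro mono_onD[OF u(1)]) auto
          then show ?thesis using 3 ij by (simp add: w_def)
        qed
      qed
    qed
    ultimately show ?thesis by simp
  qed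
  then have "?s x + var d c m b \<le> var d c a b" if "x \<in> ?P a m" for x
    unfolding var_def[of d c m b] using ne[OF m(2)] that
    by (subst ennreal_SUP_add_right) (auto intro!: SUP_least)
  then show ?thesis
    unfolding var_def[of d c a m] using ne[OF m(1)]
    by (subst ennreal_SUP_add_left[symmetric]) (auto intro!: SUP_least)
qed

lemma var_subadditive:
  assumes nn: "\<And>x y. 0 \<le> d x y" and tri: "\<And>x y z. x \<in> S \<Longrightarrow> y \<in> S \<Longrightarrow> z \<in> S \<Longrightarrow> d x z \<le> d x y + d y z"
    and c: "c ` {a..b} \<subseteq> S" and m: "a \<le> m" "m \<le> b"
  shows "var d c a b \<le> var d c a m + var d c m b"
proof (rule var_least)
  fix n and t :: "nat \<Rightarrow> real" assume t: "mono_on {..n} t" "t ` {..n} \<subseteq> {a..b}"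
  have t': "t i \<in> {a..b}" if "i \<le> n" for i using t(2) that by auto
  have cS: "c s \<in> S" if "s \<in> {a..b}" for s using c that by auto
  have mn: "t i \<le> t (Suc i)" if "i < n" for i using t(1) that by (auto simp: mono_on_def)
  let ?u = "\<lambda>i. min (t i) m" and ?v = "\<lambda>i. max (t i) m"
  have le: "ennreal (d (c (t i)) (c (t (Suc i)))) \<le>
      ennreal (d (c (?u i)) (c (?u (Suc i)))) + ennreal (d (c (?v i)) (c (?v (Suc i))))" if i: "i < n" for i
  proof -
    have I: "t i \<in> {a..b}" "t (Suc i) \<in> {a..b}" "m \<in> {a..b}" using t' i m by auto
    consider "t (Suc i) \<le> m" | "m \<le> t i" | "t i \<le> m" "m \<le> t (Suc i)" by linarith
    then have "d (c (t i)) (c (t (Suc i))) \<le> d (c (?u i)) (c (?u (Suc i))) + d (c (?v i)) (c (?v (Suc i)))"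
    proof cases
      case 1 then have "t i \<le> m" using mn[OF i] by simp
      then show ?thesis using 1 nn by (simp add: min_def)
    next
      case 2 then have "m \<le> t (Suc i)" using mn[OF i] by simp
      then show ?thesis using 2 nn by (simp add: max_def)
    next
      case 3
      then show ?thesis using tri[OF cS[OF I(1)] cS[OF I(3)] cS[OF I(2)]] nn[of "c m" "c m"] by (simp add: min_def max_def)
    qed
    then show ?thesis using nn by (simp add: ennreal_leI flip: ennreal_plus)
  qed
  have "(\<Sum>i<n. ennreal (d (c (t i)) (c (t (Suc i))))) \<le>
      (\<Sum>i<n. ennreal (d (c (?u i)) (c (?u (Suc i))))) + (\<Sum>i<n. ennreal (d (c (?v i)) (c (?v (Suc i)))))"
    unfolding sum.distrib[symmetric] by (rule sum_mono) (use le in simp)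
  also have "\<dots> \<le> var d c a m + var d c m b"
  proof (rule add_mono)
    show "(\<Sum>i<n. ennreal (d (c (?u i)) (c (?u (Suc i))))) \<le> var d c a m"
    proof (rule var_upper)
      show "mono_on {..n} ?u" by (intro mono_onI min.mono mono_onD[OF t(1)]) auto
      show "?u ` {..n} \<subseteq> {a..m}" using t' m by auto
    qed
    show "(\<Sum>i<n. ennreal (d (c (?v i)) (c (?v (Suc i))))) \<le> var d c m b"
    proof (rule var_upper)
      show "mono_on {..n} ?v" by (intro mono_onI max.mono mono_onD[OF t(1)]) auto
      show "?v ` {..n} \<subseteq> {m..b}" using t' m by auto
    qed
  qed
  finally show "(\<Sum>i<n. ennreal (d (c (t i)) (c (t (Suc i))))) \<le> var d c a m + var d c m b" .
qed

lemma less_add_ennreal: "u \<noteq> \<infinity> \<Longrightarrow> 0 < r \<Longrightarrow> u < u + ennreal r"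
  by (cases u) (auto simp: ennreal_less_iff simp flip: ennreal_plus)

section \<open>Length metrics on a covering space\<close>

locale length_cover =
  fixes E :: "'e::topological_space set" and p :: "'e \<Rightarrow> 's::topological_space" and S :: "'s set"
    and d :: "'s \<Rightarrow> 's \<Rightarrow> real"
  assumes cover: "covering_space E p S" and length_metric: "length_metric_on S d"
begin

sublocale S: Metric_space S d
  using length_metric by (simp add: length_metric_on_def)

lemma openin_S: "openin (top_of_set S) U \<longleftrightarrow> U \<subseteq> S \<and> (\<forall>x\<in>U. \<exists>r>0. \<forall>y\<in>S. d x y < r \<longrightarrow> y \<in> U)"
proof -
  have "openin (top_of_set S) U \<longleftrightarrow> openin S.mtopology U"
    using length_metric by (simp add: length_metric_on_def)
  also have "\<dots> \<longleftrightarrow> U \<subseteq> S \<and> (\<forall>x\<in>U. \<exists>r>0. S.mball x r \<subseteq> U)"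
    unfolding S.openin_mtopology by blast
  also have "\<dots> \<longleftrightarrow> U \<subseteq> S \<and> (\<forall>x\<in>U. \<exists>r>0. \<forall>y\<in>S. d x y < r \<longrightarrow> y \<in> U)"
  proof -
    have "S.mball x r \<subseteq> U \<longleftrightarrow> (\<forall>y\<in>S. d x y < r \<longrightarrow> y \<in> U)" if "x \<in> U" "U \<subseteq> S" for x r
      using that unfolding subset_iff S.in_mball by blast
    then show ?thesis by (intro conj_cong refl ball_cong ex_cong1) simp
  qed
  finally show ?thesis .
qed

lemma p_cont: "continuous_on E p" and p_S: "x \<in> E \<Longrightarrow> p x \<in> S"
  using cover by (auto simp: covering_space_def)

lemma openin_ball: "x \<in> S \<Longrightarrow> openin (top_of_set S) {y \<in> S. d x y < r}"
proof -
  assume x: "x \<in> S"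
  have "openin (top_of_set S) (S.mball x r)"
    using length_metric S.openin_mball[of x r] by (simp add: length_metric_on_def)
  moreover have "S.mball x r = {y \<in> S. d x y < r}" using x by auto
  ultimately show ?thesis by simp
qed

definition evenly :: "'s set \<Rightarrow> bool" where
  "evenly T \<longleftrightarrow> openin (top_of_set S) T \<and> (\<exists>v. \<Union>v = E \<inter> p -` T \<and> (\<forall>u\<in>v. openin (top_of_set E) u) \<and>
     pairwise disjnt v \<and> (\<forall>u\<in>v. \<exists>q. homeomorphism u T p q))"

lemma evenly_exists: "s \<in> S \<Longrightarrow> \<exists>T. s \<in> T \<and> evenly T"
  using cover unfolding covering_space_def evenly_def by meson

text \<open>The last condition makes it possible to work with single sheets: paths over \<open>T\<close> cannot leave \<open>V\<close>.\<close>

definition sheet :: "'e set \<Rightarrow> 's set \<Rightarrow> ('s \<Rightarrow> 'e) \<Rightarrow> bool" where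
  "sheet V T q \<longleftrightarrow> openin (top_of_set S) T \<and> openin (top_of_set E) V \<and> homeomorphism V T p q \<and>
     (\<forall>C. connected C \<and> C \<subseteq> E \<and> p ` C \<subseteq> T \<and> C \<inter> V \<noteq> {} \<longrightarrow> C \<subseteq> V)"

lemma evenly_sheet:
  assumes T: "evenly T" and x: "x \<in> E" "p x \<in> T"
  shows "\<exists>V q. x \<in> V \<and> sheet V T q"
proof -
  obtain v where v: "\<Union>v = E \<inter> p -` T" "\<And>u. u \<in> v \<Longrightarrow> openin (top_of_set E) u" "pairwise disjnt v"
      "\<And>u. u \<in> v \<Longrightarrow> \<exists>q. homeomorphism u T p q" and oT: "openin (top_of_set S) T"
    using T unfolding evenly_def by metis
  have "x \<in> \<Union>v" using v(1) x by auto
  then obtain V where V: "V \<in> v" "x \<in> V" by blast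
  obtain q where q: "homeomorphism V T p q" using v(4)[OF V(1)] by blast
  have "C \<subseteq> V" if C: "connected C" "C \<subseteq> E" "p ` C \<subseteq> T" "C \<inter> V \<noteq> {}" for C
  proof -
    define W where "W = \<Union>(v - {V})"
    have "openin (top_of_set E) W" unfolding W_def using v(2) by blast
    then obtain W' where W': "open W'" "W = E \<inter> W'" by (auto simp: openin_open)
    obtain V' where V': "open V'" "V = E \<inter> V'" using v(2)[OF V(1)] by (auto simp: openin_open)
    have "V \<inter> W = {}" using v(3) V(1) unfolding W_def pairwise_def disjnt_def by blast
    then have "V' \<inter> W' \<inter> C = {}" using C(2) W' V' by blast
    moreover have "C \<subseteq> V \<union> W"
    proof -
      have "C \<subseteq> \<Union>v" using C v(1) by auto
      then show ?thesis using V unfolding W_def by blast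
    qed
    then have "C \<subseteq> V' \<union> W'" using W' V' by blast
    ultimately have "V' \<inter> C = {} \<or> W' \<inter> C = {}" using connectedD[OF C(1) V'(1) W'(1)] by blast
    then have "W' \<inter> C = {}" using C(2,4) V'(2) by blast
    then show ?thesis using \<open>C \<subseteq> V \<union> W\<close> W'(2) by blast
  qed
  then show ?thesis using V(2) v(2)[OF V(1)] q oT unfolding sheet_def by blast
qed

definition L :: "'e \<Rightarrow> 'e \<Rightarrow> ennreal" where
  "L x y = (INF c \<in> paths_between E x y. curve_length d (p \<circ> c))"

definition D :: "'e \<Rightarrow> 'e \<Rightarrow> real" where "D = pullback_metric E p d"

lemma D_eq: "D x y = enn2real (L x y)"
  by (simp add: D_def L_def pullback_metric_def)

lemma L_less:
  assumes "L x y < r" obtains c where "c \<in> paths_between E x y" "curve_length d (p \<circ> c) < r"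
  using assms by (auto simp: L_def INF_less_iff)

lemma L_le: "c \<in> paths_between E x y \<Longrightarrow> L x y \<le> curve_length d (p \<circ> c)"
  unfolding L_def by (rule INF_lower)

lemma paths_betweenD:
  assumes "c \<in> paths_between E x y"
  shows "continuous_on {0..1} c" "\<And>t. t \<in> {0..1} \<Longrightarrow> c t \<in> E" "c 0 = x" "c 1 = y"
  using assms by (auto simp: paths_between_def path_def path_image_def pathstart_def pathfinish_def)

lemma paths_betweenI:
  assumes "continuous_on {0..1} c" "\<And>t. t \<in> {0..1} \<Longrightarrow> c t \<in> X" "c 0 = x" "c 1 = y"
  shows "c \<in> paths_between X x y"
  using assms by (auto simp: paths_between_def path_def path_image_def pathstart_def pathfinish_def)

lemma L_refl: "x \<in> E \<Longrightarrow> L x x = 0"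
proof -
  assume x: "x \<in> E"
  have "L x x \<le> curve_length d (p \<circ> (\<lambda>t. x))" using x by (intro L_le paths_betweenI) auto
  also have "\<dots> \<le> 0" unfolding curve_length_var
    by (rule var_least) (use x p_S in auto)
  finally show ?thesis by simp
qed

lemma L_sym_le: "L y x \<le> L x y"
  unfolding L_def[of x y]
proof (rule INF_greatest)
  fix c assume c: "c \<in> paths_between E x y"
  have "(\<lambda>t. c (1 - t)) \<in> paths_between E y x"
    by (intro paths_betweenI continuous_on_compose2[OF paths_betweenD(1)[OF c]])
      (auto intro!: continuous_intros simp: paths_betweenD[OF c])
  then have "L y x \<le> curve_length d (p \<circ> (\<lambda>t. c (1 - t)))" by (rule L_le)
  also have "\<dots> \<le> curve_length d (p \<circ> c)"
    using var_reverse[of d "p \<circ> c"] S.commute by (simp add: curve_length_var o_def)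
  finally show "L y x \<le> curve_length d (p \<circ> c)" .
qed

lemma L_sym: "L x y = L y x"
  by (intro antisym L_sym_le)

lemma L_tri: "L x z \<le> L x y + L y z"
proof -
  have "L x z \<le> curve_length d (p \<circ> c) + curve_length d (p \<circ> e)"
    if c: "c \<in> paths_between E x y" and e: "e \<in> paths_between E y z" for c e
  proof -
    have j: "c +++ e \<in> paths_between E x z"
      using c e by (auto simp: paths_between_def intro: path_image_join_subset[THEN subsetD] dest: subsetD)
        (use path_image_join_subset in fastforce)
    then have "L x z \<le> var d (p \<circ> (c +++ e)) 0 1" using L_le by (simp add: curve_length_var)
    also have "\<dots> \<le> var d (p \<circ> (c +++ e)) 0 (1/2) + var d (p \<circ> (c +++ e)) (1/2) 1"
      by (rule var_subadditive[of d S]) (use S.triangle paths_betweenD(2)[OF j] p_S in auto)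
    also have "var d (p \<circ> (c +++ e)) 0 (1/2) \<le> var d (p \<circ> c) 0 1"
      by (rule var_reparametrise[where f = "\<lambda>t. 2 * t"]) (auto simp: mono_on_def joinpaths_def)
    also have "var d (p \<circ> (c +++ e)) (1/2) 1 \<le> var d (p \<circ> e) 0 1"
    proof (rule var_reparametrise[where f = "\<lambda>t. 2 * t - 1"])
      fix t :: real assume "t \<in> {1/2..1}"
      then consider "t = 1/2" | "1/2 < t" by fastforce
      then show "(p \<circ> (c +++ e)) t = (p \<circ> e) (2 * t - 1)"
      proof cases
        case 1
        have "(c +++ e) (1/2) = c 1" by (simp add: joinpaths_def)
        then have "(c +++ e) t = e 0" unfolding 1 using paths_betweenD(3)[OF e] paths_betweenD(4)[OF c] by simp
        moreover have "2 * t - 1 = 0" using 1 by simp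
        ultimately show ?thesis by simp
      qed (simp add: joinpaths_def)
    qed (auto simp: mono_on_def)
    finally show ?thesis by (simp add: curve_length_var add_mono o_def)
  qed
  note le = this
  show ?thesis
  proof (cases "L x y = \<infinity> \<or> L y z = \<infinity>")
    case False
    show ?thesis
    proof (rule ennreal_le_epsilon)
      fix r :: real assume r: "0 < r"
      have "L x y < L x y + ennreal (r / 2)" "L y z < L y z + ennreal (r / 2)"
        using r False by (auto intro!: less_add_ennreal)
      then obtain c e where "c \<in> paths_between E x y" "curve_length d (p \<circ> c) < L x y + ennreal (r / 2)"
         "e \<in> paths_between E y z" "curve_length d (p \<circ> e) < L y z + ennreal (r / 2)" by (metis L_less)
      then have "L x z \<le> (L x y + ennreal (r / 2)) + (L y z + ennreal (r / 2))"
        using le[of c e] by (meson add_mono less_imp_le order_trans)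
      also have "\<dots> = L x y + L y z + (ennreal (r / 2) + ennreal (r / 2))" by (simp only: ac_simps)
      also have "ennreal (r / 2) + ennreal (r / 2) = ennreal r" using r by (simp flip: ennreal_plus)
      finally show "L x z \<le> L x y + L y z + ennreal r" .
    qed
  qed auto
qed

text \<open>Short paths in the base lift into a sheet, so that the pullback is not larger than \<open>d\<close> there. Short
paths upstairs stay in the sheet; this gives the converse.\<close>

lemma L_sheet_le:
  assumes V: "sheet V T q" "x \<in> V" and r: "\<And>y. y \<in> S \<Longrightarrow> d (p x) y < r \<Longrightarrow> y \<in> T"
    and y: "y \<in> S" "d (p x) y < r"
  shows "q y \<in> V" "p (q y) = y" "L x (q y) \<le> ennreal (d (p x) y)"
proof -
  have hom: "homeomorphism V T p q" and VE: "V \<subseteq> E" using V by (auto simp: sheet_def dest: openin_imp_subset)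
  have x: "x \<in> E" "p x \<in> S" "p x \<in> T" using V VE p_S hom by (auto simp: homeomorphism_def)
  have yT: "y \<in> T" using r y by auto
  then show qy: "q y \<in> V" "p (q y) = y" using hom by (auto simp: homeomorphism_def)
  show "L x (q y) \<le> ennreal (d (p x) y)"
  proof (rule dense_ge)
    fix k assume k: "ennreal (d (p x) y) < k"
    have "ennreal (d (p x) y) < min k (ennreal r)" using k y by (simp add: ennreal_less_iff)
    moreover have "ennreal (d (p x) y) = (INF c \<in> paths_between S (p x) y. curve_length d c)"
      using length_metric x y by (simp add: length_metric_on_def)
    ultimately have "(INF c \<in> paths_between S (p x) y. curve_length d c) < min k (ennreal r)" by metis
    then obtain c where c: "c \<in> paths_between S (p x) y" "curve_length d c < min k (ennreal r)"
      unfolding INF_less_iff by blast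
    have cc: "continuous_on {0..1} c" "\<And>t. t \<in> {0..1} \<Longrightarrow> c t \<in> S" "c 0 = p x" "c 1 = y"
      using c(1) by (auto simp: paths_between_def path_def path_image_def pathstart_def pathfinish_def)
    have cT: "c t \<in> T" if t: "t \<in> {0..1}" for t
    proof -
      have "ennreal (d (c 0) (c t)) \<le> curve_length d c"
        unfolding curve_length_var using t by (intro dist_le_var) auto
      then have "ennreal (d (p x) (c t)) < ennreal r" using c(2) cc(3) by auto
      then show ?thesis using r cc(2)[OF t] by (simp add: ennreal_less_iff)
    qed
    have "q \<circ> c \<in> paths_between E x (q y)"
    proof (rule paths_betweenI)
      show "continuous_on {0..1} (q \<circ> c)"
        using hom cc(1) cT by (intro continuous_on_compose) (auto simp: homeomorphism_def intro: continuous_on_subset)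
      show "(q \<circ> c) t \<in> E" if "t \<in> {0..1}" for t
        using hom VE cT[OF that] by (auto simp: homeomorphism_def)
      show "(q \<circ> c) 0 = x" using hom V(2) cc(3) by (auto simp: homeomorphism_def)
      show "(q \<circ> c) 1 = q y" using cc(4) by simp
    qed
    then have "L x (q y) \<le> curve_length d (p \<circ> (q \<circ> c))" by (rule L_le)
    also have "\<dots> = curve_length d c"
      unfolding curve_length_var by (rule var_cong) (use hom cT in \<open>auto simp: homeomorphism_def\<close>)
    also have "\<dots> \<le> k" using c(2) by auto
    finally show "L x (q y) \<le> k" .
  qed
qed

lemma L_ball_sheet:
  assumes V: "sheet V T q" "x \<in> V" and r: "\<And>y. y \<in> S \<Longrightarrow> d (p x) y < r \<Longrightarrow> y \<in> T"
    and y: "L x y < ennreal r"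
  shows "y \<in> V" "ennreal (d (p x) (p y)) \<le> L x y"
proof -
  obtain c where c: "c \<in> paths_between E x y" "curve_length d (p \<circ> c) < ennreal r" using L_less[OF y] .
  note cc = paths_betweenD[OF c(1)]
  have "p (c t) \<in> T" if t: "t \<in> {0..1}" for t
  proof -
    have "ennreal (d ((p \<circ> c) 0) ((p \<circ> c) t)) \<le> curve_length d (p \<circ> c)"
      unfolding curve_length_var using t by (intro dist_le_var) auto
    then have "ennreal (d (p x) (p (c t))) < ennreal r" using c(2) cc(3) by auto
    then show ?thesis using r p_S[OF cc(2)[OF t]] by (simp add: ennreal_less_iff)
  qed
  then have "p ` c ` {0..1} \<subseteq> T" by auto
  moreover have "connected (c ` {0..1})" by (intro connected_continuous_image cc) auto
  moreover have "c ` {0..1} \<subseteq> E" using cc(2) by auto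
  moreover have "x \<in> c ` {0..1} \<inter> V" using cc(3) V(2) by force
  ultimately have "c ` {0..1} \<subseteq> V" using V(1) unfolding sheet_def by blast
  then show "y \<in> V" using cc(4) by force
  show "ennreal (d (p x) (p y)) \<le> L x y"
    unfolding L_def
  proof (rule INF_greatest)
    fix c assume c: "c \<in> paths_between E x y"
    show "ennreal (d (p x) (p y)) \<le> curve_length d (p \<circ> c)"
      using dist_le_var[of 0 0 1 1 d "p \<circ> c"] paths_betweenD(3,4)[OF c] by (simp add: curve_length_var)
  qed
qed

text \<open>Together with \<open>small_neighbourhood\<close>, this says that the pullback induces the topology of \<open>E\<close>.\<close>

lemma sheet_radius:
  assumes "x \<in> E" "openin (top_of_set E) U" "x \<in> U"
  obtains r where "0 < r" "\<And>y. L x y < ennreal r \<Longrightarrow> y \<in> U"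
proof -
  obtain T where T: "p x \<in> T" "evenly T" using evenly_exists[OF p_S[OF assms(1)]] by blast
  obtain V q where V: "x \<in> V" "sheet V T q" using evenly_sheet[OF T(2) assms(1) T(1)] by blast
  have hom: "homeomorphism V T p q" and VE: "openin (top_of_set E) V" and oT: "openin (top_of_set S) T"
    using V by (auto simp: sheet_def)
  define W where "W = p ` (V \<inter> U)"
  have "openin (top_of_set V) (V \<inter> U)"
    using assms(2) VE by (metis openin_Int openin_imp_subset openin_subset_trans inf_le1)
  then have "openin (top_of_set T) W"
    unfolding W_def by (rule homeomorphism_imp_open_map[OF hom])
  then have "openin (top_of_set S) W" using oT by (meson openin_trans)
  moreover have "p x \<in> W" using V assms by (auto simp: W_def)
  ultimately obtain r where r: "r > 0" "\<And>y. y \<in> S \<Longrightarrow> d (p x) y < r \<Longrightarrow> y \<in> W" unfolding openin_S by meson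
  have WT: "W \<subseteq> T" using hom by (auto simp: W_def homeomorphism_def)
  show ?thesis
  proof (rule that[OF r(1)])
    fix y assume y: "L x y < ennreal r"
    have yV: "y \<in> V" "ennreal (d (p x) (p y)) \<le> L x y"
      using L_ball_sheet[OF V(2,1) _ y] r(2) WT by blast+
    have "y \<in> E" using yV(1) VE openin_imp_subset by blast
    moreover have "d (p x) (p y) < r" using yV(2) y by (metis S.nonneg ennreal_less_iff order_le_less_trans)
    ultimately have "p y \<in> W" using r(2) p_S by blast
    then obtain z where "z \<in> V" "z \<in> U" "p z = p y" by (auto simp: W_def)
    then show "y \<in> U" using hom yV(1) by (metis homeomorphism_def)
  qed
qed

lemma small_neighbourhood:
  assumes "x \<in> E" "0 < r"
  obtains U where "openin (top_of_set E) U" "x \<in> U" "\<And>y. y \<in> U \<Longrightarrow> L x y < ennreal r"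
proof -
  obtain T where T: "p x \<in> T" "evenly T" using evenly_exists[OF p_S[OF assms(1)]] by blast
  obtain V q where V: "x \<in> V" "sheet V T q" using evenly_sheet[OF T(2) assms(1) T(1)] by blast
  have hom: "homeomorphism V T p q" and VE: "openin (top_of_set E) V" and oT: "openin (top_of_set S) T"
    using V by (auto simp: sheet_def)
  obtain r0 where r0: "r0 > 0" "\<And>y. y \<in> S \<Longrightarrow> d (p x) y < r0 \<Longrightarrow> y \<in> T" using oT T(1) unfolding openin_S by meson
  define W where "W = {y \<in> S. d (p x) y < min r r0}"
  define U where "U = V \<inter> (E \<inter> p -` W)"
  have "openin (top_of_set S) W"
    unfolding W_def by (rule openin_ball[OF p_S[OF assms(1)]])
  then have "openin (top_of_set E) (E \<inter> p -` W)"
    by (rule continuous_openin_preimage[OF p_cont, rotated]) (use p_S in auto)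
  then have "openin (top_of_set E) U" unfolding U_def using VE by (rule openin_Int[rotated])
  moreover have "x \<in> U" using V assms r0 p_S by (auto simp: U_def W_def)
  moreover have "L x y < ennreal r" if y: "y \<in> U" for y
  proof -
    have py: "p y \<in> S" "d (p x) (p y) < r0" "d (p x) (p y) < r" and yV: "y \<in> V" using y by (auto simp: U_def W_def)
    have "q (p y) = y" using hom yV by (simp add: homeomorphism_def)
    then have "L x y \<le> ennreal (d (p x) (p y))"
      using L_sheet_le(3)[OF V(2,1) r0(2) py(1,2)] by simp
    also have "\<dots> < ennreal r" using py(3) by (simp add: ennreal_less_iff)
    finally show ?thesis .
  qed
  ultimately show ?thesis using that by blast
qed

lemma L_finite:
  assumes "connected E" "x \<in> E" "y \<in> E" shows "L x y < \<infinity>"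
proof (rule connected_induction_simple[OF assms, of "\<lambda>y. L x y < \<infinity>"])
  show "L x x < \<infinity>" using assms by (simp add: L_refl)
  fix a assume a: "a \<in> E"
  obtain U where U: "openin (top_of_set E) U" "a \<in> U" "\<And>y. y \<in> U \<Longrightarrow> L a y < ennreal 1"
    using small_neighbourhood[OF a zero_less_one] by blast
  have "L x z < \<infinity>" if "y \<in> U" "z \<in> U" "L x y < \<infinity>" for y z
  proof -
    have "L x z \<le> L x y + L y z" by (rule L_tri)
    also have "L y z \<le> L a y + L a z" using L_tri[of y z a] L_sym[of y a] by simp
    finally have "L x z \<le> L x y + (L a y + L a z)" by (simp add: add_left_mono)
    moreover have "L a y < \<infinity>" "L a z < \<infinity>"
      using order_less_trans[OF U(3)[OF that(1)] ennreal_less_top] order_less_trans[OF U(3)[OF that(2)] ennreal_less_top]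
      by simp_all
    then have "L x y + (L a y + L a z) < \<infinity>" using that(3) by simp
    ultimately show ?thesis by (rule order_le_less_trans)
  qed
  then show "\<exists>T. openin (top_of_set E) T \<and> a \<in> T \<and> (\<forall>y\<in>T. \<forall>z\<in>T. L x y < \<infinity> \<longrightarrow> L x z < \<infinity>)"
    using U(1,2) by blast
qed

end

locale connected_length_cover = length_cover +
  assumes connected: "connected E"
begin

lemma ennreal_D: "x \<in> E \<Longrightarrow> y \<in> E \<Longrightarrow> ennreal (D x y) = L x y"
  using L_finite[OF connected, of x y] by (simp add: D_eq)

lemma D_nonneg: "0 \<le> D x y" and D_sym: "D x y = D y x" and D_refl: "x \<in> E \<Longrightarrow> D x x = 0"
  by (simp_all add: D_eq L_refl L_sym[of x y])

lemma D_less_iff: "x \<in> E \<Longrightarrow> y \<in> E \<Longrightarrow> D x y < r \<longleftrightarrow> L x y < ennreal r"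
  by (simp add: ennreal_less_iff D_nonneg flip: ennreal_D)

lemma D_tri: "x \<in> E \<Longrightarrow> y \<in> E \<Longrightarrow> z \<in> E \<Longrightarrow> D x z \<le> D x y + D y z"
  using L_tri[of x z y] by (simp add: D_nonneg flip: ennreal_D ennreal_plus)

lemma D_path:
  assumes x: "x \<in> E" and y: "y \<in> E" and e: "0 < e"
  shows "\<exists>c l :: real \<Rightarrow> real. continuous_on {0..1} c \<and> c ` {0..1} \<subseteq> E \<and> c 0 = x \<and> c 1 = y \<and>
     l 1 - l 0 < D x y + e \<and> (\<forall>s t. 0 \<le> s \<longrightarrow> s \<le> t \<longrightarrow> t \<le> 1 \<longrightarrow> D (c s) (c t) \<le> l t - l s)"
proof -
  have "L x y < ennreal (D x y + e)" using D_less_iff[OF x y, of "D x y + e"] e by simp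
  then obtain c where c: "c \<in> paths_between E x y" "curve_length d (p \<circ> c) < ennreal (D x y + e)"
    by (rule L_less)
  note cc = paths_betweenD[OF c(1)]
  let ?v = "\<lambda>s t. var d (p \<circ> c) s t"
  define l where "l t = enn2real (?v 0 t)" for t
  have fin: "?v 0 t < \<infinity>" if "t \<in> {0..1}" for t
  proof -
    have "?v 0 t \<le> ?v 0 1" by (rule var_reparametrise[where f = "\<lambda>t. t"]) (use that in \<open>auto simp: mono_on_def\<close>)
    also have "\<dots> < \<infinity>" using c(2) unfolding curve_length_var by (metis ennreal_less_top infinity_ennreal_def order_less_trans)
    finally show ?thesis .
  qed
  have "D (c s) (c t) \<le> l t - l s" if st: "0 \<le> s" "s \<le> t" "t \<le> 1" for s t
  proof -
    let ?f = "\<lambda>u. s + u * (t - s)"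
    have f: "?f u \<in> {s..t}" if "u \<in> {0..1}" for u
      using that st mult_left_le_one_le[of "t - s" u] by auto
    have "c \<circ> ?f \<in> paths_between E (c s) (c t)"
    proof (rule paths_betweenI)
      show "continuous_on {0..1} (c \<circ> ?f)"
      proof (intro continuous_on_compose continuous_on_subset[OF cc(1)])
        show "?f ` {0..1} \<subseteq> {0..1}"
        proof
          fix v assume "v \<in> ?f ` {0..1}"
          then have "v \<in> {s..t}" using f by blast
          then show "v \<in> {0..1}" using st by simp
        qed
      qed (auto intro!: continuous_intros)
      show "(c \<circ> ?f) u \<in> E" if "u \<in> {0..1}" for u
        using cc(2)[of "?f u"] f[OF that] st by auto
    qed auto
    then have "L (c s) (c t) \<le> curve_length d (p \<circ> (c \<circ> ?f))" by (rule L_le)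
    also have "\<dots> \<le> ?v s t" unfolding curve_length_var
    proof (rule var_reparametrise[where f = ?f])
      show "mono_on {0..1} ?f" using st by (auto simp: mono_on_def mult_right_mono)
      show "?f ` {0..1} \<subseteq> {s..t}" using f by blast
    qed auto
    finally have 1: "L (c s) (c t) \<le> ?v s t" .
    have 2: "?v 0 s + ?v s t \<le> ?v 0 t" using st by (intro var_superadditive)
    have l: "ennreal (l u) = ?v 0 u" "0 \<le> l u" if "u \<in> {0..1}" for u
      unfolding l_def using fin[OF that] by auto
    have s0: "0 \<le> l s + D (c s) (c t)" using st l(2)[of s] D_nonneg by simp
    have "ennreal (l s + D (c s) (c t)) = ?v 0 s + L (c s) (c t)"
      using st l[of s] ennreal_D[OF cc(2) cc(2), of s t] by (simp add: ennreal_plus D_nonneg)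
    also have "\<dots> \<le> ?v 0 s + ?v s t" using 1 by (rule add_left_mono)
    also have "\<dots> \<le> ennreal (l t)" using 2 l[of t] st by simp
    finally have "l s + D (c s) (c t) \<le> l t" using l(2)[of t] st s0 by (subst (asm) ennreal_le_iff) auto
    then show ?thesis by simp
  qed
  moreover have "l 1 - l 0 < D x y + e"
  proof -
    have "ennreal (l 1) < ennreal (D x y + e)" using c(2) fin[of 1] by (simp add: l_def curve_length_var)
    then have "l 1 < D x y + e" by (simp add: ennreal_less_iff l_def)
    moreover have "0 \<le> l 0" by (simp add: l_def)
    ultimately show ?thesis by simp
  qed
  ultimately show ?thesis using cc by blast
qed

lemma continuous_on_D:
  assumes x: "x \<in> E" shows "continuous_on E (D x)"
  unfolding continuous_on_def
proof
  fix u assume u: "u \<in> E"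
  show "(D x \<longlongrightarrow> D x u) (at u within E)"
  proof (rule tendstoI)
    fix e :: real assume e: "0 < e"
    obtain U where U: "openin (top_of_set E) U" "u \<in> U" "\<And>y. y \<in> U \<Longrightarrow> L u y < ennreal e"
      using small_neighbourhood[OF u e] by blast
    then obtain O' where O': "open O'" "U = E \<inter> O'" by (auto simp: openin_open)
    have "dist (D x v) (D x u) < e" if "v \<in> O'" "v \<in> E" for v
    proof -
      have "D u v < e" using U(3)[of v] O' that u by (simp add: D_less_iff)
      then show ?thesis using D_tri[OF x u that(2)] D_tri[OF x that(2) u] D_sym[of u v]
        by (auto simp: dist_real_def abs_less_iff)
    qed
    then show "\<forall>\<^sub>F v in at u within E. dist (D x v) (D x u) < e"
      unfolding eventually_at_topological using O' U(2) by blast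
  qed
qed

lemma D_bounded_on_compact:
  assumes "compact K" "K \<subseteq> E" shows "\<exists>N. \<forall>x\<in>K. \<forall>y\<in>K. D x y \<le> N"
proof (cases "K = {}")
  case False
  then obtain k where k: "k \<in> K" by blast
  have "compact (D k ` K)"
    using assms k by (intro compact_continuous_image continuous_on_subset[OF continuous_on_D]) auto
  then have "bounded (D k ` K)" by (rule compact_imp_bounded)
  then obtain N where N: "\<And>x. x \<in> K \<Longrightarrow> D k x \<le> N"
    unfolding bounded_iff by (metis abs_le_D1 imageI real_norm_def)
  have "D x y \<le> 2 * N" if "x \<in> K" "y \<in> K" for x y
    using D_tri[of x k y] D_sym[of x k] N[OF that(1)] N[OF that(2)] that k assms(2) by force
  then show ?thesis by blast
qed auto

lemma D_lift_le:
  assumes g: "continuous_on E g" "g ` E \<subseteq> E" "\<And>x. x \<in> E \<Longrightarrow> p (g x) = p x"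
    and x: "x \<in> E" and y: "y \<in> E"
  shows "D (g x) (g y) \<le> D x y"
proof -
  have "L (g x) (g y) \<le> L x y"
    unfolding L_def[of x y]
  proof (rule INF_greatest)
    fix c assume c: "c \<in> paths_between E x y"
    note cc = paths_betweenD[OF c]
    have "g \<circ> c \<in> paths_between E (g x) (g y)"
      using g(2) cc by (intro paths_betweenI continuous_on_compose continuous_on_subset[OF g(1)]) auto
    then have "L (g x) (g y) \<le> curve_length d (p \<circ> (g \<circ> c))" by (rule L_le)
    also have "\<dots> = curve_length d (p \<circ> c)"
      unfolding curve_length_var by (rule var_cong) (use g(3) cc in auto)
    finally show "L (g x) (g y) \<le> curve_length d (p \<circ> c)" .
  qed
  moreover have "g x \<in> E" "g y \<in> E" using g x y by auto
  ultimately show ?thesis using x y by (simp add: D_nonneg flip: ennreal_D)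
qed

lemma D_deck:
  assumes g: "homeomorphism E E g g'" "\<And>x. x \<in> E \<Longrightarrow> p (g x) = p x"
    and x: "x \<in> E" and y: "y \<in> E"
  shows "D (g x) (g y) = D x y"
proof (rule antisym)
  have h: "continuous_on E g" "g ` E = E" "continuous_on E g'" "g' ` E = E"
     "\<And>x. x \<in> E \<Longrightarrow> g' (g x) = x" "\<And>x. x \<in> E \<Longrightarrow> g (g' x) = x"
    using g(1) by (auto simp: homeomorphism_def)
  show "D (g x) (g y) \<le> D x y" using h g x y by (intro D_lift_le) auto
  have "p (g' z) = p z" if "z \<in> E" for z
  proof -
    have "g' z \<in> E" using h(4) that by blast
    then show ?thesis using g(2)[of "g' z"] h(6)[OF that] by simp
  qed
  then have "D (g' (g x)) (g' (g y)) \<le> D (g x) (g y)" using h x y by (intro D_lift_le) auto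
  then show "D x y \<le> D (g x) (g y)" using h x y by simp
qed

end

text \<open>Around each point \<open>s\<close> of the base choose an evenly covered set that contains an \<open>h\<close>-ball and then a
\<open>\<rho>\<close>-ball inside a smaller \<open>h\<close>-ball. If \<open>p x\<close> is \<open>\<rho>\<close>-close to \<open>s\<close> and \<open>y\<close> is \<open>\<rho>\<close>-close to \<open>x\<close>, then both are in
the same sheet, on which \<open>h\<close> controls the second pullback. Finitely many \<open>s\<close> suffice.\<close>

lemma uniform_sheets:
  assumes r: "length_cover E p S \<rho>" and h: "length_cover E p S h" and S: "compact S"
  shows "\<exists>\<delta>>0. \<forall>x\<in>E. \<forall>y\<in>E. length_cover.L E p \<rho> x y < ennreal \<delta> \<longrightarrow> length_cover.L E p h x y < 1"
proof -
  interpret R: length_cover E p S \<rho> by fact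
  interpret H: length_cover E p S h by fact
  have "\<exists>\<eta>>0. \<forall>x\<in>E. \<forall>y\<in>E. \<rho> s (p x) < \<eta> \<longrightarrow> R.L x y < ennreal \<eta> \<longrightarrow> H.L x y < 1" if s: "s \<in> S" for s
  proof -
    obtain T where T: "s \<in> T" "R.evenly T" using R.evenly_exists[OF s] by blast
    then have oT: "openin (top_of_set S) T" by (simp add: R.evenly_def)
    obtain r0 where r0: "r0 > 0" "\<And>y. y \<in> S \<Longrightarrow> h s y < r0 \<Longrightarrow> y \<in> T" using oT T(1) unfolding H.openin_S by meson
    define r where "r = min (r0 / 3) (1/3)"
    have r: "0 < r" "3 * r \<le> r0" "3 * r \<le> 1" using r0(1) by (auto simp: r_def)
    have "openin (top_of_set S) {y \<in> S. h s y < r}" by (rule H.openin_ball[OF s])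
    moreover have "s \<in> {y \<in> S. h s y < r}" using s r by simp
    ultimately obtain \<eta>' where \<eta>': "\<eta>' > 0" "\<And>y. y \<in> S \<Longrightarrow> \<rho> s y < \<eta>' \<Longrightarrow> y \<in> {y \<in> S. h s y < r}"
      unfolding R.openin_S by meson
    define \<eta> where "\<eta> = \<eta>' / 2"
    have "H.L x y < 1" if x: "x \<in> E" and y: "y \<in> E" and sx: "\<rho> s (p x) < \<eta>" and xy: "R.L x y < ennreal \<eta>" for x y
    proof -
      have px: "p x \<in> S" "p y \<in> S" using R.p_S x y by auto
      have hx: "h s (p x) < r" using \<eta>'(2)[OF px(1)] sx \<eta>'(1) by (simp add: \<eta>_def)
      then have "p x \<in> T" using r0(2)[OF px(1)] r by simp
      then obtain V q where V: "x \<in> V" "R.sheet V T q" using R.evenly_sheet[OF T(2) x] by blast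
      have hom: "homeomorphism V T p q" using V by (simp add: R.sheet_def)
      have V': "H.sheet V T q" using V(2) unfolding R.sheet_def H.sheet_def .
      have near: "h s z < r" if z: "z \<in> S" "\<rho> (p x) z < \<eta>" for z
      proof -
        have "\<rho> s z < \<eta>'" using R.S.triangle[OF s px(1) z(1)] sx z(2) by (simp add: \<eta>_def)
        then show ?thesis using \<eta>'(2)[OF z(1)] by simp
      qed
      have yV: "y \<in> V" "ennreal (\<rho> (p x) (p y)) \<le> R.L x y"
        using R.L_ball_sheet[OF V(2,1) _ xy] near r0(2) r by (force)+
      then have "\<rho> (p x) (p y) < \<eta>" using xy by (metis R.S.nonneg ennreal_less_iff order_le_less_trans)
      then have "h s (p y) < r" using near px by blast
      then have hxy: "h (p x) (p y) < 2 * r"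
        using hx H.S.triangle[OF px(1) s px(2)] H.S.commute[of s "p x"] by simp
      have "z \<in> T" if "z \<in> S" "h (p x) z < 2 * r" for z
        using H.S.triangle[OF s px(1) that(1)] that hx r r0(2) by force
      from H.L_sheet_le(3)[OF V' V(1) this px(2) hxy]
      have "H.L x (q (p y)) \<le> ennreal (h (p x) (p y))" by blast
      moreover have "q (p y) = y" using hom yV(1) by (simp add: homeomorphism_def)
      moreover have "ennreal (h (p x) (p y)) < ennreal 1" using hxy r H.S.nonneg[of "p x" "p y"]
        by (intro ennreal_lessI) auto
      ultimately show ?thesis by (metis ennreal_1 order_le_less_trans)
    qed
    moreover have "\<eta> > 0" using \<eta>'(1) by (simp add: \<eta>_def)
    ultimately show ?thesis by blast
  qed
  then obtain \<eta> where \<eta>: "\<And>s. s \<in> S \<Longrightarrow> \<eta> s > (0::real)"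
      "\<And>s x y. s \<in> S \<Longrightarrow> x \<in> E \<Longrightarrow> y \<in> E \<Longrightarrow> \<rho> s (p x) < \<eta> s \<Longrightarrow> R.L x y < ennreal (\<eta> s) \<Longrightarrow> H.L x y < 1"
    by metis
  define B where "B s = {y \<in> S. \<rho> s y < \<eta> s}" for s
  have "\<forall>C. (\<forall>c\<in>C. openin (top_of_set S) c) \<and> S \<subseteq> \<Union>C \<longrightarrow> (\<exists>D\<subseteq>C. finite D \<and> S \<subseteq> \<Union>D)"
    using S by (simp add: compact_eq_openin_cover)
  moreover have "(\<forall>c\<in>B ` S. openin (top_of_set S) c) \<and> S \<subseteq> \<Union>(B ` S)"
    using R.openin_ball \<eta>(1) by (auto simp: B_def)
  ultimately obtain C where C: "C \<subseteq> B ` S" "finite C" "S \<subseteq> \<Union>C" by metis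
  then obtain F where F: "F \<subseteq> S" "finite F" "C = B ` F" using finite_subset_image[OF C(2,1)] by blast
  define \<delta> where "\<delta> = Min (insert 1 (\<eta> ` F))"
  have "\<delta> > 0" unfolding \<delta>_def using F \<eta>(1) by (subst Min_gr_iff) auto
  moreover have "H.L x y < 1" if x: "x \<in> E" and y: "y \<in> E" and l: "R.L x y < ennreal \<delta>" for x y
  proof -
    obtain s where s: "s \<in> F" "p x \<in> B s" using C(3) R.p_S[OF x] F by blast
    have "\<delta> \<le> \<eta> s" unfolding \<delta>_def using F s by (intro Min_le) auto
    then have "R.L x y < ennreal (\<eta> s)" using l by (meson ennreal_leI order_less_le_trans)
    then show ?thesis using \<eta>(2)[of s x y] s F x y by (auto simp: B_def)
  qed
  ultimately show ?thesis by blast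
qed

text \<open>A nearly minimal path for \<open>\<rho>\<close> is cut into pieces of \<open>\<rho>\<close>-displacement \<open>\<delta> / 2\<close>. The number of pieces is
bounded in terms of \<open>R\<close>, and for \<open>h\<close> each of them has displacement less than 1.\<close>

lemma comparable:
  assumes r: "connected_length_cover E p S \<rho>" and h: "connected_length_cover E p S h" and S: "compact S"
  shows "\<exists>R'. \<forall>x\<in>E. \<forall>y\<in>E. pullback_metric E p \<rho> x y \<le> R \<longrightarrow> pullback_metric E p h x y \<le> R'"
proof -
  interpret R: connected_length_cover E p S \<rho> by fact
  interpret H: connected_length_cover E p S h by fact
  obtain \<delta> where \<delta>: "\<delta> > 0" "\<And>x y. x \<in> E \<Longrightarrow> y \<in> E \<Longrightarrow> R.L x y < ennreal \<delta> \<Longrightarrow> H.L x y < 1"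
    using uniform_sheets[OF R.length_cover_axioms H.length_cover_axioms S] by blast
  have near: "H.D x y < 1" if "x \<in> E" "y \<in> E" "R.D x y < \<delta>" for x y
    using \<delta>(2)[OF that(1,2)] that H.D_less_iff[OF that(1,2), of 1] R.D_less_iff[OF that(1,2)] by simp
  have chain: "H.D x y \<le> real n" if "x \<in> E" "y \<in> E" "R.D x y < real n * (\<delta> / 2)" for n x y
    using that
  proof (induction n arbitrary: x y)
    case 0
    then show ?case using R.D_nonneg[of x y] by simp
  next
    case (Suc n)
    show ?case
    proof (cases "R.D x y < \<delta>")
      case True
      then show ?thesis using near[of x y] Suc.prems by simp
    next
      case False
      define e where "e = real (Suc n) * (\<delta> / 2) - R.D x y"
      have e: "e > 0" using Suc.prems by (simp add: e_def)
      obtain c and l :: "real \<Rightarrow> real" where c: "continuous_on {0..1} c" "c ` {0..1} \<subseteq> E" "c 0 = x" "c 1 = y"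
          "l 1 - l 0 < R.D x y + e" "\<And>s t. 0 \<le> s \<Longrightarrow> s \<le> t \<Longrightarrow> t \<le> 1 \<Longrightarrow> R.D (c s) (c t) \<le> l t - l s"
        using R.D_path[OF Suc.prems(1,2) e] by blast
      have "continuous_on {0..1} (\<lambda>t. R.D x (c t))"
        using c by (intro continuous_on_compose2[OF R.continuous_on_D[OF Suc.prems(1)]]) auto
      moreover have "R.D x (c 0) \<le> \<delta> / 2" "\<delta> / 2 \<le> R.D x (c 1)"
        using c(3,4) R.D_refl[OF Suc.prems(1)] \<delta>(1) False by auto
      ultimately obtain t where t: "0 \<le> t" "t \<le> 1" "R.D x (c t) = \<delta> / 2"
        using IVT'[of "\<lambda>t. R.D x (c t)" 0 "\<delta> / 2" 1] by auto
      have ct: "c t \<in> E" using c(2) t by auto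
      have "R.D (c t) y \<le> l 1 - l t" "\<delta> / 2 \<le> l t - l 0"
        using c(6)[of t 1] c(6)[of 0 t] t c(3,4) by auto
      then have "R.D (c t) y < real n * (\<delta> / 2)" using c(5) by (simp add: e_def algebra_simps)
      then have "H.D (c t) y \<le> real n" using Suc.IH[OF ct Suc.prems(2)] by blast
      moreover have "H.D x (c t) < 1" using near[OF Suc.prems(1) ct] t(3) \<delta>(1) by simp
      ultimately show ?thesis using H.D_tri[OF Suc.prems(1) ct Suc.prems(2)] by simp
    qed
  qed
  obtain n where n: "R / (\<delta> / 2) < real n" using reals_Archimedean2 by blast
  have "R < real n * (\<delta> / 2)" using n \<delta>(1) by (simp add: field_simps)
  then have "H.D x y \<le> real n" if "x \<in> E" "y \<in> E" "R.D x y \<le> R" for x y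
    using chain[OF that(1,2)] that(3) by fastforce
  then show ?thesis unfolding R.D_def H.D_def by blast
qed

section \<open>Covers modelled on the half plane\<close>

lemma hyp_nonneg: "z \<in> uhp \<Longrightarrow> w \<in> uhp \<Longrightarrow> 0 \<le> hyp z w"
  by (simp add: hyp_def uhp_def)

lemma hyp_zero_iff: "z \<in> uhp \<Longrightarrow> w \<in> uhp \<Longrightarrow> hyp z w = 0 \<longleftrightarrow> z = w"
  by (auto simp: hyp_def uhp_def)

lemma continuous_on_hyp: "z \<in> uhp \<Longrightarrow> continuous_on uhp (hyp z)"
  unfolding hyp_def by (intro continuous_intros) (auto simp: uhp_def)

lemma hyp_small_dist_small:
  assumes z: "z \<in> uhp" and e: "0 < e"
  shows "\<exists>k>0. \<forall>w\<in>uhp. hyp z w < k \<longrightarrow> dist w z < e"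
proof -
  have Iz: "Im z > 0" using z by (simp add: uhp_def)
  define N where "N = Im z * (Im z / e + 1)"
  have N: "N > 0" using Iz e by (simp add: N_def add_pos_pos)
  have "dist w z < e" if w: "w \<in> uhp" "hyp z w < e / N" for w
  proof (rule ccontr)
    let ?k = "cmod (z - w)"
    assume "\<not> dist w z < e"
    then have k: "e \<le> ?k" by (simp add: dist_norm norm_minus_commute)
    have Iw: "Im w > 0" using w by (simp add: uhp_def)
    have "Im w \<le> Im z + ?k" using abs_Im_le_cmod[of "z - w"] by simp
    also have "\<dots> \<le> (Im z / e + 1) * ?k"
      using mult_left_mono[OF k, of "Im z / e"] Iz e by (simp add: algebra_simps)
    finally have "Im z * Im w \<le> N * ?k" using Iz by (simp add: N_def mult.assoc)
    moreover have "?k\<^sup>2 = hyp z w * (Im z * Im w)" using Iz Iw by (simp add: hyp_def)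
    ultimately have "?k\<^sup>2 \<le> hyp z w * (N * ?k)" using hyp_nonneg[OF z w(1)] by (simp add: mult_left_mono)
    then have "?k \<le> hyp z w * N" using k e mult_le_cancel_right[of ?k ?k "hyp z w * N"] by (auto simp: power2_eq_square mult.assoc[symmetric])
    also have "\<dots> < e" using w(2) N by (simp add: field_simps)
    finally show False using k by simp
  qed
  then show ?thesis using e N by (intro exI[of _ "e / N"]) auto
qed

text \<open>An isometry of \<open>E\<close> with the hyperbolic plane, expressed by \<open>hyp\<close>.\<close>

locale hyperbolic_cover = length_cover E p S h for E p S h +
  fixes \<psi> :: "'a \<Rightarrow> complex"
  assumes bij: "bij_betw \<psi> E uhp"
    and hyp_\<psi>: "x \<in> E \<Longrightarrow> y \<in> E \<Longrightarrow> hyp (\<psi> x) (\<psi> y) = 2 * (cosh (D x y) - 1)"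
begin

lemma \<psi>_uhp [simp]: "x \<in> E \<Longrightarrow> \<psi> x \<in> uhp"
  using bij by (auto simp: bij_betw_def)

text \<open>If there were no path, then \<open>D x y\<close> would have the default value \<open>0\<close>, and \<open>\<psi>\<close> would identify the
two points. So connectedness of \<open>E\<close> is a consequence of the isometry.\<close>

lemma joined:
  assumes x: "x \<in> E" and y: "y \<in> E" shows "L x y < \<infinity>"
proof (rule ccontr)
  assume "\<not> L x y < \<infinity>"
  then have inf: "L x y = \<infinity>" by (simp add: less_top[symmetric])
  then have "hyp (\<psi> x) (\<psi> y) = 0" using hyp_\<psi>[OF x y] by (simp add: D_eq)
  then have "x = y" using hyp_zero_iff[of "\<psi> x" "\<psi> y"] x y bij by (auto simp: bij_betw_def inj_on_def)
  then show False using inf L_refl[OF x] by simp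
qed

lemma connected: "connected E"
  unfolding connected_iff_connected_component
proof (intro ballI)
  fix x y assume xy: "x \<in> E" "y \<in> E"
  obtain c where c: "c \<in> paths_between E x y" using joined[OF xy] by (rule L_less)
  note cc = paths_betweenD[OF c]
  have "connected (c ` {0..1})" by (intro connected_continuous_image cc) auto
  moreover have "c ` {0..1} \<subseteq> E" using cc(2) by auto
  moreover have "x \<in> c ` {0..1}" "y \<in> c ` {0..1}" using cc(3,4) by force+
  ultimately show "connected_component E x y" by (rule connected_componentI)
qed

sublocale connected_length_cover E p S h
  by unfold_locales (rule connected)

lemma D_less_hyp: "x \<in> E \<Longrightarrow> y \<in> E \<Longrightarrow> 0 \<le> r \<Longrightarrow> D x y < r \<longleftrightarrow> hyp (\<psi> x) (\<psi> y) < 2 * (cosh r - 1)"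
  by (simp add: hyp_\<psi> D_nonneg cosh_real_nonneg_less_iff)

lemma continuous_\<psi>: "continuous_on E \<psi>"
  unfolding continuous_on_def
proof
  fix x assume x: "x \<in> E"
  show "(\<psi> \<longlongrightarrow> \<psi> x) (at x within E)"
  proof (rule tendstoI)
    fix e :: real assume e: "0 < e"
    obtain k where k: "k > 0" "\<And>w. w \<in> uhp \<Longrightarrow> hyp (\<psi> x) w < k \<Longrightarrow> dist w (\<psi> x) < e"
      using hyp_small_dist_small[OF \<psi>_uhp[OF x] e] by blast
    define r where "r = arcosh (1 + k / 2)"
    have r: "0 < r" "cosh r = 1 + k / 2" using k(1) by (auto simp: r_def)
    obtain U where U: "openin (top_of_set E) U" "x \<in> U" "\<And>y. y \<in> U \<Longrightarrow> L x y < ennreal r"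
      using small_neighbourhood[OF x r(1)] by blast
    then obtain O' where O': "open O'" "U = E \<inter> O'" by (auto simp: openin_open)
    have "dist (\<psi> y) (\<psi> x) < e" if "y \<in> O'" "y \<in> E" for y
    proof -
      have "D x y < r" using U(3)[of y] O' that x by (simp add: D_less_iff)
      then show ?thesis using k(2)[of "\<psi> y"] D_less_hyp[of x y r] r that x by simp
    qed
    then show "\<forall>\<^sub>F y in at x within E. dist (\<psi> y) (\<psi> x) < e"
      unfolding eventually_at_topological using O' U(2) by blast
  qed
qed

definition \<psi>' :: "complex \<Rightarrow> 'a" where "\<psi>' = inv_into E \<psi>"

lemma \<psi>'_E [simp]: "z \<in> uhp \<Longrightarrow> \<psi>' z \<in> E" and \<psi>\<psi>' [simp]: "z \<in> uhp \<Longrightarrow> \<psi> (\<psi>' z) = z"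
  and \<psi>'\<psi> [simp]: "x \<in> E \<Longrightarrow> \<psi>' (\<psi> x) = x"
  using bij unfolding \<psi>'_def by (auto simp: bij_betw_inv_into_left bij_betw_inv_into_right bij_betw_apply[OF bij_betw_inv_into])

lemma continuous_\<psi>': "continuous_on uhp \<psi>'"
  unfolding continuous_on_def
proof
  fix z assume z: "z \<in> uhp"
  show "(\<psi>' \<longlongrightarrow> \<psi>' z) (at z within uhp)"
  proof (rule topological_tendstoI)
    fix O' assume O': "open O'" "\<psi>' z \<in> O'"
    have "openin (top_of_set E) (E \<inter> O')" "\<psi>' z \<in> E \<inter> O'" using O' z by auto
    then obtain r where r: "0 < r" "\<And>y. L (\<psi>' z) y < ennreal r \<Longrightarrow> y \<in> E \<inter> O'"
      using sheet_radius[OF \<psi>'_E[OF z]] by blast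
    have "0 < 2 * (cosh r - 1)" using r(1) cosh_real_nonneg_less_iff[of 0 r] by simp
    moreover have "(hyp z \<longlongrightarrow> hyp z z) (at z within uhp)"
      using continuous_on_hyp[OF z] z by (simp add: continuous_on_def)
    ultimately have "\<forall>\<^sub>F w in at z within uhp. hyp z w < 2 * (cosh r - 1)"
      by (intro order_tendstoD(2)[of "hyp z" "hyp z z"]) (auto simp: hyp_def)
    moreover have "\<forall>\<^sub>F w in at z within uhp. w \<in> uhp" by (auto simp: eventually_at_filter)
    ultimately show "\<forall>\<^sub>F w in at z within uhp. \<psi>' w \<in> O'"
    proof eventually_elim
      case (elim w)
      then have "D (\<psi>' z) (\<psi>' w) < r" using D_less_hyp[of "\<psi>' z" "\<psi>' w" r] z r(1) by simp
      then show ?case using r(2)[of "\<psi>' w"] D_less_iff[of "\<psi>' z" "\<psi>' w" r] z elim by simp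
    qed
  qed
qed

lemma plane_metric_pullback:
  assumes \<rho>: "length_metric_on S \<rho>" and S: "compact S"
  shows "plane_metric (\<lambda>z w. pullback_metric E p \<rho> (\<psi>' z) (\<psi>' w))"
proof -
  interpret R: connected_length_cover E p S \<rho>
    by unfold_locales (use cover \<rho> connected in auto)
  have R: "R.D = pullback_metric E p \<rho>" by (simp add: R.D_def)
  show ?thesis
    unfolding R[symmetric]
  proof
    show "R.D (\<psi>' z) (\<psi>' z) = 0" if "z \<in> uhp" for z using that by (simp add: R.D_refl)
    show "0 \<le> R.D (\<psi>' z) (\<psi>' w)" for z w by (rule R.D_nonneg)
    show "R.D (\<psi>' z) (\<psi>' w) = R.D (\<psi>' w) (\<psi>' z)" for z w by (rule R.D_sym)
    show "R.D (\<psi>' x) (\<psi>' z) \<le> R.D (\<psi>' x) (\<psi>' y) + R.D (\<psi>' y) (\<psi>' z)"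
      if "x \<in> uhp" "y \<in> uhp" "z \<in> uhp" for x y z using that by (intro R.D_tri) auto
    show "\<exists>N. \<forall>z\<in>K. \<forall>w\<in>K. R.D (\<psi>' z) (\<psi>' w) \<le> N" if "compact K" "K \<subseteq> uhp" for K
    proof -
      have "compact (\<psi>' ` K)" "\<psi>' ` K \<subseteq> E"
        using that by (auto intro!: compact_continuous_image continuous_on_subset[OF continuous_\<psi>'])
      then show ?thesis using R.D_bounded_on_compact by fast
    qed
    show "\<exists>R'. \<forall>z\<in>uhp. \<forall>w\<in>uhp. R.D (\<psi>' z) (\<psi>' w) \<le> R \<longrightarrow> hyp z w \<le> R'" for R
    proof -
      obtain R' where R': "\<And>x y. x \<in> E \<Longrightarrow> y \<in> E \<Longrightarrow> R.D x y \<le> R \<Longrightarrow> D x y \<le> R'"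
        using comparable[OF R.connected_length_cover_axioms connected_length_cover_axioms S, of R]
        unfolding R.D_def D_def by blast
      have "hyp z w \<le> 2 * (cosh R' - 1)" if "z \<in> uhp" "w \<in> uhp" "R.D (\<psi>' z) (\<psi>' w) \<le> R" for z w
      proof -
        have "D (\<psi>' z) (\<psi>' w) \<le> R'" using R' that by simp
        moreover have "0 \<le> D (\<psi>' z) (\<psi>' w)" by (rule D_nonneg)
        ultimately have "cosh (D (\<psi>' z) (\<psi>' w)) \<le> cosh R'" by (simp add: cosh_real_nonneg_le_iff)
        then show ?thesis using hyp_\<psi>[of "\<psi>' z" "\<psi>' w"] that by simp
      qed
      then show ?thesis by blast
    qed
    show "\<exists>c l :: real \<Rightarrow> real. continuous_on {0..1} c \<and> c ` {0..1} \<subseteq> uhp \<and> c 0 = z \<and> c 1 = w \<and>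
        l 1 - l 0 < R.D (\<psi>' z) (\<psi>' w) + e \<and>
        (\<forall>s t. 0 \<le> s \<longrightarrow> s \<le> t \<longrightarrow> t \<le> 1 \<longrightarrow> R.D (\<psi>' (c s)) (\<psi>' (c t)) \<le> l t - l s)"
      if zw: "z \<in> uhp" "w \<in> uhp" and e: "0 < e" for z w e
    proof -
      obtain c and l :: "real \<Rightarrow> real" where c: "continuous_on {0..1} c" "c ` {0..1} \<subseteq> E" "c 0 = \<psi>' z" "c 1 = \<psi>' w"
          "l 1 - l 0 < R.D (\<psi>' z) (\<psi>' w) + e" "\<And>s t. 0 \<le> s \<Longrightarrow> s \<le> t \<Longrightarrow> t \<le> 1 \<Longrightarrow> R.D (c s) (c t) \<le> l t - l s"
        using R.D_path[OF \<psi>'_E[OF zw(1)] \<psi>'_E[OF zw(2)] e] by blast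
      have "c t \<in> E" if "0 \<le> t" "t \<le> 1" for t using c(2) that by auto
      moreover have "continuous_on {0..1} (\<psi> \<circ> c)"
        by (intro continuous_on_compose c(1) continuous_on_subset[OF continuous_\<psi> c(2)])
      ultimately have "continuous_on {0..1} (\<psi> \<circ> c) \<and> (\<psi> \<circ> c) ` {0..1} \<subseteq> uhp \<and> (\<psi> \<circ> c) 0 = z \<and> (\<psi> \<circ> c) 1 = w \<and>
        l 1 - l 0 < R.D (\<psi>' z) (\<psi>' w) + e \<and>
        (\<forall>s t. 0 \<le> s \<longrightarrow> s \<le> t \<longrightarrow> t \<le> 1 \<longrightarrow> R.D (\<psi>' ((\<psi> \<circ> c) s)) (\<psi>' ((\<psi> \<circ> c) t)) \<le> l t - l s)"
        using c zw by auto
      then show ?thesis by blast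
    qed
  qed
qed

end

section \<open>Isometries of the half plane\<close>

text \<open>The Cayley transform turns an isometry fixing \<open>\<i>\<close> into a Euclidean isometry of the disc
  fixing its centre.\<close>

definition cayley :: "complex \<Rightarrow> complex" where "cayley z = (z - \<i>) / (z + \<i>)"

lemma plus_i_nonzero: "z \<in> uhp \<Longrightarrow> z + \<i> \<noteq> 0"
  by (auto simp: uhp_def complex_eq_iff)

lemma norm_plus_i: "(cmod (z + \<i>))\<^sup>2 = (cmod (z - \<i>))\<^sup>2 + 4 * Im z"
  unfolding cmod_power2 by (simp add: power2_eq_square algebra_simps)

lemma cayley_inj: "z \<in> uhp \<Longrightarrow> w \<in> uhp \<Longrightarrow> cayley z = cayley w \<Longrightarrow> z = w"
  using plus_i_nonzero[of z] plus_i_nonzero[of w]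
  by (simp add: cayley_def frac_eq_eq) (simp add: algebra_simps)

lemma cayley_norm: 
  assumes "z \<in> uhp" shows "(cmod (cayley z))\<^sup>2 = hyp z \<i> / (hyp z \<i> + 4)"
proof -
  have I: "Im z > 0" using assms by (simp add: uhp_def)
  have "hyp z \<i> / (hyp z \<i> + 4) = (cmod (z - \<i>))\<^sup>2 / ((cmod (z - \<i>))\<^sup>2 + 4 * Im z)"
    using I by (simp add: hyp_def field_simps)
  then show ?thesis by (simp add: cayley_def norm_divide power_divide norm_plus_i)
qed

lemma cayley_dist:
  assumes z: "z \<in> uhp" and w: "w \<in> uhp"
  shows "(cmod (cayley z - cayley w))\<^sup>2 = 4 * hyp z w / ((hyp z \<i> + 4) * (hyp w \<i> + 4))"
proof -
  have I: "Im z > 0" "Im w > 0" using assms by (simp_all add: uhp_def)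
  have n: "hyp z \<i> + 4 = (cmod (z + \<i>))\<^sup>2 / Im z" "hyp w \<i> + 4 = (cmod (w + \<i>))\<^sup>2 / Im w"
    using I norm_plus_i[of z] norm_plus_i[of w] by (simp_all add: hyp_def field_simps)
  have "cayley z - cayley w = 2 * \<i> * (z - w) / ((z + \<i>) * (w + \<i>))"
    using plus_i_nonzero[OF z] plus_i_nonzero[OF w] by (simp add: cayley_def divide_simps) (simp add: algebra_simps)
  then have "(cmod (cayley z - cayley w))\<^sup>2 = 4 * (cmod (z - w))\<^sup>2 / ((cmod (z + \<i>))\<^sup>2 * (cmod (w + \<i>))\<^sup>2)"
    by (simp add: norm_mult norm_divide power_mult_distrib power_divide)
  then show ?thesis unfolding n using I by (simp add: hyp_def)
qed

lemma cayley_minus_cnj: "z \<in> uhp \<Longrightarrow> cayley (- cnj z) = cnj (cayley z)"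
proof -
  assume z: "z \<in> uhp"
  have "cnj (cayley z) = (cnj z + \<i>) / (cnj z - \<i>)" by (simp add: cayley_def)
  also have "\<dots> = - (cnj z + \<i>) / - (cnj z - \<i>)" by (simp only: minus_divide_divide)
  also have "\<dots> = cayley (- cnj z)" by (simp add: cayley_def algebra_simps)
  finally show ?thesis by simp
qed

lemma cayley_rotation:
  assumes "cmod k = 1" and z: "z \<in> uhp"
  shows "Mat (Re k) (Im k) (- Im k) (Re k) \<in> SL" "cayley (mob (Mat (Re k) (Im k) (- Im k) (Re k)) z) = k\<^sup>2 * cayley z"
proof -
  let ?M = "Mat (Re k) (Im k) (- Im k) (Re k)"
  have k1: "(Re k)\<^sup>2 + (Im k)\<^sup>2 = 1" using assms(1) by (metis cmod_power2 one_power2)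
  then show SL: "?M \<in> SL" by (simp add: SL_def mdet_def power2_eq_square)
  let ?N = "of_real (Re k) * z + of_real (Im k)" and ?D = "- of_real (Im k) * z + of_real (Re k)"
  have D: "?D \<noteq> 0" using mob_denominator_nonzero[OF SL z] by simp
  have 1: "?N - \<i> * ?D = k * (z - \<i>)" "?N + \<i> * ?D = cnj k * (z + \<i>)"
    by (simp_all add: complex_eq_iff algebra_simps)
  have k0: "k \<noteq> 0" "cnj k \<noteq> 0" using assms(1) by auto
  have kk: "k * cnj k = 1" using assms(1) by (simp add: complex_mult_cnj k1)
  have "mob ?M z = ?N / ?D" by (simp add: mob_def)
  then have "cayley (mob ?M z) = (?N / ?D - \<i>) / (?N / ?D + \<i>)" by (simp add: cayley_def)
  also have "\<dots> = ((?N - \<i> * ?D) / ?D) / ((?N + \<i> * ?D) / ?D)" using D by (simp add: field_simps)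
  also have "\<dots> = (?N - \<i> * ?D) / (?N + \<i> * ?D)" using D by simp
  also have "\<dots> = (k / cnj k) * cayley z" unfolding 1 by (simp add: cayley_def)
  also have "k / cnj k = k\<^sup>2" using kk k0 by (simp add: field_simps power2_eq_square)
  finally show "cayley (mob ?M z) = k\<^sup>2 * cayley z" .
qed

text \<open>By polarisation \<open>k\<close> preserves inner products. Those with the real point \<open>r\<close> show that real parts are
fixed, and then imaginary parts are fixed up to a common sign.\<close>

lemma euclidean_rigid:
  assumes k: "\<And>u. u \<in> B \<Longrightarrow> cmod (k u) = cmod u" "\<And>u v. u \<in> B \<Longrightarrow> v \<in> B \<Longrightarrow> cmod (k u - k v) = cmod (u - v)"
    and r: "of_real r \<in> B" "r \<noteq> 0" "k (of_real r) = of_real r"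
  shows "(\<forall>u\<in>B. k u = u) \<or> (\<forall>u\<in>B. k u = cnj u)"
proof -
  have dot: "Re (k u) * Re (k v) + Im (k u) * Im (k v) = Re u * Re v + Im u * Im v" if "u \<in> B" "v \<in> B" for u v
  proof -
    have "(cmod (k u - k v))\<^sup>2 = (cmod (u - v))\<^sup>2" "(cmod (k u))\<^sup>2 = (cmod u)\<^sup>2" "(cmod (k v))\<^sup>2 = (cmod v)\<^sup>2"
      using k that by simp_all
    then show ?thesis unfolding cmod_power2 by (simp add: power2_eq_square algebra_simps)
  qed
  have re: "Re (k u) = Re u" if "u \<in> B" for u using dot[OF that r(1)] r by simp
  have im: "Im (k u) * Im (k v) = Im u * Im v" if "u \<in> B" "v \<in> B" for u v
    using dot[OF that] re that by simp
  show ?thesis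
  proof (cases "\<exists>v\<in>B. Im v \<noteq> 0")
    case False
    then have "Im (k u) = Im u" if "u \<in> B" for u using im[OF that that] that by simp
    then show ?thesis using re by (auto simp: complex_eq_iff)
  next
    case True
    then obtain v where v: "v \<in> B" "Im v \<noteq> 0" by blast
    have "(Im (k v))\<^sup>2 = (Im v)\<^sup>2" using im[OF v(1) v(1)] by (simp add: power2_eq_square)
    then consider "Im (k v) = Im v" | "Im (k v) = - Im v" by (auto simp: power2_eq_iff)
    then show ?thesis
    proof cases
      case 1
      then have "Im (k u) = Im u" if "u \<in> B" for u using im[OF that v(1)] v(2) by simp
      then show ?thesis using re by (auto simp: complex_eq_iff)
    next
      case 2
      then have "Im (k u) = - Im u" if "u \<in> B" for u using im[OF that v(1)] v(2)
        by (metis minus_mult_minus mult_cancel_right minus_mult_commute)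
      then show ?thesis using re by (auto simp: complex_eq_iff)
    qed
  qed
qed

lemma mob_uhp': "M \<in> SL \<Longrightarrow> z \<in> uhp \<Longrightarrow> mob M (- cnj z) \<in> uhp"
  by (rule mob_uhp) (auto simp: uhp_def)

text \<open>After composition with a Moebius transformation \<open>F\<close> fixes \<open>\<i>\<close>. In the disc it is then a rotation by \<open>e\<close>,
possibly composed with complex conjugation. Since a rotation matrix with entries from \<open>\<kappa>\<close> acts on the
disc by \<open>\<kappa>\<^sup>2\<close>, a square root of \<open>e\<close> is needed.\<close>

theorem half_plane_isometry:
  assumes F: "\<And>z. z \<in> uhp \<Longrightarrow> F z \<in> uhp" and iso: "\<And>z w. z \<in> uhp \<Longrightarrow> w \<in> uhp \<Longrightarrow> hyp (F z) (F w) = hyp z w"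
  shows "\<exists>M\<in>SL. (\<forall>z\<in>uhp. F z = mob M z) \<or> (\<forall>z\<in>uhp. F z = mob M (- cnj z))"
proof -
  have i: "\<i> \<in> uhp" by (simp add: uhp_def)
  define y where "y = Im (F \<i>)"
  have y: "y > 0" using F[OF i] by (simp add: y_def uhp_def)
  define N where "N = Mat (sqrt y) (Re (F \<i>) / sqrt y) 0 (1 / sqrt y)"
  have N: "N \<in> SL" using y by (simp add: N_def SL_def mdet_def)
  have Ni: "mob N \<i> = F \<i>"
    using y by (simp add: N_def mob_def complex_eq_iff y_def[symmetric] real_sqrt_mult_self[of y, simplified])
  define G where "G z = mob (adj N) (F z)" for z
  have G: "G z \<in> uhp" if "z \<in> uhp" for z using F[OF that] N by (simp add: G_def)
  have Gi: "G \<i> = \<i>" using N i by (simp add: G_def Ni[symmetric])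
  have Giso: "hyp (G z) (G w) = hyp z w" if "z \<in> uhp" "w \<in> uhp" for z w
    using that F N iso by (simp add: G_def hyp_mob)
  have Giso': "hyp (G z) \<i> = hyp z \<i>" if "z \<in> uhp" for z using Giso[OF that i] Gi by simp
  define q :: complex where "q = 3 * \<i>"
  have q: "q \<in> uhp" "cayley q = of_real (1/2)" by (auto simp: q_def uhp_def cayley_def)
  have norm: "cmod (cayley (G z)) = cmod (cayley z)" if "z \<in> uhp" for z
  proof -
    have "(cmod (cayley (G z)))\<^sup>2 = (cmod (cayley z))\<^sup>2"
      using that G by (simp add: cayley_norm Giso')
    then show ?thesis by simp
  qed
  have dist: "cmod (cayley (G z) - cayley (G w)) = cmod (cayley z - cayley w)" if "z \<in> uhp" "w \<in> uhp" for z w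
  proof -
    have "(cmod (cayley (G z) - cayley (G w)))\<^sup>2 = (cmod (cayley z - cayley w))\<^sup>2"
      using that G by (simp add: cayley_dist Giso Giso')
    then show ?thesis by simp
  qed
  define e where "e = 2 * cayley (G q)"
  have e: "cmod e = 1" using norm[OF q(1)] q(2) by (simp add: e_def norm_mult)
  define \<kappa> where "\<kappa> = csqrt e"
  have \<kappa>: "\<kappa>\<^sup>2 = e" "cmod \<kappa> = 1" using e by (simp_all add: \<kappa>_def)
  define R where "R = Mat (Re \<kappa>) (Im \<kappa>) (- Im \<kappa>) (Re \<kappa>)"
  have R: "R \<in> SL" "\<And>z. z \<in> uhp \<Longrightarrow> cayley (mob R z) = e * cayley z"
    using cayley_rotation[OF \<kappa>(2)] i by (auto simp: R_def \<kappa>(1))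
  define k where "k u = cayley (G (inv_into uhp cayley u)) / e" for u
  have inj: "inj_on cayley uhp" using cayley_inj by (auto simp: inj_on_def)
  have kc: "k (cayley z) = cayley (G z) / e" if "z \<in> uhp" for z
    using that inj by (simp add: k_def)
  have "(\<forall>u\<in>cayley ` uhp. k u = u) \<or> (\<forall>u\<in>cayley ` uhp. k u = cnj u)"
  proof (rule euclidean_rigid[where r = "1/2"])
    show "cmod (k u) = cmod u" if "u \<in> cayley ` uhp" for u
      using that e by (auto simp: kc norm norm_divide)
    show "cmod (k u - k v) = cmod (u - v)" if "u \<in> cayley ` uhp" "v \<in> cayley ` uhp" for u v
      using that e dist by (auto simp: kc norm_divide simp flip: diff_divide_distrib)
    show "complex_of_real (1/2) \<in> cayley ` uhp" using q by (metis imageI)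
    have "cayley (G q) \<noteq> 0" using e by (auto simp: e_def)
    then have "k (cayley q) = of_real (1/2)" using kc[OF q(1)] by (simp add: e_def)
    then show "k (complex_of_real (1/2)) = complex_of_real (1/2)" by (simp only: q(2))
  qed simp
  then show ?thesis
  proof
    assume "\<forall>u\<in>cayley ` uhp. k u = u"
    then have cG: "cayley (G z) = cayley (mob R z)" if "z \<in> uhp" for z
      using that kc[OF that] R(2)[OF that] e by (auto simp: field_simps)
    have Gz: "G z = mob R z" if "z \<in> uhp" for z
      by (rule cayley_inj[OF G[OF that] mob_uhp[OF R(1) that] cG[OF that]])
    have "F z = mob (N * R) z" if "z \<in> uhp" for z
    proof -
      have "F z = mob N (G z)" using that N F by (simp add: G_def)
      then show ?thesis using Gz[OF that] N R(1) that by (simp add: mob_mult)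
    qed
    moreover have "N * R \<in> SL" using N R(1) by (rule SL_mult)
    ultimately show ?thesis by blast
  next
    assume "\<forall>u\<in>cayley ` uhp. k u = cnj u"
    then have cG: "cayley (G z) = cayley (mob R (- cnj z))" if "z \<in> uhp" for z
      using that kc[OF that] R(2)[of "- cnj z"] e by (auto simp: field_simps cayley_minus_cnj uhp_def)
    have Gz: "G z = mob R (- cnj z)" if "z \<in> uhp" for z
      by (rule cayley_inj[OF G[OF that] mob_uhp'[OF R(1) that] cG[OF that]])
    have "F z = mob (N * R) (- cnj z)" if "z \<in> uhp" for z
    proof -
      have "F z = mob N (G z)" using that N F by (simp add: G_def)
      moreover have "- cnj z \<in> uhp" using that by (simp add: uhp_def)
      ultimately show ?thesis using Gz[OF that] N R(1) by (simp add: mob_mult)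
    qed
    moreover have "N * R \<in> SL" using N R(1) by (rule SL_mult)
    ultimately show ?thesis by blast
  qed
qed

section \<open>Local degrees of maps of the plane\<close>

lemma winding_number_log:
  assumes g: "path g" and e: "\<And>t. t \<in> {0..1} \<Longrightarrow> \<gamma> t = w + exp (g t)"
  shows "winding_number \<gamma> w = (pathfinish g - pathstart g) / (2 * of_real pi * \<i>)"
proof -
  have "winding_number \<gamma> w = winding_number (\<lambda>t. \<gamma> t - w) 0" by (rule winding_number_offset)
  also have "\<dots> = winding_number (exp \<circ> g) 0" by (rule winding_number_cong) (use e in auto)
  finally show ?thesis using winding_number_compose_exp[OF g] by simp
qed

lemma path_image_circlepath_subset: "0 < r \<Longrightarrow> r < R \<Longrightarrow> path_image (circlepath z r) \<subseteq> ball z R - {z}"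
  by auto

text \<open>A map without zeros on the punctured disc, read in logarithmic coordinates, gains a fixed
  multiple of \<open>2 \<pi> \<i>\<close> under the period; this multiple is its local degree.\<close>

lemma winding_number_compose:
  fixes T :: "complex \<Rightarrow> complex"
  assumes T: "continuous_on (ball w R) T" "\<And>x. x \<in> ball w R \<Longrightarrow> x \<noteq> w \<Longrightarrow> T x \<noteq> T w"
    and \<gamma>: "path \<gamma>" "pathfinish \<gamma> = pathstart \<gamma>" "path_image \<gamma> \<subseteq> ball w R - {w}"
    and r: "0 < r" "r < R"
  shows "winding_number (T \<circ> \<gamma>) (T w) = winding_number \<gamma> w * winding_number (T \<circ> circlepath w r) (T w)"
proof -
  define H where "H = {\<zeta>. Re \<zeta> < ln R}"
  have H: "w + exp \<zeta> \<in> ball w R" "w + exp \<zeta> \<noteq> w" if "\<zeta> \<in> H" for \<zeta>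
  proof -
    have "exp (Re \<zeta>) < exp (ln R)" using that by (simp add: H_def)
    then show "w + exp \<zeta> \<in> ball w R" using r by (simp add: dist_norm)
  qed simp
  have "convex H" unfolding H_def by (rule convex_halfspace_Re_lt)
  then have "contractible H" by (rule convex_imp_contractible)
  moreover have "continuous_on H (\<lambda>\<zeta>. T (w + exp \<zeta>) - T w)"
    using H by (intro continuous_intros continuous_on_compose2[OF T(1)]) auto
  moreover have "T (w + exp \<zeta>) - T w \<noteq> 0" if "\<zeta> \<in> H" for \<zeta> using T(2) H[OF that] by simp
  ultimately obtain g where g: "continuous_on H g" "\<And>\<zeta>. \<zeta> \<in> H \<Longrightarrow> T (w + exp \<zeta>) - T w = exp (g \<zeta>)"
    using continuous_logarithm_on_contractible[of H "\<lambda>\<zeta>. T (w + exp \<zeta>) - T w"] by blast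
  have per: "\<zeta> + of_real (2 * pi) * \<i> \<in> H" if "\<zeta> \<in> H" for \<zeta> using that by (simp add: H_def)
  define h where "h \<zeta> = (g (\<zeta> + of_real (2 * pi) * \<i>) - g \<zeta>) / (2 * of_real pi * \<i>)" for \<zeta>
  have hint: "\<exists>n::int. h \<zeta> = of_int n" if "\<zeta> \<in> H" for \<zeta>
  proof -
    have "exp (g (\<zeta> + of_real (2 * pi) * \<i>)) = exp (g \<zeta>)"
      using g(2)[OF that] g(2)[OF per[OF that]] by (simp add: exp_add exp_two_pi_i mult_ac)
    then obtain n :: int where "g (\<zeta> + of_real (2 * pi) * \<i>) = g \<zeta> + (of_int (2 * n) * of_real pi) * \<i>"
      by (auto simp: exp_eq)
    then show ?thesis by (intro exI[of _ n]) (simp add: h_def field_simps)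
  qed
  have "connected H" using \<open>convex H\<close> by (rule convex_connected)
  moreover have "continuous_on H h"
    unfolding h_def by (intro continuous_intros continuous_on_compose2[OF g(1)]) (use per in auto)
  moreover have "\<exists>e>0. \<forall>y. y \<in> H \<and> h y \<noteq> h x \<longrightarrow> e \<le> norm (h y - h x)" if x: "x \<in> H" for x
  proof (intro exI[of _ 1] conjI allI impI)
    fix y assume y: "y \<in> H \<and> h y \<noteq> h x"
    obtain m n :: int where mn: "h x = of_int m" "h y = of_int n" using hint[OF x] hint[of y] y by blast
    then have "m \<noteq> n" using y by auto
    then have "1 \<le> \<bar>real_of_int (n - m)\<bar>" by linarith
    also have "\<dots> = norm (h y - h x)" unfolding mn by (metis norm_of_int of_int_diff)
    finally show "1 \<le> norm (h y - h x)" .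
  qed simp
  ultimately have "h constant_on H" by (rule continuous_discrete_range_constant)
  then obtain k0 where "\<And>\<zeta>. \<zeta> \<in> H \<Longrightarrow> h \<zeta> = k0" by (auto simp: constant_on_def)
  moreover obtain n :: int where "k0 = of_int n"
    using hint[of "of_real (ln R - 1)"] calculation[of "of_real (ln R - 1)"] by (auto simp: H_def)
  ultimately have per1: "g (\<zeta> + of_real (2 * pi) * \<i>) = g \<zeta> + of_int n * (2 * of_real pi * \<i>)" if "\<zeta> \<in> H" for \<zeta>
    using that[THEN \<open>\<And>\<zeta>. \<zeta> \<in> H \<Longrightarrow> h \<zeta> = k0\<close>] by (simp add: h_def field_simps)
  have pern: "g (\<zeta> + of_nat m * (of_real (2 * pi) * \<i>)) = g \<zeta> + of_nat m * of_int n * (2 * of_real pi * \<i>)" if "\<zeta> \<in> H" for \<zeta> m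
  proof (induction m)
    case (Suc m)
    have "\<zeta> + of_nat m * (of_real (2 * pi) * \<i>) \<in> H" using that by (simp add: H_def)
    from per1[OF this] Suc.IH show ?case by (simp add: algebra_simps)
  qed simp
  have perz: "g (\<zeta> + of_int m * (of_real (2 * pi) * \<i>)) = g \<zeta> + of_int m * of_int n * (2 * of_real pi * \<i>)" if "\<zeta> \<in> H" for \<zeta> m
  proof (cases "m \<ge> 0")
    case True
    then show ?thesis using pern[OF that, of "nat m"] by simp
  next
    case False
    have "\<zeta> + of_int m * (of_real (2 * pi) * \<i>) \<in> H" using that by (simp add: H_def)
    from pern[OF this, of "nat (- m)"] False show ?thesis by (simp add: algebra_simps)
  qed
  have key: "winding_number (T \<circ> \<gamma>) (T w) = winding_number \<gamma> w * of_int n"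
    if \<gamma>: "path \<gamma>" "pathfinish \<gamma> = pathstart \<gamma>" "path_image \<gamma> \<subseteq> ball w R - {w}" for \<gamma>
  proof -
    obtain \<zeta> where \<zeta>: "path \<zeta>" "pathfinish \<zeta> - pathstart \<zeta> = 2 * of_real pi * \<i> * winding_number \<gamma> w"
        "\<And>t. t \<in> {0..1} \<Longrightarrow> \<gamma> t = w + exp (\<zeta> t)"
      using winding_number_as_continuous_log[OF \<gamma>(1), of w] \<gamma>(3) by blast
    have \<zeta>H: "\<zeta> t \<in> H" if "t \<in> {0..1}" for t
    proof -
      have "\<gamma> t \<in> ball w R" using \<gamma>(3) that unfolding path_image_def by blast
      then have "w + exp (\<zeta> t) \<in> ball w R" using \<zeta>(3)[OF that] by simp
      then have "exp (Re (\<zeta> t)) < R" by (simp add: dist_norm)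
      then show ?thesis using r by (simp add: H_def) (metis exp_gt_zero ln_exp ln_less_cancel_iff order_less_trans)
    qed
    have "winding_number \<gamma> w \<in> \<int>" using integer_winding_number[OF \<gamma>(1,2)] \<gamma>(3) by blast
    then obtain m :: int where m: "winding_number \<gamma> w = of_int m" by (auto elim: Ints_cases)
    have "winding_number (T \<circ> \<gamma>) (T w) = (pathfinish (g \<circ> \<zeta>) - pathstart (g \<circ> \<zeta>)) / (2 * of_real pi * \<i>)"
    proof (rule winding_number_log)
      show "path (g \<circ> \<zeta>)" using \<zeta>(1) \<zeta>H by (intro path_continuous_image continuous_on_subset[OF g(1)]) (auto simp: path_image_def)
      show "(T \<circ> \<gamma>) t = T w + exp ((g \<circ> \<zeta>) t)" if "t \<in> {0..1}" for t
        using g(2)[OF \<zeta>H[OF that]] \<zeta>(3)[OF that] by (simp add: algebra_simps)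
    qed
    also have "pathfinish (g \<circ> \<zeta>) = g (\<zeta> 0 + of_int m * (of_real (2 * pi) * \<i>))"
      using \<zeta>(2) by (simp add: pathfinish_def pathstart_def m algebra_simps)
    also have "\<dots> = g (\<zeta> 0) + of_int m * of_int n * (2 * of_real pi * \<i>)" using \<zeta>H[of 0] by (intro perz) auto
    finally show ?thesis by (simp add: pathstart_def m o_def)
  qed
  have "winding_number (T \<circ> circlepath w r) (T w) = winding_number (circlepath w r) w * of_int n"
    by (rule key[OF _ _ path_image_circlepath_subset]) (use r in auto)
  then have "winding_number (T \<circ> circlepath w r) (T w) = of_int n"
    using r by (simp add: winding_number_circlepath_centre)
  then show ?thesis using key[OF \<gamma>] by simp
qed

text \<open>Independence of the radius is the special case of a circle in \<open>winding_number_compose\<close>, and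
independence of the centre follows by a homotopy. The degree is not zero since \<open>T\<close> has a local
inverse: the preimage of a small circle around \<open>T z\<close> is a loop whose image winds once.\<close>

lemma local_degree:
  fixes T :: "complex \<Rightarrow> complex"
  assumes T: "continuous_on (ball z (2 * R)) T" "inj_on T (ball z (2 * R))" and R: "0 < R"
  obtains k where "k \<noteq> 0" "\<And>w r. w \<in> ball z R \<Longrightarrow> 0 < r \<Longrightarrow> r < R \<Longrightarrow> winding_number (T \<circ> circlepath w r) (T w) = k"
proof -
  have inj: "T x \<noteq> T y" if "x \<in> ball z (2 * R)" "y \<in> ball z (2 * R)" "x \<noteq> y" for x y
    using T(2) that by (auto simp: inj_on_def)
  have z: "z \<in> ball z (2 * R)" using R by simp
  define k where "k = winding_number (T \<circ> circlepath z (R/2)) (T z)"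
  have kr: "winding_number (T \<circ> circlepath z r) (T z) = k" if r: "0 < r" "r < R" for r
  proof -
    have "winding_number (T \<circ> circlepath z r) (T z) = winding_number (circlepath z r) z * winding_number (T \<circ> circlepath z (R/2)) (T z)"
      by (rule winding_number_compose[OF T(1) inj _ _ path_image_circlepath_subset]) (use r R z in auto)
    then show ?thesis using r by (simp add: winding_number_circlepath_centre k_def)
  qed
  have "winding_number (T \<circ> circlepath w r) (T w) = k" if w: "w \<in> ball z R" and r: "0 < r" "r < R" for w r
  proof -
    define c where "c s t = z + of_real s * (w - z) + of_real r * exp (2 * of_real pi * \<i> * of_real t)" for s t :: real
    define m where "m s = z + of_real s * (w - z)" for s :: real
    define h where "h = (\<lambda>(s, t). T (c s t) - T (m s))"
    have mz: "m s \<in> ball z R" if "s \<in> {0..1}" for s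
    proof -
      have "norm (of_real s * (w - z)) \<le> 1 * norm (w - z)" unfolding norm_mult using that by (intro mult_right_mono) auto
      then show ?thesis using w by (simp add: m_def dist_norm norm_minus_commute)
    qed
    have cm: "norm (c s t - m s) = r" for s t using r by (simp add: c_def m_def norm_mult)
    have cB: "c s t \<in> ball z (2 * R)" and mB: "m s \<in> ball z (2 * R)" and ne: "c s t \<noteq> m s" if "s \<in> {0..1}" for s t
    proof -
      have "dist z (c s t) \<le> dist z (m s) + dist (m s) (c s t)" by (rule dist_triangle)
      also have "dist (m s) (c s t) = r" using cm[of s t] by (simp add: dist_norm norm_minus_commute)
      finally show "c s t \<in> ball z (2 * R)" using mz[OF that] r by simp
      show "m s \<in> ball z (2 * R)" using mz[OF that] R by simp
      show "c s t \<noteq> m s" using cm[of s t] r by auto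
    qed
    have "homotopic_loops (- {0}) (\<lambda>t. T (c 0 t) - T (m 0)) (\<lambda>t. T (c 1 t) - T (m 1))"
      unfolding homotopic_loops
    proof (intro exI[of _ h] conjI ballI)
      show "continuous_on ({0..1} \<times> {0..1}) h"
        unfolding h_def split_beta
      proof (intro continuous_intros continuous_on_compose2[OF T(1)])
        show "continuous_on ({0..1} \<times> {0..1}) (\<lambda>x. c (fst x) (snd x))"
          unfolding c_def by (intro continuous_intros)
        show "continuous_on ({0..1} \<times> {0..1}) (\<lambda>x::real \<times> real. m (fst x))"
          unfolding m_def by (intro continuous_intros)
      qed (use cB mB in auto)
      show "h \<in> {0..1} \<times> {0..1} \<rightarrow> - {0}"
        using inj cB mB ne by (auto simp: h_def)
      show "pathfinish (h \<circ> Pair s) = pathstart (h \<circ> Pair s)" for s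
        by (simp add: h_def c_def pathfinish_def pathstart_def exp_two_pi_i)
    qed (auto simp: h_def)
    then have "winding_number (\<lambda>t. T (c 0 t) - T (m 0)) 0 = winding_number (\<lambda>t. T (c 1 t) - T (m 1)) 0"
      by (rule winding_number_homotopic_loops)
    moreover have "winding_number (T \<circ> circlepath z r) (T z) = winding_number (\<lambda>t. T (c 0 t) - T (m 0)) 0"
      by (subst winding_number_offset) (simp add: c_def m_def circlepath)
    moreover have "winding_number (T \<circ> circlepath w r) (T w) = winding_number (\<lambda>t. T (c 1 t) - T (m 1)) 0"
      by (subst winding_number_offset) (simp add: c_def m_def circlepath)
    ultimately show ?thesis using kr[OF r] by simp
  qed
  moreover have "k \<noteq> 0"
  proof
    assume k0: "k = 0"
    let ?B = "ball z (2 * R)"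
    obtain g where g: "homeomorphism ?B (T ` ?B) T g"
      using invariance_of_domain_homeomorphism[OF open_ball T(1) _ T(2)] by auto
    have "open (T ` ?B)" by (rule invariance_of_domain[OF T(1) open_ball T(2)])
    then obtain e where e: "e > 0" "cball (T z) e \<subseteq> T ` ?B" using z by (meson imageI open_contains_cball)
    have se: "sphere (T z) e \<subseteq> T ` ?B" using e(2) by auto
    let ?\<gamma> = "g \<circ> circlepath (T z) e"
    have gc: "continuous_on (T ` ?B) g" and gT: "\<And>x. x \<in> ?B \<Longrightarrow> g (T x) = x" and Tg: "\<And>y. y \<in> T ` ?B \<Longrightarrow> T (g y) = y"
      and gim: "g ` T ` ?B = ?B"
      using g by (auto simp: homeomorphism_def)
    have path: "path ?\<gamma>" "pathfinish ?\<gamma> = pathstart ?\<gamma>"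
      using e(1) se by (auto intro!: path_continuous_image continuous_on_subset[OF gc] simp: pathfinish_compose pathstart_compose)
    have im: "path_image ?\<gamma> \<subseteq> ?B - {z}"
    proof
      fix x assume "x \<in> path_image ?\<gamma>"
      then obtain y where y: "y \<in> sphere (T z) e" "x = g y" using e(1) by (auto simp: path_image_compose)
      have "y \<in> T ` ?B" using y se by blast
      then have "x \<in> ?B" "T x = y" using y gim Tg by auto
      moreover have "y \<noteq> T z" using y(1) e(1) by auto
      ultimately show "x \<in> ?B - {z}" by auto
    qed
    have "winding_number (T \<circ> ?\<gamma>) (T z) = winding_number ?\<gamma> z * winding_number (T \<circ> circlepath z (R/2)) (T z)"
      by (rule winding_number_compose[OF T(1) inj path im]) (use R z in auto)
    moreover have "winding_number (T \<circ> ?\<gamma>) (T z) = winding_number (circlepath (T z) e) (T z)"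
    proof (rule winding_number_cong)
      fix t :: real assume "0 \<le> t" "t \<le> 1"
      then have "circlepath (T z) e t \<in> path_image (circlepath (T z) e)" by (auto simp: path_image_def)
      then have "circlepath (T z) e t \<in> T ` ?B" using se e(1) by auto
      then show "(T \<circ> ?\<gamma>) t = circlepath (T z) e t" using Tg by simp
    qed
    ultimately show False using k0 e(1) by (simp add: winding_number_circlepath_centre k_def)
  qed
  ultimately show ?thesis using that by blast
qed

text \<open>The difference of the values at \<open>u\<close> and \<open>z\<close> is \<open>- cnj (u - z)\<close> divided by two factors that have
continuous logarithms on the half plane and do not contribute. The conjugate circle winds once in the
negative direction.\<close>

lemma anti_mob_degree:
  assumes M: "M \<in> SL" and z: "z \<in> uhp" and r: "0 < r" "cball z r \<subseteq> uhp"
  shows "winding_number ((\<lambda>u. mob M (- cnj u)) \<circ> circlepath z r) (mob M (- cnj z)) = -1"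
proof -
  let ?j = "\<lambda>u. of_real (m21 M) * u + of_real (m22 M) :: complex"
  have "convex uhp" unfolding uhp_def by (rule convex_halfspace_Im_gt)
  moreover have "continuous_on uhp ?j" by (intro continuous_intros)
  ultimately obtain g where g: "continuous_on uhp g" "\<And>u. u \<in> uhp \<Longrightarrow> ?j u = exp (g u)"
    using continuous_logarithm_on_contractible[of uhp ?j] mob_denominator_nonzero[OF M] convex_imp_contractible by metis
  define v where "v t = - cnj (circlepath z r t)" for t
  have v: "v t \<in> uhp" if "t \<in> {0..1}" for t
  proof -
    have "circlepath z r t \<in> path_image (circlepath z r)" using that by (auto simp: path_image_def)
    then have "circlepath z r t \<in> uhp" using r by auto
    then show ?thesis by (simp add: v_def uhp_def)
  qed
  have z': "- cnj z \<in> uhp" using z by (simp add: uhp_def)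
  define l where "l t = of_real pi * \<i> + of_real (ln r) - 2 * of_real pi * \<i> * of_real t - g (v t) - g (- cnj z)" for t
  have "winding_number ((\<lambda>u. mob M (- cnj u)) \<circ> circlepath z r) (mob M (- cnj z)) = (pathfinish l - pathstart l) / (2 * of_real pi * \<i>)"
  proof (rule winding_number_log)
    have "continuous_on {0..1} v" unfolding v_def circlepath by (intro continuous_intros)
    then show "path l" unfolding path_def l_def using v by (intro continuous_intros continuous_on_compose2[OF g(1)]) auto
    fix t :: real assume t: "t \<in> {0..1}"
    have "mob M (v t) - mob M (- cnj z) = (v t - - cnj z) / (exp (g (v t)) * exp (g (- cnj z)))"
      using mob_diff[OF M v[OF t] z'] g(2)[OF v[OF t]] g(2)[OF z'] by simp
    also have "v t - - cnj z = - (of_real r * exp (- (2 * of_real pi * \<i> * of_real t)))"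
      by (simp add: v_def circlepath exp_cnj)
    also have "\<dots> = exp (of_real pi * \<i> + of_real (ln r) - 2 * of_real pi * \<i> * of_real t)"
      using r(1) by (simp add: exp_add exp_diff exp_minus exp_of_real divide_inverse)
    also have "\<dots> / (exp (g (v t)) * exp (g (- cnj z))) = exp (l t)"
      by (simp add: l_def exp_diff)
    finally show "((\<lambda>u. mob M (- cnj u)) \<circ> circlepath z r) t = mob M (- cnj z) + exp (l t)"
      by (simp add: v_def algebra_simps)
  qed
  also have "pathfinish l - pathstart l = - (2 * of_real pi * \<i>)"
    by (simp add: l_def pathfinish_def pathstart_def v_def circlepath exp_two_pi_i)
  finally show ?thesis by (simp add: o_def)
qed

section \<open>Deck transformations of an oriented surface preserve orientation\<close>

text \<open>The index of \<open>q\<close> at a point is its local degree in a chart of the oriented atlas. It does not depend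
on the chart and is locally constant, hence constant on the half plane, and it is not zero. A
symmetry \<open>\<Phi>\<close> of \<open>q\<close> has \<open>f \<circ> q = f \<circ> q \<circ> \<Phi>\<close>; if it reverses orientation, this gives the index the opposite
values at \<open>z\<close> and \<open>\<Phi> z\<close>.\<close>

theorem no_orientation_reversing_symmetry:
  fixes q :: "complex \<Rightarrow> 's::topological_space"
  assumes S: "orientable_surface S"
    and q: "continuous_on uhp q" "q ` uhp \<subseteq> S"
    and loc: "\<And>z. z \<in> uhp \<Longrightarrow> \<exists>R>0. ball z R \<subseteq> uhp \<and> inj_on q (ball z R)"
    and M: "M \<in> SL" and F: "\<And>z. z \<in> uhp \<Longrightarrow> q (mob M (- cnj z)) = q z"
  shows False
proof -
  obtain A where A: "\<And>c. c \<in> A \<Longrightarrow> surface_chart S c" "(\<Union>c\<in>A. fst c) = S"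
      "\<And>U f f' W g g'. (U, f, f') \<in> A \<Longrightarrow> (W, g, g') \<in> A \<Longrightarrow> preserves_orientation_on (f ` (U \<inter> W)) (g \<circ> f')"
    using S unfolding orientable_surface_def by fast
  have chart: "openin (top_of_set S) U" "open (f ` U)" "homeomorphism U (f ` U) f f'" if "(U, f, f') \<in> A" for U f f'
    using A(1)[OF that] by (auto simp: surface_chart_def)
  have good: "\<exists>R>0. ball z (2 * R) \<subseteq> uhp \<and> q ` ball z (2 * R) \<subseteq> O' \<and> inj_on q (ball z (2 * R))"
    if z: "z \<in> uhp" and O': "openin (top_of_set S) O'" "q z \<in> O'" for z O'
  proof -
    obtain R1 where R1: "R1 > 0" "ball z R1 \<subseteq> uhp" "inj_on q (ball z R1)" using loc[OF z] by blast
    have "openin (top_of_set uhp) (uhp \<inter> q -` O')"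
      using q O'(1) by (intro continuous_openin_preimage[of uhp q S]) auto
    then have "open (uhp \<inter> q -` O')" by (simp add: openin_open_eq uhp_def open_halfspace_Im_gt)
    then obtain R2 where R2: "R2 > 0" "ball z R2 \<subseteq> uhp \<inter> q -` O'" using z O'(2) by (meson IntI openE vimageI)
    define R where "R = min R1 R2 / 2"
    have "ball z (2 * R) \<subseteq> ball z R1" "ball z (2 * R) \<subseteq> ball z R2" by (auto simp: R_def)
    then have "ball z (2 * R) \<subseteq> uhp \<and> q ` ball z (2 * R) \<subseteq> O' \<and> inj_on q (ball z (2 * R))"
      using R1 R2 inj_on_subset by blast
    moreover have "R > 0" using R1 R2 by (simp add: R_def)
    ultimately show ?thesis by blast
  qed
  have \<theta>: "continuous_on B (f \<circ> q)" "inj_on (f \<circ> q) B" if "(U, f, f') \<in> A" "B \<subseteq> uhp" "q ` B \<subseteq> U" "inj_on q B" for U f f' B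
  proof -
    have h: "continuous_on U f" "inj_on f U"
      using chart(3)[OF that(1)] by (auto simp: homeomorphism_def intro: inj_on_inverseI)
    then show "continuous_on B (f \<circ> q)"
      using that q(1) by (intro continuous_on_compose continuous_on_subset[OF h(1)] continuous_on_subset[OF q(1)])
    show "inj_on (f \<circ> q) B" using that h(2) by (intro comp_inj_on) (auto intro: inj_on_subset)
  qed
  define W where "W f z r = winding_number (f \<circ> q \<circ> circlepath z r) (f (q z))" for f :: "'s \<Rightarrow> complex" and z r
  define idx where "idx z k \<longleftrightarrow> (\<forall>U f f'. (U, f, f') \<in> A \<longrightarrow> q z \<in> U \<longrightarrow> (\<forall>\<^sub>F r in at_right 0. W f z r = k))" for z k
  \<comment> \<open>the index does not depend on the chart, since coordinate changes have degree 1\<close>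
  have change: "\<forall>\<^sub>F r in at_right 0. W g z r = W f z r"
    if z: "z \<in> uhp" and f: "(U, f, f') \<in> A" "q z \<in> U" and g: "(V, g, g') \<in> A" "q z \<in> V" for z U f f' V g g'
  proof -
    have oUV: "openin (top_of_set S) (U \<inter> V)" using chart(1) f g by blast
    obtain R where R: "R > 0" "ball z (2 * R) \<subseteq> uhp" "q ` ball z (2 * R) \<subseteq> U \<inter> V" "inj_on q (ball z (2 * R))"
      using good[OF z oUV] f g by blast
    let ?B = "ball z (2 * R)"
    define w where "w = f (q z)"
    have hf: "homeomorphism U (f ` U) f f'" and hg: "homeomorphism V (g ` V) g g'" using chart(3) f(1) g(1) by blast+
    have \<theta>c: "continuous_on ?B (f \<circ> q)" and \<theta>i: "inj_on (f \<circ> q) ?B" using \<theta>[OF f(1) R(2) _ R(4)] R(3) by blast+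
    let ?O = "(f \<circ> q) ` ?B"
    have oO: "open ?O" by (rule invariance_of_domain[OF \<theta>c open_ball \<theta>i])
    have wO: "w \<in> ?O" using R(1) by (auto simp: w_def)
    obtain e where e: "e > 0" "ball w e \<subseteq> ?O" by (rule openE[OF oO wO])
    define T where "T = g \<circ> f'"
    have "?O \<subseteq> f ` (U \<inter> V)" unfolding image_comp[symmetric] by (rule image_mono[OF R(3)])
    then have Ofg: "ball w e \<subseteq> f ` (U \<inter> V)" by (rule order_trans[OF e(2)])
    have f'f: "f' (f x) = x" if "x \<in> U" for x using hf that by (simp add: homeomorphism_def)
    have Tc: "continuous_on (ball w e) T" unfolding T_def
    proof (rule continuous_on_compose)
      have "ball w e \<subseteq> f ` U" using Ofg by blast
      then show "continuous_on (ball w e) f'" by (rule continuous_on_subset[OF homeomorphism_cont2[OF hf]])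
      have "f' ` ball w e \<subseteq> V"
      proof
        fix x assume "x \<in> f' ` ball w e"
        then obtain y where "x = f' y" "y \<in> f ` (U \<inter> V)" using Ofg by blast
        then show "x \<in> V" using f'f by auto
      qed
      then show "continuous_on (f' ` ball w e) g" by (rule continuous_on_subset[OF homeomorphism_cont1[OF hg]])
    qed
    have Ti: "T x \<noteq> T w" if x: "x \<in> ball w e" "x \<noteq> w" for x
    proof
      assume eq: "T x = T w"
      obtain u where u: "u \<in> U" "u \<in> V" "x = f u" using Ofg x(1) by blast
      have "g u = g (q z)" using eq u f f'f by (simp add: T_def w_def)
      then have "u = q z" using hg u g(2) by (metis homeomorphism_apply1)
      then show False using x(2) u by (simp add: w_def)
    qed
    have "isCont (f \<circ> q) z" by (rule continuous_on_interior[OF \<theta>c]) (use R(1) in simp)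
    then obtain \<delta> where \<delta>: "\<delta> > 0" "\<And>x. dist x z < \<delta> \<Longrightarrow> dist ((f \<circ> q) x) w < e"
      unfolding continuous_at_eps_delta w_def comp_def using e(1) by blast
    define s where "s = min \<delta> (2 * R)"
    have s: "s > 0" using \<delta>(1) R(1) by (simp add: s_def)
    have "W g z r = W f z r" if r: "0 < r" "r < s" for r
    proof -
      let ?\<gamma> = "f \<circ> q \<circ> circlepath z r"
      have sB: "sphere z r \<subseteq> ?B" using r by (auto simp: s_def)
      have pc: "path ?\<gamma>" "pathfinish ?\<gamma> = pathstart ?\<gamma>"
        using r sB by (auto intro!: path_continuous_image[OF _ continuous_on_subset[OF \<theta>c]] simp: pathfinish_compose pathstart_compose)
      have im: "path_image ?\<gamma> \<subseteq> ball w e - {w}"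
      proof
        fix y assume "y \<in> path_image ?\<gamma>"
        then obtain x where x: "x \<in> sphere z r" "y = (f \<circ> q) x" using r by (auto simp: path_image_compose)
        have "dist x z < \<delta>" using x(1) r by (simp add: s_def dist_commute)
        then have yB: "y \<in> ball w e" using \<delta>(2)[of x] x(2) by (simp add: dist_commute)
        have "x \<noteq> z" using x(1) r by auto
        moreover have "x \<in> ?B" "z \<in> ?B" using x(1) sB R(1) by auto
        ultimately have "y \<noteq> w" using inj_onD[OF \<theta>i, of x z] x(2) by (auto simp: w_def)
        then show "y \<in> ball w e - {w}" using yB by blast
      qed
      have "W g z r = winding_number (T \<circ> ?\<gamma>) (T w)"
      proof -
        have "T w = g (q z)" using f f'f by (simp add: T_def w_def)
        moreover have "winding_number (g \<circ> q \<circ> circlepath z r) (g (q z)) = winding_number (T \<circ> ?\<gamma>) (g (q z))"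
        proof (rule winding_number_cong)
          fix t :: real assume "0 \<le> t" "t \<le> 1"
          then have "circlepath z r t \<in> path_image (circlepath z r)" by (auto simp: path_image_def)
          then have "circlepath z r t \<in> ?B" using r sB by auto
          then have "q (circlepath z r t) \<in> U" using R(3) by blast
          then show "(g \<circ> q \<circ> circlepath z r) t = (T \<circ> ?\<gamma>) t" using f'f by (simp add: T_def)
        qed
        ultimately show ?thesis by (simp add: W_def)
      qed
      also have "\<dots> = winding_number ?\<gamma> w * winding_number (T \<circ> circlepath w (e/2)) (T w)"
        by (rule winding_number_compose[OF Tc Ti pc im]) (use e in auto)
      also have "winding_number (T \<circ> circlepath w (e/2)) (T w) = 1"
      proof -
        have "cball w (e/2) \<subseteq> ball w e" using e(1) by auto
        then have "cball w (e/2) \<subseteq> f ` (U \<inter> V)" using Ofg by blast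
        then show ?thesis using A(3)[OF f(1) g(1)] e(1) unfolding preserves_orientation_on_def T_def by (meson half_gt_zero)
      qed
      finally show ?thesis by (simp add: W_def w_def o_def)
    qed
    then show ?thesis using s by (auto simp: eventually_at_right)
  qed
  have idxI: "idx z k" if z: "z \<in> uhp" and f: "(U, f, f') \<in> A" "q z \<in> U" and k: "\<forall>\<^sub>F r in at_right 0. W f z r = k" for z k U f f'
    unfolding idx_def
  proof (intro allI impI)
    fix V g g' assume g: "(V, g, g') \<in> A" "q z \<in> V"
    show "\<forall>\<^sub>F r in at_right 0. W g z r = k"
      using change[OF z f g] k by eventually_elim simp
  qed
  have ch: "\<exists>U f f'. (U, f, f') \<in> A \<and> q z \<in> U" if "z \<in> uhp" for z
  proof -
    have "q z \<in> (\<Union>c\<in>A. fst c)" using A(2) q(2) that by auto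
    then show ?thesis by (metis UN_E prod.collapse)
  qed
  have unique: "k = k'" if z: "z \<in> uhp" and k: "idx z k" "idx z k'" for z k k'
  proof -
    obtain U f f' where f: "(U, f, f') \<in> A" "q z \<in> U" using ch[OF z] by blast
    have "\<forall>\<^sub>F r in at_right 0. W f z r = k" "\<forall>\<^sub>F r in at_right 0. W f z r = k'"
      using k f unfolding idx_def by blast+
    then have "\<forall>\<^sub>F r in at_right (0::real). k = k'" by eventually_elim simp
    then show ?thesis by (simp add: eventually_const_iff)
  qed
  \<comment> \<open>the index is locally constant and nonzero, by \<open>local_degree\<close> in one chart\<close>
  have locc: "\<exists>k R. k \<noteq> 0 \<and> 0 < R \<and> ball z R \<subseteq> uhp \<and> (\<forall>w\<in>ball z R. idx w k)" if z: "z \<in> uhp" for z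
  proof -
    obtain U f f' where f: "(U, f, f') \<in> A" "q z \<in> U" using ch[OF z] by blast
    obtain R where R: "R > 0" "ball z (2 * R) \<subseteq> uhp" "q ` ball z (2 * R) \<subseteq> U" "inj_on q (ball z (2 * R))"
      using good[OF z chart(1)[OF f(1)] f(2)] by blast
    obtain k where k: "k \<noteq> 0" "\<And>w r. w \<in> ball z R \<Longrightarrow> 0 < r \<Longrightarrow> r < R \<Longrightarrow> winding_number (f \<circ> q \<circ> circlepath w r) ((f \<circ> q) w) = k"
      using local_degree[OF \<theta>[OF f(1) R(2-4)] R(1)] by blast
    have BR: "ball z R \<subseteq> ball z (2 * R)" using R(1) by auto
    have "idx w k" if w: "w \<in> ball z R" for w
    proof (rule idxI[OF _ f(1)])
      show "w \<in> uhp" "q w \<in> U" using w BR R by auto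
      show "\<forall>\<^sub>F r in at_right 0. W f w r = k"
        using k(2)[OF w] R(1) by (auto simp: eventually_at_right W_def)
    qed
    then show ?thesis using k(1) R(1,2) BR by blast
  qed
  define \<sigma> where "\<sigma> z = (THE k. idx z k)" for z
  have \<sigma>: "\<sigma> z = k" if "z \<in> uhp" "idx z k" for z k
    unfolding \<sigma>_def using that unique by blast
  have ex: "idx z (\<sigma> z)" "\<sigma> z \<noteq> 0" if z: "z \<in> uhp" for z
  proof -
    obtain k R where kR: "k \<noteq> 0" "0 < R" "\<forall>w\<in>ball z R. idx w k" using locc[OF z] by blast
    then have "idx z k" by simp
    then show "idx z (\<sigma> z)" "\<sigma> z \<noteq> 0" using \<sigma>[OF z] kR(1) by auto
  qed
  have "convex uhp" unfolding uhp_def by (rule convex_halfspace_Im_gt)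
  then have "connected uhp" by (rule convex_connected)
  then have "\<sigma> constant_on uhp"
  proof (rule locally_constant_imp_constant)
    fix z assume z: "z \<in> uhp"
    obtain k R where kR: "0 < R" "ball z R \<subseteq> uhp" "\<forall>w\<in>ball z R. idx w k" using locc[OF z] by blast
    then have "\<sigma> w = k" if "w \<in> ball z R" for w using that \<sigma> by blast
    moreover have "openin (top_of_set uhp) (ball z R)" by (rule open_subset[OF kR(2) open_ball])
    ultimately show "\<exists>T. openin (top_of_set uhp) T \<and> z \<in> T \<and> (\<forall>x\<in>T. \<sigma> x = \<sigma> z)"
      using kR(1) by (intro exI[of _ "ball z R"] conjI ballI) simp_all
  qed
  then have const: "\<sigma> z = \<sigma> w" if "z \<in> uhp" "w \<in> uhp" for z w using that by (auto simp: constant_on_def)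
  \<comment> \<open>comparison of the indices at \<open>z\<close> and \<open>\<Phi> z\<close>, in the same chart\<close>
  define z where "z = \<i>"
  have z: "z \<in> uhp" by (simp add: z_def uhp_def)
  define \<Phi> where "\<Phi> u = mob M (- cnj u)" for u
  have \<Phi>: "\<Phi> u \<in> uhp" if "u \<in> uhp" for u using that M by (simp add: \<Phi>_def mob_uhp')
  have q\<Phi>: "q (\<Phi> u) = q u" if "u \<in> uhp" for u using F[OF that] by (simp add: \<Phi>_def)
  obtain U f f' where f: "(U, f, f') \<in> A" "q z \<in> U" using ch[OF z] by blast
  have f\<Phi>: "q (\<Phi> z) \<in> U" using f q\<Phi>[OF z] by simp
  obtain R where R: "R > 0" "ball (\<Phi> z) (2 * R) \<subseteq> uhp" "q ` ball (\<Phi> z) (2 * R) \<subseteq> U" "inj_on q (ball (\<Phi> z) (2 * R))"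
    using good[OF \<Phi>[OF z] chart(1)[OF f(1)] f\<Phi>] by blast
  note \<theta>R = \<theta>[OF f(1) R(2-4)]
  have \<Phi>c: "continuous_on uhp \<Phi>" unfolding \<Phi>_def
    by (intro continuous_on_compose2[OF continuous_on_mob[OF M order_refl]] continuous_intros) (auto simp: uhp_def)
  have \<Phi>i: "\<Phi> u \<noteq> \<Phi> v" if "u \<in> uhp" "v \<in> uhp" "u \<noteq> v" for u v
  proof
    assume "\<Phi> u = \<Phi> v"
    then have "mob (adj M) (mob M (- cnj u)) = mob (adj M) (mob M (- cnj v))" by (simp add: \<Phi>_def)
    moreover have "- cnj u \<in> uhp" "- cnj v \<in> uhp" using that by (auto simp: uhp_def)
    ultimately show False using M that by simp
  qed
  have ou: "open uhp" by (simp add: uhp_def open_halfspace_Im_gt)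
  have "isCont \<Phi> z" by (rule continuous_on_interior[OF \<Phi>c]) (use ou z in \<open>simp add: interior_open\<close>)
  then obtain \<delta> where \<delta>: "\<delta> > 0" "\<And>x. dist x z < \<delta> \<Longrightarrow> dist (\<Phi> x) (\<Phi> z) < 2 * R"
    unfolding continuous_at_eps_delta using R(1) by (meson mult_pos_pos zero_less_numeral)
  obtain \<delta>' where \<delta>': "\<delta>' > 0" "ball z \<delta>' \<subseteq> uhp" by (rule openE[OF ou z])
  have "\<forall>\<^sub>F r in at_right 0. W f z r = - W f (\<Phi> z) R"
  proof -
    have "W f z r = - W f (\<Phi> z) R" if r: "0 < r" "r < min \<delta> \<delta>'" for r
    proof -
      let ?\<gamma> = "\<Phi> \<circ> circlepath z r"
      have "cball z r \<subseteq> ball z \<delta>'" using r by auto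
      then have cb: "cball z r \<subseteq> uhp" using \<delta>'(2) by blast
      have sp: "sphere z r \<subseteq> uhp" using cb by auto
      have pc: "path ?\<gamma>" "pathfinish ?\<gamma> = pathstart ?\<gamma>"
        using r sp by (auto intro!: path_continuous_image[OF _ continuous_on_subset[OF \<Phi>c]] simp: pathfinish_compose pathstart_compose)
      have im: "path_image ?\<gamma> \<subseteq> ball (\<Phi> z) (2 * R) - {\<Phi> z}"
      proof
        fix y assume "y \<in> path_image ?\<gamma>"
        then obtain x where x: "x \<in> sphere z r" "y = \<Phi> x" using r by (auto simp: path_image_compose)
        then have "x \<noteq> z" "x \<in> uhp" "dist x z < \<delta>" using r sp by (auto simp: dist_commute)
        then show "y \<in> ball (\<Phi> z) (2 * R) - {\<Phi> z}" using \<delta>(2)[of x] \<Phi>i[of x z] x z by (simp add: dist_commute)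
      qed
      have "winding_number (f \<circ> q \<circ> circlepath z r) (f (q z)) = winding_number ((f \<circ> q) \<circ> ?\<gamma>) (f (q z))"
      proof (rule winding_number_cong)
        fix t :: real assume "0 \<le> t" "t \<le> 1"
        then have "circlepath z r t \<in> path_image (circlepath z r)" by (auto simp: path_image_def)
        then have "circlepath z r t \<in> uhp" using r sp by auto
        then show "(f \<circ> q \<circ> circlepath z r) t = ((f \<circ> q) \<circ> ?\<gamma>) t" using q\<Phi> by simp
      qed
      then have "W f z r = winding_number ((f \<circ> q) \<circ> ?\<gamma>) ((f \<circ> q) (\<Phi> z))"
        unfolding W_def using q\<Phi>[OF z] by simp
      also have "\<dots> = winding_number ?\<gamma> (\<Phi> z) * winding_number ((f \<circ> q) \<circ> circlepath (\<Phi> z) R) ((f \<circ> q) (\<Phi> z))"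
        by (rule winding_number_compose[OF \<theta>R(1) _ pc im]) (use R(1) \<theta>R(2) in \<open>auto simp: inj_on_def\<close>)
      also have "winding_number ?\<gamma> (\<Phi> z) = -1"
        using anti_mob_degree[OF M z r(1) cb] by (simp add: \<Phi>_def[abs_def])
      finally show ?thesis by (simp add: W_def o_def)
    qed
    then show ?thesis using \<delta>(1) \<delta>'(1) by (auto simp: eventually_at_right intro!: exI[of _ "min \<delta> \<delta>'"])
  qed
  then have 1: "\<sigma> z = - W f (\<Phi> z) R" using \<sigma>[OF z idxI[OF z f]] by blast
  have "W f (\<Phi> z) r = W f (\<Phi> z) R" if r: "0 < r" "r < R" for r
  proof -
    have "r < 2 * R" using r by simp
    have "W f (\<Phi> z) r = winding_number (circlepath (\<Phi> z) r) (\<Phi> z) * winding_number ((f \<circ> q) \<circ> circlepath (\<Phi> z) R) ((f \<circ> q) (\<Phi> z))"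
      unfolding W_def comp_apply[of f q, symmetric]
      by (rule winding_number_compose[OF \<theta>R(1) _ _ _ path_image_circlepath_subset]) (use r R(1) \<open>r < 2 * R\<close> \<theta>R(2) in \<open>auto simp: inj_on_def\<close>)
    then show ?thesis using r by (simp add: W_def winding_number_circlepath_centre o_def)
  qed
  then have "\<forall>\<^sub>F r in at_right 0. W f (\<Phi> z) r = W f (\<Phi> z) R" using R(1) by (auto simp: eventually_at_right)
  then have 2: "\<sigma> (\<Phi> z) = W f (\<Phi> z) R" using \<sigma>[OF \<Phi>[OF z] idxI[OF \<Phi>[OF z] f(1) f\<Phi>]] by blast
  show False using 1 2 const[OF z \<Phi>[OF z]] ex(2)[OF z] by simp
qed

section \<open>Crossing axes and matrices\<close>

lemma mob_cross: 
  assumes "M \<in> SL" "z \<in> uhp"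
  shows "mob M z * (of_real (m21 M) * z + of_real (m22 M)) = of_real (m11 M) * z + of_real (m12 M)"
  using mob_denominator_nonzero[OF assms] by (simp add: mob_def)

text \<open>Consecutive points \<open>w\<close>, \<open>w'\<close> of an orbit satisfy \<open>w' * (m21 M * w + m22 M) = m11 M * w + m12 M\<close>; a
finite limit is thus a fixed point. It is real in all applications.\<close>

lemma orbit_limit:
  assumes M: "M \<in> SL" and z: "z \<in> uhp" and l: "(\<lambda>m. mob (M ^ m) z) \<longlonglongrightarrow> of_real \<beta>"
  shows "m21 M * \<beta>\<^sup>2 + (m22 M - m11 M) * \<beta> = m12 M"
proof -
  let ?w = "\<lambda>m. mob (M ^ m) z"
  have "?w (Suc m) * (of_real (m21 M) * ?w m + of_real (m22 M)) = of_real (m11 M) * ?w m + of_real (m12 M)" for m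
    using mob_cross[OF M, of "?w m"] M z by (simp add: mob_mult mob_uhp)
  moreover have "(\<lambda>m. ?w (Suc m) * (of_real (m21 M) * ?w m + of_real (m22 M))) \<longlonglongrightarrow> of_real \<beta> * (of_real (m21 M) * of_real \<beta> + of_real (m22 M))"
    by (intro tendsto_intros l LIMSEQ_Suc[OF l])
  moreover have "(\<lambda>m. of_real (m11 M) * ?w m + of_real (m12 M)) \<longlonglongrightarrow> of_real (m11 M) * of_real \<beta> + of_real (m12 M)"
    by (intro tendsto_intros l)
  ultimately have "of_real \<beta> * (of_real (m21 M) * of_real \<beta> + of_real (m22 M)) = (of_real (m11 M) * of_real \<beta> + of_real (m12 M) :: complex)"
    by (intro LIMSEQ_unique) auto
  then have "complex_of_real (\<beta> * (m21 M * \<beta> + m22 M)) = of_real (m11 M * \<beta> + m12 M)" by simp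
  then have "\<beta> * (m21 M * \<beta> + m22 M) = m11 M * \<beta> + m12 M" by (simp only: of_real_eq_iff)
  then show ?thesis by (simp add: power2_eq_square algebra_simps)
qed

text \<open>If \<open>m21 M\<close> were not zero, then the orbit would tend to the finite point \<open>m11 M / m21 M\<close>. Then \<open>0\<close> is fixed
as the limit of the backward orbit. If the square of the first entry were 1, the orbit would be
constant.\<close>

lemma diagonal_of_limits:
  assumes M: "M \<in> SL" and z: "z \<in> uhp" and top: "filterlim (\<lambda>m. mob (M ^ m) z) at_infinity sequentially"
    and bot: "(\<lambda>m. mob (adj M ^ m) z) \<longlonglongrightarrow> 0"
  shows "m21 M = 0" "m12 M = 0" "(m11 M)\<^sup>2 \<noteq> 1"
proof -
  let ?w = "\<lambda>m. mob (M ^ m) z"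
  show c: "m21 M = 0"
  proof (rule ccontr)
    assume c: "m21 M \<noteq> 0"
    have i0: "(\<lambda>m. inverse (?w m)) \<longlonglongrightarrow> 0" by (rule tendsto_inverse_0[THEN filterlim_compose, OF top])
    have w0: "?w m \<noteq> 0" for m
    proof -
      have "?w m \<in> uhp" using M z by (simp add: mob_uhp)
      then show ?thesis by (auto simp: uhp_def)
    qed
    have "inverse (?w (Suc m)) * (of_real (m11 M) + of_real (m12 M) * inverse (?w m)) = of_real (m21 M) + of_real (m22 M) * inverse (?w m)" for m
    proof -
      have "?w (Suc m) * (of_real (m21 M) * ?w m + of_real (m22 M)) = of_real (m11 M) * ?w m + of_real (m12 M)"
        using mob_cross[OF M, of "?w m"] M z by (simp add: mob_mult mob_uhp)
      then show ?thesis using w0[of m] w0[of "Suc m"] by (simp add: field_simps)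
    qed
    moreover have "(\<lambda>m. inverse (?w (Suc m)) * (of_real (m11 M) + of_real (m12 M) * inverse (?w m))) \<longlonglongrightarrow> 0 * (of_real (m11 M) + of_real (m12 M) * 0)"
      by (intro tendsto_intros i0 LIMSEQ_Suc[OF i0])
    moreover have "(\<lambda>m. of_real (m21 M) + of_real (m22 M) * inverse (?w m)) \<longlonglongrightarrow> of_real (m21 M) + of_real (m22 M) * 0"
      by (intro tendsto_intros i0)
    ultimately have "0 * (of_real (m11 M) + of_real (m12 M) * 0) = (of_real (m21 M) + of_real (m22 M) * 0 :: complex)"
      by (intro LIMSEQ_unique) auto
    then show False using c by simp
  qed
  show b: "m12 M = 0" using orbit_limit[of "adj M" z 0] SL_adj[OF M] z bot by (simp add: adj_def)
  show "(m11 M)\<^sup>2 \<noteq> 1"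
  proof
    assume a: "(m11 M)\<^sup>2 = 1"
    have "m11 M * m22 M = 1" using M b by (simp add: SL_def mdet_def)
    then have "m22 M = m11 M" using a by (metis mult_cancel_left mult_zero_left power2_eq_square zero_neq_one)
    then have m: "mob M u = u" for u using a b c by (auto simp: mob_def power2_eq_1_iff)
    have "?w k = z" for k
    proof (induction k)
      case (Suc k)
      have "?w (Suc k) = mob M (?w k)" using M z by (simp add: mob_mult)
      then show ?case using Suc m by simp
    qed (use z in \<open>simp add: mob_def mat2_defs\<close>)
    then have "?w = (\<lambda>_. z)" by blast
    then have "filterlim (\<lambda>_::nat. z) at_infinity sequentially" using top by simp
    then show False using not_tendsto_and_filterlim_at_infinity[of sequentially "\<lambda>_. z" z] by simp
  qed
qed

text \<open>The limits are the two roots of the quadratic equation for the fixed points, and their product is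
\<open>- m12 M / m21 M\<close>. If \<open>m21 M\<close> were zero, the equation could have two roots only if \<open>M\<close> acts trivially.\<close>

lemma saddle_of_limits:
  assumes M: "M \<in> SL" and z: "z \<in> uhp" and top: "(\<lambda>m. mob (M ^ m) z) \<longlonglongrightarrow> of_real \<beta>"
    and bot: "(\<lambda>m. mob (adj M ^ m) z) \<longlonglongrightarrow> of_real \<gamma>" and sg: "\<beta> * \<gamma> < 0"
  shows "0 < m12 M * m21 M"
proof -
  let ?w = "\<lambda>m. mob (M ^ m) z"
  have 1: "m21 M * \<beta>\<^sup>2 + (m22 M - m11 M) * \<beta> = m12 M" by (rule orbit_limit[OF M z top])
  have 2: "m21 M * \<gamma>\<^sup>2 + (m22 M - m11 M) * \<gamma> = m12 M"
    using orbit_limit[of "adj M" z \<gamma>] SL_adj[OF M] z bot by (simp add: adj_def algebra_simps)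
  have ne: "\<beta> - \<gamma> \<noteq> 0" using sg by (auto simp: mult_less_0_iff)
  have "(\<beta> - \<gamma>) * (m21 M * (\<beta> + \<gamma>) + (m22 M - m11 M)) = 0"
    using 1 2 by (simp add: power2_eq_square algebra_simps)
  then have 3: "m22 M - m11 M = - m21 M * (\<beta> + \<gamma>)" using ne by simp
  then have 4: "m12 M = - m21 M * (\<beta> * \<gamma>)" using 1 unfolding 3 by (simp add: power2_eq_square algebra_simps)
  have "m21 M \<noteq> 0"
  proof
    assume c: "m21 M = 0"
    then have d: "m22 M = m11 M" "m12 M = 0" using 3 4 by simp_all
    then have "m11 M \<noteq> 0" using M c by (auto simp: SL_def mdet_def)
    then have m: "mob M u = u" for u using c d by (simp add: mob_def)
    have "?w k = z" for k
    proof (induction k)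
      case (Suc k)
      have "?w (Suc k) = mob M (?w k)" using M z by (simp add: mob_mult)
      then show ?case using Suc m by simp
    qed (use z in \<open>simp add: mob_def mat2_defs\<close>)
    then have "z = of_real \<beta>" using top by (simp add: LIMSEQ_const_iff)
    then show False using z by (simp add: uhp_def)
  qed
  then have "0 < (m21 M)\<^sup>2 * - (\<beta> * \<gamma>)" using sg by (intro mult_pos_pos) auto
  then show ?thesis using 4 by (simp add: power2_eq_square algebra_simps)
qed

text \<open>The polynomial in the definition of crossing is \<open>- (l - k)\<^sup>2 * m12 Y * m21 Y\<close> if \<open>l\<close>, \<open>k\<close> are the diagonal
entries of \<open>X\<close>.\<close>

lemma crossing_of_diagonal_saddle:
  assumes X: "X \<in> SL" "m21 X = 0" "m12 X = 0" "(m11 X)\<^sup>2 \<noteq> 1" and Y: "Y \<in> SL" "0 < m12 Y * m21 Y"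
  shows "crossing X Y"
proof -
  define l k where "l = m11 X" and "k = m22 X"
  have lk: "l * k = 1" using X by (simp add: SL_def mdet_def l_def k_def)
  have dY: "m11 Y * m22 Y = 1 + m12 Y * m21 Y" using Y by (simp add: SL_def mdet_def)
  have "l - k \<noteq> 0"
  proof
    assume "l - k = 0"
    then have "k = l" by simp
    then show False using lk X(4) by (simp add: l_def power2_eq_square)
  qed
  then have pos: "0 < (l - k)\<^sup>2" by simp
  have "(mtr X)\<^sup>2 = (l - k)\<^sup>2 + 4 * (l * k)" by (simp add: mtr_def l_def k_def power2_eq_square algebra_simps)
  then have 1: "4 < (mtr X)\<^sup>2" using pos lk by simp
  have "(mtr X)\<^sup>2 + (mtr Y)\<^sup>2 + (mtr (X * Y))\<^sup>2 - mtr X * mtr Y * mtr (X * Y) - 4 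
      = (l - k)\<^sup>2 * (1 - m11 Y * m22 Y) + (4 * (l * k) - 4) + (1 - l * k) * (m11 Y + m22 Y)\<^sup>2"
    using X by (simp add: mtr_def times_mat2_def l_def[symmetric] k_def[symmetric] power2_eq_square algebra_simps)
  also have "\<dots> = - ((l - k)\<^sup>2 * (m12 Y * m21 Y))" using lk dY by simp
  also have "\<dots> < 0" using pos Y(2) by simp
  finally show ?thesis using 1 X Y by (simp add: crossing_def)
qed

section \<open>The half plane with a boundary point of the disc at infinity\<close>

text \<open>The transformation from the disc to the half plane that takes the boundary point \<open>v\<close> to \<open>\<infinity>\<close>.\<close>

definition to_half_plane :: "complex \<Rightarrow> complex \<Rightarrow> complex" where
  "to_half_plane v \<zeta> = \<i> * (v + \<zeta>) / (v - \<zeta>)"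

lemma ball_not_unit: "cmod v = 1 \<Longrightarrow> \<zeta> \<in> ball 0 1 \<Longrightarrow> v - \<zeta> \<noteq> 0"
  by auto

lemma Im_to_half_plane:
  assumes "cmod v = 1" shows "Im (to_half_plane v \<zeta>) = (1 - (cmod \<zeta>)\<^sup>2) / (cmod (v - \<zeta>))\<^sup>2"
proof -
  have v: "(Re v)\<^sup>2 + (Im v)\<^sup>2 = 1" using assms by (metis cmod_power2 one_power2)
  have "Im (to_half_plane v \<zeta>) = ((Re v)\<^sup>2 + (Im v)\<^sup>2 - ((Re \<zeta>)\<^sup>2 + (Im \<zeta>)\<^sup>2)) / ((Re v - Re \<zeta>)\<^sup>2 + (Im v - Im \<zeta>)\<^sup>2)"
    by (simp add: to_half_plane_def Im_divide power2_eq_square algebra_simps)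
  then show ?thesis unfolding v by (simp add: cmod_power2)
qed

lemma to_half_plane_uhp: "cmod v = 1 \<Longrightarrow> \<zeta> \<in> ball 0 1 \<Longrightarrow> to_half_plane v \<zeta> \<in> uhp"
  using ball_not_unit[of v \<zeta>] by (auto simp: uhp_def Im_to_half_plane power_less_one_iff abs_square_less_1 intro!: divide_pos_pos)

lemma hyp_to_half_plane:
  assumes v: "cmod v = 1" and z: "\<zeta> \<in> ball 0 1" "\<omega> \<in> ball 0 1"
  shows "hyp (to_half_plane v \<zeta>) (to_half_plane v \<omega>) = 4 * (cmod (\<zeta> - \<omega>))\<^sup>2 / ((1 - (cmod \<zeta>)\<^sup>2) * (1 - (cmod \<omega>)\<^sup>2))"
proof -
  note n = ball_not_unit[OF v z(1)] ball_not_unit[OF v z(2)]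
  have "to_half_plane v \<zeta> - to_half_plane v \<omega> = 2 * \<i> * v * (\<zeta> - \<omega>) / ((v - \<zeta>) * (v - \<omega>))"
    using n by (simp add: to_half_plane_def divide_simps) (simp add: algebra_simps)
  then have "(cmod (to_half_plane v \<zeta> - to_half_plane v \<omega>))\<^sup>2 = 4 * (cmod (\<zeta> - \<omega>))\<^sup>2 / ((cmod (v - \<zeta>))\<^sup>2 * (cmod (v - \<omega>))\<^sup>2)"
    using v by (simp add: norm_mult norm_divide power_mult_distrib power_divide)
  then show ?thesis using n by (simp add: hyp_def Im_to_half_plane[OF v])
qed

lemma cosh_disc_dist:
  assumes "\<zeta> \<in> ball 0 1" "\<omega> \<in> ball 0 1"
  shows "2 * (cosh (disc_dist \<zeta> \<omega>) - 1) = 4 * (cmod (\<zeta> - \<omega>))\<^sup>2 / ((1 - (cmod \<zeta>)\<^sup>2) * (1 - (cmod \<omega>)\<^sup>2))"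
proof -
  have "0 \<le> (1 - (cmod \<zeta>)\<^sup>2) * (1 - (cmod \<omega>)\<^sup>2)"
    using assms by (intro mult_nonneg_nonneg) (auto simp: power_le_one_iff abs_square_le_1)
  then have "1 \<le> 1 + 2 * (cmod (\<zeta> - \<omega>))\<^sup>2 / ((1 - (cmod \<zeta>)\<^sup>2) * (1 - (cmod \<omega>)\<^sup>2))" by simp
  then show ?thesis unfolding disc_dist_def by (subst cosh_arcosh_real) auto
qed

lemma bij_to_half_plane:
  assumes v: "cmod v = 1" shows "bij_betw (\<lambda>\<zeta>. to_half_plane v \<zeta> - of_real x) (ball 0 1) uhp"
proof (rule bij_betw_byWitness[where f' = "\<lambda>w. v * cayley (w + of_real x)"])
  have sh: "w + of_real x \<in> uhp" if "w \<in> uhp" for w using that by (simp add: uhp_def)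
  have v0: "v \<noteq> 0" using v by auto
  show "\<forall>\<zeta>\<in>ball 0 1. v * cayley (to_half_plane v \<zeta> - of_real x + of_real x) = \<zeta>"
  proof
    fix \<zeta> :: complex assume z: "\<zeta> \<in> ball 0 1"
    have n: "v - \<zeta> \<noteq> 0" by (rule ball_not_unit[OF v z])
    have "to_half_plane v \<zeta> - \<i> = 2 * \<i> * \<zeta> / (v - \<zeta>)" "to_half_plane v \<zeta> + \<i> = 2 * \<i> * v / (v - \<zeta>)"
      using n by (simp_all add: to_half_plane_def field_simps)
    then have "cayley (to_half_plane v \<zeta>) = \<zeta> / v" using n v0 by (simp add: cayley_def)
    then show "v * cayley (to_half_plane v \<zeta> - of_real x + of_real x) = \<zeta>" using v0 by simp
  qed
  show "\<forall>w\<in>uhp. to_half_plane v (v * cayley (w + of_real x)) - of_real x = w"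
  proof
    fix w assume "w \<in> uhp"
    then have n: "w + of_real x + \<i> \<noteq> 0" using plus_i_nonzero[OF sh] by simp
    define u where "u = w + of_real x"
    have "v + v * cayley u = v * (2 * u) / (u + \<i>)" "v - v * cayley u = v * (2 * \<i>) / (u + \<i>)"
      using n by (simp_all add: u_def[symmetric] cayley_def field_simps)
    then have "to_half_plane v (v * cayley u) = u" using n v0 by (simp add: to_half_plane_def u_def[symmetric])
    then show "to_half_plane v (v * cayley (w + of_real x)) - of_real x = w" by (simp add: u_def)
  qed
  show "(\<lambda>\<zeta>. to_half_plane v \<zeta> - of_real x) ` ball 0 1 \<subseteq> uhp"
    using to_half_plane_uhp[OF v] by (auto simp: uhp_def)
  show "(\<lambda>w. v * cayley (w + of_real x)) ` uhp \<subseteq> ball 0 1"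
  proof
    fix \<zeta> assume "\<zeta> \<in> (\<lambda>w. v * cayley (w + of_real x)) ` uhp"
    then obtain w where w: "w \<in> uhp" "\<zeta> = v * cayley (w + of_real x)" by blast
    have "0 \<le> hyp (w + of_real x) \<i>" using sh[OF w(1)] by (intro hyp_nonneg) (auto simp: uhp_def)
    then have "(cmod \<zeta>)\<^sup>2 < 1" using w(2) v by (simp add: norm_mult cayley_norm[OF sh[OF w(1)]])
    then show "\<zeta> \<in> ball 0 1" by (simp add: abs_square_less_1)
  qed
qed

text \<open>On the boundary circle the transformation is a cotangent of half the angle from \<open>v\<close>. Hence it takes the
counterclockwise order, starting from \<open>v\<close>, to the order of the real line.\<close>

lemma to_half_plane_boundary:
  assumes s: "sin ((t - s) / 2) \<noteq> 0"
  shows "cis s - cis t \<noteq> 0" "to_half_plane (cis s) (cis t) = of_real (- cot ((t - s) / 2))"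
proof -
  define \<theta> where "\<theta> = (t - s) / 2"
  have t: "cis t = cis s * cis \<theta> * cis \<theta>" by (simp add: cis_mult \<theta>_def)
  have c: "cis \<theta> * cis (- \<theta>) = 1" by (simp add: cis_mult)
  have p: "cis s + cis t = cis s * cis \<theta> * (cis (- \<theta>) + cis \<theta>)"
    using c by (simp add: t algebra_simps)
  have m: "cis s - cis t = cis s * cis \<theta> * (cis (- \<theta>) - cis \<theta>)"
    using c by (simp add: t algebra_simps)
  have sc: "cis (- \<theta>) + cis \<theta> = of_real (2 * cos \<theta>)" "cis (- \<theta>) - cis \<theta> = - \<i> * of_real (2 * sin \<theta>)"
    by (auto simp: complex_eq_iff)
  have ne: "sin \<theta> \<noteq> 0" "cis s * cis \<theta> \<noteq> 0" using s by (auto simp: \<theta>_def)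
  show d: "cis s - cis t \<noteq> 0" unfolding m sc using ne by simp
  have "to_half_plane (cis s) (cis t) = \<i> * of_real (2 * cos \<theta>) / (- \<i> * of_real (2 * sin \<theta>))"
    unfolding to_half_plane_def p m sc using ne by (simp add: mult.assoc mult.left_commute[of \<i>])
  also have "\<dots> = of_real (- cot \<theta>)" using ne by (simp add: cot_def field_simps)
  finally show "to_half_plane (cis s) (cis t) = of_real (- cot ((t - s) / 2))" by (simp add: \<theta>_def)
qed

lemma minus_cot_less:
  fixes s t :: real
  assumes "0 < sin s * sin t" "s < t" "t - s < pi" shows "- cot s < - cot t"
proof -
  have "sin s \<noteq> 0" "sin t \<noteq> 0" using assms(1) by auto
  then have "cot s - cot t = sin (t - s) / (sin s * sin t)"
    by (simp add: cot_def sin_diff field_simps)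
  also have "\<dots> > 0" using assms by (intro divide_pos_pos sin_gt_zero) auto
  finally show ?thesis by simp
qed

text \<open>With \<open>ap\<close> at infinity, the two endpoints of the other axis lie on different sides of \<open>am\<close>. In one of
the two cyclic orders all angles are measured backwards from \<open>ap\<close>, in the other one forwards.\<close>

lemma crossing_boundary:
  assumes c: "counterclockwise4 bm am bp ap \<or> counterclockwise4 ap bp am bm"
  shows "cmod ap = 1" "\<exists>x y w. ap \<noteq> am \<and> ap \<noteq> bm \<and> ap \<noteq> bp \<and> to_half_plane ap am = of_real x \<and>
     to_half_plane ap bp = of_real y \<and> to_half_plane ap bm = of_real w \<and> (y - x) * (w - x) < 0"
proof -
  show "cmod ap = 1" using c by (auto simp: counterclockwise4_def)
  show "\<exists>x y w. ap \<noteq> am \<and> ap \<noteq> bm \<and> ap \<noteq> bp \<and> to_half_plane ap am = of_real x \<and>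
     to_half_plane ap bp = of_real y \<and> to_half_plane ap bm = of_real w \<and> (y - x) * (w - x) < 0"
    using c
  proof
    assume "counterclockwise4 bm am bp ap"
    then obtain t1 t2 t3 t4 where t: "bm = cis t1" "am = cis t2" "bp = cis t3" "ap = cis t4"
        "t1 < t2" "t2 < t3" "t3 < t4" "t4 < t1 + 2 * pi" by (auto simp: counterclockwise4_def)
    have sn: "sin ((u - t4) / 2) < 0" if "t1 \<le> u" "u < t4" for u
    proof -
      have "0 < sin (- ((u - t4) / 2))" using that t by (intro sin_gt_zero) (auto simp: field_simps)
      then show ?thesis by simp
    qed
    have less: "- cot ((u - t4) / 2) < - cot ((v - t4) / 2)" if "t1 \<le> u" "u < v" "v < t4" for u v
      by (rule minus_cot_less) (use that t sn[of u] sn[of v] in \<open>auto intro: mult_neg_neg simp: field_simps\<close>)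
    have n: "sin ((t1 - t4) / 2) \<noteq> 0" "sin ((t2 - t4) / 2) \<noteq> 0" "sin ((t3 - t4) / 2) \<noteq> 0"
      using sn[of t1] sn[of t2] sn[of t3] t by auto
    have "(- cot ((t3 - t4) / 2) - - cot ((t2 - t4) / 2)) * (- cot ((t1 - t4) / 2) - - cot ((t2 - t4) / 2)) < 0"
      using less[of t1 t2] less[of t2 t3] t by (intro mult_pos_neg) auto
    then show ?thesis
      using to_half_plane_boundary[OF n(1)] to_half_plane_boundary[OF n(2)] to_half_plane_boundary[OF n(3)]
      unfolding t(1-4) by (intro exI conjI) auto
  next
    assume "counterclockwise4 ap bp am bm"
    then obtain t1 t2 t3 t4 where t: "ap = cis t1" "bp = cis t2" "am = cis t3" "bm = cis t4"
        "t1 < t2" "t2 < t3" "t3 < t4" "t4 < t1 + 2 * pi" by (auto simp: counterclockwise4_def)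
    have sn: "0 < sin ((u - t1) / 2)" if "t1 < u" "u \<le> t4" for u
      using that t by (intro sin_gt_zero) (auto simp: field_simps)
    have less: "- cot ((u - t1) / 2) < - cot ((v - t1) / 2)" if "t1 < u" "u < v" "v \<le> t4" for u v
      by (rule minus_cot_less) (use that t sn[of u] sn[of v] in \<open>auto intro: mult_pos_pos simp: field_simps\<close>)
    have n: "sin ((t2 - t1) / 2) \<noteq> 0" "sin ((t3 - t1) / 2) \<noteq> 0" "sin ((t4 - t1) / 2) \<noteq> 0"
      using sn[of t2] sn[of t3] sn[of t4] t by auto
    have "(- cot ((t2 - t1) / 2) - - cot ((t3 - t1) / 2)) * (- cot ((t4 - t1) / 2) - - cot ((t3 - t1) / 2)) < 0"
      using less[of t2 t3] less[of t3 t4] t by (intro mult_neg_pos) auto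
    then show ?thesis
      using to_half_plane_boundary[OF n(1)] to_half_plane_boundary[OF n(2)] to_half_plane_boundary[OF n(3)]
      unfolding t(1-4) by (intro exI conjI) auto
  qed
qed

lemma to_half_plane_tendsto:
  assumes "f \<longlonglongrightarrow> u" "v \<noteq> u" shows "(\<lambda>m. to_half_plane v (f m)) \<longlonglongrightarrow> to_half_plane v u"
  unfolding to_half_plane_def by (intro tendsto_intros assms) (use assms in auto)

lemma to_half_plane_at_infinity:
  assumes f: "f \<longlonglongrightarrow> v" and v: "cmod v = 1" and b: "\<And>m. f m \<in> ball 0 1"
  shows "filterlim (\<lambda>m. to_half_plane v (f m)) at_infinity sequentially"
proof -
  have "(\<lambda>m. \<i> * (v + f m)) \<longlonglongrightarrow> \<i> * (v + v)" by (intro tendsto_intros f)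
  moreover have "\<i> * (v + v) \<noteq> 0" using v by (auto simp flip: mult_2)
  moreover have "(\<lambda>m. v - f m) \<longlonglongrightarrow> v - v" by (intro tendsto_intros f)
  then have "filterlim (\<lambda>m. v - f m) (at 0) sequentially"
    using ball_not_unit[OF v b] by (auto simp: filterlim_at)
  then have "filterlim (\<lambda>m. inverse (v - f m)) at_infinity sequentially"
    by (rule filterlim_compose[OF filterlim_inverse_at_infinity])
  ultimately have "filterlim (\<lambda>m. \<i> * (v + f m) * inverse (v - f m)) at_infinity sequentially"
    by (rule tendsto_mult_filterlim_at_infinity)
  then show ?thesis by (simp add: to_half_plane_def divide_inverse)
qed

section \<open>Deck transformations as matrices\<close>

context hyperbolic_cover
begin

definition rep :: "('a \<Rightarrow> 'a) \<Rightarrow> mat2 \<Rightarrow> bool" where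
  "rep g M \<longleftrightarrow> M \<in> SL \<and> (\<forall>x\<in>E. \<psi> (g x) = mob M (\<psi> x))"

abbreviation G where "G \<equiv> deck_group E p"

lemma deckD:
  assumes "g \<in> carrier G"
  shows "g \<in> Bij E" "\<exists>g'. homeomorphism E E g g'" "\<And>x. x \<in> E \<Longrightarrow> p (g x) = p x" "\<And>x. x \<in> E \<Longrightarrow> g x \<in> E"
proof -
  show 1: "g \<in> Bij E" "\<exists>g'. homeomorphism E E g g'" "\<And>x. x \<in> E \<Longrightarrow> p (g x) = p x"
    using assms by (auto simp: deck_group_def)
  show "\<And>x. x \<in> E \<Longrightarrow> g x \<in> E" using Bij_imp_funcset[OF 1(1)] by auto
qed

lemma mult_apply:
  assumes "g \<in> carrier G" "k \<in> carrier G" "x \<in> E" shows "(g \<otimes>\<^bsub>G\<^esub> k) x = g (k x)"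
  using deckD(1)[OF assms(1)] deckD(1)[OF assms(2)] assms(3)
  by (simp add: deck_group_def BijGroup_def compose_def)

lemma one_apply: "x \<in> E \<Longrightarrow> \<one>\<^bsub>G\<^esub> x = x"
  by (simp add: deck_group_def BijGroup_def)

lemma rep_mult: "g \<in> carrier G \<Longrightarrow> k \<in> carrier G \<Longrightarrow> rep g M \<Longrightarrow> rep k N \<Longrightarrow> rep (g \<otimes>\<^bsub>G\<^esub> k) (M * N)"
  unfolding rep_def using deckD(4)[of k] by (auto simp: mult_apply mob_mult)

lemma rep_one: "rep \<one>\<^bsub>G\<^esub> 1"
  by (simp add: rep_def one_apply)

lemma rep_pow:
  assumes g: "g \<in> carrier G" and r: "rep g M" shows "rep (g [^]\<^bsub>G\<^esub> (n::nat)) (M ^ n)"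
proof -
  interpret group G by (rule group_deck_group)
  show ?thesis
  proof (induction n)
    case (Suc n)
    then show ?case using rep_mult[OF nat_pow_closed[OF g] g Suc r] by (simp add: power_commutes)
  qed (simp add: rep_one)
qed

lemma rep_inv:
  assumes g: "g \<in> carrier G" and r: "rep g M" shows "rep (inv\<^bsub>G\<^esub> g) (adj M)"
proof -
  interpret group G by (rule group_deck_group)
  have "\<psi> ((inv\<^bsub>G\<^esub> g) x) = mob (adj M) (\<psi> x)" if x: "x \<in> E" for x
  proof -
    have "g ((inv\<^bsub>G\<^esub> g) x) = x" using mult_apply[OF g inv_closed[OF g] x] g x by (simp add: one_apply)
    moreover have ix: "(inv\<^bsub>G\<^esub> g) x \<in> E" using deckD(4)[OF inv_closed[OF g] x] .
    ultimately have "\<psi> x = mob M (\<psi> ((inv\<^bsub>G\<^esub> g) x))" using r unfolding rep_def by metis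
    then show ?thesis using r ix by (simp add: rep_def)
  qed
  then show ?thesis using r by (simp add: rep_def)
qed

lemma rep_neg_pow:
  assumes g: "g \<in> carrier G" and r: "rep g M" shows "rep (g [^]\<^bsub>G\<^esub> (- int n)) (adj M ^ n)"
proof -
  interpret group G by (rule group_deck_group)
  show ?thesis
    using rep_inv[OF nat_pow_closed[OF g] rep_pow[OF g r], of n] by (simp add: int_pow_neg_int[OF g] adj_power)
qed

text \<open>A deck transformation preserves \<open>p\<close>, and the composition of \<open>p\<close> with the inverse of \<open>\<psi>\<close> is a local
homeomorphism from the half plane to the surface; therefore the transformation cannot reverse
orientation.\<close>

theorem rep_exists:
  assumes S: "orientable_surface S" and g: "g \<in> carrier G"
  shows "\<exists>M. rep g M"
proof -
  note dg = deckD[OF g]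
  obtain g' where g': "homeomorphism E E g g'" using dg(2) by blast
  define F where "F z = \<psi> (g (\<psi>' z))" for z
  have F: "F z \<in> uhp" if "z \<in> uhp" for z using that dg(4) by (simp add: F_def)
  have "hyp (F z) (F w) = hyp z w" if "z \<in> uhp" "w \<in> uhp" for z w
    using that dg(4) D_deck[OF g' dg(3)] hyp_\<psi>[of "g (\<psi>' z)" "g (\<psi>' w)"] hyp_\<psi>[of "\<psi>' z" "\<psi>' w"] by (simp add: F_def)
  with F obtain M where M: "M \<in> SL" "(\<forall>z\<in>uhp. F z = mob M z) \<or> (\<forall>z\<in>uhp. F z = mob M (- cnj z))"
    using half_plane_isometry[of F] by blast
  have "\<not> (\<forall>z\<in>uhp. F z = mob M (- cnj z))"
  proof
    assume anti: "\<forall>z\<in>uhp. F z = mob M (- cnj z)"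
    define q where "q z = p (\<psi>' z)" for z
    have qc: "continuous_on uhp q"
      unfolding q_def by (rule continuous_on_compose2[OF p_cont continuous_\<psi>']) auto
    have loc: "\<exists>R>0. ball z R \<subseteq> uhp \<and> inj_on q (ball z R)" if z: "z \<in> uhp" for z
    proof -
      obtain T where T: "p (\<psi>' z) \<in> T" "evenly T" using evenly_exists[OF p_S[OF \<psi>'_E[OF z]]] by blast
      obtain V r where V: "\<psi>' z \<in> V" "sheet V T r" using evenly_sheet[OF T(2) \<psi>'_E[OF z] T(1)] by blast
      have oV: "openin (top_of_set E) V" and hom: "homeomorphism V T p r" using V(2) by (auto simp: sheet_def)
      have "openin (top_of_set uhp) (uhp \<inter> \<psi>' -` V)"
        by (rule continuous_openin_preimage[OF continuous_\<psi>' _ oV]) auto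
      then have "open (uhp \<inter> \<psi>' -` V)" by (simp add: openin_open_eq uhp_def open_halfspace_Im_gt)
      moreover have "z \<in> uhp \<inter> \<psi>' -` V" using z V(1) by simp
      ultimately obtain R where R: "R > 0" "ball z R \<subseteq> uhp \<inter> \<psi>' -` V" by (rule openE)
      have "inj_on q (ball z R)"
      proof (rule inj_onI)
        fix u w assume u: "u \<in> ball z R" and w: "w \<in> ball z R" and eq: "q u = q w"
        have uw: "u \<in> uhp" "w \<in> uhp" "\<psi>' u \<in> V" "\<psi>' w \<in> V" using R(2) u w by auto
        have "r (p (\<psi>' u)) = r (p (\<psi>' w))" using eq by (simp only: q_def)
        then have "\<psi>' u = \<psi>' w" by (simp only: homeomorphism_apply1[OF hom uw(3)] homeomorphism_apply1[OF hom uw(4)])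
        then show "u = w" using uw by (metis \<psi>\<psi>')
      qed
      then show ?thesis using R by (intro exI[of _ R]) auto
    qed
    have "q (mob M (- cnj z)) = q z" if "z \<in> uhp" for z
    proof -
      have "mob M (- cnj z) = F z" using anti that by simp
      then show ?thesis using that dg(3,4) by (simp add: q_def F_def)
    qed
    moreover have "q ` uhp \<subseteq> S" using p_S by (auto simp: q_def)
    ultimately show False using no_orientation_reversing_symmetry[OF S qc _ loc M(1)] by blast
  qed
  then have Fm: "\<forall>z\<in>uhp. F z = mob M z" using M(2) by blast
  have "\<psi> (g x) = mob M (\<psi> x)" if "x \<in> E" for x
    using Fm that \<psi>_uhp[OF that] \<psi>'\<psi>[OF that] unfolding F_def by metis
  then show ?thesis using M(1) by (auto simp: rep_def)
qed

text \<open>The orbit of \<open>x\<close> under \<open>g\<close> corresponds to the orbit of \<open>\<psi> x\<close> under \<open>M\<close>, so that \<open>stable_length_eq_tau\<close>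
applies.\<close>

lemma stable_length_rep:
  assumes \<rho>: "length_metric_on S \<rho>" and S: "compact S" and g: "g \<in> carrier G" and r: "rep g M" and x: "x \<in> E"
  defines "d \<equiv> \<lambda>z w. pullback_metric E p \<rho> (\<psi>' z) (\<psi>' w)"
  shows "M \<in> plane_metric.isom d" "4 < (mtr M)\<^sup>2 \<Longrightarrow> stable_length E p \<rho> x g = plane_metric.tau d M"
proof -
  interpret P: plane_metric d unfolding d_def by (rule plane_metric_pullback[OF \<rho> S])
  interpret R: connected_length_cover E p S \<rho>
    by unfold_locales (use cover \<rho> connected in auto)
  note dg = deckD[OF g]
  obtain g' where g': "homeomorphism E E g g'" using dg(2) by blast
  have M: "M \<in> SL" using r by (simp add: rep_def)
  have pb: "\<psi>' (mob M z) = g (\<psi>' z)" if "z \<in> uhp" for z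
  proof -
    have "mob M z = \<psi> (g (\<psi>' z))" using r that by (simp add: rep_def)
    then show ?thesis using dg(4) that by simp
  qed
  show iso: "M \<in> P.isom"
  proof (rule P.isomI[OF M])
    show "d (mob M z) (mob M w) = d z w" if "z \<in> uhp" "w \<in> uhp" for z w
      using R.D_deck[OF g' dg(3) \<psi>'_E[OF that(1)] \<psi>'_E[OF that(2)]] that by (simp add: d_def pb R.D_def)
  qed
  assume h: "4 < (mtr M)\<^sup>2"
  have "pullback_metric E p \<rho> x ((g [^]\<^bsub>G\<^esub> m) x) = d (\<psi> x) (mob (M ^ m) (\<psi> x))" for m :: nat
  proof -
    interpret group G by (rule group_deck_group)
    have "mob (M ^ m) (\<psi> x) = \<psi> ((g [^]\<^bsub>G\<^esub> m) x)" using rep_pow[OF g r, of m] x by (simp add: rep_def)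
    moreover have "(g [^]\<^bsub>G\<^esub> m) x \<in> E" using deckD(4)[OF nat_pow_closed[OF g] x] .
    ultimately show ?thesis using x by (simp add: d_def)
  qed
  then show "stable_length E p \<rho> x g = P.tau M"
    unfolding stable_length_def using limI[OF P.stable_length_eq_tau[OF iso h \<psi>_uhp[OF x]]] by simp
qed

end

section \<open>The inequality for stable lengths\<close>

text \<open>The translation by \<open>x\<close> makes it possible to put the repelling endpoint of an axis at \<open>0\<close>.\<close>

lemma hyperbolic_cover_of_disc:
  assumes "length_cover E p S h" and \<phi>: "disc_isometry E p h \<phi>" and v: "cmod v = 1"
  shows "hyperbolic_cover E p S h (\<lambda>e. to_half_plane v (\<phi> e) - of_real x)"
proof -
  interpret length_cover E p S h by fact
  have bij: "bij_betw \<phi> E (ball 0 1)" and iso: "\<And>e e'. e \<in> E \<Longrightarrow> e' \<in> E \<Longrightarrow> disc_dist (\<phi> e) (\<phi> e') = D e e'"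
    using \<phi> by (auto simp: disc_isometry_def D_def)
  show ?thesis
  proof
    show "bij_betw (\<lambda>e. to_half_plane v (\<phi> e) - of_real x) E uhp"
      using bij_betw_trans[OF bij bij_to_half_plane[OF v, of x]] by (simp add: o_def)
    fix e e' assume e: "e \<in> E" "e' \<in> E"
    then have b: "\<phi> e \<in> ball 0 1" "\<phi> e' \<in> ball 0 1" using bij by (auto simp: bij_betw_def)
    have "hyp (to_half_plane v (\<phi> e) - of_real x) (to_half_plane v (\<phi> e') - of_real x)
        = hyp (to_half_plane v (\<phi> e)) (to_half_plane v (\<phi> e'))" by (simp add: hyp_def)
    also have "\<dots> = 2 * (cosh (D e e') - 1)"
      using hyp_to_half_plane[OF v b] cosh_disc_dist[OF b] iso[OF e] by simp
    finally show "hyp (to_half_plane v (\<phi> e) - of_real x) (to_half_plane v (\<phi> e') - of_real x) = 2 * (cosh (D e e') - 1)" .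
  qed
qed

text \<open>Put the attracting endpoint of \<open>a\<close> at \<open>\<infinity>\<close> and the repelling one at \<open>0\<close>. Then \<open>A\<close> is diagonal, and \<open>B\<close>
has real fixed points of opposite signs. Powers have the same endpoints, since their orbits are
subsequences; so the same holds for \<open>A\<^sup>n\<close> and \<open>B\<^sup>n\<close>.\<close>

lemma crossing_matrices:
  assumes h: "length_cover E p S h" and S: "orientable_surface S"
    and a: "a \<in> carrier (deck_group E p)" and b: "b \<in> carrier (deck_group E p)"
    and cr: "crossing_axes E p h a b" and e: "e \<in> E"
  shows "\<exists>\<psi> A B. hyperbolic_cover E p S h \<psi> \<and> hyperbolic_cover.rep E \<psi> a A \<and> hyperbolic_cover.rep E \<psi> b B \<and>
     (\<forall>n>0. crossing (A ^ n) (B ^ n))"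
proof -
  obtain \<phi> am ap bm bp where \<phi>: "disc_isometry E p h \<phi>" and ae: "axis_endpoints E p \<phi> a am ap"
    and be: "axis_endpoints E p \<phi> b bm bp" and cc: "counterclockwise4 bm am bp ap \<or> counterclockwise4 ap bp am bm"
    using cr unfolding crossing_axes_def by blast
  have v: "cmod ap = 1" by (rule crossing_boundary(1)[OF cc])
  obtain x y w where ne: "ap \<noteq> am" "ap \<noteq> bm" "ap \<noteq> bp" and hx: "to_half_plane ap am = of_real x"
      "to_half_plane ap bp = of_real y" "to_half_plane ap bm = of_real w" and sg: "(y - x) * (w - x) < 0"
    using crossing_boundary(2)[OF cc] by blast
  define \<psi> where "\<psi> e = to_half_plane ap (\<phi> e) - of_real x" for e
  interpret hyperbolic_cover E p S h \<psi>
    unfolding \<psi>_def[abs_def] by (rule hyperbolic_cover_of_disc[OF h \<phi> v])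
  obtain A where A: "rep a A" using rep_exists[OF S a] by blast
  obtain B where B: "rep b B" using rep_exists[OF S b] by blast
  have SL: "A \<in> SL" "B \<in> SL" using A B by (auto simp: rep_def)
  have pos: "\<psi> ((g [^]\<^bsub>G\<^esub> m) e) = mob (M ^ m) (\<psi> e)" and neg: "\<psi> ((g [^]\<^bsub>G\<^esub> (- int m)) e) = mob (adj M ^ m) (\<psi> e)"
    if "g \<in> carrier G" "rep g M" for g M and m :: nat
    using rep_pow[OF that, of m] rep_neg_pow[OF that, of m] e by (simp_all add: rep_def)
  have lim: "(\<lambda>m. \<psi> (f m)) \<longlonglongrightarrow> of_real (t - x)" if "(\<lambda>m. \<phi> (f m)) \<longlonglongrightarrow> u" "ap \<noteq> u" "to_half_plane ap u = of_real t" for f u t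
    unfolding \<psi>_def using tendsto_diff[OF to_half_plane_tendsto[OF that(1,2)] tendsto_const[of "of_real x"]] that(3) by simp
  have "filterlim (\<lambda>m. to_half_plane ap (\<phi> ((a [^]\<^bsub>G\<^esub> m) e))) at_infinity (sequentially :: nat filter)"
  proof (rule to_half_plane_at_infinity[OF _ v])
    show "(\<lambda>m. \<phi> ((a [^]\<^bsub>G\<^esub> m) e)) \<longlonglongrightarrow> ap" using ae e by (simp add: axis_endpoints_def)
    interpret group G by (rule group_deck_group)
    show "\<phi> ((a [^]\<^bsub>G\<^esub> m) e) \<in> ball 0 1" for m :: nat
      using \<phi> deckD(4)[OF nat_pow_closed[OF a] e] by (auto simp: disc_isometry_def bij_betw_def)
  qed
  then have "filterlim (\<lambda>m. - of_real x + to_half_plane ap (\<phi> ((a [^]\<^bsub>G\<^esub> m) e))) at_infinity (sequentially :: nat filter)"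
    by (rule tendsto_add_filterlim_at_infinity[OF tendsto_const])
  then have A1: "filterlim (\<lambda>m. mob (A ^ m) (\<psi> e)) at_infinity sequentially"
    by (simp add: pos[OF a A, symmetric]) (simp add: \<psi>_def)
  have "(\<lambda>m. \<psi> ((a [^]\<^bsub>G\<^esub> (- int m)) e)) \<longlonglongrightarrow> of_real (x - x)"
    by (rule lim[OF _ ne(1) hx(1)]) (use ae e in \<open>simp add: axis_endpoints_def\<close>)
  then have A2: "(\<lambda>m. mob (adj A ^ m) (\<psi> e)) \<longlonglongrightarrow> 0" by (simp add: neg[OF a A])
  have "(\<lambda>m::nat. \<psi> ((b [^]\<^bsub>G\<^esub> m) e)) \<longlonglongrightarrow> of_real (y - x)"
    by (rule lim[OF _ ne(3) hx(2)]) (use be e in \<open>simp add: axis_endpoints_def\<close>)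
  then have B1: "(\<lambda>m. mob (B ^ m) (\<psi> e)) \<longlonglongrightarrow> of_real (y - x)" by (simp only: pos[OF b B])
  have "(\<lambda>m. \<psi> ((b [^]\<^bsub>G\<^esub> (- int m)) e)) \<longlonglongrightarrow> of_real (w - x)"
    by (rule lim[OF _ ne(2) hx(3)]) (use be e in \<open>simp add: axis_endpoints_def\<close>)
  then have B2: "(\<lambda>m. mob (adj B ^ m) (\<psi> e)) \<longlonglongrightarrow> of_real (w - x)" by (simp only: neg[OF b B])
  have "crossing (A ^ n) (B ^ n)" if n: "0 < n" for n
  proof (rule crossing_of_diagonal_saddle)
    have sub: "strict_mono (\<lambda>m. n * m)" using n by (simp add: strict_mono_def)
    have A1': "filterlim (\<lambda>m. mob ((A ^ n) ^ m) (\<psi> e)) at_infinity sequentially"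
      using filterlim_compose[OF A1 filterlim_subseq[OF sub]] by (simp add: power_mult)
    have A2': "(\<lambda>m. mob (adj (A ^ n) ^ m) (\<psi> e)) \<longlonglongrightarrow> 0"
      using filterlim_compose[OF A2 filterlim_subseq[OF sub]] by (simp add: power_mult adj_power)
    have B1': "(\<lambda>m. mob ((B ^ n) ^ m) (\<psi> e)) \<longlonglongrightarrow> of_real (y - x)"
      using filterlim_compose[OF B1 filterlim_subseq[OF sub]] by (simp add: power_mult)
    have B2': "(\<lambda>m. mob (adj (B ^ n) ^ m) (\<psi> e)) \<longlonglongrightarrow> of_real (w - x)"
      using filterlim_compose[OF B2 filterlim_subseq[OF sub]] by (simp add: power_mult adj_power)
    show "A ^ n \<in> SL" "B ^ n \<in> SL" using SL by simp_all
    show "m21 (A ^ n) = 0" "m12 (A ^ n) = 0" "(m11 (A ^ n))\<^sup>2 \<noteq> 1"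
      using diagonal_of_limits[OF SL_power[OF SL(1)] \<psi>_uhp[OF e] A1' A2'] by blast+
    show "0 < m12 (B ^ n) * m21 (B ^ n)"
      by (rule saddle_of_limits[OF SL_power[OF SL(2)] \<psi>_uhp[OF e] B1' B2' sg])
  qed
  then show ?thesis using hyperbolic_cover_axioms A B by blast
qed

lemma stable_length_one:
  assumes "length_cover E p S d" "x \<in> E" shows "stable_length E p d x \<one>\<^bsub>deck_group E p\<^esub> = 0"
proof -
  interpret length_cover E p S d by fact
  interpret group "deck_group E p" by (rule group_deck_group)
  have "\<one>\<^bsub>deck_group E p\<^esub> x = x" using assms(2) by (simp add: deck_group_def BijGroup_def)
  moreover have "pullback_metric E p d x x = 0" using D_eq[of x x] L_refl[OF assms(2)] by (simp add: D_def)
  ultimately show ?thesis by (simp add: stable_length_def)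
qed

theorem theorem5:
  fixes S :: "'s::topological_space set"
    and E :: "'e::topological_space set"
    and p :: "'e \<Rightarrow> 's"
    and \<rho> h :: "'s \<Rightarrow> 's \<Rightarrow> real"
    and a b :: "'e \<Rightarrow> 'e"
    and x\<^sub>0 :: 'e
    and n :: nat
  assumes "closed_surface S" and "orientable_surface S" and "2 \<le> surface_genus S"
    and "covering_space E p S" and "simply_connected E"
    and "length_metric_on S \<rho>" and "ptolemaic E (pullback_metric E p \<rho>)"
    and "hyperbolic_metric_on S h"
    and "a \<in> carrier (deck_group E p)" and "b \<in> carrier (deck_group E p)"
    and "crossing_axes E p h a b"
    and "x\<^sub>0 \<in> E"
  shows
    "stable_length E p \<rho> x\<^sub>0 (a [^]\<^bsub>deck_group E p\<^esub> n) *
     stable_length E p \<rho> x\<^sub>0 (b [^]\<^bsub>deck_group E p\<^esub> n)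
     \<le> (stable_length E p \<rho> x\<^sub>0
          ((a [^]\<^bsub>deck_group E p\<^esub> n) \<otimes>\<^bsub>deck_group E p\<^esub> (b [^]\<^bsub>deck_group E p\<^esub> n)))\<^sup>2 / 4
      + (stable_length E p \<rho> x\<^sub>0
          ((a [^]\<^bsub>deck_group E p\<^esub> n) \<otimes>\<^bsub>deck_group E p\<^esub> (b [^]\<^bsub>deck_group E p\<^esub> (- int n))))\<^sup>2 / 4"
proof (cases "n = 0")
  case True
  have "length_cover E p S \<rho>" using assms(4,6) by (simp add: length_cover_def)
  then have "stable_length E p \<rho> x\<^sub>0 (a [^]\<^bsub>deck_group E p\<^esub> n) = 0"
    using stable_length_one assms(12) True by (simp add: nat_pow_def)
  then show ?thesis by simp
next
  case False
  have h: "length_cover E p S h"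
    using assms(4,8) by (simp add: length_cover_def hyperbolic_metric_on_def)
  have S: "compact S" using assms(1) by (simp add: closed_surface_def)
  obtain \<psi> A B where \<psi>: "hyperbolic_cover E p S h \<psi>" and A: "hyperbolic_cover.rep E \<psi> a A"
      and B: "hyperbolic_cover.rep E \<psi> b B" and cr: "\<forall>n>0. crossing (A ^ n) (B ^ n)"
    using crossing_matrices[OF h assms(2,9,10,11,12)] by blast
  interpret hyperbolic_cover E p S h \<psi> by fact
  define d where "d = (\<lambda>z w. pullback_metric E p \<rho> (\<psi>' z) (\<psi>' w))"
  interpret P: plane_metric d unfolding d_def by (rule plane_metric_pullback[OF assms(6) S])
  interpret group G by (rule group_deck_group)
  define X Y where "X = A ^ n" and "Y = B ^ n"
  have XY: "crossing X Y" using cr False by (simp add: X_def Y_def)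
  let ?a = "a [^]\<^bsub>G\<^esub> n" and ?b = "b [^]\<^bsub>G\<^esub> n" and ?b' = "b [^]\<^bsub>G\<^esub> (- int n)"
  note a = assms(9) and b = assms(10)
  have cl: "?a \<in> carrier G" "?b \<in> carrier G" "?b' \<in> carrier G" using a b by auto
  have r: "rep ?a X" "rep ?b Y" "rep ?b' (adj Y)"
    using rep_pow[OF a A] rep_pow[OF b B] rep_neg_pow[OF b B] by (simp_all add: X_def Y_def adj_power)
  note sl = stable_length_rep[OF assms(6) S _ _ assms(12), folded d_def]
  have "P.tau X * P.tau Y \<le> (P.tau (X * Y))\<^sup>2 / 4 + (P.tau (X * adj Y))\<^sup>2 / 4"
  proof (rule P.crossing_inequality[OF _ sl(1)[OF cl(1) r(1)] sl(1)[OF cl(2) r(2)] XY])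
    fix x y z w assume "x \<in> uhp" "y \<in> uhp" "z \<in> uhp" "w \<in> uhp"
    then show "d x z * d y w \<le> d x y * d z w + d x w * d y z"
      using assms(7) unfolding d_def ptolemaic_def by simp
  qed
  moreover have "stable_length E p \<rho> x\<^sub>0 ?a = P.tau X"
    by (rule sl(2)[OF cl(1) r(1) crossing_hyperbolic(1)[OF XY]])
  moreover have "stable_length E p \<rho> x\<^sub>0 ?b = P.tau Y"
    by (rule sl(2)[OF cl(2) r(2) crossing_hyperbolic(2)[OF XY]])
  moreover have "stable_length E p \<rho> x\<^sub>0 (?a \<otimes>\<^bsub>G\<^esub> ?b) = P.tau (X * Y)"
    by (rule sl(2)[OF m_closed[OF cl(1,2)] rep_mult[OF cl(1,2) r(1,2)] crossing_hyperbolic(1)[OF crossing_mult_mult_adj[OF XY]]])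
  moreover have "stable_length E p \<rho> x\<^sub>0 (?a \<otimes>\<^bsub>G\<^esub> ?b') = P.tau (X * adj Y)"
    by (rule sl(2)[OF m_closed[OF cl(1,3)] rep_mult[OF cl(1,3) r(1,3)] crossing_hyperbolic(2)[OF crossing_mult_mult_adj[OF XY]]])
  ultimately show ?thesis by simp
qed

end
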